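(* Let $k$ be a field of characteristic zero, let $H$ be a finite-dimensional Hopf algebra over $k$, and let $\alpha:H\times H\to k$ be a normalized convolution-invertible two-cocycle. Let $\mathcal K_H^{\alpha}$ be the field of fractions of the integral domain $\mathcal B_H^{\alpha}$. If the algebra ${}^{\alpha}H$ is semisimple, then so is the algebra $\mathcal K_H^{\alpha}\otimes_{\mathcal B_H^{\alpha}}\mathcal A_H^{\alpha}$.
   Context: All algebras are associative unital $k$-algebras; unadorned tensor products are over $k$; $\Delta$, $\varepsilon$ are the comultiplication and counit of $H$, with Sweedler notation. Cocycles and twisted algebras: let $R$ be a commutative algebra. A two-cocycle with values in $R$ is a bilinear map $\alpha:H\times H\to R$ with $\sum\alpha(x_{(1)},y_{(1)})\alpha(x_{(2)}y_{(2)},z)=\sum\alpha(y_{(1)},z_{(1)})\alpha(x,y_{(2)}z_{(2)})$ for all $x,y,z\in H$; it is normalized if $\alpha(x,1)=\alpha(1,x)=\varepsilon(x)1$, and convolution-invertible if it is invertible for convolution in $\operatorname{Hom}(H\otimes H,R)$. The twisted algebra $R\otimes{}^{\alpha}H$ is $R\otimes H$ with product $(b\otimes x)\cdot_\alpha(c\otimes y)=\sum bc\,\alpha(x_{(1)},y_{(1)})\otimes x_{(2)}y_{(2)}$. For $R=k$ write ${}^{\alpha}H=k\otimes{}^{\alpha}H$. Universal cocycle: let $t_H$ be a copy of the vector space $H$ (with identity map $h\mapsto t_h$), $S(t_H)$ its symmetric algebra, $K_H$ the field of fractions of $S(t_H)$. Let $t^{-1}:H\to K_H$, $h\mapsto t_h^{-1}$,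 be the unique linear map with $\sum t_{h_{(1)}}t^{-1}_{h_{(2)}}=\sum t^{-1}_{h_{(1)}}t_{h_{(2)}}=\varepsilon(h)1$ for all $h\in H$ (it exists; note that $t^{-1}_h$ is in general not $1/t_h$). Define $\sigma:H\times H\to K_H$ by $\sigma(x,y)=\sum t_{x_{(1)}}t_{y_{(1)}}\alpha(x_{(2)},y_{(2)})t^{-1}_{x_{(3)}y_{(3)}}$; it is a convolution-invertible two-cocycle with convolution inverse $\sigma^{-1}(x,y)=\sum t_{x_{(1)}y_{(1)}}\alpha^{-1}(x_{(2)},y_{(2)})t^{-1}_{x_{(3)}}t^{-1}_{y_{(3)}}$. $\mathcal B_H^{\alpha}$ is the subalgebra of $K_H$ generated by all values of $\sigma$ and $\sigma^{-1}$, and $\mathcal A_H^{\alpha}=\mathcal B_H^{\alpha}\otimes{}^{\sigma}H$ is the corresponding twisted algebra, which is associative with unit $t_1^{-1}\otimes1$ and is a $\mathcal B_H^{\alpha}$-algebra. *)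

theory Defs
  imports "HOL-Algebra.Algebra" "HOL-Algebra.Algebraic_Closure_Type"
begin

definition left_ideal :: "'a set \<Rightarrow> ('a, 'z) ring_scheme \<Rightarrow> bool" where
  "left_ideal I R \<longleftrightarrow> additive_subgroup I R \<and> (\<forall>a\<in>carrier R. \<forall>x\<in>I. a \<otimes>\<^bsub>R\<^esub> x \<in> I)"

text \<open>The left regular module is semisimple (completely reducible): each of its submodules is
  a direct summand.\<close>

definition semisimple_ring :: "('a, 'z) ring_scheme \<Rightarrow> bool" where
  "semisimple_ring R \<longleftrightarrow> ring R \<and>
     (\<forall>I. left_ideal I R \<longrightarrow>
        (\<exists>J. left_ideal J R \<and> I \<inter> J = {\<zero>\<^bsub>R\<^esub>} \<and> I <+>\<^bsub>R\<^esub> J = carrier R))"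

text \<open>The constructions below depend on the scalar multiplication and the coproduct of a Hopf
  algebra, so they are ring and module records with carriers.  The ground field and the Hopf
  algebra are types; this embeds them into the record world.  In particular
  \<open>type_algebra (*)\<close> is the ground field as an algebra over itself.\<close>

definition type_algebra :: "('k \<Rightarrow> 'h \<Rightarrow> 'h) \<Rightarrow> ('k, 'h::ring_1) module" where
  "type_algebra scale =
     \<lparr>carrier = UNIV, monoid.mult = (*), monoid.one = 1, ring.zero = 0, add = (+),
      module.smult = scale\<rparr>"

definition algebra_via :: "('r \<Rightarrow> 'a) \<Rightarrow> ('a, 'z) ring_scheme \<Rightarrow> ('r, 'a) module" where
  "algebra_via \<phi> A =
     \<lparr>carrier = carrier A, monoid.mult = monoid.mult A, monoid.one = monoid.one A,
      ring.zero = ring.zero A, add = ring.add A,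
      module.smult = (\<lambda>r x. \<phi> r \<otimes>\<^bsub>A\<^esub> x)\<rparr>"

definition tensor_rels ::
  "('r, 'x) ring_scheme \<Rightarrow> ('r, 'm, 'y) module_scheme \<Rightarrow> ('r, 'n, 'z) module_scheme
     \<Rightarrow> ('m \<times> 'n \<Rightarrow>\<^sub>0 int) set" where
  "tensor_rels R M N =
     {frag_of (m \<oplus>\<^bsub>M\<^esub> m', n) - frag_of (m, n) - frag_of (m', n) | m m' n.
        m \<in> carrier M \<and> m' \<in> carrier M \<and> n \<in> carrier N} \<union>
     {frag_of (m, n \<oplus>\<^bsub>N\<^esub> n') - frag_of (m, n) - frag_of (m, n') | m n n'.
        m \<in> carrier M \<and> n \<in> carrier N \<and> n' \<in> carrier N} \<union>
     {frag_of (r \<odot>\<^bsub>M\<^esub> m, n) - frag_of (m, r \<odot>\<^bsub>N\<^esub> n) | r m n.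
        r \<in> carrier R \<and> m \<in> carrier M \<and> n \<in> carrier N}"

definition tensor_kernel ::
  "('r, 'x) ring_scheme \<Rightarrow> ('r, 'm, 'y) module_scheme \<Rightarrow> ('r, 'n, 'z) module_scheme
     \<Rightarrow> ('m \<times> 'n \<Rightarrow>\<^sub>0 int) set" where
  "tensor_kernel R M N =
     generate (free_Abelian_group (carrier M \<times> carrier N)) (tensor_rels R M N)"

definition tensor_group ::
  "('r, 'x) ring_scheme \<Rightarrow> ('r, 'm, 'y) module_scheme \<Rightarrow> ('r, 'n, 'z) module_scheme
     \<Rightarrow> ('m \<times> 'n \<Rightarrow>\<^sub>0 int) set monoid" where
  "tensor_group R M N =
     free_Abelian_group (carrier M \<times> carrier N) Mod tensor_kernel R M N"

definition pure_tensor ::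
  "('r, 'x) ring_scheme \<Rightarrow> ('r, 'm, 'y) module_scheme \<Rightarrow> ('r, 'n, 'z) module_scheme
     \<Rightarrow> 'm \<Rightarrow> 'n \<Rightarrow> ('m \<times> 'n \<Rightarrow>\<^sub>0 int) set" where
  "pure_tensor R M N m n =
     tensor_kernel R M N #>\<^bsub>free_Abelian_group (carrier M \<times> carrier N)\<^esub> frag_of (m, n)"

text \<open>If \<open>f\<close> is biadditive and balanced with values in \<open>T\<close>, then \<open>tensor_lift T f\<close> is the
  additive map with \<open>m \<otimes> n \<mapsto> f m n\<close>: it sends the class \<open>U\<close> of a formal sum
  \<open>\<Sum> c\<^sub>i (m\<^sub>i, n\<^sub>i)\<close> to \<open>\<Sum> c\<^sub>i f m\<^sub>i n\<^sub>i\<close>, whichever representative is chosen.  Every use below is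
  of this kind.\<close>

definition tensor_lift ::
  "('t, 'z) ring_scheme \<Rightarrow> ('m \<Rightarrow> 'n \<Rightarrow> 't) \<Rightarrow> ('m \<times> 'n \<Rightarrow>\<^sub>0 int) set \<Rightarrow> 't" where
  "tensor_lift T f U =
     (let u = (SOME u. u \<in> U) in
      \<Oplus>\<^bsub>T\<^esub>p\<in>Poly_Mapping.keys u. [Poly_Mapping.lookup u p] \<cdot>\<^bsub>T\<^esub> f (fst p) (snd p))"

text \<open>Only the additive structure of \<open>tensor_additive\<close> is meaningful.\<close>

definition tensor_additive ::
  "('r, 'x) ring_scheme \<Rightarrow> ('r, 'm, 'y) module_scheme \<Rightarrow> ('r, 'n, 'z) module_scheme
     \<Rightarrow> ('m \<times> 'n \<Rightarrow>\<^sub>0 int) set ring" where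
  "tensor_additive R M N =
     \<lparr>carrier = carrier (tensor_group R M N), monoid.mult = undefined, monoid.one = undefined,
      ring.zero = \<one>\<^bsub>tensor_group R M N\<^esub>, add = monoid.mult (tensor_group R M N)\<rparr>"

definition tensor_algebra ::
  "('r, 'x) ring_scheme \<Rightarrow> ('r, 'm, 'y) module_scheme \<Rightarrow> ('r, 'n, 'z) module_scheme
     \<Rightarrow> ('r, ('m \<times> 'n \<Rightarrow>\<^sub>0 int) set) module" where
  "tensor_algebra R M N =
     (let T = tensor_additive R M N in
      \<lparr>carrier = carrier T,
       monoid.mult = (\<lambda>U V. tensor_lift T (\<lambda>m n. tensor_lift T (\<lambda>m' n'.
                 pure_tensor R M N (m \<otimes>\<^bsub>M\<^esub> m') (n \<otimes>\<^bsub>N\<^esub> n')) V) U),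
       monoid.one = pure_tensor R M N \<one>\<^bsub>M\<^esub> \<one>\<^bsub>N\<^esub>,
       ring.zero = ring.zero T,
       add = ring.add T,
       module.smult = (\<lambda>r. tensor_lift T (\<lambda>m n. pure_tensor R M N (r \<odot>\<^bsub>M\<^esub> m) n))\<rparr>)"

text \<open>Sweedler notation: \<open>sweedler \<Delta> M x (\<lambda>x1 x2. f x1 x2)\<close> is \<open>\<Sum> f(x\<^sub>(\<^sub>1\<^sub>), x\<^sub>(\<^sub>2\<^sub>))\<close> in \<open>M\<close>, for
  bilinear \<open>f\<close>.\<close>

definition sweedler ::
  "('h \<Rightarrow> ('h \<times> 'h \<Rightarrow>\<^sub>0 int) set) \<Rightarrow> ('m, 'z) ring_scheme \<Rightarrow> 'h \<Rightarrow> ('h \<Rightarrow> 'h \<Rightarrow> 'm) \<Rightarrow> 'm" where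
  "sweedler \<Delta> M x f = tensor_lift M f (\<Delta> x)"

definition sweedler3 ::
  "('h \<Rightarrow> ('h \<times> 'h \<Rightarrow>\<^sub>0 int) set) \<Rightarrow> ('m, 'z) ring_scheme \<Rightarrow> 'h
     \<Rightarrow> ('h \<Rightarrow> 'h \<Rightarrow> 'h \<Rightarrow> 'm) \<Rightarrow> 'm" where
  "sweedler3 \<Delta> M x f = sweedler \<Delta> M x (\<lambda>x1 x'. sweedler \<Delta> M x' (\<lambda>x2 x3. f x1 x2 x3))"

abbreviation tensor_square ::
  "('k::field \<Rightarrow> 'h::ring_1 \<Rightarrow> 'h) \<Rightarrow> ('k, ('h \<times> 'h \<Rightarrow>\<^sub>0 int) set) module" where
  "tensor_square scale \<equiv>
     tensor_algebra ring_of_type_algebra (type_algebra scale) (type_algebra scale)"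

abbreviation tensor_cube ::
  "('k::field \<Rightarrow> 'h::ring_1 \<Rightarrow> 'h) \<Rightarrow> ('k, ('h \<times> ('h \<times> 'h \<Rightarrow>\<^sub>0 int) set \<Rightarrow>\<^sub>0 int) set) module" where
  "tensor_cube scale \<equiv>
     tensor_algebra ring_of_type_algebra (type_algebra scale) (tensor_square scale)"

abbreviation pure2 ::
  "('k::field \<Rightarrow> 'h::ring_1 \<Rightarrow> 'h) \<Rightarrow> 'h \<Rightarrow> 'h \<Rightarrow> ('h \<times> 'h \<Rightarrow>\<^sub>0 int) set" where
  "pure2 scale \<equiv> pure_tensor ring_of_type_algebra (type_algebra scale) (type_algebra scale)"

abbreviation pure3 ::
  "('k::field \<Rightarrow> 'h::ring_1 \<Rightarrow> 'h) \<Rightarrow> 'h \<Rightarrow> ('h \<times> 'h \<Rightarrow>\<^sub>0 int) set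
     \<Rightarrow> ('h \<times> ('h \<times> 'h \<Rightarrow>\<^sub>0 int) set \<Rightarrow>\<^sub>0 int) set" where
  "pure3 scale \<equiv> pure_tensor ring_of_type_algebra (type_algebra scale) (tensor_square scale)"

text \<open>Coassociativity compares the images of \<open>(\<Delta> \<otimes> id) \<Delta> x\<close> and \<open>(id \<otimes> \<Delta>) \<Delta> x\<close> in
  \<open>H \<otimes> (H \<otimes> H)\<close>.\<close>

locale hopf_algebra = vector_space scale
  for scale :: "'k::field \<Rightarrow> 'h::ring_1 \<Rightarrow> 'h" +
  fixes \<Delta> :: "'h \<Rightarrow> ('h \<times> 'h \<Rightarrow>\<^sub>0 int) set"
    and \<epsilon> :: "'h \<Rightarrow> 'k"
    and antipode :: "'h \<Rightarrow> 'h"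
  assumes mult_scale_left: "scale c x * y = scale c (x * y)"
    and mult_scale_right: "x * scale c y = scale c (x * y)"
    and comult_hom: "\<Delta> \<in> ring_hom (type_algebra scale) (tensor_square scale)"
    and comult_scale: "\<Delta> (scale c x) = c \<odot>\<^bsub>tensor_square scale\<^esub> \<Delta> x"
    and coassoc:
      "sweedler \<Delta> (tensor_cube scale) x
         (\<lambda>x1 x2. sweedler \<Delta> (tensor_cube scale) x1
           (\<lambda>x11 x12. pure3 scale x11 (pure2 scale x12 x2))) =
       sweedler \<Delta> (tensor_cube scale) x (\<lambda>x1 x2. pure3 scale x1 (\<Delta> x2))"
    and counit_linear: "Vector_Spaces.linear scale (*) \<epsilon>"
    and counit_mult: "\<epsilon> (x * y) = \<epsilon> x * \<epsilon> y"
    and counit_one: "\<epsilon> 1 = 1"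
    and counit_left: "sweedler \<Delta> (type_algebra scale) x (\<lambda>x1 x2. scale (\<epsilon> x1) x2) = x"
    and counit_right: "sweedler \<Delta> (type_algebra scale) x (\<lambda>x1 x2. scale (\<epsilon> x2) x1) = x"
    and antipode_linear: "Vector_Spaces.linear scale scale antipode"
    and antipode_left:
      "sweedler \<Delta> (type_algebra scale) x (\<lambda>x1 x2. antipode x1 * x2) = scale (\<epsilon> x) 1"
    and antipode_right:
      "sweedler \<Delta> (type_algebra scale) x (\<lambda>x1 x2. x1 * antipode x2) = scale (\<epsilon> x) 1"

definition linear_map ::
  "('k \<Rightarrow> 'h::ab_group_add \<Rightarrow> 'h) \<Rightarrow> ('k, 'm, 'z) module_scheme \<Rightarrow> ('h \<Rightarrow> 'm) \<Rightarrow> bool" where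
  "linear_map scale M f \<longleftrightarrow>
     (\<forall>x. f x \<in> carrier M) \<and>
     (\<forall>x y. f (x + y) = f x \<oplus>\<^bsub>M\<^esub> f y) \<and>
     (\<forall>c x. f (scale c x) = c \<odot>\<^bsub>M\<^esub> f x)"

definition bilinear_map ::
  "('k \<Rightarrow> 'h::ab_group_add \<Rightarrow> 'h) \<Rightarrow> ('k, 'm, 'z) module_scheme \<Rightarrow> ('h \<Rightarrow> 'h \<Rightarrow> 'm) \<Rightarrow> bool" where
  "bilinear_map scale M f \<longleftrightarrow>
     (\<forall>x. linear_map scale M (\<lambda>y. f x y)) \<and> (\<forall>y. linear_map scale M (\<lambda>x. f x y))"

text \<open>In the next definitions \<open>R\<close> is a commutative algebra over the ground field.\<close>

definition two_cocycle ::
  "('k \<Rightarrow> 'h::ring_1 \<Rightarrow> 'h) \<Rightarrow> ('h \<Rightarrow> ('h \<times> 'h \<Rightarrow>\<^sub>0 int) set) \<Rightarrow> ('k, 'r, 'z) module_scheme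
     \<Rightarrow> ('h \<Rightarrow> 'h \<Rightarrow> 'r) \<Rightarrow> bool" where
  "two_cocycle scale \<Delta> R \<alpha> \<longleftrightarrow>
     bilinear_map scale R \<alpha> \<and>
     (\<forall>x y z.
        sweedler \<Delta> R x (\<lambda>x1 x2. sweedler \<Delta> R y (\<lambda>y1 y2. \<alpha> x1 y1 \<otimes>\<^bsub>R\<^esub> \<alpha> (x2 * y2) z)) =
        sweedler \<Delta> R y (\<lambda>y1 y2. sweedler \<Delta> R z (\<lambda>z1 z2. \<alpha> y1 z1 \<otimes>\<^bsub>R\<^esub> \<alpha> x (y2 * z2))))"

definition normalized ::
  "('h::ring_1 \<Rightarrow> 'k) \<Rightarrow> ('k, 'r, 'z) module_scheme \<Rightarrow> ('h \<Rightarrow> 'h \<Rightarrow> 'r) \<Rightarrow> bool" where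
  "normalized \<epsilon> R \<alpha> \<longleftrightarrow>
     (\<forall>x. \<alpha> x 1 = \<epsilon> x \<odot>\<^bsub>R\<^esub> \<one>\<^bsub>R\<^esub> \<and> \<alpha> 1 x = \<epsilon> x \<odot>\<^bsub>R\<^esub> \<one>\<^bsub>R\<^esub>)"

definition is_conv_inverse ::
  "('k::field \<Rightarrow> 'h::ring_1 \<Rightarrow> 'h) \<Rightarrow> ('h \<Rightarrow> ('h \<times> 'h \<Rightarrow>\<^sub>0 int) set) \<Rightarrow> ('h \<Rightarrow> 'k)
     \<Rightarrow> ('k, 'r, 'z) module_scheme \<Rightarrow> ('h \<Rightarrow> 'h \<Rightarrow> 'r) \<Rightarrow> ('h \<Rightarrow> 'h \<Rightarrow> 'r) \<Rightarrow> bool" where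
  "is_conv_inverse scale \<Delta> \<epsilon> R \<alpha> \<beta> \<longleftrightarrow>
     bilinear_map scale R \<beta> \<and>
     (\<forall>x y.
        sweedler \<Delta> R x (\<lambda>x1 x2. sweedler \<Delta> R y (\<lambda>y1 y2. \<alpha> x1 y1 \<otimes>\<^bsub>R\<^esub> \<beta> x2 y2))
          = (\<epsilon> x * \<epsilon> y) \<odot>\<^bsub>R\<^esub> \<one>\<^bsub>R\<^esub> \<and>
        sweedler \<Delta> R x (\<lambda>x1 x2. sweedler \<Delta> R y (\<lambda>y1 y2. \<beta> x1 y1 \<otimes>\<^bsub>R\<^esub> \<alpha> x2 y2))
          = (\<epsilon> x * \<epsilon> y) \<odot>\<^bsub>R\<^esub> \<one>\<^bsub>R\<^esub>)"

definition conv_invertible ::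
  "('k::field \<Rightarrow> 'h::ring_1 \<Rightarrow> 'h) \<Rightarrow> ('h \<Rightarrow> ('h \<times> 'h \<Rightarrow>\<^sub>0 int) set) \<Rightarrow> ('h \<Rightarrow> 'k)
     \<Rightarrow> ('k, 'r, 'z) module_scheme \<Rightarrow> ('h \<Rightarrow> 'h \<Rightarrow> 'r) \<Rightarrow> bool" where
  "conv_invertible scale \<Delta> \<epsilon> R \<alpha> \<longleftrightarrow> (\<exists>\<beta>. is_conv_inverse scale \<Delta> \<epsilon> R \<alpha> \<beta>)"

definition conv_inverse ::
  "('k::field \<Rightarrow> 'h::ring_1 \<Rightarrow> 'h) \<Rightarrow> ('h \<Rightarrow> ('h \<times> 'h \<Rightarrow>\<^sub>0 int) set) \<Rightarrow> ('h \<Rightarrow> 'k)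
     \<Rightarrow> ('k, 'r, 'z) module_scheme \<Rightarrow> ('h \<Rightarrow> 'h \<Rightarrow> 'r) \<Rightarrow> 'h \<Rightarrow> 'h \<Rightarrow> 'r" where
  "conv_inverse scale \<Delta> \<epsilon> R \<alpha> = (THE \<beta>. is_conv_inverse scale \<Delta> \<epsilon> R \<alpha> \<beta>)"

text \<open>The twisted algebra, as an \<open>R\<close>-algebra.  Its unit is \<open>\<alpha>(1,1)\<^sup>-\<^sup>1 \<otimes> 1\<close>; this is \<open>1 \<otimes> 1\<close> if \<open>\<alpha>\<close> is
  normalized, and \<open>t\<^sub>1\<^sup>-\<^sup>1 \<otimes> 1\<close> for the universal cocycle below.\<close>

definition twisted_algebra ::
  "('k::field \<Rightarrow> 'h::ring_1 \<Rightarrow> 'h) \<Rightarrow> ('h \<Rightarrow> ('h \<times> 'h \<Rightarrow>\<^sub>0 int) set)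
     \<Rightarrow> ('k, 'r, 'z) module_scheme \<Rightarrow> ('h \<Rightarrow> 'h \<Rightarrow> 'r)
     \<Rightarrow> ('r, ('r \<times> 'h \<Rightarrow>\<^sub>0 int) set) module" where
  "twisted_algebra scale \<Delta> R \<alpha> =
     (let T = tensor_additive ring_of_type_algebra R (type_algebra scale);
          tens = pure_tensor ring_of_type_algebra R (type_algebra scale) in
      \<lparr>carrier = carrier T,
       monoid.mult = (\<lambda>U V. tensor_lift T (\<lambda>b x. tensor_lift T (\<lambda>c y.
                 sweedler \<Delta> T x (\<lambda>x1 x2. sweedler \<Delta> T y (\<lambda>y1 y2.
                   tens (b \<otimes>\<^bsub>R\<^esub> c \<otimes>\<^bsub>R\<^esub> \<alpha> x1 y1) (x2 * y2)))) V) U),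
       monoid.one = tens (inv\<^bsub>R\<^esub> (\<alpha> 1 1)) 1,
       ring.zero = ring.zero T,
       add = ring.add T,
       module.smult = (\<lambda>b. tensor_lift T (\<lambda>c x. tens (b \<otimes>\<^bsub>R\<^esub> c) x))\<rparr>)"

text \<open>\<open>fraction D a b\<close> is the fraction \<open>a / b\<close> over an integral domain \<open>D\<close>, as an equivalence class
  of pairs.  Each union in \<open>fraction_field\<close> is over pairs representing one and the same class.\<close>

definition fraction :: "('a, 'z) ring_scheme \<Rightarrow> 'a \<Rightarrow> 'a \<Rightarrow> ('a \<times> 'a) set" where
  "fraction D a b =
     {(c, d). c \<in> carrier D \<and> d \<in> carrier D - {\<zero>\<^bsub>D\<^esub>} \<and> a \<otimes>\<^bsub>D\<^esub> d = c \<otimes>\<^bsub>D\<^esub> b}"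

definition fraction_field :: "('a, 'z) ring_scheme \<Rightarrow> ('a \<times> 'a) set ring" where
  "fraction_field D =
     \<lparr>carrier = {fraction D a b | a b. a \<in> carrier D \<and> b \<in> carrier D - {\<zero>\<^bsub>D\<^esub>}},
      monoid.mult = (\<lambda>U V. \<Union>(a, b)\<in>U. \<Union>(c, d)\<in>V. fraction D (a \<otimes>\<^bsub>D\<^esub> c) (b \<otimes>\<^bsub>D\<^esub> d)),
      monoid.one = fraction D \<one>\<^bsub>D\<^esub> \<one>\<^bsub>D\<^esub>,
      ring.zero = fraction D \<zero>\<^bsub>D\<^esub> \<one>\<^bsub>D\<^esub>,
      add = (\<lambda>U V. \<Union>(a, b)\<in>U. \<Union>(c, d)\<in>V.
               fraction D (a \<otimes>\<^bsub>D\<^esub> d \<oplus>\<^bsub>D\<^esub> c \<otimes>\<^bsub>D\<^esub> b) (b \<otimes>\<^bsub>D\<^esub> d))\<rparr>"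

definition fraction_algebra :: "('a, 'z) ring_scheme \<Rightarrow> ('a, ('a \<times> 'a) set) module" where
  "fraction_algebra D = algebra_via (\<lambda>a. fraction D a \<one>\<^bsub>D\<^esub>) (fraction_field D)"

text \<open>The symmetric algebra of a vector space is the commutative algebra with a generator for
  every vector, subject to the linear relations between vectors: a quotient of the polynomial
  ring \<open>('h \<Rightarrow>\<^sub>0 nat) \<Rightarrow>\<^sub>0 'k\<close> whose indeterminates are all elements of \<open>'h\<close>.\<close>

type_synonym ('k, 'h) polys = "('h \<Rightarrow>\<^sub>0 nat) \<Rightarrow>\<^sub>0 'k"

definition Const :: "'k::comm_ring_1 \<Rightarrow> ('k, 'h) polys" where
  "Const c = Poly_Mapping.single 0 c"

definition Indet :: "'h \<Rightarrow> ('k::comm_ring_1, 'h) polys" where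
  "Indet h = Poly_Mapping.single (Poly_Mapping.single h 1) 1"

definition symmetric_ideal ::
  "('k::field \<Rightarrow> 'h::ab_group_add \<Rightarrow> 'h) \<Rightarrow> ('k, 'h) polys set" where
  "symmetric_ideal scale = genideal ring_of_type_algebra
     ({Indet (x + y) - Indet x - Indet y | x y. True} \<union>
      {Indet (scale c x) - Const c * Indet x | c x. True})"

definition symmetric_algebra ::
  "('k::field \<Rightarrow> 'h::ab_group_add \<Rightarrow> 'h) \<Rightarrow> ('k, 'h) polys set ring" where
  "symmetric_algebra scale = ring_of_type_algebra Quot symmetric_ideal scale"

definition sym_class ::
  "('k::field \<Rightarrow> 'h::ab_group_add \<Rightarrow> 'h) \<Rightarrow> ('k, 'h) polys \<Rightarrow> ('k, 'h) polys set" where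
  "sym_class scale p = symmetric_ideal scale +>\<^bsub>ring_of_type_algebra\<^esub> p"

type_synonym ('k, 'h) sym_fracs = "(('k, 'h) polys set \<times> ('k, 'h) polys set) set"

definition sym_field ::
  "('k::field \<Rightarrow> 'h::ab_group_add \<Rightarrow> 'h) \<Rightarrow> ('k, ('k, 'h) sym_fracs) module" where
  "sym_field scale =
     algebra_via
       (\<lambda>c. fraction (symmetric_algebra scale) (sym_class scale (Const c))
              \<one>\<^bsub>symmetric_algebra scale\<^esub>)
       (fraction_field (symmetric_algebra scale))"

definition t_elem ::
  "('k::field \<Rightarrow> 'h::ab_group_add \<Rightarrow> 'h) \<Rightarrow> 'h \<Rightarrow> ('k, 'h) sym_fracs" where
  "t_elem scale h =
     fraction (symmetric_algebra scale) (sym_class scale (Indet h)) \<one>\<^bsub>symmetric_algebra scale\<^esub>"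

text \<open>The convolution inverse of \<open>t\<close>, not the pointwise inverse.\<close>

definition t_inv ::
  "('k::field \<Rightarrow> 'h::ring_1 \<Rightarrow> 'h) \<Rightarrow> ('h \<Rightarrow> ('h \<times> 'h \<Rightarrow>\<^sub>0 int) set) \<Rightarrow> ('h \<Rightarrow> 'k)
     \<Rightarrow> 'h \<Rightarrow> ('k, 'h) sym_fracs" where
  "t_inv scale \<Delta> \<epsilon> =
     (let K = sym_field scale in
      THE s. linear_map scale K s \<and>
        (\<forall>h. sweedler \<Delta> K h (\<lambda>h1 h2. t_elem scale h1 \<otimes>\<^bsub>K\<^esub> s h2) = \<epsilon> h \<odot>\<^bsub>K\<^esub> \<one>\<^bsub>K\<^esub> \<and>
             sweedler \<Delta> K h (\<lambda>h1 h2. s h1 \<otimes>\<^bsub>K\<^esub> t_elem scale h2) = \<epsilon> h \<odot>\<^bsub>K\<^esub> \<one>\<^bsub>K\<^esub>))"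

text \<open>From here on \<open>\<alpha>\<close> is a convolution-invertible two-cocycle with values in the ground field.\<close>

definition sigma ::
  "('k::field \<Rightarrow> 'h::ring_1 \<Rightarrow> 'h) \<Rightarrow> ('h \<Rightarrow> ('h \<times> 'h \<Rightarrow>\<^sub>0 int) set) \<Rightarrow> ('h \<Rightarrow> 'k)
     \<Rightarrow> ('h \<Rightarrow> 'h \<Rightarrow> 'k) \<Rightarrow> 'h \<Rightarrow> 'h \<Rightarrow> ('k, 'h) sym_fracs" where
  "sigma scale \<Delta> \<epsilon> \<alpha> x y =
     (let K = sym_field scale in
      sweedler3 \<Delta> K x (\<lambda>x1 x2 x3. sweedler3 \<Delta> K y (\<lambda>y1 y2 y3.
        t_elem scale x1 \<otimes>\<^bsub>K\<^esub> t_elem scale y1 \<otimes>\<^bsub>K\<^esub> (\<alpha> x2 y2 \<odot>\<^bsub>K\<^esub> t_inv scale \<Delta> \<epsilon> (x3 * y3)))))"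

definition sigma_inv ::
  "('k::field \<Rightarrow> 'h::ring_1 \<Rightarrow> 'h) \<Rightarrow> ('h \<Rightarrow> ('h \<times> 'h \<Rightarrow>\<^sub>0 int) set) \<Rightarrow> ('h \<Rightarrow> 'k)
     \<Rightarrow> ('h \<Rightarrow> 'h \<Rightarrow> 'k) \<Rightarrow> 'h \<Rightarrow> 'h \<Rightarrow> ('k, 'h) sym_fracs" where
  "sigma_inv scale \<Delta> \<epsilon> \<alpha> x y =
     (let K = sym_field scale; \<beta> = conv_inverse scale \<Delta> \<epsilon> (type_algebra (*)) \<alpha> in
      sweedler3 \<Delta> K x (\<lambda>x1 x2 x3. sweedler3 \<Delta> K y (\<lambda>y1 y2 y3.
        t_elem scale (x1 * y1) \<otimes>\<^bsub>K\<^esub>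
          (\<beta> x2 y2 \<odot>\<^bsub>K\<^esub> (t_inv scale \<Delta> \<epsilon> x3 \<otimes>\<^bsub>K\<^esub> t_inv scale \<Delta> \<epsilon> y3)))))"

definition B_alg ::
  "('k::field \<Rightarrow> 'h::ring_1 \<Rightarrow> 'h) \<Rightarrow> ('h \<Rightarrow> ('h \<times> 'h \<Rightarrow>\<^sub>0 int) set) \<Rightarrow> ('h \<Rightarrow> 'k)
     \<Rightarrow> ('h \<Rightarrow> 'h \<Rightarrow> 'k) \<Rightarrow> ('k, ('k, 'h) sym_fracs) module" where
  "B_alg scale \<Delta> \<epsilon> \<alpha> =
     (let K = sym_field scale in
      K\<lparr>carrier := generate_ring K
          ({c \<odot>\<^bsub>K\<^esub> \<one>\<^bsub>K\<^esub> | c. True} \<union>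
           {sigma scale \<Delta> \<epsilon> \<alpha> x y | x y. True} \<union>
           {sigma_inv scale \<Delta> \<epsilon> \<alpha> x y | x y. True})\<rparr>)"

definition A_alg ::
  "('k::field \<Rightarrow> 'h::ring_1 \<Rightarrow> 'h) \<Rightarrow> ('h \<Rightarrow> ('h \<times> 'h \<Rightarrow>\<^sub>0 int) set) \<Rightarrow> ('h \<Rightarrow> 'k)
     \<Rightarrow> ('h \<Rightarrow> 'h \<Rightarrow> 'k)
     \<Rightarrow> (('k, 'h) sym_fracs, (('k, 'h) sym_fracs \<times> 'h \<Rightarrow>\<^sub>0 int) set) module" where
  "A_alg scale \<Delta> \<epsilon> \<alpha> =
     twisted_algebra scale \<Delta> (B_alg scale \<Delta> \<epsilon> \<alpha>) (sigma scale \<Delta> \<epsilon> \<alpha>)"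

end

theory Submission
  imports
    Defs
    "HOL-Library.Function_Algebras"
    "Jordan_Normal_Form.Determinant"
    "HOL-Computational_Algebra.Fraction_Field"
begin

text \<open>Over \<open>K\<^sub>H\<close> the cocycle \<open>\<sigma>\<close> is cohomologous to \<open>\<alpha>\<close>: the map \<open>x \<mapsto> \<Sum> t(x\<^sub>1) \<otimes> x\<^sub>2\<close> is an
  isomorphism from the \<open>\<sigma>\<close>-twisted to the \<open>\<alpha>\<close>-twisted algebra, and it is invertible because the
  determinant of its matrix is a polynomial that specialises to \<open>1\<close> at the counit. In characteristic
  zero a finite-dimensional algebra is semisimple if and only if its trace form is nondegenerate: an
  idempotent generating a left ideal inside the radical of the form has rank equal to its trace, which
  is \<open>0\<close>; conversely, a dual basis gives a separability idempotent. Nondegeneracy is the nonvanishing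
  of a Gram determinant, so it passes from \<open>k\<close> to \<open>K\<^sub>H\<close>, through the isomorphism, and down to the
  field of fractions of \<open>B\<close>, over which the structure constants of the \<open>\<sigma>\<close>-twisted algebra lie.
  Everything is computed with the coordinates of one fixed basis of \<open>H\<close>; in particular the
  associativity of the \<open>\<sigma>\<close>-twisted algebra is pulled back along the isomorphism.\<close>

section \<open>Tensor products over a commutative ring\<close>

text \<open>Elements of a tensor product are cosets of formal sums, and maps out of it choose a
  representative; nothing can be computed until coordinates are known to separate its elements. The
  second factor is therefore always free of finite rank. S(t_H), \<open>B\<close> and their fields
  of fractions are records: each receives an injective map into one field type, and ring laws and
  identities are checked there. The matrix of the gauge isomorphism has entries in K_H, with nothing
  to place them in the field of fractions of \<open>B\<close>, so the algebra laws and the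
  nondegeneracy are transferred over the large field. Only then does one descend to the smaller
  field, which contains the structure constants: the inverse of the Gram matrix, being made of
  determinants, stays in it, and with it the dual basis and the projection onto a left ideal. The
  map t^{-1} enters as a definite description, so its existence and uniqueness are proved too; both
  rest on the same determinant as the gauge isomorphism.\<close>

lemma abelian_group_cong:
  assumes "abelian_group A" "carrier B = carrier A" "add B = add A" "\<zero>\<^bsub>B\<^esub> = \<zero>\<^bsub>A\<^esub>"
  shows "abelian_group B"
proof -
  interpret A: abelian_group A by fact
  show ?thesis
  proof (rule abelian_groupI)
    show "\<exists>y\<in>carrier B. y \<oplus>\<^bsub>B\<^esub> x = \<zero>\<^bsub>B\<^esub>" if "x \<in> carrier B" for x
      using that assms A.l_neg by (intro bexI[of _ "\<ominus>\<^bsub>A\<^esub> x"]) auto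
  qed (use assms in \<open>auto simp: A.a_assoc intro: A.a_comm\<close>)
qed

text \<open>\<open>tensor_lift\<close> applies this sum to a representative picked by
  \<open>SOME\<close>. Separating the sum from the choice lets additivity be proved first and
  independence of the representative be deduced from it.\<close>

definition formal_lift ::
  "('t, 'z) ring_scheme \<Rightarrow> ('m \<Rightarrow> 'n \<Rightarrow> 't) \<Rightarrow> ('m \<times> 'n \<Rightarrow>\<^sub>0 int) \<Rightarrow> 't" where
  "formal_lift T f u =
     (\<Oplus>\<^bsub>T\<^esub>p\<in>Poly_Mapping.keys u. [Poly_Mapping.lookup u p] \<cdot>\<^bsub>T\<^esub> f (fst p) (snd p))"

context abelian_group
begin

lemma formal_lift_superset:
  assumes "\<And>m n. (m, n) \<in> S \<Longrightarrow> f m n \<in> carrier G" "finite A" "A \<subseteq> S" "Poly_Mapping.keys u \<subseteq> A"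
  shows "formal_lift G f u = (\<Oplus>p\<in>A. [Poly_Mapping.lookup u p] \<cdot> f (fst p) (snd p))"
  unfolding formal_lift_def
proof (rule add.finprod_mono_neutral_cong_left)
  fix i assume "i \<in> A - Poly_Mapping.keys u"
  then have "Poly_Mapping.lookup u i = 0" by (simp add: in_keys_iff)
  then show "[Poly_Mapping.lookup u i] \<cdot> f (fst i) (snd i) = \<zero>"
    by (simp add: add_pow_def)
qed (use assms in \<open>auto intro!: add.int_pow_closed\<close>)

text \<open>Supports may shrink under addition, so everything is rewritten over the union of the two
  supports, where the coefficients add termwise.\<close>

lemma formal_lift_hom:
  assumes "\<And>m n. (m, n) \<in> S \<Longrightarrow> f m n \<in> carrier G"
  shows "formal_lift G f \<in> hom (free_Abelian_group S) (add_monoid G)"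
proof (rule homI)
  fix u v assume u: "u \<in> carrier (free_Abelian_group S)" and v: "v \<in> carrier (free_Abelian_group S)"
  let ?A = "Poly_Mapping.keys u \<union> Poly_Mapping.keys v"
  have A: "finite ?A" "?A \<subseteq> S" using u v by auto
  have "formal_lift G f (u + v) = (\<Oplus>p\<in>?A. [Poly_Mapping.lookup (u+v) p] \<cdot> f (fst p) (snd p))"
    by (rule formal_lift_superset[OF assms A]) (auto simp: Poly_Mapping.keys_add)
  also have "\<dots> = (\<Oplus>p\<in>?A. [Poly_Mapping.lookup u p] \<cdot> f (fst p) (snd p) \<oplus>
                       [Poly_Mapping.lookup v p] \<cdot> f (fst p) (snd p))"
    using A(2) assms
    by (intro add.finprod_cong') (auto simp: lookup_add add.int_pow_mult subset_iff intro!: add.int_pow_closed)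
  also have "\<dots> = (\<Oplus>p\<in>?A. [Poly_Mapping.lookup u p] \<cdot> f (fst p) (snd p)) \<oplus>
                  (\<Oplus>p\<in>?A. [Poly_Mapping.lookup v p] \<cdot> f (fst p) (snd p))"
    by (rule add.finprod_multf) (use A(2) assms in \<open>auto simp: subset_iff intro!: add.int_pow_closed\<close>)
  also have "\<dots> = formal_lift G f u \<oplus> formal_lift G f v"
    by (simp add: formal_lift_superset[OF assms A])
  finally show "formal_lift G f (u \<otimes>\<^bsub>free_Abelian_group S\<^esub> v) =
      formal_lift G f u \<otimes>\<^bsub>add_monoid G\<^esub> formal_lift G f v" by simp
next
  fix u assume u: "u \<in> carrier (free_Abelian_group S)"
  show "formal_lift G f u \<in> carrier (add_monoid G)"
    unfolding formal_lift_def using u assms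
    by (auto intro!: add.finprod_closed add.int_pow_closed)
qed

lemma formal_lift_frag_of:
  assumes "f m n \<in> carrier G"
  shows "formal_lift G f (frag_of (m, n)) = f m n"
  using assms by (simp add: formal_lift_def add.finprod_singleton add.int_pow_1)

end

section \<open>The tensor product as an abelian group, with its universal property\<close>

locale tensor_pair =
  fixes R :: "('r, 'x) ring_scheme" and M :: "('r, 'm, 'y) module_scheme"
    and N :: "('r, 'n, 'z) module_scheme"
  assumes M_group: "abelian_group M" and N_group: "abelian_group N"
    and M_smult: "\<And>r m. r \<in> carrier R \<Longrightarrow> m \<in> carrier M \<Longrightarrow> r \<odot>\<^bsub>M\<^esub> m \<in> carrier M"
    and N_smult: "\<And>r n. r \<in> carrier R \<Longrightarrow> n \<in> carrier N \<Longrightarrow> r \<odot>\<^bsub>N\<^esub> n \<in> carrier N"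
begin

sublocale M: abelian_group M by (rule M_group)
sublocale N: abelian_group N by (rule N_group)

abbreviation "FG \<equiv> free_Abelian_group (carrier M \<times> carrier N)"
abbreviation "Ker \<equiv> tensor_kernel R M N"
abbreviation "T \<equiv> tensor_additive R M N"
abbreviation "tens \<equiv> pure_tensor R M N"

lemma keys_frag_diff: "a \<in> carrier FG \<Longrightarrow> b \<in> carrier FG \<Longrightarrow> a - b \<in> carrier FG"
  using Poly_Mapping.keys_diff[of a b] by auto

lemma rels_carrier: "tensor_rels R M N \<subseteq> carrier FG"
  unfolding tensor_rels_def
  using M_smult N_smult
  by (auto simp del: carrier_free_Abelian_group_iff intro!: keys_frag_diff simp: frag_of_in_free_Abelian_group)

lemma Ker_subgroup: "subgroup Ker FG"
  unfolding tensor_kernel_def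
  by (rule group.generate_is_subgroup[OF group_free_Abelian_group rels_carrier])

sublocale Q: comm_group "FG Mod Ker"
  by (rule comm_group.abelian_FactGroup[OF abelian_free_Abelian_group Ker_subgroup])

sublocale K: normal Ker FG
  by (rule comm_group.subgroup_imp_normal[OF abelian_free_Abelian_group Ker_subgroup])

lemma T_group: "abelian_group T"
proof (rule comm_group_abelian_groupI)
  have "add_monoid T = FG Mod Ker"
    by (simp add: tensor_additive_def tensor_group_def)
  then show "comm_group (add_monoid T)"
    using Q.comm_group_axioms by simp
qed

sublocale T: abelian_group T by (rule T_group)

lemma T_carrier: "carrier T = {Ker #>\<^bsub>FG\<^esub> u | u. u \<in> carrier FG}"
  by (auto simp: tensor_additive_def tensor_group_def FactGroup_def RCOSETS_def)

lemma T_add: "u \<in> carrier FG \<Longrightarrow> v \<in> carrier FG \<Longrightarrow>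
    (Ker #>\<^bsub>FG\<^esub> u) \<oplus>\<^bsub>T\<^esub> (Ker #>\<^bsub>FG\<^esub> v) = Ker #>\<^bsub>FG\<^esub> (u + v)"
  using K.rcos_sum[of u v]
  by (simp add: tensor_additive_def tensor_group_def FactGroup_def)

lemma T_zero: "\<zero>\<^bsub>T\<^esub> = Ker #>\<^bsub>FG\<^esub> 0"
  using K.coset_mult_one[OF K.subset]
  by (simp add: tensor_additive_def tensor_group_def FactGroup_def)

lemma tens_closed: "m \<in> carrier M \<Longrightarrow> n \<in> carrier N \<Longrightarrow> tens m n \<in> carrier T"
  by (auto simp: T_carrier pure_tensor_def)

lemma coset_eqI:
  assumes "u \<in> carrier FG" "v \<in> carrier FG" "u - v \<in> Ker"
  shows "Ker #>\<^bsub>FG\<^esub> u = Ker #>\<^bsub>FG\<^esub> v"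
proof -
  have "u \<in> Ker #>\<^bsub>FG\<^esub> v"
    unfolding r_coset_def using assms by (auto intro!: bexI[of _ "u - v"])
  then show ?thesis
    using K.repr_independence assms Ker_subgroup by blast
qed

lemma rel_in_Ker: "u \<in> tensor_rels R M N \<Longrightarrow> u \<in> Ker"
  unfolding tensor_kernel_def by (rule generate.incl)

lemma tens_add_left:
  assumes "m \<in> carrier M" "m' \<in> carrier M" "n \<in> carrier N"
  shows "tens (m \<oplus>\<^bsub>M\<^esub> m') n = tens m n \<oplus>\<^bsub>T\<^esub> tens m' n"
  unfolding pure_tensor_def
proof (subst T_add)
  show "Ker #>\<^bsub>FG\<^esub> frag_of (m \<oplus>\<^bsub>M\<^esub> m', n) = Ker #>\<^bsub>FG\<^esub> (frag_of (m, n) + frag_of (m', n))"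
  proof (rule coset_eqI)
    have "frag_of (m \<oplus>\<^bsub>M\<^esub> m', n) - frag_of (m, n) - frag_of (m', n) \<in> Ker"
      using assms by (intro rel_in_Ker) (auto simp: tensor_rels_def)
    then show "frag_of (m \<oplus>\<^bsub>M\<^esub> m', n) - (frag_of (m, n) + frag_of (m', n)) \<in> Ker"
      by (simp add: algebra_simps)
  qed (use assms Poly_Mapping.keys_add[of "frag_of (m, n)" "frag_of (m', n)"] in auto)
qed (use assms in auto)

lemma tens_add_right:
  assumes "m \<in> carrier M" "n \<in> carrier N" "n' \<in> carrier N"
  shows "tens m (n \<oplus>\<^bsub>N\<^esub> n') = tens m n \<oplus>\<^bsub>T\<^esub> tens m n'"
  unfolding pure_tensor_def
proof (subst T_add)
  show "Ker #>\<^bsub>FG\<^esub> frag_of (m, n \<oplus>\<^bsub>N\<^esub> n') = Ker #>\<^bsub>FG\<^esub> (frag_of (m, n) + frag_of (m, n'))"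
  proof (rule coset_eqI)
    have "frag_of (m, n \<oplus>\<^bsub>N\<^esub> n') - frag_of (m, n) - frag_of (m, n') \<in> Ker"
      using assms by (intro rel_in_Ker) (auto simp: tensor_rels_def)
    then show "frag_of (m, n \<oplus>\<^bsub>N\<^esub> n') - (frag_of (m, n) + frag_of (m, n')) \<in> Ker"
      by (simp add: algebra_simps)
  qed (use assms Poly_Mapping.keys_add[of "frag_of (m, n)" "frag_of (m, n')"] in auto)
qed (use assms in auto)

lemma tens_balanced:
  assumes "r \<in> carrier R" "m \<in> carrier M" "n \<in> carrier N"
  shows "tens (r \<odot>\<^bsub>M\<^esub> m) n = tens m (r \<odot>\<^bsub>N\<^esub> n)"
  unfolding pure_tensor_def
proof (rule coset_eqI)
  show "frag_of (r \<odot>\<^bsub>M\<^esub> m, n) - frag_of (m, r \<odot>\<^bsub>N\<^esub> n) \<in> Ker"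
    using assms by (intro rel_in_Ker) (auto simp: tensor_rels_def)
qed (use assms M_smult N_smult in auto)

lemma tens_uminus:
  assumes "m \<in> carrier M" "n \<in> carrier N"
  shows "tens (\<ominus>\<^bsub>M\<^esub> m) n = \<ominus>\<^bsub>T\<^esub> tens m n"
proof -
  have 0: "tens \<zero>\<^bsub>M\<^esub> n = \<zero>\<^bsub>T\<^esub>"
    using tens_add_left[of "\<zero>\<^bsub>M\<^esub>" "\<zero>\<^bsub>M\<^esub>" n] assms tens_closed[of "\<zero>\<^bsub>M\<^esub>" n] 
    by (simp add: T.add.r_cancel_one')
  have "tens (\<ominus>\<^bsub>M\<^esub> m) n \<oplus>\<^bsub>T\<^esub> tens m n = \<zero>\<^bsub>T\<^esub>"
    using tens_add_left[of "\<ominus>\<^bsub>M\<^esub> m" m n] assms 0 by (simp add: M.l_neg)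
  then show ?thesis
    using assms by (intro T.minus_equality[symmetric]) (auto intro: tens_closed)
qed

text \<open>There is no case for negatives: the induction on the free abelian group passes through
  differences, so the claim is carried for \<open>u\<close> and \<open>- u\<close> together, and the
  negative of a pure tensor is again pure by \<open>tens_uminus\<close>.\<close>

lemma tensor_induct [consumes 1, case_names zero pure add]:
  assumes U: "U \<in> carrier T"
    and zero: "P \<zero>\<^bsub>T\<^esub>"
    and pure: "\<And>m n. m \<in> carrier M \<Longrightarrow> n \<in> carrier N \<Longrightarrow> P (tens m n)"
    and add: "\<And>U V. U \<in> carrier T \<Longrightarrow> V \<in> carrier T \<Longrightarrow> P U \<Longrightarrow> P V \<Longrightarrow> P (U \<oplus>\<^bsub>T\<^esub> V)"
  shows "P U"
proof -
  have *: "P (Ker #>\<^bsub>FG\<^esub> u) \<and> P (Ker #>\<^bsub>FG\<^esub> (- u))" if "Poly_Mapping.keys u \<subseteq> carrier M \<times> carrier N" for u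
  proof (rule free_Abelian_group_induct[OF that])
    show "P (Ker #>\<^bsub>FG\<^esub> 0) \<and> P (Ker #>\<^bsub>FG\<^esub> (- 0))" using zero by (simp add: T_zero)
  next
    fix x y
    assume 2: "Poly_Mapping.keys x \<subseteq> carrier M \<times> carrier N" "Poly_Mapping.keys y \<subseteq> carrier M \<times> carrier N"
      "P (Ker #>\<^bsub>FG\<^esub> x) \<and> P (Ker #>\<^bsub>FG\<^esub> (- x))" "P (Ker #>\<^bsub>FG\<^esub> y) \<and> P (Ker #>\<^bsub>FG\<^esub> (- y))"
    have coset: "Ker #>\<^bsub>FG\<^esub> v \<in> carrier T" if "v \<in> carrier FG" for v
      using that by (auto simp: T_carrier)
    have "P ((Ker #>\<^bsub>FG\<^esub> x) \<oplus>\<^bsub>T\<^esub> (Ker #>\<^bsub>FG\<^esub> (- y)))"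
      by (intro add coset) (use 2 in auto)
    moreover have "P ((Ker #>\<^bsub>FG\<^esub> (- x)) \<oplus>\<^bsub>T\<^esub> (Ker #>\<^bsub>FG\<^esub> y))"
      by (intro add coset) (use 2 in auto)
    ultimately show "P (Ker #>\<^bsub>FG\<^esub> (x - y)) \<and> P (Ker #>\<^bsub>FG\<^esub> (- (x - y)))"
      using 2 by (simp add: T_add)
  next
    fix a assume 3: "a \<in> carrier M \<times> carrier N"
    obtain m n where a: "a = (m, n)" and mn: "m \<in> carrier M" "n \<in> carrier N" using 3 by auto
    have "(Ker #>\<^bsub>FG\<^esub> (- frag_of (m, n))) \<oplus>\<^bsub>T\<^esub> tens m n = \<zero>\<^bsub>T\<^esub>"
      unfolding pure_tensor_def using mn by (subst T_add) (auto simp: T_zero)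
    moreover have "Ker #>\<^bsub>FG\<^esub> (- frag_of (m, n)) \<in> carrier T"
      unfolding T_carrier using mn by (auto intro!: exI[of _ "- frag_of (m, n)"])
    ultimately have "\<ominus>\<^bsub>T\<^esub> tens m n = Ker #>\<^bsub>FG\<^esub> (- frag_of (m, n))"
      using mn by (intro T.minus_equality) (auto intro: tens_closed)
    then show "P (Ker #>\<^bsub>FG\<^esub> frag_of a) \<and> P (Ker #>\<^bsub>FG\<^esub> (- frag_of a))"
      using pure[OF mn] pure[of "\<ominus>\<^bsub>M\<^esub> m" n] mn tens_uminus[OF mn]
      by (simp add: a pure_tensor_def)
  qed
  then show ?thesis using U by (auto simp: T_carrier)
qed

definition balanced :: "('t, 'w) ring_scheme \<Rightarrow> ('m \<Rightarrow> 'n \<Rightarrow> 't) \<Rightarrow> bool" where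
  "balanced W f \<longleftrightarrow>
     (\<forall>m\<in>carrier M. \<forall>n\<in>carrier N. f m n \<in> carrier W) \<and>
     (\<forall>m\<in>carrier M. \<forall>m'\<in>carrier M. \<forall>n\<in>carrier N. f (m \<oplus>\<^bsub>M\<^esub> m') n = f m n \<oplus>\<^bsub>W\<^esub> f m' n) \<and>
     (\<forall>m\<in>carrier M. \<forall>n\<in>carrier N. \<forall>n'\<in>carrier N. f m (n \<oplus>\<^bsub>N\<^esub> n') = f m n \<oplus>\<^bsub>W\<^esub> f m n') \<and>
     (\<forall>r\<in>carrier R. \<forall>m\<in>carrier M. \<forall>n\<in>carrier N. f (r \<odot>\<^bsub>M\<^esub> m) n = f m (r \<odot>\<^bsub>N\<^esub> n))"

text \<open>The formal lift is a homomorphism that kills the generating relations, hence all of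
  \<open>Ker\<close>; the representative chosen by \<open>SOME\<close> differs from \<open>u\<close>
  by an element of \<open>Ker\<close>.\<close>

lemma lift_coset:
  assumes W: "abelian_group W" and f: "balanced W f" and u: "u \<in> carrier FG"
  shows "tensor_lift W f (Ker #>\<^bsub>FG\<^esub> u) = formal_lift W f u"
proof -
  interpret W: abelian_group W by fact
  let ?L = "formal_lift W f"
  have fc: "\<And>m n. (m, n) \<in> carrier M \<times> carrier N \<Longrightarrow> f m n \<in> carrier W"
    using f by (auto simp: balanced_def)
  interpret L: group_hom FG "add_monoid W" ?L
    using W.formal_lift_hom[of "carrier M \<times> carrier N" f] fc
    by (intro group_hom.intro group_hom_axioms.intro W.a_group group_free_Abelian_group) auto
  have diff: "?L (a - b) = ?L a \<ominus>\<^bsub>W\<^esub> ?L b" if "a \<in> carrier FG" "b \<in> carrier FG" for a b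
  proof -
    have "?L (a + (- b)) = ?L a \<oplus>\<^bsub>W\<^esub> ?L (- b)"
      using L.hom_mult[of a "- b"] that by simp
    moreover have "?L (- b) = \<ominus>\<^bsub>W\<^esub> ?L b"
      using L.hom_inv[of b] that by (simp add: a_inv_def)
    ultimately show ?thesis by (simp add: a_minus_def)
  qed
  have frag: "?L (frag_of (m, n)) = f m n" if "m \<in> carrier M" "n \<in> carrier N" for m n
    using that fc by (intro W.formal_lift_frag_of) auto
  \<comment> \<open>This is the shape to which the two biadditivity relations are sent; the
    balancing relation becomes a plain difference of equal terms.\<close>
  have cancel: "(a \<oplus>\<^bsub>W\<^esub> b) \<oplus>\<^bsub>W\<^esub> \<ominus>\<^bsub>W\<^esub> a \<oplus>\<^bsub>W\<^esub> \<ominus>\<^bsub>W\<^esub> b = \<zero>\<^bsub>W\<^esub>"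
    if "a \<in> carrier W" "b \<in> carrier W" for a b
    using that by (metis W.a_assoc W.a_comm W.a_inv_closed W.add.m_closed W.minus_add W.r_neg)
  have rel: "?L v = \<zero>\<^bsub>W\<^esub>" if "v \<in> tensor_rels R M N" for v
    using that f M_smult N_smult fc unfolding tensor_rels_def balanced_def
    by (auto simp: diff frag keys_frag_diff[simplified] W.minus_eq W.r_neg cancel)
  have ker: "?L v = \<zero>\<^bsub>W\<^esub>" if "v \<in> Ker" for v
    using that unfolding tensor_kernel_def
  proof (induction rule: generate.induct)
    case one then show ?case using L.hom_one by simp
  next
    case (incl h) then show ?case by (rule rel)
  next
    case (inv h)
    then show ?case using rels_carrier rel[OF inv] L.hom_inv[of h] W.add.inv_one by (auto simp: a_inv_def)
  next
    case (eng a b)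
    have "a \<in> carrier FG" "b \<in> carrier FG"
      using eng group.generate_in_carrier[OF group_free_Abelian_group rels_carrier] by blast+
    then show ?case using L.hom_mult[of a b] eng by simp
  qed
  let ?u = "SOME v. v \<in> Ker #>\<^bsub>FG\<^esub> u"
  have "u \<in> Ker #>\<^bsub>FG\<^esub> u" using K.rcos_self[OF u] Ker_subgroup by simp
  then have "?u \<in> Ker #>\<^bsub>FG\<^esub> u" by (rule someI)
  then obtain v where v: "v \<in> Ker" "?u = v + u" by (auto simp: r_coset_def)
  have "?L (v + u) = ?L u"
    using L.hom_mult[of v u] ker[OF v(1)] u v K.subset L.hom_closed[of u] by (auto simp: subset_iff)
  then show ?thesis
    unfolding tensor_lift_def Let_def v(2)[symmetric] by (simp add: formal_lift_def)
qed

lemma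
  assumes W: "abelian_group W" and f: "balanced W f"
  shows lift_closed: "U \<in> carrier T \<Longrightarrow> tensor_lift W f U \<in> carrier W"
    and lift_add: "U \<in> carrier T \<Longrightarrow> V \<in> carrier T \<Longrightarrow>
           tensor_lift W f (U \<oplus>\<^bsub>T\<^esub> V) = tensor_lift W f U \<oplus>\<^bsub>W\<^esub> tensor_lift W f V"
    and lift_pure: "m \<in> carrier M \<Longrightarrow> n \<in> carrier N \<Longrightarrow> tensor_lift W f (tens m n) = f m n"
proof -
  interpret W: abelian_group W by fact
  have fc: "\<And>m n. (m, n) \<in> carrier M \<times> carrier N \<Longrightarrow> f m n \<in> carrier W"
    using f by (auto simp: balanced_def)
  note L = W.formal_lift_hom[of "carrier M \<times> carrier N" f, OF fc]
  show "tensor_lift W f U \<in> carrier W" if "U \<in> carrier T"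
    using that lift_coset[OF W f] hom_in_carrier[OF L] by (auto simp: T_carrier)
  show "tensor_lift W f (U \<oplus>\<^bsub>T\<^esub> V) = tensor_lift W f U \<oplus>\<^bsub>W\<^esub> tensor_lift W f V"
    if UV: "U \<in> carrier T" "V \<in> carrier T"
  proof -
    obtain u v where uv: "U = Ker #>\<^bsub>FG\<^esub> u" "V = Ker #>\<^bsub>FG\<^esub> v" "u \<in> carrier FG" "v \<in> carrier FG"
      using UV by (auto simp: T_carrier)
    have "u + v \<in> carrier FG"
      using uv(3,4) Poly_Mapping.keys_add[of u v] by auto
    then show ?thesis
      using hom_mult[OF L uv(3,4)] lift_coset[OF W f] uv T_add by simp
  qed
  show "tensor_lift W f (tens m n) = f m n" if "m \<in> carrier M" "n \<in> carrier N"
    unfolding pure_tensor_def using that fc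
    by (subst lift_coset[OF W f]) (auto intro!: W.formal_lift_frag_of)
qed

lemma lift_zero:
  assumes W: "abelian_group W" and f: "balanced W f"
  shows "tensor_lift W f \<zero>\<^bsub>T\<^esub> = \<zero>\<^bsub>W\<^esub>"
proof -
  interpret W: abelian_group W by fact
  show ?thesis
    using lift_add[OF W f, of "\<zero>\<^bsub>T\<^esub>" "\<zero>\<^bsub>T\<^esub>"] lift_closed[OF W f, of "\<zero>\<^bsub>T\<^esub>"]
    by (simp add: W.add.r_cancel_one')
qed

end


text \<open>A family of additive functionals, indexed by \<open>l\<close>, that separates points
  only jointly. Through it, identities in a quotient group become identities in a commutative ring
  type.\<close>

definition joint_embedding :: "('t, 'w) ring_scheme \<Rightarrow> ('t \<Rightarrow> 'l \<Rightarrow> 'f::comm_ring_1) \<Rightarrow> bool" where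
  "joint_embedding W \<chi> \<longleftrightarrow> abelian_group W \<and>
     (\<forall>x\<in>carrier W. \<forall>y\<in>carrier W. \<forall>l. \<chi> (x \<oplus>\<^bsub>W\<^esub> y) l = \<chi> x l + \<chi> y l) \<and>
     (\<forall>x\<in>carrier W. \<forall>y\<in>carrier W. (\<forall>l. \<chi> x l = \<chi> y l) \<longrightarrow> x = y)"

lemma joint_embedding_add:
  "joint_embedding W \<chi> \<Longrightarrow> x \<in> carrier W \<Longrightarrow> y \<in> carrier W \<Longrightarrow> \<chi> (x \<oplus>\<^bsub>W\<^esub> y) l = \<chi> x l + \<chi> y l"
  by (simp add: joint_embedding_def)

lemma joint_embedding_inj:
  "joint_embedding W \<chi> \<Longrightarrow> x \<in> carrier W \<Longrightarrow> y \<in> carrier W \<Longrightarrow> (\<And>l. \<chi> x l = \<chi> y l) \<Longrightarrow> x = y"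
  by (simp add: joint_embedding_def)

lemma joint_embedding_zero:
  assumes "joint_embedding W \<chi>"
  shows "\<chi> \<zero>\<^bsub>W\<^esub> l = 0"
proof -
  interpret abelian_group W using assms by (simp add: joint_embedding_def)
  show ?thesis using joint_embedding_add[OF assms, of "\<zero>\<^bsub>W\<^esub>" "\<zero>\<^bsub>W\<^esub>" l] by simp
qed

lemma joint_embedding_finsum:
  assumes W: "joint_embedding W \<chi>" and A: "finite A" and f: "\<And>i. i \<in> A \<Longrightarrow> f i \<in> carrier W"
  shows "\<chi> (\<Oplus>\<^bsub>W\<^esub>i\<in>A. f i) l = (\<Sum>i\<in>A. \<chi> (f i) l)"
proof -
  interpret abelian_group W using W by (simp add: joint_embedding_def)
  show ?thesis using A f
    by (induction A rule: finite_induct)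
      (auto simp: joint_embedding_zero[OF W] joint_embedding_add[OF W] finsum_closed Pi_def finsum_insert)
qed

lemma ring_of_type_algebra_simps [simp]:
  "carrier ring_of_type_algebra = UNIV"
  "x \<oplus>\<^bsub>ring_of_type_algebra\<^esub> y = x + y"
  "x \<otimes>\<^bsub>ring_of_type_algebra\<^esub> y = x * y"
  "\<zero>\<^bsub>ring_of_type_algebra\<^esub> = 0"
  "\<one>\<^bsub>ring_of_type_algebra\<^esub> = 1"
  by (simp_all add: ring_of_type_algebra_def)

lemma abelian_group_ring_of_type: "abelian_group (ring_of_type_algebra :: 'f::comm_ring_1 ring)"
  by (rule ringE(1)) (rule ring_from_type_algebra)

text \<open>The functionals separate points, so balancedness may be checked after applying each of
  them.\<close>

lemma (in tensor_pair) balanced_embI: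
  assumes W: "joint_embedding W \<chi>"
    and f: "\<And>m n. m \<in> carrier M \<Longrightarrow> n \<in> carrier N \<Longrightarrow> f m n \<in> carrier W"
    and b: "\<And>l. balanced ring_of_type_algebra (\<lambda>m n. \<chi> (f m n) l)"
  shows "balanced W f"
proof -
  interpret W: abelian_group W using W by (simp add: joint_embedding_def)
  show ?thesis
    using b M_smult N_smult unfolding balanced_def
    by (auto simp: f joint_embedding_add[OF W] intro!: joint_embedding_inj[OF W])
qed

text \<open>\<open>N\<close> is free of finite rank over \<open>R\<close> with basis
  \<open>e\<close>, and coordinates are read in the ring \<open>'f\<close> through
  \<open>\<rho>\<close>. By \<open>kappa_range\<close> each coordinate comes from a scalar, so that
  elements of \<open>N\<close> really are combinations of the basis. The instances are H tensor H, H
  tensor (H tensor H), R tensor H, and the extension of scalars to a field of fractions.\<close>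

locale free_tensor = tensor_pair R M N
  for R :: "('r, 'x) ring_scheme" and M :: "('r, 'm, 'y) module_scheme"
    and N :: "('r, 'n, 'z) module_scheme" +
  fixes \<rho> :: "'r \<Rightarrow> 'f::comm_ring_1" and \<phi> :: "'m \<Rightarrow> 'p \<Rightarrow> 'f" and \<kappa> :: "'n \<Rightarrow> 'l \<Rightarrow> 'f"
    and L :: "'l set" and e :: "'l \<Rightarrow> 'n"
  assumes phi_emb: "joint_embedding M \<phi>" and kappa_emb: "joint_embedding N \<kappa>"
    and phi_smult: "\<And>r m p. r \<in> carrier R \<Longrightarrow> m \<in> carrier M \<Longrightarrow> \<phi> (r \<odot>\<^bsub>M\<^esub> m) p = \<rho> r * \<phi> m p"
    and kappa_smult: "\<And>r n l. r \<in> carrier R \<Longrightarrow> n \<in> carrier N \<Longrightarrow> \<kappa> (r \<odot>\<^bsub>N\<^esub> n) l = \<rho> r * \<kappa> n l"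
    and finite_L: "finite L"
    and kappa_outside: "\<And>n l. n \<in> carrier N \<Longrightarrow> l \<notin> L \<Longrightarrow> \<kappa> n l = 0"
    and kappa_range: "\<And>n l. n \<in> carrier N \<Longrightarrow> l \<in> L \<Longrightarrow> \<kappa> n l \<in> \<rho> ` carrier R"
    and e_closed: "\<And>l. l \<in> L \<Longrightarrow> e l \<in> carrier N"
    and kappa_e: "\<And>l l'. l \<in> L \<Longrightarrow> \<kappa> (e l) l' = (if l = l' then 1 else 0)"
begin

abbreviation "\<F> \<equiv> (ring_of_type_algebra :: 'f ring)"

definition coord :: "('m \<times> 'n \<Rightarrow>\<^sub>0 int) set \<Rightarrow> 'p \<times> 'l \<Rightarrow> 'f" where
  "coord U i = tensor_lift \<F> (\<lambda>m n. \<phi> m (fst i) * \<kappa> n (snd i)) U"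

lemma coord_balanced: "balanced \<F> (\<lambda>m n. \<phi> m p * \<kappa> n l)"
  by (auto simp: balanced_def joint_embedding_add[OF phi_emb] joint_embedding_add[OF kappa_emb]
      phi_smult kappa_smult algebra_simps)

lemma coord_add: "U \<in> carrier T \<Longrightarrow> V \<in> carrier T \<Longrightarrow> coord (U \<oplus>\<^bsub>T\<^esub> V) i = coord U i + coord V i"
  by (simp add: coord_def lift_add[OF abelian_group_ring_of_type coord_balanced])

lemma coord_pure: "m \<in> carrier M \<Longrightarrow> n \<in> carrier N \<Longrightarrow> coord (tens m n) i = \<phi> m (fst i) * \<kappa> n (snd i)"
  by (simp add: coord_def lift_pure[OF abelian_group_ring_of_type coord_balanced])

lemma coord_zero: "coord \<zero>\<^bsub>T\<^esub> i = 0"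
  by (simp add: coord_def lift_zero[OF abelian_group_ring_of_type coord_balanced])

lemma coord_finsum:
  assumes "finite A" "\<And>i. i \<in> A \<Longrightarrow> f i \<in> carrier T"
  shows "coord (\<Oplus>\<^bsub>T\<^esub>i\<in>A. f i) j = (\<Sum>i\<in>A. coord (f i) j)"
  using assms
  by (induction A rule: finite_induct)
    (auto simp: coord_zero coord_add T.finsum_closed Pi_def T.finsum_insert)

lemma tens_finsum:
  assumes m: "m \<in> carrier M" and A: "finite A" and f: "\<And>i. i \<in> A \<Longrightarrow> f i \<in> carrier N"
  shows "tens m (\<Oplus>\<^bsub>N\<^esub>i\<in>A. f i) = (\<Oplus>\<^bsub>T\<^esub>i\<in>A. tens m (f i))"
  using A f
proof (induction A rule: finite_induct)
  case empty
  have "tens m \<zero>\<^bsub>N\<^esub> = \<zero>\<^bsub>T\<^esub>"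
    using tens_add_right[of m "\<zero>\<^bsub>N\<^esub>" "\<zero>\<^bsub>N\<^esub>"] m tens_closed[of m "\<zero>\<^bsub>N\<^esub>"]
    by (simp add: T.add.r_cancel_one')
  then show ?case by simp
next
  case (insert i A)
  then show ?case
    using m by (simp add: T.finsum_insert N.finsum_insert Pi_def tens_closed tens_add_right N.finsum_closed)
qed

lemma expansion:
  assumes n: "n \<in> carrier N"
  obtains r where "\<And>l. l \<in> L \<Longrightarrow> r l \<in> carrier R" "n = (\<Oplus>\<^bsub>N\<^esub>l\<in>L. r l \<odot>\<^bsub>N\<^esub> e l)"
proof -
  have "\<forall>l\<in>L. \<exists>r. r \<in> carrier R \<and> \<kappa> n l = \<rho> r" using kappa_range[OF n] by blast
  then obtain r where r: "\<And>l. l \<in> L \<Longrightarrow> r l \<in> carrier R" "\<And>l. l \<in> L \<Longrightarrow> \<kappa> n l = \<rho> (r l)"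
    by metis
  have "n = (\<Oplus>\<^bsub>N\<^esub>l\<in>L. r l \<odot>\<^bsub>N\<^esub> e l)"
  proof (rule joint_embedding_inj[OF kappa_emb n])
    show "(\<Oplus>\<^bsub>N\<^esub>l\<in>L. r l \<odot>\<^bsub>N\<^esub> e l) \<in> carrier N"
      by (rule N.finsum_closed) (auto intro!: N_smult r e_closed)
    show "\<kappa> n l = \<kappa> (\<Oplus>\<^bsub>N\<^esub>l\<in>L. r l \<odot>\<^bsub>N\<^esub> e l) l" for l
    proof -
      have "\<kappa> (\<Oplus>\<^bsub>N\<^esub>l\<in>L. r l \<odot>\<^bsub>N\<^esub> e l) l = (\<Sum>k\<in>L. \<kappa> (r k \<odot>\<^bsub>N\<^esub> e k) l)"
        by (rule joint_embedding_finsum[OF kappa_emb finite_L]) (auto intro!: N_smult r e_closed)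
      also have "\<dots> = (\<Sum>k\<in>L. if k = l then \<rho> (r k) else 0)"
        by (rule sum.cong) (auto simp: kappa_smult r e_closed kappa_e)
      also have "\<dots> = \<kappa> n l"
        using finite_L by (auto simp: r kappa_outside[OF n])
      finally show ?thesis by simp
    qed
  qed
  with r that show thesis by blast
qed

text \<open>Expanding the second factor in the basis and moving the scalars across the tensor sign
  collects everything in the first factor.\<close>

lemma tensor_expansion:
  assumes "U \<in> carrier T"
  shows "\<exists>m. (\<forall>l\<in>L. m l \<in> carrier M) \<and> U = (\<Oplus>\<^bsub>T\<^esub>l\<in>L. tens (m l) (e l))"
  using assms
proof (induction rule: tensor_induct)
  case zero
  have "(\<Oplus>\<^bsub>T\<^esub>l\<in>L. tens \<zero>\<^bsub>M\<^esub> (e l)) = \<zero>\<^bsub>T\<^esub>"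
  proof (rule T.add.finprod_one_eqI)
    fix l assume l: "l \<in> L"
    show "tens \<zero>\<^bsub>M\<^esub> (e l) = \<zero>\<^bsub>T\<^esub>"
      using tens_add_left[of "\<zero>\<^bsub>M\<^esub>" "\<zero>\<^bsub>M\<^esub>" "e l"] tens_closed[of "\<zero>\<^bsub>M\<^esub>" "e l"] e_closed[OF l]
      by (simp add: T.add.r_cancel_one')
  qed
  then show ?case by (intro exI[of _ "\<lambda>_. \<zero>\<^bsub>M\<^esub>"]) auto
next
  case (pure m n)
  obtain r where r: "\<And>l. l \<in> L \<Longrightarrow> r l \<in> carrier R" "n = (\<Oplus>\<^bsub>N\<^esub>l\<in>L. r l \<odot>\<^bsub>N\<^esub> e l)"
    using expansion[OF pure(2)] by blast
  have "tens m n = (\<Oplus>\<^bsub>T\<^esub>l\<in>L. tens m (r l \<odot>\<^bsub>N\<^esub> e l))"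
    unfolding r(2) by (rule tens_finsum[OF pure(1) finite_L]) (auto intro!: N_smult r e_closed)
  also have "\<dots> = (\<Oplus>\<^bsub>T\<^esub>l\<in>L. tens (r l \<odot>\<^bsub>M\<^esub> m) (e l))"
    using pure(1) r(1) e_closed by (intro T.finsum_cong') (auto simp: tens_balanced intro!: tens_closed M_smult)
  finally show ?case
    using M_smult r(1) pure(1) by (intro exI[of _ "\<lambda>l. r l \<odot>\<^bsub>M\<^esub> m"]) auto
next
  case (add U V)
  then obtain m m' where m: "\<forall>l\<in>L. m l \<in> carrier M" "U = (\<Oplus>\<^bsub>T\<^esub>l\<in>L. tens (m l) (e l))"
    and m': "\<forall>l\<in>L. m' l \<in> carrier M" "V = (\<Oplus>\<^bsub>T\<^esub>l\<in>L. tens (m' l) (e l))" by auto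
  have "U \<oplus>\<^bsub>T\<^esub> V = (\<Oplus>\<^bsub>T\<^esub>l\<in>L. tens (m l) (e l) \<oplus>\<^bsub>T\<^esub> tens (m' l) (e l))"
    unfolding m m' using m m' e_closed by (intro T.finsum_addf[symmetric]) (auto intro!: tens_closed)
  also have "\<dots> = (\<Oplus>\<^bsub>T\<^esub>l\<in>L. tens (m l \<oplus>\<^bsub>M\<^esub> m' l) (e l))"
    using m m' e_closed by (intro T.finsum_cong') (auto simp: tens_add_left intro!: tens_closed)
  finally show ?case
    using m m' by (intro exI[of _ "\<lambda>l. m l \<oplus>\<^bsub>M\<^esub> m' l"]) auto
qed

lemma coord_expansion:
  assumes "\<And>l. l \<in> L \<Longrightarrow> m l \<in> carrier M"
  shows "coord (\<Oplus>\<^bsub>T\<^esub>l\<in>L. tens (m l) (e l)) (p, l) = (if l \<in> L then \<phi> (m l) p else 0)"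
proof -
  have "coord (\<Oplus>\<^bsub>T\<^esub>l\<in>L. tens (m l) (e l)) (p, l) = (\<Sum>k\<in>L. if k = l then \<phi> (m k) p else 0)"
    using assms e_closed
    by (subst coord_finsum[OF finite_L]) (auto intro!: tens_closed sum.cong simp: coord_pure kappa_e)
  also have "\<dots> = (if l \<in> L then \<phi> (m l) p else 0)"
    using finite_L by auto
  finally show ?thesis .
qed

text \<open>The coordinates at \<open>(p, l)\<close> are those of the coefficient of
  \<open>e l\<close>, and \<open>\<phi>\<close> separates the points of \<open>M\<close>; hence the
  coefficients, and with them the tensor, are determined.\<close>

lemma coord_emb: "joint_embedding T coord"
  unfolding joint_embedding_def
proof (intro conjI ballI allI impI T_group)
  fix U V assume U: "U \<in> carrier T" and V: "V \<in> carrier T" and eq: "\<forall>l. coord U l = coord V l"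
  obtain m where m: "\<And>l. l \<in> L \<Longrightarrow> m l \<in> carrier M" "U = (\<Oplus>\<^bsub>T\<^esub>l\<in>L. tens (m l) (e l))"
    using tensor_expansion[OF U] by auto
  obtain m' where m': "\<And>l. l \<in> L \<Longrightarrow> m' l \<in> carrier M" "V = (\<Oplus>\<^bsub>T\<^esub>l\<in>L. tens (m' l) (e l))"
    using tensor_expansion[OF V] by auto
  have "m l = m' l" if l: "l \<in> L" for l
  proof (rule joint_embedding_inj[OF phi_emb m(1)[OF l] m'(1)[OF l]])
    show "\<phi> (m l) p = \<phi> (m' l) p" for p
      using eq[rule_format, of "(p, l)"] coord_expansion[of m p l, OF m(1)] coord_expansion[of m' p l, OF m'(1)] l
      unfolding m(2)[symmetric] m'(2)[symmetric] by simp
  qed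
  then show "U = V" unfolding m(2) m'(2) using m(1) e_closed
    by (intro T.finsum_cong') (auto intro!: tens_closed)
qed (auto simp: coord_add)

lemma coord_outside: "U \<in> carrier T \<Longrightarrow> l \<notin> L \<Longrightarrow> coord U (p, l) = 0"
  using tensor_expansion[of U] coord_expansion by auto

lemma coord_range: "U \<in> carrier T \<Longrightarrow> l \<in> L \<Longrightarrow> \<exists>m\<in>carrier M. \<forall>p. coord U (p, l) = \<phi> m p"
  using tensor_expansion[of U] coord_expansion by fastforce

lemma coord_surj:
  assumes "\<And>l. l \<in> L \<Longrightarrow> m l \<in> carrier M"
  shows "\<exists>U\<in>carrier T. \<forall>p l. coord U (p, l) = (if l \<in> L then \<phi> (m l) p else 0)"
  using assms coord_expansion[of m, OF assms] e_closed
  by (intro bexI[of _ "\<Oplus>\<^bsub>T\<^esub>l\<in>L. tens (m l) (e l)"]) (auto intro!: T.finsum_closed tens_closed)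

text \<open>The working rule for maps defined by \<open>tensor_lift\<close>. If on pure tensors the
  values depend additively on the coordinates, balancedness is automatic, because pure tensors are
  themselves biadditive and balanced; the formula \<open>\<Lambda>\<close> then extends to all
  tensors by induction.\<close>

lemma lift_linear:
  assumes W: "joint_embedding W \<chi>"
    and f: "\<And>m n. m \<in> carrier M \<Longrightarrow> n \<in> carrier N \<Longrightarrow> f m n \<in> carrier W"
    and \<chi>f: "\<And>m n k. m \<in> carrier M \<Longrightarrow> n \<in> carrier N \<Longrightarrow> \<chi> (f m n) k = \<Lambda> k (coord (tens m n))"
    and add: "\<And>k v w. \<Lambda> k (\<lambda>i. v i + w i) = \<Lambda> k v + (\<Lambda> k w :: 'g::comm_ring_1)"
    and U: "U \<in> carrier T"
  shows "tensor_lift W f U \<in> carrier W" and "\<chi> (tensor_lift W f U) k = \<Lambda> k (coord U)"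
proof -
  have \<Lambda>_add: "\<Lambda> k (coord (V \<oplus>\<^bsub>T\<^esub> V')) = \<Lambda> k (coord V) + \<Lambda> k (coord V')"
    if "V \<in> carrier T" "V' \<in> carrier T" for k V V'
  proof -
    have "coord (V \<oplus>\<^bsub>T\<^esub> V') = (\<lambda>i. coord V i + coord V' i)"
      by (rule ext) (rule coord_add[OF that])
    then show ?thesis using add by simp
  qed
  have b: "balanced W f"
    by (rule balanced_embI[OF W f])
      (auto simp: balanced_def \<chi>f tens_add_left tens_add_right tens_balanced tens_closed \<Lambda>_add M_smult N_smult)
  have W': "abelian_group W" using W by (simp add: joint_embedding_def)
  show "tensor_lift W f U \<in> carrier W" by (rule lift_closed[OF W' b U])
  have "\<Lambda> k (\<lambda>_. 0) = 0" using add[of k "\<lambda>_. 0" "\<lambda>_. 0"] by simp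
  moreover have "coord \<zero>\<^bsub>T\<^esub> = (\<lambda>_. 0)" by (auto simp: coord_zero)
  ultimately have z: "\<Lambda> k (coord \<zero>\<^bsub>T\<^esub>) = 0" by simp
  show "\<chi> (tensor_lift W f U) k = \<Lambda> k (coord U)"
    using U
    by (induction rule: tensor_induct)
      (auto simp: z lift_zero[OF W' b] joint_embedding_zero[OF W] lift_pure[OF W' b] \<chi>f
        lift_add[OF W' b] joint_embedding_add[OF W] lift_closed[OF W' b] \<Lambda>_add)
qed

text \<open>Products on tensor algebras are nested lifts. For a pure outer argument the inner lift
  falls under \<open>lift_linear\<close>, and its value depends additively on the coordinates of
  that argument, so the rule applies a second time.\<close>

lemma lift_bilinear:
  assumes W: "joint_embedding W \<chi>"
    and f: "\<And>m n m' n'. m \<in> carrier M \<Longrightarrow> n \<in> carrier N \<Longrightarrow> m' \<in> carrier M \<Longrightarrow> n' \<in> carrier N \<Longrightarrow>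
      f m n m' n' \<in> carrier W"
    and \<chi>f: "\<And>m n m' n' k. m \<in> carrier M \<Longrightarrow> n \<in> carrier N \<Longrightarrow> m' \<in> carrier M \<Longrightarrow> n' \<in> carrier N \<Longrightarrow>
      \<chi> (f m n m' n') k = \<Lambda> k (coord (tens m n)) (coord (tens m' n'))"
    and add_left: "\<And>k v w u. \<Lambda> k (\<lambda>i. v i + w i) u = \<Lambda> k v u + (\<Lambda> k w u :: 'g::comm_ring_1)"
    and add_right: "\<And>k v w u. \<Lambda> k u (\<lambda>i. v i + w i) = \<Lambda> k u v + \<Lambda> k u w"
    and U: "U \<in> carrier T" and V: "V \<in> carrier T"
  shows "tensor_lift W (\<lambda>m n. tensor_lift W (\<lambda>m' n'. f m n m' n') V) U \<in> carrier W"
    and "\<chi> (tensor_lift W (\<lambda>m n. tensor_lift W (\<lambda>m' n'. f m n m' n') V) U) k = \<Lambda> k (coord U) (coord V)"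
proof -
  have inner: "tensor_lift W (\<lambda>m' n'. f m n m' n') V \<in> carrier W"
    "\<chi> (tensor_lift W (\<lambda>m' n'. f m n m' n') V) k = \<Lambda> k (coord (tens m n)) (coord V)"
    if mn: "m \<in> carrier M" "n \<in> carrier N" for m n k
    using lift_linear[OF W, where f="f m n" and \<Lambda>="\<lambda>k. \<Lambda> k (coord (tens m n))",
        OF f[OF mn] \<chi>f[OF mn] add_right V] by blast+
  show "tensor_lift W (\<lambda>m n. tensor_lift W (\<lambda>m' n'. f m n m' n') V) U \<in> carrier W"
    by (rule lift_linear(1)[OF W inner(1) inner(2) add_left U])
  show "\<chi> (tensor_lift W (\<lambda>m n. tensor_lift W (\<lambda>m' n'. f m n m' n') V) U) k = \<Lambda> k (coord U) (coord V)"
    by (rule lift_linear(2)[OF W inner(1) inner(2) add_left U])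
qed

end

section \<open>Algebras given by structure constants\<close>

lemma sum_fun_apply: "(\<Sum>i\<in>A. f i) x = (\<Sum>i\<in>A. f i x)" for f :: "'i \<Rightarrow> 'a \<Rightarrow> 'b::comm_monoid_add"
  by (induction A rule: infinite_finite_induct) auto

text \<open>A subfield is kept as a subset of a field type, so that vectors over it and vectors over
  the large field have the same type and need no conversion.\<close>

definition subfield_set :: "'f::field set \<Rightarrow> bool" where
  "subfield_set K \<longleftrightarrow> 0 \<in> K \<and> 1 \<in> K \<and> (\<forall>x\<in>K. \<forall>y\<in>K. x + y \<in> K \<and> x * y \<in> K) \<and>
     (\<forall>x\<in>K. - x \<in> K \<and> inverse x \<in> K)"

lemma subfield_set_UNIV: "subfield_set UNIV"
  by (simp add: subfield_set_def)

lemma subfield_set_ops: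
  assumes "subfield_set K"
  shows "0 \<in> K" "1 \<in> K" "x \<in> K \<Longrightarrow> y \<in> K \<Longrightarrow> x + y \<in> K" "x \<in> K \<Longrightarrow> y \<in> K \<Longrightarrow> x * y \<in> K"
    "x \<in> K \<Longrightarrow> - x \<in> K" "x \<in> K \<Longrightarrow> inverse x \<in> K" "x \<in> K \<Longrightarrow> y \<in> K \<Longrightarrow> x / y \<in> K"
    "x \<in> K \<Longrightarrow> y \<in> K \<Longrightarrow> x - y \<in> K"
  using assms unfolding subfield_set_def divide_inverse diff_conv_add_uminus by blast+

lemma subfield_set_sum:
  "subfield_set K \<Longrightarrow> (\<And>i. i \<in> A \<Longrightarrow> f i \<in> K) \<Longrightarrow> sum f A \<in> K"
  by (induction A rule: infinite_finite_induct) (auto intro: subfield_set_ops)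

lemma subfield_set_prod:
  "subfield_set K \<Longrightarrow> (\<And>i. i \<in> A \<Longrightarrow> f i \<in> K) \<Longrightarrow> prod f A \<in> K"
  by (induction A rule: infinite_finite_induct) (auto intro: subfield_set_ops)

lemma det_subfield_set:
  assumes K: "subfield_set K" and A: "A \<in> carrier_mat n n"
    and e: "\<And>i j. i < n \<Longrightarrow> j < n \<Longrightarrow> A $$ (i, j) \<in> K"
  shows "det A \<in> K"
proof -
  have "signof p \<in> K" for p :: "nat \<Rightarrow> nat"
    by (auto simp: sign_def intro: subfield_set_ops[OF K])
  then show ?thesis
    unfolding det_def'[OF A]
    by (intro subfield_set_sum[OF K] subfield_set_ops(4)[OF K] subfield_set_prod[OF K] e)
      (auto simp: permutes_in_image)
qed

text \<open>Entries from \<open>n\<close> on are forced to be 0: one type serves all dimensions, and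
  equality of vectors is equality of functions.\<close>

definition vecs :: "nat \<Rightarrow> 'f::zero set \<Rightarrow> (nat \<Rightarrow> 'f) set" where
  "vecs n K = {v. (\<forall>i<n. v i \<in> K) \<and> (\<forall>i\<ge>n. v i = 0)}"

lemma vecs_eqI: "v \<in> vecs n K \<Longrightarrow> w \<in> vecs n K' \<Longrightarrow> (\<And>i. i < n \<Longrightarrow> v i = w i) \<Longrightarrow> v = w"
proof (rule ext)
  fix i assume "v \<in> vecs n K" "w \<in> vecs n K'" "\<And>i. i < n \<Longrightarrow> v i = w i"
  then show "v i = w i" by (cases "i < n") (auto simp: vecs_def)
qed

text \<open>Injectivity is tested on vectors over the whole field, yet the inverse has entries in
  \<open>K\<close>: by the adjugate formula they are quotients of determinants of matrices over
  \<open>K\<close>.\<close>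

lemma matrix_inverse_subfield_set:
  fixes G :: "nat \<Rightarrow> nat \<Rightarrow> 'f::field"
  assumes K: "subfield_set K" and G: "\<And>i j. i < n \<Longrightarrow> j < n \<Longrightarrow> G i j \<in> K"
    and inj: "\<And>v. v \<in> vecs n UNIV \<Longrightarrow> (\<And>i. i < n \<Longrightarrow> (\<Sum>j<n. G i j * v j) = 0) \<Longrightarrow> v = 0"
  obtains N where "\<And>i j. i < n \<Longrightarrow> j < n \<Longrightarrow> N i j \<in> K"
    "\<And>i j. i < n \<Longrightarrow> j < n \<Longrightarrow> (\<Sum>m<n. G i m * N m j) = (if i = j then 1 else 0)"
    "\<And>i j. i < n \<Longrightarrow> j < n \<Longrightarrow> (\<Sum>m<n. N i m * G m j) = (if i = j then 1 else 0)"
proof -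
  define A where "A = mat n n (\<lambda>(i, j). G i j)"
  have A: "A \<in> carrier_mat n n" by (simp add: A_def)
  have det: "det A \<noteq> 0"
  proof
    assume "det A = 0"
    then obtain x where x: "x \<in> carrier_vec n" "x \<noteq> 0\<^sub>v n" "A *\<^sub>v x = 0\<^sub>v n"
      using det_0_iff_vec_prod_zero[OF A] by auto
    define v where "v = (\<lambda>i. if i < n then x $ i else 0)"
    have "v = 0"
    proof (rule inj)
      show "v \<in> vecs n UNIV" by (simp add: vecs_def v_def)
      fix i assume i: "i < n"
      have "(A *\<^sub>v x) $ i = 0" using x(3) i by simp
      then show "(\<Sum>j<n. G i j * v j) = 0"
        using i x(1) by (simp add: A_def scalar_prod_def v_def atLeast0LessThan)
    qed
    then have "\<forall>i<n. x $ i = 0" by (auto simp: v_def fun_eq_iff split: if_splits)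
    then have "x = 0\<^sub>v n" using x(1) by (intro eq_vecI) auto
    then show False using x(2) by simp
  qed
  define N where "N = (\<lambda>i j. inverse (det A) * (adj_mat A $$ (i, j)))"
  note adj = adj_mat[OF A]
  show thesis
  proof (rule that[of N])
    fix i j assume ij: "i < n" "j < n"
    have "det A \<in> K" by (rule det_subfield_set[OF K A]) (auto simp: A_def G)
    moreover have "adj_mat A $$ (i, j) \<in> K"
    proof -
      have "(-1) ^ m \<in> K" for m :: nat
        by (induction m) (auto intro: subfield_set_ops[OF K])
      moreover have "det (mat_delete A j i) \<in> K"
        by (rule det_subfield_set[OF K, of _ "n - 1"])
          (use ij in \<open>auto simp: A_def mat_delete_def G\<close>)
      ultimately show ?thesis
        using ij A by (auto simp: adj_mat_def cofactor_def intro: subfield_set_ops[OF K])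
    qed
    ultimately show "N i j \<in> K" by (auto simp: N_def intro: subfield_set_ops[OF K])
  next
    fix i j assume ij: "i < n" "j < n"
    have "(A * adj_mat A) $$ (i, j) = (det A \<cdot>\<^sub>m 1\<^sub>m n) $$ (i, j)" using adj by simp
    then have "(\<Sum>m<n. G i m * adj_mat A $$ (m, j)) = (if i = j then det A else 0)"
      using ij adj(1) by (simp add: A_def scalar_prod_def atLeast0LessThan)
    then have "inverse (det A) * (\<Sum>m<n. G i m * adj_mat A $$ (m, j)) = (if i = j then 1 else 0)"
      using det by simp
    then show "(\<Sum>m<n. G i m * N m j) = (if i = j then 1 else 0)"
      by (simp add: N_def sum_distrib_left algebra_simps)
  next
    fix i j assume ij: "i < n" "j < n"
    have "(adj_mat A * A) $$ (i, j) = (det A \<cdot>\<^sub>m 1\<^sub>m n) $$ (i, j)" using adj by simp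
    then have "(\<Sum>m<n. adj_mat A $$ (i, m) * G m j) = (if i = j then det A else 0)"
      using ij adj(1) by (simp add: A_def scalar_prod_def atLeast0LessThan)
    then have "inverse (det A) * (\<Sum>m<n. adj_mat A $$ (i, m) * G m j) = (if i = j then 1 else 0)"
      using det by simp
    then show "(\<Sum>m<n. N i m * G m j) = (if i = j then 1 else 0)"
      by (simp add: N_def sum_distrib_left algebra_simps)
  qed
qed

definition vscale :: "'f::times \<Rightarrow> (nat \<Rightarrow> 'f) \<Rightarrow> nat \<Rightarrow> 'f" where
  "vscale c v = (\<lambda>i. c * v i)"

definition dot :: "nat \<Rightarrow> (nat \<Rightarrow> 'f::comm_ring_1) \<Rightarrow> (nat \<Rightarrow> 'f) \<Rightarrow> 'f" where
  "dot n p v = (\<Sum>i<n. p i * v i)"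

lemma dot_add: "dot n p (v + w) = dot n p v + dot n p w"
  by (simp add: dot_def algebra_simps sum.distrib)

lemma dot_scale: "dot n p (vscale c v) = c * dot n p v"
  by (simp add: dot_def vscale_def sum_distrib_left algebra_simps)

text \<open>Induction on the ambient dimension. The vectors of \<open>W\<close> with vanishing last
  coordinate are covered by the induction hypothesis; if they are not all of \<open>W\<close>, one
  further vector \<open>z\<close> with last coordinate 1 completes the basis. The functionals serve
  twice: to read a trace as a rank, and to build a projection onto a left ideal.\<close>

lemma dual_bases:
  fixes W :: "(nat \<Rightarrow> 'f::field) set"
  assumes K: "subfield_set K"
    and "W \<subseteq> vecs n K" "0 \<in> W" "\<And>v w. v \<in> W \<Longrightarrow> w \<in> W \<Longrightarrow> v + w \<in> W"
    "\<And>c w. c \<in> K \<Longrightarrow> w \<in> W \<Longrightarrow> vscale c w \<in> W"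
  shows "\<exists>r b p. (\<forall>j<r. b j \<in> W) \<and> (\<forall>j<r. p j \<in> vecs n K) \<and>
     (\<forall>j<(r::nat). \<forall>m<r. dot n (p j) (b m) = (if j = m then 1 else 0)) \<and>
     (\<forall>w\<in>W. w = (\<Sum>j<r. vscale (dot n (p j) w) (b j)))"
  using assms(2-)
proof (induction n arbitrary: W)
  case 0
  have "w = 0" if "w \<in> W" for w
    using 0 that by (auto simp: vecs_def fun_eq_iff)
  then have "W = {0}" using 0 by blast
  then show ?case by (intro exI[of _ 0]) auto
next
  case (Suc n)
  define W0 where "W0 = {w\<in>W. w n = 0}"
  have W0_vecs: "W0 \<subseteq> vecs n K"
    using Suc.prems(1) by (auto simp: W0_def vecs_def subset_iff) (metis Suc_leI le_neq_implies_less)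
  have W0_zero: "0 \<in> W0" using Suc.prems(2) unfolding W0_def mem_Collect_eq zero_fun_apply by blast
  have W0_add: "v + w \<in> W0" if "v \<in> W0" "w \<in> W0" for v w
    using that Suc.prems(3)[of v w] unfolding W0_def mem_Collect_eq plus_fun_apply by simp
  have W0_scale: "vscale c w \<in> W0" if "c \<in> K" "w \<in> W0" for c w
    using that Suc.prems(4)[of c w] unfolding W0_def mem_Collect_eq by (simp add: vscale_def)
  obtain r b p where b: "\<And>j. j < r \<Longrightarrow> b j \<in> W0" and p: "\<And>j. j < r \<Longrightarrow> p j \<in> vecs n K"
    and pb: "\<And>j m. j < (r::nat) \<Longrightarrow> m < r \<Longrightarrow> dot n (p j) (b m) = (if j = m then 1 else 0)"
    and W0: "\<And>w. w \<in> W0 \<Longrightarrow> w = (\<Sum>j<r. vscale (dot n (p j) w) (b j))"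
    using Suc.IH[OF W0_vecs W0_zero W0_add W0_scale] by blast
  show ?case
  proof (cases "W = W0")
    case True
    have "dot (Suc n) (p j) v = dot n (p j) v" if "j < r" for j v
      using p[OF that] by (simp add: dot_def vecs_def)
    moreover have "p j \<in> vecs (Suc n) K" if "j < r" for j
      using p[OF that] subfield_set_ops(1)[OF K] by (auto simp: vecs_def less_Suc_eq)
    ultimately have "(\<forall>j<r. b j \<in> W) \<and> (\<forall>j<r. p j \<in> vecs (Suc n) K) \<and>
        (\<forall>j<r. \<forall>m<r. dot (Suc n) (p j) (b m) = (if j = m then 1 else 0)) \<and>
        (\<forall>w\<in>W. w = (\<Sum>j<r. vscale (dot (Suc n) (p j) w) (b j)))"
      using b pb W0 True by simp
    then show ?thesis by blast
  next
    case False
    then obtain w1 where w1: "w1 \<in> W" "w1 n \<noteq> 0" by (auto simp: W0_def)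
    define z where "z = vscale (inverse (w1 n)) w1"
    have w1K: "w1 n \<in> K" using w1 Suc.prems(1) by (auto simp: vecs_def)
    have z: "z \<in> W" unfolding z_def by (rule Suc.prems(4)[OF subfield_set_ops(6)[OF K w1K] w1(1)])
    have zn: "z n = 1" using w1 by (simp add: z_def vscale_def)
    have zK: "z i \<in> K" if "i < Suc n" for i using z Suc.prems(1) that by (auto simp: vecs_def)
    \<comment> \<open>The new functional is the last coordinate. The old ones receive the entry
      \<open>- dot n (p j) z\<close> in place \<open>n\<close>, which makes them vanish on
      \<open>z\<close> and leaves them unchanged on \<open>W0\<close>.\<close>
    define p' where "p' j = (if j = r then (\<lambda>i. if i = n then 1 else 0)
        else (\<lambda>i. if i = n then - dot n (p j) z else p j i))" for j
    define b' where "b' = b(r := z)"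
    have dot': "dot (Suc n) (p' j) v = (if j = r then v n else dot n (p j) v - v n * dot n (p j) z)" for j v
      by (auto simp: dot_def p'_def)
    have "\<forall>j<Suc r. p' j \<in> vecs (Suc n) K"
    proof (intro allI impI)
      fix j assume j: "j < Suc r"
      have "dot n (p j) z \<in> K" if "j < r"
        unfolding dot_def using p[OF that] zK
        by (auto intro!: subfield_set_sum[OF K] subfield_set_ops(4)[OF K] simp: vecs_def)
      then show "p' j \<in> vecs (Suc n) K"
        using j p[of j] subfield_set_ops[OF K] by (auto simp: p'_def vecs_def less_Suc_eq)
    qed
    moreover have "\<forall>j<Suc r. b' j \<in> W" using b z by (auto simp: b'_def W0_def less_Suc_eq)
    moreover have "\<forall>j<Suc r. \<forall>m<Suc r. dot (Suc n) (p' j) (b' m) = (if j = m then 1 else 0)"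
      using b pb zn by (auto simp: dot' b'_def less_Suc_eq W0_def)
    moreover have "\<forall>w\<in>W. w = (\<Sum>j<Suc r. vscale (dot (Suc n) (p' j) w) (b' j))"
    proof
      fix w assume w: "w \<in> W"
      \<comment> \<open>Subtracting the multiple of \<open>z\<close> that clears the last coordinate
        brings \<open>w\<close> into \<open>W0\<close>.\<close>
      define w0 where "w0 = w + vscale (- w n) z"
      have wn: "w n \<in> K" using w Suc.prems(1) by (auto simp: vecs_def)
      have "w0 \<in> W"
        unfolding w0_def by (intro Suc.prems(3)[OF w] Suc.prems(4)[OF _ z] subfield_set_ops(5)[OF K wn])
      then have "w0 \<in> W0"
        using zn by (simp add: W0_def) (simp add: w0_def vscale_def)
      have "(\<Sum>j<Suc r. vscale (dot (Suc n) (p' j) w) (b' j))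
          = (\<Sum>j<r. vscale (dot n (p j) w0) (b j)) + vscale (w n) z"
        by (simp add: dot' b'_def w0_def dot_add dot_scale algebra_simps)
      also have "\<dots> = w0 + vscale (w n) z"
        using W0[OF \<open>w0 \<in> W0\<close>] by simp
      also have "\<dots> = w" by (auto simp: w0_def vscale_def)
      finally show "w = (\<Sum>j<Suc r. vscale (dot (Suc n) (p' j) w) (b' j))" by simp
    qed
    ultimately show ?thesis by blast
  qed
qed


section \<open>Multiplication and regular trace from structure constants\<close>

definition sc_mul :: "nat \<Rightarrow> (nat \<Rightarrow> nat \<Rightarrow> nat \<Rightarrow> 'f::comm_ring_1) \<Rightarrow> (nat \<Rightarrow> 'f) \<Rightarrow> (nat \<Rightarrow> 'f) \<Rightarrow> nat \<Rightarrow> 'f" where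
  "sc_mul n s v w = (\<lambda>l. if l < n then \<Sum>i<n. \<Sum>j<n. v i * w j * s i j l else 0)"

definition sc_ring :: "nat \<Rightarrow> 'f set \<Rightarrow> (nat \<Rightarrow> nat \<Rightarrow> nat \<Rightarrow> 'f::comm_ring_1) \<Rightarrow> (nat \<Rightarrow> 'f) \<Rightarrow> (nat \<Rightarrow> 'f) ring" where
  "sc_ring n K s u = \<lparr>carrier = vecs n K, monoid.mult = sc_mul n s, monoid.one = u,
     ring.zero = 0, add = (+)\<rparr>"

lemma sc_ring_simps [simp]:
  "carrier (sc_ring n K s u) = vecs n K"
  "x \<otimes>\<^bsub>sc_ring n K s u\<^esub> y = sc_mul n s x y"
  "\<one>\<^bsub>sc_ring n K s u\<^esub> = u"
  "\<zero>\<^bsub>sc_ring n K s u\<^esub> = 0"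
  "x \<oplus>\<^bsub>sc_ring n K s u\<^esub> y = x + y"
  by (simp_all add: sc_ring_def)

definition unitv :: "nat \<Rightarrow> nat \<Rightarrow> 'f::zero_neq_one" where
  "unitv i = (\<lambda>j. if j = i then 1 else 0)"

lemma vecs_UNIV: "v \<in> vecs n K \<Longrightarrow> v \<in> vecs n UNIV"
  by (auto simp: vecs_def)

lemma unitv_vecs: "subfield_set K \<Longrightarrow> i < n \<Longrightarrow> unitv i \<in> vecs n K"
  by (auto simp: vecs_def unitv_def intro: subfield_set_ops)

lemma vecs_add: "subfield_set K \<Longrightarrow> v \<in> vecs n K \<Longrightarrow> w \<in> vecs n K \<Longrightarrow> v + w \<in> vecs n K"
  by (auto simp: vecs_def intro: subfield_set_ops)

lemma vecs_zero: "subfield_set K \<Longrightarrow> 0 \<in> vecs n K"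
  by (auto simp: vecs_def intro: subfield_set_ops)

lemma vecs_scale: "subfield_set K \<Longrightarrow> c \<in> K \<Longrightarrow> v \<in> vecs n K \<Longrightarrow> vscale c v \<in> vecs n K"
  by (auto simp: vecs_def vscale_def intro: subfield_set_ops)

lemma vecs_sum: "subfield_set K \<Longrightarrow> (\<And>i. i \<in> A \<Longrightarrow> f i \<in> vecs n K) \<Longrightarrow> sum f A \<in> vecs n K"
  by (induction A rule: infinite_finite_induct) (auto intro: vecs_add vecs_zero)

lemma vec_expansion:
  fixes v :: "nat \<Rightarrow> 'f::comm_ring_1"
  assumes "v \<in> vecs n K" shows "v = (\<Sum>i<n. vscale (v i) (unitv i))"
proof
  fix j
  have "vscale (v i) (unitv i) j = (if i = j then v i else 0)" for i
    by (auto simp: vscale_def unitv_def)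
  then have "(\<Sum>i<n. vscale (v i) (unitv i)) j = (\<Sum>i<n. if i = j then v i else 0)"
    by (simp only: sum_fun_apply)
  also have "\<dots> = v j" using assms by (auto simp: vecs_def)
  finally show "v j = (\<Sum>i<n. vscale (v i) (unitv i)) j" by simp
qed

lemma sc_mul_vecs:
  assumes "subfield_set K" "\<And>i j l. i < n \<Longrightarrow> j < n \<Longrightarrow> l < n \<Longrightarrow> s i j l \<in> K" "v \<in> vecs n K" "w \<in> vecs n K"
  shows "sc_mul n s v w \<in> vecs n K"
  using assms by (auto simp: sc_mul_def vecs_def intro!: subfield_set_sum subfield_set_ops(4))

lemma sc_mul_add_left: "sc_mul n s (v + v') w = sc_mul n s v w + sc_mul n s v' w"
  by (auto simp: sc_mul_def algebra_simps sum.distrib)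

lemma sc_mul_add_right: "sc_mul n s v (w + w') = sc_mul n s v w + sc_mul n s v w'"
  by (auto simp: sc_mul_def algebra_simps sum.distrib)

lemma sc_mul_zero_left: "sc_mul n s 0 w = 0"
  by (auto simp: sc_mul_def)

lemma sc_mul_zero_right: "sc_mul n s v 0 = 0"
  by (auto simp: sc_mul_def)

lemma sc_mul_scale_left: "sc_mul n s (vscale c v) w = vscale c (sc_mul n s v w)"
  by (auto simp: sc_mul_def vscale_def sum_distrib_left algebra_simps)

lemma sc_mul_scale_right: "sc_mul n s v (vscale c w) = vscale c (sc_mul n s v w)"
  by (auto simp: sc_mul_def vscale_def sum_distrib_left algebra_simps)

lemma sc_mul_sum_left: "sc_mul n s (\<Sum>i\<in>A. f i) w = (\<Sum>i\<in>A. sc_mul n s (f i) w)"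
  by (induction A rule: infinite_finite_induct) (simp_all add: sc_mul_zero_left sc_mul_add_left del: plus_fun_apply zero_fun_apply)

lemma sc_mul_sum_right: "sc_mul n s v (\<Sum>i\<in>A. f i) = (\<Sum>i\<in>A. sc_mul n s v (f i))"
  by (induction A rule: infinite_finite_induct) (simp_all add: sc_mul_zero_right sc_mul_add_right del: plus_fun_apply zero_fun_apply)

definition sc_trace :: "nat \<Rightarrow> (nat \<Rightarrow> nat \<Rightarrow> nat \<Rightarrow> 'f::comm_ring_1) \<Rightarrow> (nat \<Rightarrow> 'f) \<Rightarrow> 'f" where
  "sc_trace n s v = (\<Sum>i<n. sc_mul n s v (unitv i) i)"

lemma sc_trace_add: "sc_trace n s (v + w) = sc_trace n s v + sc_trace n s w"
  by (simp add: sc_trace_def sc_mul_add_left sum.distrib)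

lemma sc_trace_scale: "sc_trace n s (vscale c v) = c * sc_trace n s v"
  unfolding sc_trace_def sc_mul_scale_left by (simp add: vscale_def sum_distrib_left)

lemma sc_trace_zero: "sc_trace n s 0 = 0"
  by (simp add: sc_trace_def sc_mul_zero_left)

lemma sc_trace_sum: "sc_trace n s (\<Sum>i\<in>A. f i) = (\<Sum>i\<in>A. sc_trace n s (f i))"
  by (induction A rule: infinite_finite_induct) (simp_all add: sc_trace_zero sc_trace_add del: plus_fun_apply zero_fun_apply)

text \<open>The laws are required for all vectors over the whole field, even where the ring of
  interest has its vectors over a subfield. In this form they can be carried along an isomorphism
  that is defined over the large field only.\<close>

locale sc_algebra =
  fixes n :: nat and s :: "nat \<Rightarrow> nat \<Rightarrow> nat \<Rightarrow> 'f::field" and u :: "nat \<Rightarrow> 'f"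
  assumes assoc: "\<And>v w x. v \<in> vecs n UNIV \<Longrightarrow> w \<in> vecs n UNIV \<Longrightarrow> x \<in> vecs n UNIV \<Longrightarrow>
      sc_mul n s (sc_mul n s v w) x = sc_mul n s v (sc_mul n s w x)"
    and u_vecs: "u \<in> vecs n UNIV"
    and unit_left: "\<And>v. v \<in> vecs n UNIV \<Longrightarrow> sc_mul n s u v = v"
    and unit_right: "\<And>v. v \<in> vecs n UNIV \<Longrightarrow> sc_mul n s v u = v"
begin

abbreviation mul (infixl "\<odot>" 70) where "mul \<equiv> sc_mul n s"
abbreviation "tr \<equiv> sc_trace n s"
abbreviation "V \<equiv> vecs n (UNIV :: 'f set)"

lemma mul_V [simp]: "v \<odot> w \<in> V" by (auto simp: sc_mul_def vecs_def)

lemma unitv_V [simp]: "i < n \<Longrightarrow> unitv i \<in> V" by (rule unitv_vecs[OF subfield_set_UNIV])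

text \<open>By associativity, left multiplication by a product is the product of the two matrices,
  and the trace of a product of matrices does not depend on the order of the factors.\<close>

lemma tr_commute:
  assumes v: "v \<in> V" and w: "w \<in> V"
  shows "tr (v \<odot> w) = tr (w \<odot> v)"
proof -
  have *: "tr (v \<odot> w) = (\<Sum>l<n. \<Sum>m<n. (w \<odot> unitv l) m * (v \<odot> unitv m) l)" if v: "v \<in> V" and w: "w \<in> V" for v w
    unfolding sc_trace_def
  proof (rule sum.cong[OF refl])
    fix l assume "l \<in> {..<n}"
    then have l: "l < n" by simp
    have "(v \<odot> w) \<odot> unitv l = v \<odot> (w \<odot> unitv l)" using assoc v w l by simp
    also have "w \<odot> unitv l = (\<Sum>m<n. vscale ((w \<odot> unitv l) m) (unitv m))"
      by (rule vec_expansion[OF mul_V])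
    finally have "(v \<odot> w) \<odot> unitv l = (\<Sum>m<n. vscale ((w \<odot> unitv l) m) (v \<odot> unitv m))"
      by (simp add: sc_mul_sum_right sc_mul_scale_right)
    then show "((v \<odot> w) \<odot> unitv l) l = (\<Sum>m<n. (w \<odot> unitv l) m * (v \<odot> unitv m) l)"
      by (simp add: sum_fun_apply vscale_def)
  qed
  show ?thesis
    unfolding *[OF v w] *[OF w v] by (subst sum.swap) (simp add: mult.commute)
qed

definition nondegenerate :: bool where
  "nondegenerate \<longleftrightarrow> (\<forall>v\<in>V. (\<forall>w\<in>V. tr (w \<odot> v) = 0) \<longrightarrow> v = 0)"

end

text \<open>\<open>W\<close> is the image of left multiplication by \<open>e\<close>, which acts on
  it as the identity. Computed with dual bases of \<open>W\<close>, the trace becomes a sum of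
  \<open>r\<close> ones, where \<open>r\<close> is the dimension of \<open>W\<close>.\<close>

lemma (in sc_algebra) idempotent_trace:
  assumes e: "e \<in> V" "e \<odot> e = e"
  shows "\<exists>r. tr e = of_nat r \<and> (r = 0 \<longrightarrow> e = 0)"
proof -
  define W where "W = {w\<in>V. e \<odot> w = w}"
  have W_vecs: "W \<subseteq> V" by (auto simp: W_def)
  have W_zero: "0 \<in> W" unfolding W_def mem_Collect_eq
    by (simp only: sc_mul_zero_right vecs_zero[OF subfield_set_UNIV] simp_thms)
  have W_add: "v + w \<in> W" if "v \<in> W" "w \<in> W" for v w
    using that unfolding W_def mem_Collect_eq sc_mul_add_right
    by (simp only: vecs_add[OF subfield_set_UNIV] simp_thms)
  have W_scale: "vscale c w \<in> W" if "c \<in> UNIV" "w \<in> W" for c w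
    using that unfolding W_def mem_Collect_eq sc_mul_scale_right
    by (simp only: vecs_scale[OF subfield_set_UNIV] simp_thms UNIV_I)
  obtain r b p where b: "\<And>j. j < r \<Longrightarrow> b j \<in> W"
    and pb: "\<And>j m. j < (r::nat) \<Longrightarrow> m < r \<Longrightarrow> dot n (p j) (b m) = (if j = m then 1 else 0)"
    and W: "\<And>w. w \<in> W \<Longrightarrow> w = (\<Sum>j<r. vscale (dot n (p j) w) (b j))"
    using dual_bases[OF subfield_set_UNIV W_vecs W_zero W_add W_scale] by blast
  have "tr e = (\<Sum>i<n. \<Sum>j<r. dot n (p j) (e \<odot> unitv i) * b j i)"
    unfolding sc_trace_def
  proof (rule sum.cong[OF refl])
    fix i assume "i \<in> {..<n}"
    then have "e \<odot> unitv i \<in> W" using e assoc[of e e "unitv i"] by (simp add: W_def)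
    from W[OF this] have "(e \<odot> unitv i) i = (\<Sum>j<r. vscale (dot n (p j) (e \<odot> unitv i)) (b j)) i"
      by (rule arg_cong)
    then show "(e \<odot> unitv i) i = (\<Sum>j<r. dot n (p j) (e \<odot> unitv i) * b j i)"
      by (simp add: sum_fun_apply vscale_def)
  qed
  also have "\<dots> = (\<Sum>j<r. \<Sum>i<n. dot n (p j) (e \<odot> unitv i) * b j i)" by (rule sum.swap)
  \<comment> \<open>The sum over \<open>i\<close> reassembles \<open>b j\<close> from its
    coordinates: this is the cyclic property of the trace, for the factorisation of left
    multiplication by \<open>e\<close> through \<open>W\<close>.\<close>
  also have "\<dots> = (\<Sum>j<r. dot n (p j) (e \<odot> b j))"
  proof (rule sum.cong[OF refl])
    fix j assume "j \<in> {..<r}"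
    then have bj: "b j \<in> V" using b by (auto simp: W_def)
    have dsum: "dot n q (\<Sum>i\<in>A. f i) = (\<Sum>i\<in>A. dot n q (f i))" for q :: "nat \<Rightarrow> 'f" and A :: "nat set" and f
      by (induction A rule: infinite_finite_induct)
        (simp_all add: dot_add del: plus_fun_apply zero_fun_apply, simp_all add: dot_def)
    have "e \<odot> b j = e \<odot> (\<Sum>i<n. vscale (b j i) (unitv i))"
      using vec_expansion[OF bj] by (rule arg_cong)
    then show "(\<Sum>i<n. dot n (p j) (e \<odot> unitv i) * b j i) = dot n (p j) (e \<odot> b j)"
      by (simp add: sc_mul_sum_right sc_mul_scale_right dsum dot_scale mult.commute)
  qed
  also have "\<dots> = (\<Sum>j<r. 1)"
    by (rule sum.cong[OF refl]) (use b pb in \<open>auto simp: W_def\<close>)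
  finally have "tr e = of_nat r" by simp
  moreover have "e = 0" if "r = 0"
    using W[of e] e that by (simp add: W_def)
  ultimately show ?thesis by blast
qed

theorem semisimple_imp_nondegenerate:
  fixes s :: "nat \<Rightarrow> nat \<Rightarrow> nat \<Rightarrow> 'f::field_char_0"
  assumes "sc_algebra n s u" and ss: "semisimple_ring (sc_ring n UNIV s u)"
  shows "sc_algebra.nondegenerate n s"
proof -
  interpret sc_algebra n s u by fact
  interpret R: ring "sc_ring n UNIV s u" using ss by (simp add: semisimple_ring_def)
  define I where "I = {v\<in>V. \<forall>w\<in>V. tr (w \<odot> v) = 0}"
  have I_zero: "0 \<in> I" unfolding I_def mem_Collect_eq
    by (simp add: sc_mul_zero_right sc_trace_zero vecs_zero[OF subfield_set_UNIV] del: zero_fun_apply)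
  have I_add: "v + w \<in> I" if "v \<in> I" "w \<in> I" for v w
    using that vecs_add[OF subfield_set_UNIV, of v n w] unfolding I_def mem_Collect_eq
    by (simp add: sc_mul_add_right sc_trace_add del: plus_fun_apply)
  have I_scale: "vscale c w \<in> I" if "w \<in> I" for c w
    using that vecs_scale[OF subfield_set_UNIV, of c w n] unfolding I_def mem_Collect_eq
    by (simp add: sc_mul_scale_right sc_trace_scale)
  have I_mul: "a \<odot> v \<in> I" if "a \<in> V" "v \<in> I" for a v
    using that unfolding I_def by (auto simp: assoc[symmetric])
  have neg: "\<ominus>\<^bsub>sc_ring n UNIV s u\<^esub> v = vscale (-1) v" if "v \<in> V" for v
    by (rule R.minus_equality)
      (use that vecs_scale[OF subfield_set_UNIV, of "-1" v n] in \<open>auto simp: vscale_def fun_eq_iff\<close>)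
  have "additive_subgroup I (sc_ring n UNIV s u)"
  proof (intro additive_subgroup.intro subgroup.intro)
    show "inv\<^bsub>add_monoid (sc_ring n UNIV s u)\<^esub> x \<in> I" if "x \<in> I" for x
      using neg[of x] that I_scale[of x "-1"] by (auto simp: a_inv_def I_def)
  qed (use I_zero I_add in \<open>auto simp: I_def\<close>)
  then have "left_ideal I (sc_ring n UNIV s u)"
    using I_mul by (auto simp: left_ideal_def)
  then obtain J where J: "left_ideal J (sc_ring n UNIV s u)" "I \<inter> J = {0}" 
    and IJ: "I <+>\<^bsub>sc_ring n UNIV s u\<^esub> J = V"
    using ss unfolding semisimple_ring_def by auto
  interpret J: additive_subgroup J "sc_ring n UNIV s u" using J by (simp add: left_ideal_def)
  have J_mul: "a \<odot> v \<in> J" if "a \<in> V" "v \<in> J" for a v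
    using J(1) that by (auto simp: left_ideal_def)
  have "u \<in> I <+>\<^bsub>sc_ring n UNIV s u\<^esub> J" using IJ u_vecs by simp
  then obtain e f where ef: "e \<in> I" "f \<in> J" "u = e + f"
    by (auto simp: set_add_def set_mult_def)
  have eV: "e \<in> V" and fV: "f \<in> V" using ef J.a_subset by (auto simp: I_def)
  have "e = e \<odot> e + e \<odot> f"
    using unit_right[OF eV] ef(3) by (simp add: sc_mul_add_right)
  \<comment> \<open>The product lies in \<open>J\<close> as a left multiple of \<open>f\<close>, and
    in \<open>I\<close> because it equals \<open>e\<close> minus \<open>e \<odot> e\<close>; the two
    ideals meet in 0. Hence \<open>e\<close> is idempotent.\<close>
  moreover have "e \<odot> f = 0"
  proof -
    have "e + vscale (-1) (e \<odot> e) = (e \<odot> e + e \<odot> f) + vscale (-1) (e \<odot> e)"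
      using calculation by simp
    also have "\<dots> = e \<odot> f" by (rule ext) (simp add: vscale_def)
    finally have "e \<odot> f = e + vscale (-1) (e \<odot> e)" by simp
    then have "e \<odot> f \<in> I" using I_add[OF ef(1) I_scale[OF I_mul[OF eV ef(1)]]] by simp
    moreover have "e \<odot> f \<in> J" using J_mul eV ef(2) by blast
    ultimately show ?thesis using J(2) by blast
  qed
  ultimately have ee: "e \<odot> e = e" by simp
  have "tr (u \<odot> e) = 0" using ef(1) u_vecs by (auto simp: I_def)
  then have "tr e = 0" using unit_left[OF eV] by simp
  then have "e = 0" using idempotent_trace[OF eV ee] by auto
  \<comment> \<open>With the unit in \<open>J\<close>, this ideal is the whole algebra, so
    \<open>I\<close>, which meets it in 0, vanishes.\<close>
  then have "u \<in> J" using ef by simp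
  have "v = 0" if "v \<in> I" for v
  proof -
    have "v \<in> V" using that by (auto simp: I_def)
    then have "v \<in> J" using J_mul[of v u] \<open>u \<in> J\<close> unit_right[of v] by simp
    then show ?thesis using that J(2) by blast
  qed
  then show ?thesis unfolding nondegenerate_def I_def by blast
qed


lemma sc_ring_is_ring:
  assumes "sc_algebra n s u" and K: "subfield_set K"
    and sK: "\<And>i j l. i < n \<Longrightarrow> j < n \<Longrightarrow> l < n \<Longrightarrow> s i j l \<in> K" and uK: "u \<in> vecs n K"
  shows "ring (sc_ring n K s u)"
proof -
  interpret sc_algebra n s u by fact
  show ?thesis
  proof (rule ringI)
    show "abelian_group (sc_ring n K s u)"
    proof (rule abelian_groupI)
      fix x assume x: "x \<in> carrier (sc_ring n K s u)"
      have "vscale (-1) x + x = 0" by (rule ext) (simp add: vscale_def)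
      then show "\<exists>y\<in>carrier (sc_ring n K s u). y \<oplus>\<^bsub>sc_ring n K s u\<^esub> x = \<zero>\<^bsub>sc_ring n K s u\<^esub>"
        using x subfield_set_ops[OF K] by (intro bexI[of _ "vscale (-1) x"]) (auto intro: vecs_scale[OF K] simp del: plus_fun_apply zero_fun_apply)
    qed (use vecs_add[OF K] vecs_zero[OF K] in \<open>simp_all add: add_ac del: plus_fun_apply zero_fun_apply\<close>)
    show "monoid (sc_ring n K s u)"
      by (rule monoidI) (auto simp: assoc[OF vecs_UNIV vecs_UNIV vecs_UNIV] uK unit_left[OF vecs_UNIV] unit_right[OF vecs_UNIV]
         intro!: sc_mul_vecs[OF K sK])
  qed (simp_all add: sc_mul_add_left sc_mul_add_right del: plus_fun_apply)
qed

text \<open>If \<open>a i\<close> is the basis dual to \<open>unitv i\<close> for the trace form, then \<open>\<Sum> a i \<otimes> unitv i\<close> is a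
  separability idempotent: averaging a linear projection onto a left ideal with it gives a
  projection that is linear over the algebra.\<close>

theorem nondegenerate_imp_semisimple:
  assumes "sc_algebra n s u" and K: "subfield_set K"
    and sK: "\<And>i j l. i < n \<Longrightarrow> j < n \<Longrightarrow> l < n \<Longrightarrow> s i j l \<in> K" and uK: "u \<in> vecs n K"
    and nd: "sc_algebra.nondegenerate n s"
  shows "semisimple_ring (sc_ring n K s u)"
proof -
  interpret sc_algebra n s u by fact
  interpret R: ring "sc_ring n K s u" using sc_ring_is_ring assms by blast
  define G where "G i j = tr (unitv i \<odot> unitv j)" for i j
  have mulK: "v \<odot> w \<in> vecs n K" if "v \<in> vecs n K" "w \<in> vecs n K" for v w
    by (rule sc_mul_vecs[OF K sK that])
  have unK: "unitv i \<in> vecs n K" if "i < n" for i by (rule unitv_vecs[OF K that])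
  have G_K: "G i j \<in> K" if "i < n" "j < n" for i j
  proof -
    have "unitv i \<odot> unitv j \<odot> unitv l \<in> vecs n K" if "l < n" for l
      using mulK unK that \<open>i < n\<close> \<open>j < n\<close> by blast
    then show ?thesis
      by (auto simp: G_def sc_trace_def vecs_def intro!: subfield_set_sum[OF K])
  qed
  have G_sym: "G i j = G j i" if "i < n" "j < n" for i j
    unfolding G_def using that by (intro tr_commute) auto
  have tr_right: "tr (w \<odot> v) = (\<Sum>j<n. tr (w \<odot> unitv j) * v j)" if "v \<in> V" for v w
  proof -
    have "tr (w \<odot> v) = tr (w \<odot> (\<Sum>j<n. vscale (v j) (unitv j)))"
      using vec_expansion[OF that] by (rule arg_cong)
    then show ?thesis
      by (simp add: sc_mul_sum_right sc_mul_scale_right sc_trace_sum sc_trace_scale mult.commute)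
  qed
  have tr_left: "tr (v \<odot> w) = (\<Sum>j<n. v j * tr (unitv j \<odot> w))" if "v \<in> V" for v w
  proof -
    have "tr (v \<odot> w) = tr ((\<Sum>j<n. vscale (v j) (unitv j)) \<odot> w)"
      using arg_cong[OF vec_expansion[OF that], of "\<lambda>v. tr (v \<odot> w)"] .
    then show ?thesis
      by (simp add: sc_mul_sum_left sc_mul_scale_left sc_trace_sum sc_trace_scale)
  qed
  have nondeg: "v = 0" if "v \<in> V" "\<And>i. i < n \<Longrightarrow> tr (unitv i \<odot> v) = 0" for v
  proof -
    have "tr (w \<odot> v) = 0" if "w \<in> V" for w
      using tr_left[OF that, of v] \<open>\<And>i. i < n \<Longrightarrow> tr (unitv i \<odot> v) = 0\<close> by simp
    then show ?thesis using nd that unfolding nondegenerate_def by blast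
  qed
  \<comment> \<open>Nondegeneracy makes the Gram matrix injective over the whole field; its inverse
    nevertheless has entries in \<open>K\<close>. This is where the descent to the subfield
    happens.\<close>
  obtain N where N_K: "\<And>i j. i < n \<Longrightarrow> j < n \<Longrightarrow> N i j \<in> K"
    and GN: "\<And>i j. i < n \<Longrightarrow> j < n \<Longrightarrow> (\<Sum>m<n. G i m * N m j) = (if i = j then 1 else 0)"
    and NG: "\<And>i j. i < n \<Longrightarrow> j < n \<Longrightarrow> (\<Sum>m<n. N i m * G m j) = (if i = j then 1 else 0)"
  proof (rule matrix_inverse_subfield_set[OF K G_K])
    show "v = 0" if "v \<in> V" "\<And>i. i < n \<Longrightarrow> (\<Sum>j<n. G i j * v j) = 0" for v
      using that by (intro nondeg) (auto simp: tr_right G_def)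
  qed blast+
  \<comment> \<open>The columns of the inverse Gram matrix are the basis dual to
    \<open>unitv\<close> for the trace form; pairing with \<open>a j\<close> therefore reads off the
    coordinate \<open>j\<close>.\<close>
  define a where "a i = (\<lambda>m. if m < n then N m i else 0)" for i
  have a_K: "a i \<in> vecs n K" if "i < n" for i using N_K that by (auto simp: a_def vecs_def)
  have a_V: "a i \<in> V" for i by (auto simp: a_def vecs_def)
  have dual: "tr (unitv i \<odot> a j) = (if i = j then 1 else 0)" if "i < n" "j < n" for i j
    using GN[OF that] unfolding tr_right[OF a_V] by (simp add: G_def[symmetric] a_def)
  have coeff: "tr (v \<odot> a j) = v j" if "v \<in> V" "j < n" for v j
    using that by (simp add: tr_left[OF that(1)] dual if_distrib cong: if_cong)
  have a_expansion: "w = (\<Sum>i<n. vscale (tr (unitv i \<odot> w)) (a i))" if w: "w \<in> V" for w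
  proof -
    let ?d = "w + vscale (-1) (\<Sum>i<n. vscale (tr (unitv i \<odot> w)) (a i))"
    have "?d = 0"
    proof (rule nondeg)
      show "?d \<in> V"
        by (intro vecs_add vecs_scale vecs_sum subfield_set_UNIV w a_V UNIV_I)
      fix j assume j: "j < n"
      have "(\<Sum>i<n. tr (unitv i \<odot> w) * tr (unitv j \<odot> a i)) = tr (unitv j \<odot> w)"
        using j by (simp add: dual if_distrib cong: if_cong)
      then show "tr (unitv j \<odot> ?d) = 0"
        by (simp add: sc_mul_add_right sc_mul_scale_right sc_mul_sum_right sc_trace_add sc_trace_scale
            sc_trace_sum del: plus_fun_apply)
    qed
    then have "?d + (\<Sum>i<n. vscale (tr (unitv i \<odot> w)) (a i)) = (\<Sum>i<n. vscale (tr (unitv i \<odot> w)) (a i))"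
      by simp
    moreover have "?d + (\<Sum>i<n. vscale (tr (unitv i \<odot> w)) (a i)) = w"
      by (rule ext) (simp add: vscale_def)
    ultimately show ?thesis by simp
  qed
  \<comment> \<open>The inverse of a symmetric matrix is symmetric, which allows the two factors of
    the sum of \<open>a i\<close> tensor \<open>unitv i\<close> to be exchanged.\<close>
  have N_sym: "N i j = N j i" if ij: "i < n" "j < n" for i j
  proof -
    have "N j i = (\<Sum>m<n. N m i * (\<Sum>l<n. G m l * N l j))"
      using ij by (simp add: GN if_distrib cong: if_cong)
    also have "\<dots> = (\<Sum>m<n. \<Sum>l<n. N m i * G m l * N l j)"
      by (simp add: sum_distrib_left mult.assoc)
    also have "\<dots> = (\<Sum>l<n. (\<Sum>m<n. G l m * N m i) * N l j)"
      by (subst sum.swap) (auto simp: sum_distrib_left sum_distrib_right G_sym mult_ac intro!: sum.cong)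
    also have "\<dots> = N i j" using ij by (simp add: GN if_distrib[of "\<lambda>x. x * _"] cong: if_cong)
    finally show ?thesis by simp
  qed
  have casimir_one: "(\<Sum>i<n. a i \<odot> unitv i) = u"
  proof -
    have a_exp: "a i = (\<Sum>m<n. vscale (N m i) (unitv m))" for i
    proof -
      have "a i = (\<Sum>m<n. vscale (a i m) (unitv m))" by (rule vec_expansion[OF a_V])
      then show ?thesis by (simp add: a_def)
    qed
    have "(\<Sum>i<n. a i \<odot> unitv i) = (\<Sum>i<n. \<Sum>m<n. vscale (N m i) (unitv m \<odot> unitv i))"
      by (simp add: a_exp sc_mul_sum_left sc_mul_scale_left)
    also have "\<dots> = (\<Sum>m<n. \<Sum>i<n. vscale (N i m) (unitv m \<odot> unitv i))"
      by (subst sum.swap) (auto simp: N_sym intro!: sum.cong)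
    also have "\<dots> = (\<Sum>m<n. unitv m \<odot> a m)"
      by (simp add: a_exp sc_mul_sum_right sc_mul_scale_right)
    finally have eq: "(\<Sum>i<n. a i \<odot> unitv i) = (\<Sum>m<n. unitv m \<odot> a m)" .
    let ?z = "\<Sum>m<n. unitv m \<odot> a m"
    have zV: "?z \<in> V" by (intro vecs_sum subfield_set_UNIV mul_V)
    \<comment> \<open>After the exchange, the trace of \<open>w \<odot> ?z\<close> is the sum of the
      diagonal entries of left multiplication by \<open>w\<close>, that is, the trace of
      \<open>w\<close> itself; the expansion in the dual basis then identifies \<open>?z\<close>
      with the unit.\<close>
    have "tr (w \<odot> ?z) = tr (w \<odot> u)" if w: "w \<in> V" for w
    proof -
      have "tr (w \<odot> ?z) = (\<Sum>m<n. tr ((w \<odot> unitv m) \<odot> a m))"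
        using w a_V by (simp add: sc_mul_sum_right sc_trace_sum assoc)
      also have "\<dots> = (\<Sum>m<n. (w \<odot> unitv m) m)" by (simp add: coeff)
      also have "\<dots> = tr (w \<odot> u)" using unit_right[OF w] by (simp add: sc_trace_def)
      finally show ?thesis .
    qed
    then have "?z = u" using a_expansion[OF zV] a_expansion[OF u_vecs] by simp
    then show ?thesis using eq by simp
  qed
  \<comment> \<open>In coordinates: multiplying the first factor of the sum of \<open>a i\<close>
    tensor \<open>unitv i\<close> on the left by \<open>c\<close> has the same effect as multiplying
    its second factor on the right by \<open>c\<close>.\<close>
  have casimir: "c \<odot> a j = (\<Sum>i<n. vscale ((unitv i \<odot> c) j) (a i))" if c: "c \<in> V" and j: "j < n" for c j
  proof -
    have "c \<odot> a j = (\<Sum>i<n. vscale (tr (unitv i \<odot> (c \<odot> a j))) (a i))"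
      by (rule a_expansion) simp
    also have "\<dots> = (\<Sum>i<n. vscale ((unitv i \<odot> c) j) (a i))"
    proof (rule sum.cong[OF refl])
      fix i assume "i \<in> {..<n}"
      then have "tr (unitv i \<odot> (c \<odot> a j)) = tr ((unitv i \<odot> c) \<odot> a j)"
        using c a_V by (simp add: assoc)
      then show "vscale (tr (unitv i \<odot> (c \<odot> a j))) (a i) = vscale ((unitv i \<odot> c) j) (a i)"
        using coeff[of "unitv i \<odot> c" j] j by simp
    qed
    finally show ?thesis .
  qed
  show ?thesis
    unfolding semisimple_ring_def
  proof (intro conjI allI impI R.ring_axioms)
    fix I assume I: "left_ideal I (sc_ring n K s u)"
    interpret I: additive_subgroup I "sc_ring n K s u" using I by (simp add: left_ideal_def)
    have I_vecs: "I \<subseteq> vecs n K" using I.a_subset by simp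
    have I_mul: "c \<odot> v \<in> I" if "c \<in> vecs n K" "v \<in> I" for c v
      using I that by (auto simp: left_ideal_def)
    have I_zero: "0 \<in> I" using I.zero_closed by simp
    have I_add: "v + w \<in> I" if "v \<in> I" "w \<in> I" for v w using I.a_closed that by simp
    have I_scale: "vscale c w \<in> I" if "c \<in> K" "w \<in> I" for c w
    proof -
      have "w \<in> V" using that I_vecs vecs_UNIV by blast
      then have "vscale c w = vscale c u \<odot> w" by (simp add: sc_mul_scale_left unit_left)
      then show ?thesis using I_mul[OF vecs_scale[OF K that(1) uK] that(2)] by simp
    qed
    have I_sum: "sum f A \<in> I" if "\<And>i. i \<in> A \<Longrightarrow> f i \<in> I" for A :: "nat set" and f
      using that by (induction A rule: infinite_finite_induct)
        (simp_all add: I_zero I_add del: plus_fun_apply zero_fun_apply)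
    obtain r b p where b: "\<And>j. j < r \<Longrightarrow> b j \<in> I" and p: "\<And>j. j < r \<Longrightarrow> p j \<in> vecs n K"
      and I_exp: "\<And>w. w \<in> I \<Longrightarrow> w = (\<Sum>j<(r::nat). vscale (dot n (p j) w) (b j))"
      using dual_bases[OF K I_vecs I_zero I_add I_scale] by blast
    \<comment> \<open>A projection onto \<open>I\<close> that is linear over \<open>K\<close> but in
      general not over the algebra; averaging repairs this.\<close>
    define P where "P v = (\<Sum>j<r. vscale (dot n (p j) v) (b j))" for v
    have P_I: "P v \<in> I" if "v \<in> vecs n K" for v
    proof -
      have "dot n (p j) v \<in> K" if "j < r" for j
        using p[OF that] \<open>v \<in> vecs n K\<close> unfolding dot_def vecs_def
        by (auto intro!: subfield_set_sum[OF K] subfield_set_ops(4)[OF K])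
      then show ?thesis unfolding P_def by (intro I_sum I_scale b) auto
    qed
    have vscale_add: "vscale (c + d) v = vscale c v + vscale d v" for c d and v :: "nat \<Rightarrow> 'a"
      by (rule ext) (simp add: vscale_def algebra_simps)
    have vscale_mult: "vscale (c * d) v = vscale c (vscale d v)" for c d and v :: "nat \<Rightarrow> 'a"
      by (rule ext) (simp add: vscale_def algebra_simps)
    have vscale_sum: "vscale c (sum f A) = (\<Sum>i\<in>A. vscale c (f i))" for c :: 'a and f and A :: "nat set"
      by (rule ext) (simp add: vscale_def sum_fun_apply sum_distrib_left)
    have P_add: "P (v + w) = P v + P w" for v w
      unfolding P_def dot_add vscale_add by (rule sum.distrib)
    have P_scale: "P (vscale c v) = vscale c (P v)" for c v
      unfolding P_def dot_scale vscale_mult vscale_sum ..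
    have P_zero: "P 0 = 0" using P_scale[of 0 0] by (simp add: vscale_def zero_fun_def)
    have P_sum: "P (sum f A) = (\<Sum>i\<in>A. P (f i))" for f and A :: "nat set"
      by (induction A rule: infinite_finite_induct)
        (simp_all add: P_zero P_add del: plus_fun_apply zero_fun_apply)
    have P_id: "P w = w" if "w \<in> I" for w using I_exp[OF that] by (simp add: P_def)
    define avg where "avg v = (\<Sum>i<n. a i \<odot> P (unitv i \<odot> v))" for v
    have avg_I: "avg v \<in> I" if "v \<in> vecs n K" for v
      unfolding avg_def by (intro I_sum I_mul a_K P_I mulK unK that) auto
    have avg_id: "avg w = w" if "w \<in> I" for w
    proof -
      have wV: "w \<in> V" using that I_vecs vecs_UNIV by blast
      have "avg w = (\<Sum>i<n. a i \<odot> (unitv i \<odot> w))"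
        unfolding avg_def by (intro sum.cong refl) (use that in \<open>auto simp: P_id I_mul unK\<close>)
      also have "\<dots> = (\<Sum>i<n. a i \<odot> unitv i) \<odot> w"
        using wV a_V by (simp add: sc_mul_sum_left assoc)
      finally show ?thesis using casimir_one unit_left[OF wV] by simp
    qed
    have avg_mul: "avg (c \<odot> v) = c \<odot> avg v" if c: "c \<in> vecs n K" and v: "v \<in> vecs n K" for c v
    proof -
      have cV: "c \<in> V" and vV: "v \<in> V" using c v vecs_UNIV by auto
      have PV: "P (unitv j \<odot> v) \<in> V" if "j < n" for j
        using P_I[OF mulK[OF unK[OF that] v]] I_vecs vecs_UNIV by blast
      have "avg (c \<odot> v) = (\<Sum>i<n. \<Sum>j<n. vscale ((unitv i \<odot> c) j) (a i \<odot> P (unitv j \<odot> v)))"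
        unfolding avg_def
      proof (rule sum.cong[OF refl])
        fix i assume "i \<in> {..<n}"
        then have "unitv i \<odot> (c \<odot> v) = (unitv i \<odot> c) \<odot> v" using cV vV by (simp add: assoc)
        also have "\<dots> = (\<Sum>j<n. vscale ((unitv i \<odot> c) j) (unitv j)) \<odot> v"
          using arg_cong[OF vec_expansion[OF mul_V[of "unitv i" c]], of "\<lambda>x. x \<odot> v"] .
        also have "\<dots> = (\<Sum>j<n. vscale ((unitv i \<odot> c) j) (unitv j \<odot> v))"
          by (simp add: sc_mul_sum_left sc_mul_scale_left)
        finally show "a i \<odot> P (unitv i \<odot> (c \<odot> v)) = (\<Sum>j<n. vscale ((unitv i \<odot> c) j) (a i \<odot> P (unitv j \<odot> v)))"
          by (simp add: P_sum P_scale sc_mul_sum_right sc_mul_scale_right)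
      qed
      also have "\<dots> = (\<Sum>j<n. \<Sum>i<n. vscale ((unitv i \<odot> c) j) (a i \<odot> P (unitv j \<odot> v)))"
        by (rule sum.swap)
      also have "\<dots> = (\<Sum>j<n. c \<odot> (a j \<odot> P (unitv j \<odot> v)))"
      proof (rule sum.cong[OF refl])
        fix j assume "j \<in> {..<n}"
        then have j: "j < n" by simp
        have "c \<odot> (a j \<odot> P (unitv j \<odot> v)) = (c \<odot> a j) \<odot> P (unitv j \<odot> v)"
          using cV a_V PV[OF j] by (simp add: assoc)
        then show "(\<Sum>i<n. vscale ((unitv i \<odot> c) j) (a i \<odot> P (unitv j \<odot> v))) = c \<odot> (a j \<odot> P (unitv j \<odot> v))"
          by (simp add: casimir[OF cV j] sc_mul_sum_left sc_mul_scale_left)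
      qed
      also have "\<dots> = c \<odot> avg v" by (simp add: avg_def sc_mul_sum_right)
      finally show ?thesis .
    qed
    have avg_add: "avg (v + w) = avg v + avg w" for v w
      by (simp add: avg_def sc_mul_add_right P_add sum.distrib del: plus_fun_apply)
    have avg_scale: "avg (vscale c v) = vscale c (avg v)" for c v
      by (simp add: avg_def sc_mul_scale_right P_scale vscale_sum)
    have avg_zero: "avg 0 = 0" using avg_scale[of 0 0] by (simp add: vscale_def zero_fun_def)
    have neg: "\<ominus>\<^bsub>sc_ring n K s u\<^esub> v = vscale (-1) v" if "v \<in> vecs n K" for v
    proof (rule R.minus_equality)
      have "vscale (-1) v + v = 0" by (rule ext) (simp add: vscale_def)
      then show "vscale (-1) v \<oplus>\<^bsub>sc_ring n K s u\<^esub> v = \<zero>\<^bsub>sc_ring n K s u\<^esub>" by simp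
    qed (use that in \<open>auto intro: vecs_scale[OF K] subfield_set_ops[OF K]\<close>)
    \<comment> \<open>The averaged map is a left-linear projection onto \<open>I\<close>, so its
      kernel is a complementary left ideal.\<close>
    define J where "J = {v\<in>vecs n K. avg v = 0}"
    have J_zero: "0 \<in> J" unfolding J_def mem_Collect_eq using avg_zero vecs_zero[OF K] by blast
    have J_add: "v + w \<in> J" if "v \<in> J" "w \<in> J" for v w
      using that vecs_add[OF K, of v n w] unfolding J_def mem_Collect_eq avg_add
      by (simp add: zero_fun_def) 
    have J_scale: "vscale (-1) v \<in> J" if "v \<in> J" for v
      using that vecs_scale[OF K _, of "-1" v n] subfield_set_ops[OF K] unfolding J_def mem_Collect_eq avg_scale
      by (simp add: vscale_def zero_fun_def)
    have "additive_subgroup J (sc_ring n K s u)"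
    proof (intro additive_subgroup.intro subgroup.intro)
      show "inv\<^bsub>add_monoid (sc_ring n K s u)\<^esub> x \<in> J" if "x \<in> J" for x
        using neg[of x] that J_scale[OF that] by (auto simp: a_inv_def J_def)
    qed (use J_zero J_add in \<open>auto simp: J_def\<close>)
    moreover have "c \<odot> v \<in> J" if "c \<in> vecs n K" "v \<in> J" for c v
      using that mulK avg_mul by (auto simp: J_def sc_mul_zero_right)
    ultimately have J: "left_ideal J (sc_ring n K s u)" by (auto simp: left_ideal_def)
    have "v = 0" if "v \<in> I" "v \<in> J" for v
      using avg_id[OF that(1)] that(2) unfolding J_def by simp
    then have IJ: "I \<inter> J = {0}" using I_zero J_zero by blast
    have sum: "I <+>\<^bsub>sc_ring n K s u\<^esub> J = vecs n K"
    proof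
      show "I <+>\<^bsub>sc_ring n K s u\<^esub> J \<subseteq> vecs n K"
        using I_vecs vecs_add[OF K] by (auto simp: set_add_def set_mult_def J_def subset_iff simp del: plus_fun_apply)
      show "vecs n K \<subseteq> I <+>\<^bsub>sc_ring n K s u\<^esub> J"
      proof
        fix v assume v: "v \<in> vecs n K"
        have m1: "-1 \<in> K" using subfield_set_ops[OF K] by blast
        have "avg (v + vscale (-1) (avg v)) = 0"
        proof -
          have "avg (v + vscale (-1) (avg v)) = avg v + vscale (-1) (avg v)"
            using avg_id[OF avg_I[OF v]] unfolding avg_add avg_scale by simp
          also have "\<dots> = 0" by (rule ext) (simp add: vscale_def)
          finally show ?thesis .
        qed
        then have "v + vscale (-1) (avg v) \<in> J"
          using v avg_I[OF v] I_vecs m1 unfolding J_def by (auto intro!: vecs_add[OF K] vecs_scale[OF K] simp del: plus_fun_apply zero_fun_apply)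
        moreover have "v = avg v + (v + vscale (-1) (avg v))" by (rule ext) (simp add: vscale_def)
        ultimately show "v \<in> I <+>\<^bsub>sc_ring n K s u\<^esub> J"
          unfolding set_add_def set_mult_def using avg_I[OF v] by fastforce
      qed
    qed
    show "\<exists>J. left_ideal J (sc_ring n K s u) \<and> I \<inter> J = {\<zero>\<^bsub>sc_ring n K s u\<^esub>} \<and>
        I <+>\<^bsub>sc_ring n K s u\<^esub> J = carrier (sc_ring n K s u)"
      using J IJ sum by auto
  qed
qed

section \<open>Polynomials in coordinates and fields of fractions\<close>

definition monom_eval :: "('v \<Rightarrow> 'a::comm_ring_1) \<Rightarrow> ('v \<Rightarrow>\<^sub>0 nat) \<Rightarrow> 'a" where
  "monom_eval g m = (\<Prod>v\<in>Poly_Mapping.keys m. g v ^ Poly_Mapping.lookup m v)"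

text \<open>\<open>h\<close> moves the coefficients and \<open>g\<close> replaces the
  indeterminates. Both are needed: the passage between the two polynomial rings keeps coefficients
  through \<open>Const\<close>, while the specialisation at the counit evaluates in the ground
  field.\<close>

definition peval :: "('k::comm_ring_1 \<Rightarrow> 'a::comm_ring_1) \<Rightarrow> ('v \<Rightarrow> 'a) \<Rightarrow> ('k, 'v) polys \<Rightarrow> 'a" where
  "peval h g p = (\<Sum>m\<in>Poly_Mapping.keys p. h (Poly_Mapping.lookup p m) * monom_eval g m)"

lemma monom_eval_superset:
  assumes "finite A" "Poly_Mapping.keys m \<subseteq> A"
  shows "monom_eval g m = (\<Prod>v\<in>A. g v ^ Poly_Mapping.lookup m v)"
  unfolding monom_eval_def
  by (rule prod.mono_neutral_left) (use assms in \<open>auto simp: in_keys_iff\<close>)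

lemma monom_eval_add: "monom_eval g (m + m') = monom_eval g m * monom_eval g m'"
proof -
  let ?A = "Poly_Mapping.keys m \<union> Poly_Mapping.keys m'"
  have "monom_eval g x = (\<Prod>v\<in>?A. g v ^ Poly_Mapping.lookup x v)" if "x \<in> {m, m', m + m'}" for x
    by (rule monom_eval_superset) (use that Poly_Mapping.keys_add[of m m'] in auto)
  then show ?thesis
    by (simp add: lookup_add power_add prod.distrib)
qed

lemma monom_eval_zero [simp]: "monom_eval g 0 = 1"
  by (simp add: monom_eval_def)

lemma monom_eval_single [simp]: "monom_eval g (Poly_Mapping.single v (Suc 0)) = g v"
  by (simp add: monom_eval_def)

lemma polys_sum_monomials:
  "p = (\<Sum>m\<in>Poly_Mapping.keys p. Poly_Mapping.single m (Poly_Mapping.lookup p m))"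
proof (rule poly_mapping_eqI)
  fix k
  have "Poly_Mapping.lookup (\<Sum>m\<in>Poly_Mapping.keys p. Poly_Mapping.single m (Poly_Mapping.lookup p m)) k
     = (\<Sum>m\<in>Poly_Mapping.keys p. if m = k then Poly_Mapping.lookup p m else 0)"
    by (auto simp: lookup_sum lookup_single when_def intro!: sum.cong)
  also have "\<dots> = Poly_Mapping.lookup p k" by (simp add: in_keys_iff)
  finally show "Poly_Mapping.lookup p k =
    Poly_Mapping.lookup (\<Sum>m\<in>Poly_Mapping.keys p. Poly_Mapping.single m (Poly_Mapping.lookup p m)) k" by simp
qed

lemma polys_induct_monomials [case_names single add]:
  fixes p :: "('k::comm_ring_1, 'v) polys"
  assumes single: "\<And>m c. P (Poly_Mapping.single m c)" and add: "\<And>p q. P p \<Longrightarrow> P q \<Longrightarrow> P (p + q)"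
  shows "P p"
proof -
  have "P 0" using single[of 0 0] by simp
  have "P (\<Sum>m\<in>A. Poly_Mapping.single m (Poly_Mapping.lookup p m))" for A
    by (induction A rule: infinite_finite_induct) (auto intro: \<open>P 0\<close> add single)
  then show ?thesis using polys_sum_monomials[of p] by metis
qed

text \<open>Monomials are built as iterated products of indeterminates. Thus a congruence that
  respects sums and products can be checked on generators.\<close>

lemma polys_induct [case_names Const Indet add mult]:
  fixes p :: "('k::comm_ring_1, 'v) polys"
  assumes Const: "\<And>c. P (Const c)" and Indet: "\<And>v. P (Indet v)"
    and add: "\<And>p q. P p \<Longrightarrow> P q \<Longrightarrow> P (p + q)" and mult: "\<And>p q. P p \<Longrightarrow> P q \<Longrightarrow> P (p * q)"
  shows "P p"
proof (induction p rule: polys_induct_monomials)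
  case (single m c)
  have "P (Const 1)" by (rule Const)
  then have P1: "P (Poly_Mapping.single 0 1)" by (simp add: Const_def)
  have v: "P (Poly_Mapping.single (Poly_Mapping.single v i) 1)" for v and i :: nat
  proof (induction i)
    case 0 then show ?case using P1 by simp
  next
    case (Suc i)
    have "P (Indet v * Poly_Mapping.single (Poly_Mapping.single v i) 1)" by (rule mult[OF Indet Suc])
    then show ?case by (simp add: Indet_def mult_single single_add[symmetric])
  qed
  have "P (Poly_Mapping.single (\<Sum>v\<in>A. Poly_Mapping.single v (Poly_Mapping.lookup m v)) 1)" for A
  proof (induction A rule: infinite_finite_induct)
    case (insert x F)
    then have "P (Poly_Mapping.single (Poly_Mapping.single x (Poly_Mapping.lookup m x)) 1 *
        Poly_Mapping.single (\<Sum>v\<in>F. Poly_Mapping.single v (Poly_Mapping.lookup m v)) 1)"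
      by (intro mult v)
    then show ?case using insert by (simp add: mult_single)
  qed (use P1 in auto)
  then have m: "P (Poly_Mapping.single m 1)"
  proof -
    have "m = (\<Sum>v\<in>Poly_Mapping.keys m. Poly_Mapping.single v (Poly_Mapping.lookup m v))"
    proof (rule poly_mapping_eqI)
      fix k
      have "Poly_Mapping.lookup (\<Sum>v\<in>Poly_Mapping.keys m. Poly_Mapping.single v (Poly_Mapping.lookup m v)) k
         = (\<Sum>v\<in>Poly_Mapping.keys m. if v = k then Poly_Mapping.lookup m v else 0)"
        by (auto simp: lookup_sum lookup_single when_def intro!: sum.cong)
      also have "\<dots> = Poly_Mapping.lookup m k" by (simp add: in_keys_iff)
      finally show "Poly_Mapping.lookup m k =
        Poly_Mapping.lookup (\<Sum>v\<in>Poly_Mapping.keys m. Poly_Mapping.single v (Poly_Mapping.lookup m v)) k" by simp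
    qed
    then show ?thesis
      using \<open>\<And>A. P (Poly_Mapping.single (\<Sum>v\<in>A. Poly_Mapping.single v (Poly_Mapping.lookup m v)) 1)\<close> by metis
  qed
  have "P (Const c * Poly_Mapping.single m 1)" by (rule mult[OF Const m])
  then show ?case by (simp add: Const_def mult_single)
next
  case (add p q)
  then show ?case by (rule assms(3))
qed

lemma Const_add: "Const (a + b) = Const a + Const b"
  by (simp add: Const_def single_add)

lemma Const_mult: "Const (a * b) = Const a * Const b"
  by (simp add: Const_def mult_single)

lemma Const_one: "Const 1 = 1"
  by (simp add: Const_def)

lemma comm_ring_hom_Const: "comm_ring_hom (Const :: 'k::comm_ring_1 \<Rightarrow> ('k, 'v) polys)"
  by unfold_locales (simp_all add: Const_add Const_mult Const_one, simp add: Const_def)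

locale polynomial_evaluation = comm_ring_hom h for h :: "'k::comm_ring_1 \<Rightarrow> 'a::comm_ring_1" +
  fixes g :: "'v \<Rightarrow> 'a"
begin

lemma peval_superset:
  assumes "finite A" "Poly_Mapping.keys p \<subseteq> A"
  shows "peval h g p = (\<Sum>m\<in>A. h (Poly_Mapping.lookup p m) * monom_eval g m)"
  unfolding peval_def
  by (rule sum.mono_neutral_left) (use assms in \<open>auto simp: in_keys_iff\<close>)

lemma peval_add: "peval h g (p + q) = peval h g p + peval h g q"
proof -
  let ?A = "Poly_Mapping.keys p \<union> Poly_Mapping.keys q"
  have "peval h g x = (\<Sum>m\<in>?A. h (Poly_Mapping.lookup x m) * monom_eval g m)" if "x \<in> {p, q, p + q}" for x
    by (rule peval_superset) (use that Poly_Mapping.keys_add[of p q] in auto)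
  then show ?thesis
    by (simp add: lookup_add hom_add algebra_simps sum.distrib)
qed

lemma peval_single: "peval h g (Poly_Mapping.single m c) = h c * monom_eval g m"
  by (simp add: peval_def)

lemma peval_mult: "peval h g (p * q) = peval h g p * peval h g q"
proof (induction p rule: polys_induct_monomials)
  case (single m c)
  show ?case
  proof (induction q rule: polys_induct_monomials)
    case (single m' c')
    then show ?case by (simp add: mult_single peval_single monom_eval_add hom_mult mult_ac)
  next
    case (add q q')
    then show ?case by (simp add: distrib_left peval_add)
  qed
next
  case (add p p')
  then show ?case by (simp add: distrib_right peval_add)
qed

lemma peval_Const: "peval h g (Const c) = h c"
  by (simp add: Const_def peval_single)

lemma peval_Indet: "peval h g (Indet v) = g v"
  by (simp add: Indet_def peval_single)

sublocale peval: comm_ring_hom "peval h g"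
  using peval_Const[of 0] peval_Const[of 1]
  by unfold_locales (auto simp: peval_add peval_mult Const_def)

end

text \<open>\<open>D\<close> is a bare record. An injective map into a commutative ring type that
  respects the operations transports the ring laws back to \<open>D\<close>. The last clause asks
  only that a negative exist, since the record carries no operation for it.\<close>

definition cring_embedding :: "('a, 'z) ring_scheme \<Rightarrow> ('a \<Rightarrow> 'f::comm_ring_1) \<Rightarrow> bool" where
  "cring_embedding D \<phi> \<longleftrightarrow> inj_on \<phi> (carrier D) \<and>
     (\<forall>x\<in>carrier D. \<forall>y\<in>carrier D. x \<oplus>\<^bsub>D\<^esub> y \<in> carrier D \<and> \<phi> (x \<oplus>\<^bsub>D\<^esub> y) = \<phi> x + \<phi> y) \<and>
     (\<forall>x\<in>carrier D. \<forall>y\<in>carrier D. x \<otimes>\<^bsub>D\<^esub> y \<in> carrier D \<and> \<phi> (x \<otimes>\<^bsub>D\<^esub> y) = \<phi> x * \<phi> y) \<and>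
     \<zero>\<^bsub>D\<^esub> \<in> carrier D \<and> \<phi> \<zero>\<^bsub>D\<^esub> = 0 \<and> \<one>\<^bsub>D\<^esub> \<in> carrier D \<and> \<phi> \<one>\<^bsub>D\<^esub> = 1 \<and>
     (\<forall>x\<in>carrier D. \<exists>y\<in>carrier D. \<phi> y = - \<phi> x)"

lemma cring_embedding_simps:
  assumes "cring_embedding D \<phi>"
  shows "x \<in> carrier D \<Longrightarrow> y \<in> carrier D \<Longrightarrow> x \<oplus>\<^bsub>D\<^esub> y \<in> carrier D"
    "x \<in> carrier D \<Longrightarrow> y \<in> carrier D \<Longrightarrow> \<phi> (x \<oplus>\<^bsub>D\<^esub> y) = \<phi> x + \<phi> y"
    "x \<in> carrier D \<Longrightarrow> y \<in> carrier D \<Longrightarrow> x \<otimes>\<^bsub>D\<^esub> y \<in> carrier D"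
    "x \<in> carrier D \<Longrightarrow> y \<in> carrier D \<Longrightarrow> \<phi> (x \<otimes>\<^bsub>D\<^esub> y) = \<phi> x * \<phi> y"
    "\<zero>\<^bsub>D\<^esub> \<in> carrier D" "\<phi> \<zero>\<^bsub>D\<^esub> = 0" "\<one>\<^bsub>D\<^esub> \<in> carrier D" "\<phi> \<one>\<^bsub>D\<^esub> = 1"
    "x \<in> carrier D \<Longrightarrow> y \<in> carrier D \<Longrightarrow> \<phi> x = \<phi> y \<longleftrightarrow> x = y"
  using assms unfolding cring_embedding_def inj_on_def by blast+

lemma cring_embedding_neg:
  "cring_embedding D \<phi> \<Longrightarrow> x \<in> carrier D \<Longrightarrow> \<exists>y\<in>carrier D. \<phi> y = - \<phi> x"
  by (simp add: cring_embedding_def)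

lemma cring_embedding_cring:
  assumes D: "cring_embedding D \<phi>"
  shows "cring D"
proof (rule cringI)
  note [simp] = cring_embedding_simps(1-8)[OF D] cring_embedding_simps(9)[OF D, symmetric]
  show "abelian_group D"
  proof (rule abelian_groupI)
    show "\<exists>y\<in>carrier D. y \<oplus>\<^bsub>D\<^esub> x = \<zero>\<^bsub>D\<^esub>" if x: "x \<in> carrier D" for x
    proof -
      obtain y where "y \<in> carrier D" "\<phi> y = - \<phi> x" using cring_embedding_neg[OF D x] by blast
      then show ?thesis using x by (intro bexI[of _ y]) auto
    qed
  qed (auto simp: algebra_simps)
  show "comm_monoid D"
    by (rule comm_monoidI) (auto simp: algebra_simps)
qed (use cring_embedding_simps[OF D] in \<open>auto simp: cring_embedding_simps(9)[OF D, symmetric] algebra_simps\<close>)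

lemma cring_embedding_minus:
  assumes D: "cring_embedding D \<phi>" and x: "x \<in> carrier D"
  shows "\<phi> (\<ominus>\<^bsub>D\<^esub> x) = - \<phi> x"
proof -
  interpret cring D by (rule cring_embedding_cring[OF D])
  have "\<phi> (\<ominus>\<^bsub>D\<^esub> x \<oplus>\<^bsub>D\<^esub> x) = 0" using x l_neg cring_embedding_simps(6)[OF D] by simp
  then have "\<phi> (\<ominus>\<^bsub>D\<^esub> x) + \<phi> x = 0" using x by (simp add: cring_embedding_simps(2)[OF D])
  then show ?thesis by (simp add: eq_neg_iff_add_eq_0)
qed

lemma cring_embedding_cong:
  assumes "cring_embedding D \<phi>" "carrier D' = carrier D" "\<And>x y. x \<oplus>\<^bsub>D'\<^esub> y = x \<oplus>\<^bsub>D\<^esub> y"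
    "\<And>x y. x \<otimes>\<^bsub>D'\<^esub> y = x \<otimes>\<^bsub>D\<^esub> y" "\<zero>\<^bsub>D'\<^esub> = \<zero>\<^bsub>D\<^esub>" "\<one>\<^bsub>D'\<^esub> = \<one>\<^bsub>D\<^esub>"
  shows "cring_embedding D' \<phi>"
  using assms unfolding cring_embedding_def by simp

definition fraction_value :: "('a \<Rightarrow> 'f::field) \<Rightarrow> ('a \<times> 'a) set \<Rightarrow> 'f" where
  "fraction_value \<phi> U = (let p = SOME p. p \<in> U in \<phi> (fst p) / \<phi> (snd p))"

text \<open>A fraction, as a class of pairs, is determined by the quotient of the values of
  numerator and denominator. So the classes are indexed by the set of such quotients, and the
  set-theoretic operations on classes become the operations of the field.\<close>

lemma
  assumes D: "cring_embedding D (\<phi> :: 'a \<Rightarrow> 'f::field)"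
  shows fraction_value: "a \<in> carrier D \<Longrightarrow> b \<in> carrier D \<Longrightarrow> b \<noteq> \<zero>\<^bsub>D\<^esub> \<Longrightarrow>
           fraction_value \<phi> (fraction D a b) = \<phi> a / \<phi> b"
    and fraction_field_embedding: "cring_embedding (fraction_field D) (fraction_value \<phi>)"
    and fraction_field_subfield: "subfield_set (fraction_value \<phi> ` carrier (fraction_field D))"
    and fraction_carrier: "a \<in> carrier D \<Longrightarrow> b \<in> carrier D \<Longrightarrow> b \<noteq> \<zero>\<^bsub>D\<^esub> \<Longrightarrow>
           fraction D a b \<in> carrier (fraction_field D)"
proof -
  note D_simps [simp] = cring_embedding_simps(1-8)[OF D]
  have nz: "\<phi> b \<noteq> 0 \<longleftrightarrow> b \<noteq> \<zero>\<^bsub>D\<^esub>" if "b \<in> carrier D" for b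
    using that cring_embedding_simps(9)[OF D, of b "\<zero>\<^bsub>D\<^esub>"] by simp
  \<comment> \<open>The class belonging to a value \<open>q\<close> in the field; every fraction
    with that value is literally this set.\<close>
  define cls where "cls q = {(c, d). c \<in> carrier D \<and> d \<in> carrier D \<and> d \<noteq> \<zero>\<^bsub>D\<^esub> \<and> \<phi> c / \<phi> d = q}" for q
  define Q where "Q = {\<phi> a / \<phi> b | a b. a \<in> carrier D \<and> b \<in> carrier D \<and> b \<noteq> \<zero>\<^bsub>D\<^esub>}"
  have frac: "fraction D a b = cls (\<phi> a / \<phi> b)" if "a \<in> carrier D" "b \<in> carrier D" "b \<noteq> \<zero>\<^bsub>D\<^esub>" for a b
  proof -
    have "a \<otimes>\<^bsub>D\<^esub> d = c \<otimes>\<^bsub>D\<^esub> b \<longleftrightarrow> \<phi> c / \<phi> d = \<phi> a / \<phi> b"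
      if "c \<in> carrier D" "d \<in> carrier D" "d \<noteq> \<zero>\<^bsub>D\<^esub>" for c d
    proof -
      have "a \<otimes>\<^bsub>D\<^esub> d = c \<otimes>\<^bsub>D\<^esub> b \<longleftrightarrow> \<phi> (a \<otimes>\<^bsub>D\<^esub> d) = \<phi> (c \<otimes>\<^bsub>D\<^esub> b)"
        using that \<open>a \<in> carrier D\<close> \<open>b \<in> carrier D\<close>
        by (intro cring_embedding_simps(9)[OF D, symmetric]) auto
      then show ?thesis
        using that \<open>a \<in> carrier D\<close> \<open>b \<in> carrier D\<close> \<open>b \<noteq> \<zero>\<^bsub>D\<^esub>\<close> nz[of b] nz[of d]
        by (auto simp: field_simps)
    qed
    then show ?thesis unfolding fraction_def cls_def by auto
  qed
  have ne: "cls q \<noteq> {}" if "q \<in> Q" for q using that by (auto simp: cls_def Q_def)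
  have clsD: "c \<in> carrier D" "d \<in> carrier D" "d \<noteq> \<zero>\<^bsub>D\<^esub>" "\<phi> c / \<phi> d = q" if "(c, d) \<in> cls q" for c d q
    using that by (auto simp: cls_def)
  have fv: "fraction_value \<phi> (cls q) = q" if "q \<in> Q" for q
  proof -
    have "(SOME p. p \<in> cls q) \<in> cls q" using ne[OF that] by (simp add: some_in_eq)
    then show ?thesis by (auto simp: fraction_value_def cls_def Let_def split_beta)
  qed
  have car: "carrier (fraction_field D) = cls ` Q"
  proof -
    have "carrier (fraction_field D) =
        (\<lambda>(a, b). fraction D a b) ` (carrier D \<times> (carrier D - {\<zero>\<^bsub>D\<^esub>}))"
      by (auto simp: fraction_field_def)
    also have "\<dots> = (\<lambda>(a, b). cls (\<phi> a / \<phi> b)) ` (carrier D \<times> (carrier D - {\<zero>\<^bsub>D\<^esub>}))"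
      by (rule image_cong) (auto simp: frac)
    also have "\<dots> = cls ` Q"
    proof -
      have "Q = (\<lambda>(a, b). \<phi> a / \<phi> b) ` (carrier D \<times> (carrier D - {\<zero>\<^bsub>D\<^esub>}))"
        unfolding Q_def by force
      then show ?thesis by (simp add: image_image split_beta)
    qed
    finally show ?thesis .
  qed
  have dnz: "b \<otimes>\<^bsub>D\<^esub> d \<noteq> \<zero>\<^bsub>D\<^esub>" if "b \<in> carrier D" "b \<noteq> \<zero>\<^bsub>D\<^esub>" "d \<in> carrier D" "d \<noteq> \<zero>\<^bsub>D\<^esub>" for b d
    using that nz[of "b \<otimes>\<^bsub>D\<^esub> d"] nz[of b] nz[of d] by auto
  have QI: "\<phi> a / \<phi> b \<in> Q" if "a \<in> carrier D" "b \<in> carrier D" "b \<noteq> \<zero>\<^bsub>D\<^esub>" for a b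
    using that by (auto simp: Q_def)
  have Q_mult: "q * q' \<in> Q" if qq': "q \<in> Q" "q' \<in> Q" for q q'
  proof -
    obtain a b c d where "a \<in> carrier D" "b \<in> carrier D" "b \<noteq> \<zero>\<^bsub>D\<^esub>" "q = \<phi> a / \<phi> b"
      "c \<in> carrier D" "d \<in> carrier D" "d \<noteq> \<zero>\<^bsub>D\<^esub>" "q' = \<phi> c / \<phi> d"
      using qq' unfolding Q_def by blast
    then show ?thesis using QI[of "a \<otimes>\<^bsub>D\<^esub> c" "b \<otimes>\<^bsub>D\<^esub> d"] dnz[of b d] by simp
  qed
  have Q_add: "q + q' \<in> Q" if qq': "q \<in> Q" "q' \<in> Q" for q q'
  proof -
    obtain a b c d where *: "a \<in> carrier D" "b \<in> carrier D" "b \<noteq> \<zero>\<^bsub>D\<^esub>" "q = \<phi> a / \<phi> b"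
      "c \<in> carrier D" "d \<in> carrier D" "d \<noteq> \<zero>\<^bsub>D\<^esub>" "q' = \<phi> c / \<phi> d"
      using qq' unfolding Q_def by blast
    then have "q + q' = \<phi> (a \<otimes>\<^bsub>D\<^esub> d \<oplus>\<^bsub>D\<^esub> c \<otimes>\<^bsub>D\<^esub> b) / \<phi> (b \<otimes>\<^bsub>D\<^esub> d)"
      using nz[of b] nz[of d] by (simp add: add_frac_eq)
    then show ?thesis using * QI[of "a \<otimes>\<^bsub>D\<^esub> d \<oplus>\<^bsub>D\<^esub> c \<otimes>\<^bsub>D\<^esub> b" "b \<otimes>\<^bsub>D\<^esub> d"] dnz[of b d] by simp
  qed
  have one_nz: "\<one>\<^bsub>D\<^esub> \<noteq> \<zero>\<^bsub>D\<^esub>" using nz[of "\<one>\<^bsub>D\<^esub>"] by simp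
  have Q01: "0 \<in> Q" "1 \<in> Q"
    using QI[of "\<zero>\<^bsub>D\<^esub>" "\<one>\<^bsub>D\<^esub>"] QI[of "\<one>\<^bsub>D\<^esub>" "\<one>\<^bsub>D\<^esub>"] one_nz by simp_all
  have Q_neg: "- q \<in> Q" if q: "q \<in> Q" for q
  proof -
    obtain a b where *: "a \<in> carrier D" "b \<in> carrier D" "b \<noteq> \<zero>\<^bsub>D\<^esub>" "q = \<phi> a / \<phi> b"
      using q unfolding Q_def by blast
    obtain c where "c \<in> carrier D" "\<phi> c = - \<phi> a" using cring_embedding_neg[OF D *(1)] by blast
    then show ?thesis using QI[of c b] * by simp
  qed
  have Q_inv: "inverse q \<in> Q" if q: "q \<in> Q" for q
  proof (cases "q = 0")
    case False
    obtain a b where *: "a \<in> carrier D" "b \<in> carrier D" "b \<noteq> \<zero>\<^bsub>D\<^esub>" "q = \<phi> a / \<phi> b"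
      using q unfolding Q_def by blast
    then have "a \<noteq> \<zero>\<^bsub>D\<^esub>" using False by auto
    then show ?thesis using QI[of b a] * by simp
  qed (use Q01 in auto)
  \<comment> \<open>All pairs of representatives contribute one and the same class, so the union
    equals that class; for this the index sets must be nonempty.\<close>
  have mult: "cls q \<otimes>\<^bsub>fraction_field D\<^esub> cls q' = cls (q * q')" if qq': "q \<in> Q" "q' \<in> Q" for q q'
  proof -
    have "fraction D (a \<otimes>\<^bsub>D\<^esub> c) (b \<otimes>\<^bsub>D\<^esub> d) = cls (q * q')" if "(a, b) \<in> cls q" "(c, d) \<in> cls q'" for a b c d
      using clsD[OF that(1)] clsD[OF that(2)] dnz[of b d] by (subst frac) auto
    then show ?thesis
      using ne[OF qq'(1)] ne[OF qq'(2)] by (fastforce simp: fraction_field_def)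
  qed
  have add: "cls q \<oplus>\<^bsub>fraction_field D\<^esub> cls q' = cls (q + q')" if qq': "q \<in> Q" "q' \<in> Q" for q q'
  proof -
    have "fraction D (a \<otimes>\<^bsub>D\<^esub> d \<oplus>\<^bsub>D\<^esub> c \<otimes>\<^bsub>D\<^esub> b) (b \<otimes>\<^bsub>D\<^esub> d) = cls (q + q')"
      if "(a, b) \<in> cls q" "(c, d) \<in> cls q'" for a b c d
    proof -
      note 1 = clsD[OF that(1)] and 2 = clsD[OF that(2)]
      have "\<phi> (a \<otimes>\<^bsub>D\<^esub> d \<oplus>\<^bsub>D\<^esub> c \<otimes>\<^bsub>D\<^esub> b) / \<phi> (b \<otimes>\<^bsub>D\<^esub> d) = q + q'"
        unfolding 1(4)[symmetric] 2(4)[symmetric] using 1(1-3) 2(1-3) nz[of b] nz[of d] by (simp add: add_frac_eq)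
      then show ?thesis using 1 2 dnz[of b d] frac[of "a \<otimes>\<^bsub>D\<^esub> d \<oplus>\<^bsub>D\<^esub> c \<otimes>\<^bsub>D\<^esub> b" "b \<otimes>\<^bsub>D\<^esub> d"] by simp
    qed
    then show ?thesis
      using ne[OF qq'(1)] ne[OF qq'(2)] by (fastforce simp: fraction_field_def)
  qed
  have one: "\<one>\<^bsub>fraction_field D\<^esub> = cls 1" using frac[of "\<one>\<^bsub>D\<^esub>" "\<one>\<^bsub>D\<^esub>"] one_nz by (simp add: fraction_field_def)
  have zero: "\<zero>\<^bsub>fraction_field D\<^esub> = cls 0" using frac[of "\<zero>\<^bsub>D\<^esub>" "\<one>\<^bsub>D\<^esub>"] one_nz by (simp add: fraction_field_def)
  show "fraction_value \<phi> (fraction D a b) = \<phi> a / \<phi> b"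
    if "a \<in> carrier D" "b \<in> carrier D" "b \<noteq> \<zero>\<^bsub>D\<^esub>"
    using frac[OF that] fv[OF QI[OF that]] by simp
  show "fraction D a b \<in> carrier (fraction_field D)"
    if "a \<in> carrier D" "b \<in> carrier D" "b \<noteq> \<zero>\<^bsub>D\<^esub>"
    using frac[OF that] QI[OF that] car by simp
  have im: "fraction_value \<phi> ` carrier (fraction_field D) = Q"
    unfolding car by (auto simp: fv image_image)
  then show "subfield_set (fraction_value \<phi> ` carrier (fraction_field D))"
    unfolding im subfield_set_def by (simp add: Q01 Q_add Q_mult Q_neg Q_inv)
  show "cring_embedding (fraction_field D) (fraction_value \<phi>)"
    unfolding cring_embedding_def
  proof (intro conjI ballI)
    show "inj_on (fraction_value \<phi>) (carrier (fraction_field D))"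
      by (rule inj_on_inverseI[of _ cls]) (auto simp: car fv)
    show "\<exists>y\<in>carrier (fraction_field D). fraction_value \<phi> y = - fraction_value \<phi> x"
      if "x \<in> carrier (fraction_field D)" for x
    proof -
      obtain q where "q \<in> Q" "x = cls q" using \<open>x \<in> carrier (fraction_field D)\<close> car by blast
      then show ?thesis using car fv Q_neg by (intro bexI[of _ "cls (- q)"]) auto
    qed
  qed (auto simp: car one zero fv mult add Q01 Q_add Q_mult)
qed

section \<open>The symmetric algebra and its polynomial coordinates\<close>

lemma symmetric_ideal_ideal: "ideal (symmetric_ideal scale) (ring_of_type_algebra :: ('k::field, 'h::ab_group_add) polys ring)"
proof -
  interpret ring "ring_of_type_algebra :: ('k, 'h) polys ring" by (rule ring_from_type_algebra)
  show ?thesis unfolding symmetric_ideal_def by (rule genideal_ideal) simp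
qed

lemma symmetric_ideal_add:
  fixes p q :: "('k::field, 'h::ab_group_add) polys"
  assumes "p \<in> symmetric_ideal scale" "q \<in> symmetric_ideal scale"
  shows "p + q \<in> symmetric_ideal scale"
proof -
  interpret ideal "symmetric_ideal scale" "ring_of_type_algebra :: ('k, 'h) polys ring"
    by (rule symmetric_ideal_ideal)
  show ?thesis using additive_subgroup.a_closed[OF additive_subgroup_axioms] assms by simp
qed

lemma symmetric_ideal_mult:
  fixes p q :: "('k::field, 'h::ab_group_add) polys"
  assumes "p \<in> symmetric_ideal scale"
  shows "q * p \<in> symmetric_ideal scale"
proof -
  interpret ideal "symmetric_ideal scale" "ring_of_type_algebra :: ('k, 'h) polys ring"
    by (rule symmetric_ideal_ideal)
  show ?thesis using I_l_closed[OF assms, of q] by simp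
qed

lemma symmetric_ideal_uminus:
  fixes p :: "('k::field, 'h::ab_group_add) polys"
  shows "p \<in> symmetric_ideal scale \<Longrightarrow> - p \<in> symmetric_ideal scale"
  using symmetric_ideal_mult[of p scale "-1"] by simp

lemma symmetric_ideal_zero: "(0 :: ('k::field, 'h::ab_group_add) polys) \<in> symmetric_ideal scale"
proof -
  interpret ideal "symmetric_ideal scale" "ring_of_type_algebra :: ('k, 'h) polys ring"
    by (rule symmetric_ideal_ideal)
  show ?thesis using additive_subgroup.zero_closed[OF additive_subgroup_axioms] by simp
qed

lemma symmetric_ideal_gens:
  fixes scale :: "'k::field \<Rightarrow> 'h::ab_group_add \<Rightarrow> 'h"
  shows "Indet (x + y) - Indet x - Indet y \<in> symmetric_ideal scale"
  "Indet (scale c x) - Const c * Indet x \<in> symmetric_ideal scale"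
proof -
  interpret ring "ring_of_type_algebra :: ('k, 'h) polys ring" by (rule ring_from_type_algebra)
  show "Indet (x + y) - Indet x - Indet y \<in> symmetric_ideal scale"
    "Indet (scale c x) - Const c * Indet x \<in> symmetric_ideal scale"
    unfolding symmetric_ideal_def by (rule subsetD[OF genideal_self], simp, blast)+
qed

text \<open>The kernel of \<open>E\<close> is an ideal, and the two hypotheses on
  \<open>Indet\<close> say that it contains the generators.\<close>

lemma symmetric_ideal_kernel:
  fixes E :: "('k::field, 'h::ab_group_add) polys \<Rightarrow> 'a::comm_ring_1"
  assumes "comm_ring_hom E"
    and "\<And>x y. E (Indet (x + y)) = E (Indet x) + E (Indet y)"
    and "\<And>c x. E (Indet (scale c x)) = E (Const c) * E (Indet x)"
    and p: "p \<in> symmetric_ideal scale"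
  shows "E p = 0"
proof -
  interpret E: comm_ring_hom E by fact
  interpret R: cring "ring_of_type_algebra :: ('k, 'h) polys ring" by (rule cring_from_type_algebra)
  have neg: "\<ominus>\<^bsub>ring_of_type_algebra\<^esub> q = - q" for q :: "('k, 'h) polys"
    by (rule R.minus_equality) auto
  have "ideal {p. E p = 0} ring_of_type_algebra"
  proof (rule idealI)
    show "ring (ring_of_type_algebra :: ('k, 'h) polys ring)" by (rule R.ring_axioms)
    show "subgroup {p. E p = 0} (add_monoid ring_of_type_algebra)"
    proof (rule subgroup.intro)
      show "inv\<^bsub>add_monoid ring_of_type_algebra\<^esub> q \<in> {p. E p = 0}" if "q \<in> {p. E p = 0}" for q
        using that neg[of q] unfolding a_inv_def by (simp add: E.hom_uminus)
    qed (auto simp: E.hom_add)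
  qed (simp_all add: E.hom_mult)
  then have "symmetric_ideal scale \<subseteq> {p. E p = 0}"
    unfolding symmetric_ideal_def
    by (rule R.genideal_minimal) (auto simp: assms E.hom_minus E.hom_mult)
  then show ?thesis using p by auto
qed

lemma sym_class_eq_iff:
  "sym_class scale p = sym_class scale q \<longleftrightarrow> p - q \<in> symmetric_ideal scale"
proof -
  have cls: "sym_class scale p = {r. r - p \<in> symmetric_ideal scale}" for p
  proof -
    have "(\<exists>h\<in>symmetric_ideal scale. r = h + p) \<longleftrightarrow> r - p \<in> symmetric_ideal scale" for r
      by (auto intro: bexI[of _ "r - p"])
    then show ?thesis by (auto simp: sym_class_def a_r_coset_def' )
  qed
  show ?thesis
  proof
    assume "sym_class scale p = sym_class scale q"
    moreover have "p \<in> sym_class scale p" unfolding cls using symmetric_ideal_zero by simp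
    ultimately have "p \<in> sym_class scale q" by simp
    then have "p \<in> {r. r - q \<in> symmetric_ideal scale}" unfolding cls .
    then show "p - q \<in> symmetric_ideal scale" by simp
  next
    assume pq: "p - q \<in> symmetric_ideal scale"
    have "r - p \<in> symmetric_ideal scale \<longleftrightarrow> r - q \<in> symmetric_ideal scale" for r
      using symmetric_ideal_add[OF _ pq, of "r - p"]
        symmetric_ideal_add[OF _ symmetric_ideal_uminus[OF pq], of "r - q"] by auto
    then show "sym_class scale p = sym_class scale q" by (simp add: cls)
  qed
qed

lemma symmetric_algebra_simps:
  fixes scale :: "'k::field \<Rightarrow> 'h::ab_group_add \<Rightarrow> 'h"
  shows "carrier (symmetric_algebra scale) = range (sym_class scale)"
  "sym_class scale p \<oplus>\<^bsub>symmetric_algebra scale\<^esub> sym_class scale q = sym_class scale (p + q)"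
  "sym_class scale p \<otimes>\<^bsub>symmetric_algebra scale\<^esub> sym_class scale q = sym_class scale (p * q)"
  "\<zero>\<^bsub>symmetric_algebra scale\<^esub> = sym_class scale 0"
  "\<one>\<^bsub>symmetric_algebra scale\<^esub> = sym_class scale 1"
proof -
  interpret ideal "symmetric_ideal scale" "ring_of_type_algebra :: ('k, 'h) polys ring"
    by (rule symmetric_ideal_ideal)
  have h: "sym_class scale \<in> Ring.ring_hom ring_of_type_algebra (symmetric_algebra scale)"
    using rcos_ring_hom unfolding symmetric_algebra_def sym_class_def[abs_def] .
  show "carrier (symmetric_algebra scale) = range (sym_class scale)"
    by (auto simp: symmetric_algebra_def FactRing_def A_RCOSETS_def' sym_class_def a_r_coset_def')
  show "sym_class scale p \<oplus>\<^bsub>symmetric_algebra scale\<^esub> sym_class scale q = sym_class scale (p + q)"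
    "sym_class scale p \<otimes>\<^bsub>symmetric_algebra scale\<^esub> sym_class scale q = sym_class scale (p * q)"
    using ring_hom_memE[OF h] by auto
  show "\<one>\<^bsub>symmetric_algebra scale\<^esub> = sym_class scale 1"
    using ring_hom_memE(4)[OF h] by simp
  have "sym_class scale (0::('k, 'h) polys) = symmetric_ideal scale"
    by (auto simp: sym_class_def a_r_coset_def')
  then show "\<zero>\<^bsub>symmetric_algebra scale\<^esub> = sym_class scale 0"
    by (simp add: symmetric_algebra_def FactRing_def)
qed

text \<open>A polynomial representation of the symmetric algebra by means of a basis \<open>e 0, \<dots>, e (n - 1)\<close>:
  the indeterminate of a vector goes to the linear form with its coordinates, and the indeterminate
  \<open>i\<close> goes back to that of \<open>e i\<close>.\<close>

locale symmetric_coordinates =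
  fixes scale :: "'k::field \<Rightarrow> 'h::ab_group_add \<Rightarrow> 'h" and n :: nat
    and e :: "nat \<Rightarrow> 'h" and crd :: "nat \<Rightarrow> 'h \<Rightarrow> 'k"
  assumes crd_add: "crd i (x + y) = crd i x + crd i y"
    and crd_scale: "crd i (scale c x) = c * crd i x"
    and crd_expansion: "x = (\<Sum>i<n. scale (crd i x) (e i))"
begin

definition lin_form :: "'h \<Rightarrow> ('k, nat) polys" where
  "lin_form x = (\<Sum>i<n. Const (crd i x) * Indet i)"

abbreviation "sym_eval \<equiv> peval Const lin_form"

sublocale ev: polynomial_evaluation "Const :: 'k \<Rightarrow> ('k, nat) polys" lin_form
  unfolding polynomial_evaluation_def by (rule comm_ring_hom_Const)

sublocale bk: polynomial_evaluation "Const :: 'k \<Rightarrow> ('k, 'h) polys" "\<lambda>i::nat. Indet (e i)"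
  unfolding polynomial_evaluation_def by (rule comm_ring_hom_Const)

lemma lin_form_add: "lin_form (x + y) = lin_form x + lin_form y"
  by (simp add: lin_form_def crd_add Const_add algebra_simps sum.distrib)

lemma lin_form_scale: "lin_form (scale c x) = Const c * lin_form x"
  by (simp add: lin_form_def crd_scale Const_mult sum_distrib_left mult.assoc)

text \<open>For the harder direction, going to coordinates and back changes a polynomial only by an
  element of the ideal. This is checked on generators and passes to sums and products; a polynomial
  with zero image is thereby congruent to 0.\<close>

lemma sym_eval_kernel: "sym_eval p = 0 \<longleftrightarrow> p \<in> symmetric_ideal scale"
proof
  assume "p \<in> symmetric_ideal scale"
  then show "sym_eval p = 0"
    by (rule symmetric_ideal_kernel[OF ev.peval.comm_ring_hom_axioms, rotated 2])
      (simp_all add: ev.peval_Indet ev.peval_Const lin_form_add lin_form_scale)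
next
  have indet_sum: "Indet (sum f A) - (\<Sum>i\<in>A. Indet (f i)) \<in> symmetric_ideal scale" if "finite A" for f :: "nat \<Rightarrow> 'h" and A
    using that
  proof (induction A rule: finite_induct)
    case empty
    \<comment> \<open>The additivity generator for the pair of zero vectors is the negative of
      \<open>Indet 0\<close>, so the indeterminate of the zero vector lies in the ideal.\<close>
    have "- (Indet (0 + 0) - Indet 0 - Indet 0 :: ('k, 'h) polys) \<in> symmetric_ideal scale"
      by (intro symmetric_ideal_uminus symmetric_ideal_gens)
    then show ?case by simp
  next
    case (insert i A)
    have "(Indet (f i + sum f A) - Indet (f i) - Indet (sum f A)) + (Indet (sum f A) - (\<Sum>i\<in>A. Indet (f i)))
        \<in> symmetric_ideal scale"
      by (intro symmetric_ideal_add symmetric_ideal_gens insert)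
    then show ?case using insert by (simp add: algebra_simps)
  qed
  have ideal_sum: "sum f A \<in> symmetric_ideal scale" if "\<And>i. i \<in> A \<Longrightarrow> f i \<in> symmetric_ideal scale"
    for f :: "nat \<Rightarrow> ('k, 'h) polys" and A
    using that by (induction A rule: infinite_finite_induct) (auto simp: symmetric_ideal_zero symmetric_ideal_add)
  have key: "p - peval Const (\<lambda>i. Indet (e i)) (sym_eval p) \<in> symmetric_ideal scale" for p
  proof (induction p rule: polys_induct)
    case (Const c)
    then show ?case by (simp add: ev.peval_Const bk.peval_Const symmetric_ideal_zero)
  next
    case (Indet x)
    have "(Indet (\<Sum>i<n. scale (crd i x) (e i)) - (\<Sum>i<n. Indet (scale (crd i x) (e i))))
       + (\<Sum>i<n. Indet (scale (crd i x) (e i)) - Const (crd i x) * Indet (e i)) \<in> symmetric_ideal scale"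
      by (intro symmetric_ideal_add indet_sum ideal_sum symmetric_ideal_gens) simp
    moreover have "peval Const (\<lambda>i. Indet (e i)) (sym_eval (Indet x)) = (\<Sum>i<n. Const (crd i x) * Indet (e i))"
      by (simp add: ev.peval_Indet lin_form_def bk.peval.hom_sum bk.peval_mult bk.peval_Const bk.peval_Indet)
    ultimately show ?case
      by (simp add: crd_expansion[symmetric] sum_subtractf)
  next
    case (add p q)
    from symmetric_ideal_add[OF add] show ?case
      by (simp add: ev.peval_add bk.peval_add algebra_simps)
  next
    case (mult p q)
    let ?b = "\<lambda>p. peval Const (\<lambda>i. Indet (e i)) (sym_eval p)"
    \<comment> \<open>The usual splitting of a difference of products into two terms, each
      containing one of the given differences.\<close>
    have "q * (p - ?b p) + ?b p * (q - ?b q) \<in> symmetric_ideal scale"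
      by (intro symmetric_ideal_add symmetric_ideal_mult mult)
    then show ?case by (simp add: ev.peval_mult bk.peval_mult algebra_simps)
  qed
  assume "sym_eval p = 0"
  then show "p \<in> symmetric_ideal scale" using key[of p] by simp
qed

definition sym_value :: "('k, 'h) polys set \<Rightarrow> ('k, nat) polys fract" where
  "sym_value U = to_fract (sym_eval (SOME p. U = sym_class scale p))"

lemma sym_value_class: "sym_value (sym_class scale p) = to_fract (sym_eval p)"
proof -
  let ?q = "SOME q. sym_class scale p = sym_class scale q"
  have "sym_class scale p = sym_class scale ?q" by (rule someI[of _ p]) simp
  then have "sym_eval (p - ?q) = 0" by (simp add: sym_class_eq_iff sym_eval_kernel)
  then show ?thesis by (simp add: sym_value_def ev.peval.hom_minus)
qed

text \<open>Well-definedness and injectivity are the two directions of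
  \<open>sym_eval_kernel\<close>. The embedding into a field also contains the fact that the
  symmetric algebra is an integral domain.\<close>

lemma sym_value_embedding: "cring_embedding (symmetric_algebra scale) sym_value"
  unfolding cring_embedding_def
proof (intro conjI ballI)
  show "inj_on sym_value (carrier (symmetric_algebra scale))"
  proof (rule inj_onI)
    fix U V assume "U \<in> carrier (symmetric_algebra scale)" "V \<in> carrier (symmetric_algebra scale)"
      and eq: "sym_value U = sym_value V"
    then obtain p q where UV: "U = sym_class scale p" "V = sym_class scale q"
      by (auto simp: symmetric_algebra_simps)
    then have "sym_eval (p - q) = 0" using eq by (simp add: sym_value_class ev.peval.hom_minus)
    then show "U = V" by (simp add: UV sym_class_eq_iff sym_eval_kernel)
  qed
  show "\<exists>y\<in>carrier (symmetric_algebra scale). sym_value y = - sym_value x"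
    if "x \<in> carrier (symmetric_algebra scale)" for x
  proof -
    obtain p where "x = sym_class scale p"
      using \<open>x \<in> carrier (symmetric_algebra scale)\<close> unfolding symmetric_algebra_simps by blast
    then show ?thesis
      by (intro bexI[of _ "sym_class scale (- p)"])
        (auto simp: symmetric_algebra_simps sym_value_class ev.peval.hom_uminus)
  qed
qed (auto simp: symmetric_algebra_simps sym_value_class ev.peval_add ev.peval_mult)

end

section \<open>The trace form under base change and gauge transformations\<close>

lemma sum_swap3:
  "(\<Sum>a\<in>A. \<Sum>b\<in>B. \<Sum>c\<in>C. f a b c) = (\<Sum>b\<in>B. \<Sum>c\<in>C. \<Sum>a\<in>A. f a b c)"
  by (rule trans[OF sum.swap]) (intro sum.cong refl sum.swap)

lemma sum_swap22:
  "(\<Sum>a\<in>A. \<Sum>b\<in>B. \<Sum>c\<in>C. \<Sum>d\<in>D. f a b c d) = (\<Sum>c\<in>C. \<Sum>d\<in>D. \<Sum>a\<in>A. \<Sum>b\<in>B. f a b c d)"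
  by (rule trans[OF _ sum_swap3]) (intro sum.cong refl sum_swap3)

lemma delta_sum:
  fixes f :: "nat \<Rightarrow> 'f::comm_ring_1"
  shows "j < n \<Longrightarrow> (\<Sum>i<n. (if i = j then 1 else 0) * f i) = f j"
    "j < n \<Longrightarrow> (\<Sum>i<n. (if j = i then 1 else 0) * f i) = f j"
    "j < n \<Longrightarrow> (\<Sum>i<n. f i * (if i = j then 1 else 0)) = f j"
    "j < n \<Longrightarrow> (\<Sum>i<n. f i * (if j = i then 1 else 0)) = f j"
  by (simp_all add: if_distrib[of "\<lambda>x. x * _"] if_distrib[of "\<lambda>x. _ * x"] cong: if_cong)

lemma unitv_mult:
  fixes f :: "nat \<Rightarrow> 'f::comm_ring_1"
  shows "j < n \<Longrightarrow> (\<Sum>i<n. unitv j i * f i) = f j" "j < n \<Longrightarrow> (\<Sum>i<n. f i * unitv j i) = f j"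
  unfolding unitv_def by (simp_all only: delta_sum)

lemma sc_mul_unitv:
  assumes "i < n" "j < n" "l < n"
  shows "sc_mul n s (unitv i) (unitv j) l = s i j l"
  using assms by (simp add: sc_mul_def mult.assoc sum_distrib_left[symmetric] unitv_mult)

text \<open>The laws become finitely many polynomial equations in the constants. In this form they
  pass along a field homomorphism, whereas the vectors over the larger field are not images of
  vectors over the smaller one.\<close>

lemma sc_algebra_iff_constants:
  "sc_algebra n s u \<longleftrightarrow> u \<in> vecs n UNIV \<and>
     (\<forall>i<n. \<forall>j<n. \<forall>k<n. \<forall>l<n. (\<Sum>m<n. s i j m * s m k l) = (\<Sum>m<n. s j k m * s i m l)) \<and>
     (\<forall>j<n. \<forall>l<n. (\<Sum>i<n. u i * s i j l) = (if j = l then 1 else 0)) \<and>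
     (\<forall>j<n. \<forall>l<n. (\<Sum>i<n. u i * s j i l) = (if j = l then 1 else 0))" (is "_ \<longleftrightarrow> ?R")
proof
  assume A: "sc_algebra n s u"
  interpret sc_algebra n s u by fact
  have 1: "(\<Sum>m<n. s i j m * s m k l) = (\<Sum>m<n. s j k m * s i m l)" if "i < n" "j < n" "k < n" "l < n" for i j k l
  proof -
    have "(unitv i \<odot> unitv j \<odot> unitv k) l = (unitv i \<odot> (unitv j \<odot> unitv k)) l"
      using assoc that by simp
    moreover have "(unitv i \<odot> unitv j \<odot> unitv k) l = (\<Sum>m<n. (unitv i \<odot> unitv j) m * (\<Sum>k'<n. unitv k k' * s m k' l))"
      using that(4) by (simp add: sc_mul_def[of _ _ "unitv i \<odot> unitv j"] sum_distrib_left mult.assoc)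
    moreover have "(unitv i \<odot> (unitv j \<odot> unitv k)) l = (\<Sum>i'<n. unitv i i' * (\<Sum>m<n. (unitv j \<odot> unitv k) m * s i' m l))"
      using that(4) by (simp add: sc_mul_def[of _ _ "unitv i" "unitv j \<odot> unitv k"] sum_distrib_left mult.assoc)
    ultimately show ?thesis using that by (simp add: unitv_mult sc_mul_unitv)
  qed
  have 2: "(\<Sum>i<n. u i * s i j l) = (if j = l then 1 else 0)" if "j < n" "l < n" for j l
  proof -
    have "(u \<odot> unitv j) l = unitv j l" using unit_left[of "unitv j"] that by simp
    moreover have "(u \<odot> unitv j) l = (\<Sum>i<n. u i * (\<Sum>j'<n. unitv j j' * s i j' l))"
      using that by (simp add: sc_mul_def sum_distrib_left mult.assoc)
    ultimately show ?thesis using that by (simp add: unitv_mult) (simp add: unitv_def)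
  qed
  have 3: "(\<Sum>i<n. u i * s j i l) = (if j = l then 1 else 0)" if "j < n" "l < n" for j l
  proof -
    have "(unitv j \<odot> u) l = unitv j l" using unit_right[of "unitv j"] that by simp
    moreover have "(unitv j \<odot> u) l = (\<Sum>j'<n. unitv j j' * (\<Sum>i<n. u i * s j' i l))"
      using that by (simp add: sc_mul_def sum_distrib_left mult.assoc)
    ultimately show ?thesis using that by (simp add: unitv_mult) (simp add: unitv_def)
  qed
  show ?R using 1 2 3 u_vecs by blast
next
  assume R: ?R
  show "sc_algebra n s u"
  proof
    show "u \<in> vecs n UNIV" using R by blast
    fix v w x :: "nat \<Rightarrow> 'a" assume v: "v \<in> vecs n UNIV"
    have cong: "(\<Sum>i<n. \<Sum>j<n. \<Sum>k<n. v i * w j * x k * (\<Sum>m<n. s i j m * s m k l))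
        = (\<Sum>i<n. \<Sum>j<n. \<Sum>k<n. v i * w j * x k * (\<Sum>m<n. s j k m * s i m l))" if "l < n" for l
      by (rule sum.cong[OF refl], rule sum.cong[OF refl], rule sum.cong[OF refl]) (use R that in auto)
    show "sc_mul n s (sc_mul n s v w) x = sc_mul n s v (sc_mul n s w x)"
    proof
      fix l
      show "sc_mul n s (sc_mul n s v w) x l = sc_mul n s v (sc_mul n s w x) l"
      proof (cases "l < n")
        case l: True
        have "sc_mul n s (sc_mul n s v w) x l = (\<Sum>m<n. \<Sum>k<n. \<Sum>i<n. \<Sum>j<n. v i * w j * x k * (s i j m * s m k l))"
          using l by (simp add: sc_mul_def sum_distrib_left sum_distrib_right mult_ac)
        also have "\<dots> = (\<Sum>i<n. \<Sum>j<n. \<Sum>k<n. \<Sum>m<n. v i * w j * x k * (s i j m * s m k l))"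
          by (rule trans[OF sum_swap22]) (intro sum.cong refl sum.swap)
        also have "\<dots> = (\<Sum>i<n. \<Sum>j<n. \<Sum>k<n. \<Sum>m<n. v i * w j * x k * (s j k m * s i m l))"
          using cong[OF l] by (simp only: sum_distrib_left)
        also have "\<dots> = (\<Sum>i<n. \<Sum>m<n. \<Sum>j<n. \<Sum>k<n. v i * w j * x k * (s j k m * s i m l))"
          by (intro sum.cong refl sum_swap3[symmetric])
        also have "\<dots> = sc_mul n s v (sc_mul n s w x) l"
          using l by (simp add: sc_mul_def sum_distrib_left sum_distrib_right mult_ac)
        finally show ?thesis .
      qed (simp add: sc_mul_def)
    qed
    show "sc_mul n s u v = v"
    proof
      fix l
      show "sc_mul n s u v l = v l"
      proof (cases "l < n")
        case l: True
        have "sc_mul n s u v l = (\<Sum>j<n. v j * (\<Sum>i<n. u i * s i j l))"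
          using l unfolding sc_mul_def by (simp add: sum_distrib_left mult_ac) (rule sum.swap)
        also have "\<dots> = (\<Sum>j<n. v j * (if j = l then 1 else 0))" using R l by simp
        finally show ?thesis using l by (simp only: delta_sum)
      qed (use v in \<open>simp add: sc_mul_def vecs_def\<close>)
    qed
    show "sc_mul n s v u = v"
    proof
      fix l
      show "sc_mul n s v u l = v l"
      proof (cases "l < n")
        case l: True
        have "sc_mul n s v u l = (\<Sum>j<n. v j * (\<Sum>i<n. u i * s j i l))"
          using l unfolding sc_mul_def by (simp add: sum_distrib_left mult_ac)
        also have "\<dots> = (\<Sum>j<n. v j * (if j = l then 1 else 0))" using R l by simp
        finally show ?thesis using l by (simp only: delta_sum)
      qed (use v in \<open>simp add: sc_mul_def vecs_def\<close>)
    qed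
  qed
qed

text \<open>The inner sum is the trace of left multiplication by \<open>unitv l\<close>, so this is
  the trace form on two basis vectors, written as a polynomial in the structure constants
  alone.\<close>

definition gram :: "nat \<Rightarrow> (nat \<Rightarrow> nat \<Rightarrow> nat \<Rightarrow> 'f::comm_ring_1) \<Rightarrow> nat \<Rightarrow> nat \<Rightarrow> 'f" where
  "gram n s i j = (\<Sum>l<n. s i j l * (\<Sum>m<n. s l m m))"

context sc_algebra
begin

lemma tr_eq: "v \<in> V \<Longrightarrow> tr v = (\<Sum>l<n. v l * (\<Sum>m<n. s l m m))"
proof -
  have "tr v = (\<Sum>m<n. \<Sum>l<n. v l * s l m m)"
    unfolding sc_trace_def by (rule sum.cong) (auto simp: sc_mul_def mult.assoc unitv_mult sum_distrib_left[symmetric])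
  then show ?thesis by (subst (asm) sum.swap) (simp add: sum_distrib_left)
qed

lemma gram_eq:
  assumes "i < n" "j < n"
  shows "tr (unitv i \<odot> unitv j) = gram n s i j"
  using assms by (simp add: tr_eq gram_def sc_mul_unitv)

lemma nondegenerate_iff_gram:
  "nondegenerate \<longleftrightarrow> (\<forall>v\<in>V. (\<forall>i<n. (\<Sum>j<n. gram n s i j * v j) = 0) \<longrightarrow> v = 0)"
proof -
  have 1: "tr (unitv i \<odot> v) = (\<Sum>j<n. gram n s i j * v j)" if "v \<in> V" "i < n" for v i
  proof -
    have "tr (unitv i \<odot> v) = tr (unitv i \<odot> (\<Sum>j<n. vscale (v j) (unitv j)))"
      using vec_expansion[OF that(1)] by (rule arg_cong)
    then show ?thesis using that(2)
      by (simp add: sc_mul_sum_right sc_mul_scale_right sc_trace_sum sc_trace_scale mult.commute gram_eq)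
  qed
  have 2: "tr (w \<odot> v) = (\<Sum>j<n. w j * tr (unitv j \<odot> v))" if "w \<in> V" for v w
  proof -
    have "tr (w \<odot> v) = tr ((\<Sum>j<n. vscale (w j) (unitv j)) \<odot> v)"
      using arg_cong[OF vec_expansion[OF that], of "\<lambda>w. tr (w \<odot> v)"] .
    then show ?thesis
      by (simp add: sc_mul_sum_left sc_mul_scale_left sc_trace_sum sc_trace_scale)
  qed
  have "(\<forall>w\<in>V. tr (w \<odot> v) = 0) \<longleftrightarrow> (\<forall>i<n. (\<Sum>j<n. gram n s i j * v j) = 0)" if v: "v \<in> V" for v
  proof
    assume *: "\<forall>w\<in>V. tr (w \<odot> v) = 0"
    show "\<forall>i<n. (\<Sum>j<n. gram n s i j * v j) = 0"
      using * 1[OF v] unitv_V by (metis (no_types))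
  next
    assume "\<forall>i<n. (\<Sum>j<n. gram n s i j * v j) = 0"
    then have "tr (unitv i \<odot> v) = 0" if "i < n" for i using 1[OF v that] that by simp
    then show "\<forall>w\<in>V. tr (w \<odot> v) = 0" by (auto simp: 2 intro!: sum.neutral)
  qed
  then show ?thesis unfolding nondegenerate_def by blast
qed

end

lemma sc_algebra_hom:
  fixes h :: "'k::field \<Rightarrow> 'f::field"
  assumes "comm_ring_hom h" and A: "sc_algebra n s u"
  shows "sc_algebra n (\<lambda>i j l. h (s i j l)) (\<lambda>i. h (u i))"
proof -
  interpret h: comm_ring_hom h by fact
  have [simp]: "h (if b then 1 else 0) = (if b then 1 else 0)" for b by simp
  show ?thesis
    using A unfolding sc_algebra_iff_constants
    by (simp add: h.hom_mult[symmetric] h.hom_sum[symmetric] vecs_def)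
qed

text \<open>A kernel vector over the larger field cannot be pulled back. Instead, a left inverse of
  the Gram matrix is pushed forward, and it kills every kernel vector.\<close>

lemma nondegenerate_hom:
  fixes h :: "'k::field \<Rightarrow> 'f::field"
  assumes h: "comm_ring_hom h" and A: "sc_algebra n s u" and nd: "sc_algebra.nondegenerate n s"
  shows "sc_algebra.nondegenerate n (\<lambda>i j l. h (s i j l))"
proof -
  interpret h: comm_ring_hom h by fact
  interpret A: sc_algebra n s u by fact
  interpret B: sc_algebra n "\<lambda>i j l. h (s i j l)" "\<lambda>i. h (u i)" by (rule sc_algebra_hom[OF h A])
  obtain N where N: "\<And>i j. i < n \<Longrightarrow> j < n \<Longrightarrow> (\<Sum>m<n. N i m * gram n s m j) = (if i = j then 1 else 0)"
  proof (rule matrix_inverse_subfield_set[OF subfield_set_UNIV, of n "gram n s"])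
    show "v = 0" if "v \<in> vecs n UNIV" "\<And>i. i < n \<Longrightarrow> (\<Sum>j<n. gram n s i j * v j) = 0" for v
      using nd that unfolding A.nondegenerate_iff_gram by blast
  qed (use that in blast)+
  have g: "gram n (\<lambda>i j l. h (s i j l)) i j = h (gram n s i j)" for i j
    by (simp add: gram_def h.hom_sum h.hom_mult)
  show ?thesis unfolding B.nondegenerate_iff_gram
  proof (intro ballI impI)
    fix v :: "nat \<Rightarrow> 'f"
    assume v: "v \<in> vecs n UNIV" and 0: "\<forall>i<n. (\<Sum>j<n. gram n (\<lambda>i j l. h (s i j l)) i j * v j) = 0"
    have "v i = 0" if i: "i < n" for i
    proof -
      have "0 = (\<Sum>m<n. h (N i m) * (\<Sum>j<n. h (gram n s m j) * v j))" using 0 by (simp add: g)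
      also have "\<dots> = (\<Sum>j<n. \<Sum>m<n. h (N i m) * h (gram n s m j) * v j)"
        by (subst sum.swap) (simp add: sum_distrib_left mult.assoc)
      also have "\<dots> = (\<Sum>j<n. h (\<Sum>m<n. N i m * gram n s m j) * v j)"
        by (simp add: h.hom_sum h.hom_mult sum_distrib_right)
      also have "\<dots> = (\<Sum>j<n. (if i = j then 1 else 0) * v j)"
        using N[OF i] by (intro sum.cong refl) auto
      also have "\<dots> = v i" using i by (simp only: delta_sum)
      finally show ?thesis by simp
    qed
    then show "v = 0" using v vecs_zero[OF subfield_set_UNIV] by (intro vecs_eqI) auto
  qed
qed

text \<open>Change of basis: \<open>\<Theta>\<close> is the matrix of an algebra isomorphism with inverse \<open>\<Xi>\<close>.\<close>

lemma sc_algebra_transfer: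
  fixes s s' :: "nat \<Rightarrow> nat \<Rightarrow> nat \<Rightarrow> 'f::field"
  assumes A: "sc_algebra n s' u'"
    and inv1: "\<And>i j. i < n \<Longrightarrow> j < n \<Longrightarrow> (\<Sum>m<n. \<Theta> i m * \<Xi> m j) = (if i = j then 1 else 0)"
    and inv2: "\<And>i j. i < n \<Longrightarrow> j < n \<Longrightarrow> (\<Sum>m<n. \<Xi> i m * \<Theta> m j) = (if i = j then 1 else 0)"
    and hom: "\<And>i j l. i < n \<Longrightarrow> j < n \<Longrightarrow> l < n \<Longrightarrow>
      (\<Sum>p<n. s i j p * \<Theta> p l) = (\<Sum>p<n. \<Sum>q<n. \<Theta> i p * \<Theta> j q * s' p q l)"
    and u: "u \<in> vecs n UNIV" "\<And>l. l < n \<Longrightarrow> (\<Sum>i<n. u i * \<Theta> i l) = u' l"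
  shows "sc_algebra n s u" and "sc_algebra.nondegenerate n s' \<Longrightarrow> sc_algebra.nondegenerate n s"
proof -
  interpret A: sc_algebra n s' u' by fact
  \<comment> \<open>The matrices act on row vectors: row \<open>i\<close> of \<open>\<Theta>\<close>
    is the image of the basis vector \<open>unitv i\<close>.\<close>
  define \<theta> where "\<theta> v = (\<lambda>l. if l < n then \<Sum>i<n. v i * \<Theta> i l else 0)" for v
  define \<xi> where "\<xi> v = (\<lambda>l. if l < n then \<Sum>i<n. v i * \<Xi> i l else 0)" for v
  have V: "\<theta> v \<in> vecs n UNIV" "\<xi> v \<in> vecs n UNIV" "sc_mul n s v w \<in> vecs n UNIV" for v w
    by (auto simp: \<theta>_def \<xi>_def vecs_def sc_mul_def)
  have comp: "\<xi> (\<theta> v) = v" "\<theta> (\<xi> v) = v" if v: "v \<in> vecs n UNIV" for v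
  proof -
    have *: "(\<Sum>i<n. (\<Sum>j<n. v j * A j i) * B i l) = (\<Sum>j<n. v j * (\<Sum>i<n. A j i * B i l))"
      for A B :: "nat \<Rightarrow> nat \<Rightarrow> 'f" and l
      unfolding sum_distrib_left sum_distrib_right by (subst sum.swap) (simp add: mult.assoc)
    have "\<xi> (\<theta> v) l = v l" for l
    proof (cases "l < n")
      case True
      then have "\<xi> (\<theta> v) l = (\<Sum>j<n. v j * (\<Sum>i<n. \<Theta> j i * \<Xi> i l))" by (simp add: \<theta>_def \<xi>_def *)
      also have "\<dots> = (\<Sum>j<n. v j * (if j = l then 1 else 0))" using inv1 True by simp
      finally show ?thesis using True by (simp only: delta_sum)
    qed (use v in \<open>simp add: \<xi>_def vecs_def\<close>)
    then show "\<xi> (\<theta> v) = v" by blast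
    have "\<theta> (\<xi> v) l = v l" for l
    proof (cases "l < n")
      case True
      then have "\<theta> (\<xi> v) l = (\<Sum>j<n. v j * (\<Sum>i<n. \<Xi> j i * \<Theta> i l))" by (simp add: \<theta>_def \<xi>_def *)
      also have "\<dots> = (\<Sum>j<n. v j * (if j = l then 1 else 0))" using inv2 True by simp
      finally show ?thesis using True by (simp only: delta_sum)
    qed (use v in \<open>simp add: \<theta>_def vecs_def\<close>)
    then show "\<theta> (\<xi> v) = v" by blast
  qed
  have mul: "\<theta> (sc_mul n s v w) = sc_mul n s' (\<theta> v) (\<theta> w)" for v w
  proof
    fix l
    show "\<theta> (sc_mul n s v w) l = sc_mul n s' (\<theta> v) (\<theta> w) l"
    proof (cases "l < n")
      case l: True
      have "\<theta> (sc_mul n s v w) l = (\<Sum>p<n. \<Sum>i<n. \<Sum>j<n. v i * w j * (s i j p * \<Theta> p l))"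
        using l by (simp add: \<theta>_def sc_mul_def sum_distrib_right mult.assoc)
      also have "\<dots> = (\<Sum>i<n. \<Sum>j<n. \<Sum>p<n. v i * w j * (s i j p * \<Theta> p l))"
        by (rule sum_swap3)
      also have "\<dots> = (\<Sum>i<n. \<Sum>j<n. v i * w j * (\<Sum>p<n. \<Sum>q<n. \<Theta> i p * \<Theta> j q * s' p q l))"
        by (rule sum.cong[OF refl], rule sum.cong[OF refl])
          (use hom l in \<open>simp add: sum_distrib_left[symmetric]\<close>)
      also have "\<dots> = (\<Sum>i<n. \<Sum>j<n. \<Sum>p<n. \<Sum>q<n. v i * w j * (\<Theta> i p * \<Theta> j q * s' p q l))"
        by (simp only: sum_distrib_left)
      also have "\<dots> = (\<Sum>p<n. \<Sum>q<n. \<Sum>i<n. \<Sum>j<n. v i * w j * (\<Theta> i p * \<Theta> j q * s' p q l))"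
        by (rule sum_swap22)
      also have "\<dots> = sc_mul n s' (\<theta> v) (\<theta> w) l"
      proof -
        have "(\<Sum>i<n. \<Sum>j<n. v i * w j * (\<Theta> i p * \<Theta> j q * s' p q l)) =
            (\<Sum>i<n. v i * \<Theta> i p) * (\<Sum>j<n. w j * \<Theta> j q) * s' p q l" for p q
          unfolding sum_product unfolding sum_distrib_right by (intro sum.cong refl) (simp only: mult_ac)
        then show ?thesis using l by (simp add: \<theta>_def sc_mul_def)
      qed
      finally show ?thesis .
    qed (simp add: \<theta>_def sc_mul_def)
  qed
  \<comment> \<open>Through this injectivity each law of the new algebra is read off from the same
    law for \<open>s'\<close>; in particular its associativity needs no separate
    computation.\<close>
  have inj: "v = w" if "\<theta> v = \<theta> w" "v \<in> vecs n UNIV" "w \<in> vecs n UNIV" for v w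
    using that comp(1) by metis
  have \<theta>u: "\<theta> u = u'"
    by (rule vecs_eqI[OF V(1) A.u_vecs]) (use u in \<open>simp add: \<theta>_def\<close>)
  show sc: "sc_algebra n s u"
  proof
    show "u \<in> vecs n UNIV" by fact
    fix v w x :: "nat \<Rightarrow> 'f" assume v: "v \<in> vecs n UNIV"
    show "sc_mul n s (sc_mul n s v w) x = sc_mul n s v (sc_mul n s w x)"
      by (rule inj) (simp_all add: mul V A.assoc)
    show "sc_mul n s u v = v"
      by (rule inj) (simp_all add: mul V v \<theta>u A.unit_left)
    show "sc_mul n s v u = v"
      by (rule inj) (simp_all add: mul V v \<theta>u A.unit_right)
  qed
  assume nd: "sc_algebra.nondegenerate n s'"
  interpret B: sc_algebra n s u by fact
  \<comment> \<open>Left multiplications by corresponding elements are conjugate under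
    \<open>\<theta>\<close>, so their traces agree.\<close>
  have tr: "B.tr v = A.tr (\<theta> v)" if v: "v \<in> vecs n UNIV" for v
  proof -
    have "B.tr v = (\<Sum>i<n. \<xi> (sc_mul n s' (\<theta> v) (\<theta> (unitv i))) i)"
      unfolding sc_trace_def mul[symmetric] by (simp add: comp V)
    also have "\<dots> = (\<Sum>i<n. \<Sum>l<n. \<Sum>m<n. \<Theta> i m * sc_mul n s' (\<theta> v) (unitv m) l * \<Xi> l i)"
    proof (rule sum.cong[OF refl])
      fix i assume "i \<in> {..<n}"
      then have i: "i < n" by simp
      have "\<theta> (unitv i) m = \<Theta> i m" if "m < n" for m
        using i that by (simp add: \<theta>_def unitv_mult)
      then have "\<theta> (unitv i) = (\<Sum>m<n. vscale (\<Theta> i m) (unitv m))"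
        using vec_expansion[OF V(1), of "unitv i"] by simp
      then have "sc_mul n s' (\<theta> v) (\<theta> (unitv i)) = (\<Sum>m<n. vscale (\<Theta> i m) (sc_mul n s' (\<theta> v) (unitv m)))"
        by (simp add: sc_mul_sum_right sc_mul_scale_right)
      then show "\<xi> (sc_mul n s' (\<theta> v) (\<theta> (unitv i))) i = (\<Sum>l<n. \<Sum>m<n. \<Theta> i m * sc_mul n s' (\<theta> v) (unitv m) l * \<Xi> l i)"
        using i by (simp add: \<xi>_def sum_fun_apply sum_distrib_right vscale_def)
    qed
    also have "\<dots> = (\<Sum>l<n. \<Sum>m<n. \<Sum>i<n. \<Theta> i m * sc_mul n s' (\<theta> v) (unitv m) l * \<Xi> l i)"
      by (rule sum_swap3)
    also have "\<dots> = (\<Sum>l<n. \<Sum>m<n. (\<Sum>i<n. \<Xi> l i * \<Theta> i m) * sc_mul n s' (\<theta> v) (unitv m) l)"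
      unfolding sum_distrib_right by (intro sum.cong refl) (simp only: mult_ac)
    also have "\<dots> = (\<Sum>l<n. \<Sum>m<n. (if l = m then 1 else 0) * sc_mul n s' (\<theta> v) (unitv m) l)"
      using inv2 by (intro sum.cong refl) auto
    also have "\<dots> = A.tr (\<theta> v)"
      unfolding sc_trace_def by (intro sum.cong refl) (simp only: delta_sum lessThan_iff)
    finally show ?thesis .
  qed
  show "sc_algebra.nondegenerate n s"
    unfolding B.nondegenerate_def
  proof (intro ballI impI)
    fix v :: "nat \<Rightarrow> 'f" assume v: "v \<in> vecs n UNIV" and 0: "\<forall>w\<in>vecs n UNIV. B.tr (sc_mul n s w v) = 0"
    have "A.tr (sc_mul n s' w (\<theta> v)) = 0" if "w \<in> vecs n UNIV" for w
      using 0[rule_format, of "\<xi> w"] tr[OF V(3), of "\<xi> w" v] by (simp add: V mul comp that)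
    then have "\<theta> v = 0" using nd V(1) unfolding A.nondegenerate_def by blast
    moreover have "\<theta> 0 = 0" by (auto simp: \<theta>_def)
    ultimately show "v = 0" by (intro inj[OF _ v vecs_zero[OF subfield_set_UNIV]]) (simp only:)
  qed
qed

text \<open>A coalgebra in a basis: \<open>c i j k\<close> is the coefficient of the tensor of the
  basis vectors \<open>j\<close> and \<open>k\<close> in the coproduct of the basis vector
  \<open>i\<close>. The index type is arbitrary because the tensor square, indexed by pairs, is an
  instance as well.\<close>

locale coalgebra_constants =
  fixes I :: "'i set" and c :: "'i \<Rightarrow> 'i \<Rightarrow> 'i \<Rightarrow> 'f::comm_ring_1" and eps :: "'i \<Rightarrow> 'f"
  assumes fin: "finite I"
    and coassoc: "\<And>i p q m. i \<in> I \<Longrightarrow> p \<in> I \<Longrightarrow> q \<in> I \<Longrightarrow> m \<in> I \<Longrightarrow>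
      (\<Sum>j\<in>I. c i j m * c j p q) = (\<Sum>j\<in>I. c i p j * c j q m)"
    and counit_left: "\<And>i m. i \<in> I \<Longrightarrow> m \<in> I \<Longrightarrow> (\<Sum>j\<in>I. c i j m * eps j) = (if i = m then 1 else 0)"
    and counit_right: "\<And>i m. i \<in> I \<Longrightarrow> m \<in> I \<Longrightarrow> (\<Sum>j\<in>I. c i m j * eps j) = (if i = m then 1 else 0)"
begin

definition conv :: "('i \<Rightarrow> 'f) \<Rightarrow> ('i \<Rightarrow> 'f) \<Rightarrow> 'i \<Rightarrow> 'f" (infixl "\<star>" 70) where
  "(f \<star> g) i = (\<Sum>j\<in>I. \<Sum>k\<in>I. c i j k * f j * g k)"

lemma conv_cong: "(\<And>j. j \<in> I \<Longrightarrow> f j = f' j) \<Longrightarrow> (\<And>j. j \<in> I \<Longrightarrow> g j = g' j) \<Longrightarrow> (f \<star> g) i = (f' \<star> g') i"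
  by (simp add: conv_def)

lemma conv_assoc:
  assumes i: "i \<in> I"
  shows "((f \<star> g) \<star> h) i = (f \<star> (g \<star> h)) i"
proof -
  have "((f \<star> g) \<star> h) i = (\<Sum>j\<in>I. \<Sum>m\<in>I. \<Sum>p\<in>I. \<Sum>q\<in>I. f p * g q * h m * (c i j m * c j p q))"
    by (simp add: conv_def sum_distrib_left sum_distrib_right mult_ac)
  also have "\<dots> = (\<Sum>m\<in>I. \<Sum>p\<in>I. \<Sum>j\<in>I. \<Sum>q\<in>I. f p * g q * h m * (c i j m * c j p q))"
    by (subst sum.swap) (intro sum.cong refl sum.swap)
  also have "\<dots> = (\<Sum>m\<in>I. \<Sum>p\<in>I. \<Sum>q\<in>I. \<Sum>j\<in>I. f p * g q * h m * (c i j m * c j p q))"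
    by (intro sum.cong refl sum.swap)
  also have "\<dots> = (\<Sum>m\<in>I. \<Sum>p\<in>I. \<Sum>q\<in>I. f p * g q * h m * (\<Sum>j\<in>I. c i p j * c j q m))"
    using coassoc[OF i] by (intro sum.cong refl) (simp add: sum_distrib_left[symmetric])
  also have "\<dots> = (\<Sum>p\<in>I. \<Sum>m\<in>I. \<Sum>q\<in>I. \<Sum>j\<in>I. f p * g q * h m * (c i p j * c j q m))"
    by (subst sum.swap) (simp only: sum_distrib_left)
  also have "\<dots> = (\<Sum>p\<in>I. \<Sum>m\<in>I. \<Sum>j\<in>I. \<Sum>q\<in>I. f p * g q * h m * (c i p j * c j q m))"
    by (intro sum.cong refl sum.swap)
  also have "\<dots> = (\<Sum>p\<in>I. \<Sum>j\<in>I. \<Sum>m\<in>I. \<Sum>q\<in>I. f p * g q * h m * (c i p j * c j q m))"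
    by (intro sum.cong refl sum.swap)
  also have "\<dots> = (\<Sum>p\<in>I. \<Sum>j\<in>I. \<Sum>q\<in>I. \<Sum>m\<in>I. f p * g q * h m * (c i p j * c j q m))"
    by (intro sum.cong refl sum.swap)
  also have "\<dots> = (f \<star> (g \<star> h)) i"
    by (simp add: conv_def sum_distrib_left sum_distrib_right mult_ac)
  finally show ?thesis .
qed

lemma conv_eps_right: "i \<in> I \<Longrightarrow> (f \<star> eps) i = f i"
proof -
  assume i: "i \<in> I"
  have "(f \<star> eps) i = (\<Sum>j\<in>I. (\<Sum>k\<in>I. c i j k * eps k) * f j)"
    by (simp add: conv_def sum_distrib_left mult_ac)
  also have "\<dots> = (\<Sum>j\<in>I. if i = j then f j else 0)"
    by (rule sum.cong) (auto simp: counit_right i)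
  finally show ?thesis using i fin by simp
qed

lemma conv_eps_left: "i \<in> I \<Longrightarrow> (eps \<star> f) i = f i"
proof -
  assume i: "i \<in> I"
  have "(eps \<star> f) i = (\<Sum>k\<in>I. (\<Sum>j\<in>I. c i j k * eps j) * f k)"
    unfolding conv_def by (subst sum.swap) (simp add: sum_distrib_right)
  also have "\<dots> = (\<Sum>k\<in>I. if i = k then f k else 0)"
    by (rule sum.cong) (auto simp: counit_left i)
  finally show ?thesis using i fin by simp
qed

end


section \<open>Convolution on the tensor square and the gauge transformation\<close>

locale hopf_constants = coalgebra_constants "{..<n}" c eps
  for n :: nat and c :: "nat \<Rightarrow> nat \<Rightarrow> nat \<Rightarrow> 'f::field" and eps :: "nat \<Rightarrow> 'f" +
  fixes \<mu> :: "nat \<Rightarrow> nat \<Rightarrow> nat \<Rightarrow> 'f"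
  assumes comult_mult: "\<And>i j p q. i < n \<Longrightarrow> j < n \<Longrightarrow> p < n \<Longrightarrow> q < n \<Longrightarrow>
      (\<Sum>l<n. \<mu> i j l * c l p q) =
      (\<Sum>a<n. \<Sum>a'<n. \<Sum>b<n. \<Sum>b'<n. c i a b * c j a' b' * \<mu> a a' p * \<mu> b b' q)"
    and counit_mult: "\<And>i j. i < n \<Longrightarrow> j < n \<Longrightarrow> (\<Sum>l<n. \<mu> i j l * eps l) = eps i * eps j"
begin

abbreviation "cc \<equiv> \<lambda>i j k. c (fst i) (fst j) (fst k) * c (snd i) (snd j) (snd k)"
abbreviation "eeps \<equiv> \<lambda>i. eps (fst i) * eps (snd i)"
abbreviation "sq \<equiv> {..<n} \<times> {..<n}"

lemma sum_sq: "(\<Sum>i\<in>sq. f i) = (\<Sum>a<n. \<Sum>b<n. f (a, b))"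
  by (simp add: sum.cartesian_product split_beta)

lemma sum_sq_product: "(\<Sum>i\<in>sq. f (fst i) * g (snd i)) = (\<Sum>a<n. f a) * (\<Sum>b<n. g b :: 'f)"
  by (simp add: sum_sq sum_product)

text \<open>The tensor product coalgebra H tensor H. Bilinear forms on H are functions on
  \<open>sq\<close>, and their convolution is the one of this coalgebra; its axioms are products of
  those for H.\<close>

sublocale pair: coalgebra_constants sq cc eeps
proof
  show "(\<Sum>j\<in>sq. cc i j m * cc j p q) = (\<Sum>j\<in>sq. cc i p j * cc j q m)"
    if "i \<in> sq" "p \<in> sq" "q \<in> sq" "m \<in> sq" for i p q m
  proof -
    have "(\<Sum>j\<in>sq. cc i j m * cc j p q) = (\<Sum>j<n. c (fst i) j (fst m) * c j (fst p) (fst q)) *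
      (\<Sum>j<n. c (snd i) j (snd m) * c j (snd p) (snd q))"
      unfolding sum_sq_product[symmetric] by (simp only: mult_ac)
    also have "\<dots> = (\<Sum>j<n. c (fst i) (fst p) j * c j (fst q) (fst m)) *
      (\<Sum>j<n. c (snd i) (snd p) j * c j (snd q) (snd m))"
      using coassoc[of "fst i" "fst p" "fst q" "fst m"] coassoc[of "snd i" "snd p" "snd q" "snd m"] that by auto
    also have "\<dots> = (\<Sum>j\<in>sq. cc i p j * cc j q m)"
      unfolding sum_sq_product[symmetric] by (simp only: mult_ac)
    finally show ?thesis .
  qed
  show "(\<Sum>j\<in>sq. cc i j m * eeps j) = (if i = m then 1 else 0)" if "i \<in> sq" "m \<in> sq" for i m
  proof -
    have "(\<Sum>j\<in>sq. cc i j m * eeps j) = (\<Sum>j<n. c (fst i) j (fst m) * eps j) * (\<Sum>j<n. c (snd i) j (snd m) * eps j)"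
      unfolding sum_sq_product[symmetric] by (simp only: mult_ac)
    then show ?thesis using that counit_left[of "fst i" "fst m"] counit_left[of "snd i" "snd m"] by (auto simp: prod_eq_iff)
  qed
  show "(\<Sum>j\<in>sq. cc i m j * eeps j) = (if i = m then 1 else 0)" if "i \<in> sq" "m \<in> sq" for i m
  proof -
    have "(\<Sum>j\<in>sq. cc i m j * eeps j) = (\<Sum>j<n. c (fst i) (fst m) j * eps j) * (\<Sum>j<n. c (snd i) (snd m) j * eps j)"
      unfolding sum_sq_product[symmetric] by (simp only: mult_ac)
    then show ?thesis using that counit_right[of "fst i" "fst m"] counit_right[of "snd i" "snd m"] by (auto simp: prod_eq_iff)
  qed
qed simp

notation conv (infixl "\<star>" 70)
notation pair.conv (infixl "\<star>\<star>" 70)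

text \<open>Composition of a linear form with the multiplication: the bilinear form with value f(xy)
  at (x, y), on basis vectors.\<close>

definition pull :: "(nat \<Rightarrow> 'f) \<Rightarrow> nat \<times> nat \<Rightarrow> 'f" where
  "pull f i = (\<Sum>l<n. \<mu> (fst i) (snd i) l * f l)"

definition tensor :: "(nat \<Rightarrow> 'f) \<Rightarrow> nat \<times> nat \<Rightarrow> 'f" where
  "tensor f i = f (fst i) * f (snd i)"

text \<open>Multiplication is a coalgebra map from H tensor H to H, so composing with it respects
  convolution. In coordinates this is \<open>comult_mult\<close> followed by reordering of
  sums.\<close>

lemma pull_conv:
  assumes "i \<in> sq"
  shows "(pull f \<star>\<star> pull g) i = pull (f \<star> g) i"
proof -
  obtain i1 i2 where i: "i = (i1, i2)" "i1 < n" "i2 < n" using assms by auto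
  have "pull (f \<star> g) i = (\<Sum>l<n. \<Sum>p<n. \<Sum>q<n. f p * g q * (\<mu> i1 i2 l * c l p q))"
    by (simp add: pull_def conv_def i sum_distrib_left mult_ac)
  also have "\<dots> = (\<Sum>p<n. \<Sum>q<n. \<Sum>l<n. f p * g q * (\<mu> i1 i2 l * c l p q))" by (rule sum_swap3)
  also have "\<dots> = (\<Sum>p<n. \<Sum>q<n. f p * g q *
      (\<Sum>a<n. \<Sum>a'<n. \<Sum>b<n. \<Sum>b'<n. c i1 a b * c i2 a' b' * \<mu> a a' p * \<mu> b b' q))"
    by (rule sum.cong[OF refl], rule sum.cong[OF refl])
      (use i comult_mult in \<open>simp add: sum_distrib_left[symmetric]\<close>)
  also have "\<dots> = (\<Sum>p<n. \<Sum>q<n. \<Sum>a<n. \<Sum>a'<n. \<Sum>b<n. \<Sum>b'<n.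
      f p * g q * (c i1 a b * c i2 a' b' * \<mu> a a' p * \<mu> b b' q))"
    by (simp only: sum_distrib_left)
  also have "\<dots> = (\<Sum>a<n. \<Sum>a'<n. \<Sum>p<n. \<Sum>q<n. \<Sum>b<n. \<Sum>b'<n.
      f p * g q * (c i1 a b * c i2 a' b' * \<mu> a a' p * \<mu> b b' q))"
    by (rule sum_swap22)
  also have "\<dots> = (\<Sum>a<n. \<Sum>a'<n. \<Sum>b<n. \<Sum>b'<n. \<Sum>p<n. \<Sum>q<n.
      f p * g q * (c i1 a b * c i2 a' b' * \<mu> a a' p * \<mu> b b' q))"
    by (intro sum.cong refl sum_swap22)
  also have "\<dots> = (\<Sum>a<n. \<Sum>a'<n. \<Sum>b<n. \<Sum>b'<n.
      (c i1 a b * c i2 a' b') * (\<Sum>p<n. \<mu> a a' p * f p) * (\<Sum>q<n. \<mu> b b' q * g q))"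
    unfolding mult.assoc sum_product unfolding sum_distrib_left
    by (intro sum.cong refl) (simp only: mult_ac)
  also have "\<dots> = (pull f \<star>\<star> pull g) i"
    by (simp add: pair.conv_def sum_sq pull_def i)
  finally show ?thesis by simp
qed

lemma pull_eps: "i \<in> sq \<Longrightarrow> pull eps i = eeps i"
  using counit_mult by (auto simp: pull_def)

context
  fixes t t' :: "nat \<Rightarrow> 'f" and \<alpha> \<sigma> :: "nat \<times> nat \<Rightarrow> 'f"
  assumes t_inv: "\<And>i. i < n \<Longrightarrow> (t' \<star> t) i = eps i"
    and \<sigma>: "\<And>i. i \<in> sq \<Longrightarrow> \<sigma> i = (tensor t \<star>\<star> (\<alpha> \<star>\<star> pull t')) i"
begin

text \<open>Convolving on the right with \<open>pull t\<close> cancels \<open>pull t'\<close>, since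
  \<open>t'\<close> is a left inverse of \<open>t\<close> and \<open>pull\<close> respects
  convolution. The result is the relation that makes the two cocycles cohomologous.\<close>

lemma sigma_coboundary:
  assumes i: "i \<in> sq"
  shows "(\<sigma> \<star>\<star> pull t) i = (tensor t \<star>\<star> \<alpha>) i"
proof -
  have "(\<sigma> \<star>\<star> pull t) i = ((tensor t \<star>\<star> (\<alpha> \<star>\<star> pull t')) \<star>\<star> pull t) i"
    by (rule pair.conv_cong) (auto simp: \<sigma>)
  also have "\<dots> = (tensor t \<star>\<star> ((\<alpha> \<star>\<star> pull t') \<star>\<star> pull t)) i" by (rule pair.conv_assoc[OF i])
  also have "\<dots> = (tensor t \<star>\<star> \<alpha>) i"
  proof (rule pair.conv_cong[OF refl])
    fix j assume j: "j \<in> sq"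
    have "((\<alpha> \<star>\<star> pull t') \<star>\<star> pull t) j = (\<alpha> \<star>\<star> (pull t' \<star>\<star> pull t)) j" by (rule pair.conv_assoc[OF j])
    also have "\<dots> = (\<alpha> \<star>\<star> eeps) j"
    proof (rule pair.conv_cong[OF refl])
      fix k assume k: "k \<in> sq"
      have "pull (t' \<star> t) k = pull eps k" unfolding pull_def using t_inv by simp
      then show "(pull t' \<star>\<star> pull t) k = eeps k" using pull_conv[OF k] pull_eps[OF k] by simp
    qed
    also have "\<dots> = \<alpha> j" by (rule pair.conv_eps_right[OF j])
    finally show "((\<alpha> \<star>\<star> pull t') \<star>\<star> pull t) j = \<alpha> j" .
  qed
  finally show ?thesis .
qed

text \<open>The gauge transformation \<open>x \<mapsto> \<Sum> t(x\<^sub>1) \<otimes> x\<^sub>2\<close> is multiplicative from the \<open>\<sigma>\<close>-twisted to the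
  \<open>\<alpha>\<close>-twisted algebra.\<close>

lemma gauge_multiplicative:
  assumes "i < n" "j < n" "l < n"
  shows "(\<Sum>p<n. (\<sigma> \<star>\<star> (\<lambda>k. \<mu> (fst k) (snd k) p)) (i, j) * (t \<star> unitv l) p) =
    (\<Sum>p<n. \<Sum>q<n. (t \<star> unitv p) i * (t \<star> unitv q) j * (\<alpha> \<star>\<star> (\<lambda>k. \<mu> (fst k) (snd k) l)) (p, q))"
proof -
  let ?m = "\<lambda>p k. \<mu> (fst k) (snd k) p"
  have ij: "(i, j) \<in> sq" using assms by simp
  have pull_unitv: "pull (unitv l) k = ?m l k" for k
    using assms by (simp add: pull_def unitv_mult)
  \<comment> \<open>The coordinate \<open>p\<close> of a product is \<open>?m p\<close>, so summing
    against the values of a form \<open>g\<close> turns the family \<open>?m p\<close> into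
    \<open>pull g\<close>. From here on only associativity and \<open>sigma_coboundary\<close> are
    used, until the last factor is expanded again.\<close>
  have "(\<Sum>p<n. (\<sigma> \<star>\<star> ?m p) (i, j) * (t \<star> unitv l) p) = (\<sigma> \<star>\<star> pull (t \<star> unitv l)) (i, j)"
    unfolding pair.conv_def pull_def sum_distrib_left sum_distrib_right
    by (rule trans[OF sum_swap3]) (simp only: mult_ac)
  also have "\<dots> = (\<sigma> \<star>\<star> (pull t \<star>\<star> ?m l)) (i, j)"
    by (rule pair.conv_cong[OF refl]) (simp add: pull_conv[symmetric] pull_unitv[abs_def, symmetric])
  also have "\<dots> = ((\<sigma> \<star>\<star> pull t) \<star>\<star> ?m l) (i, j)" by (rule pair.conv_assoc[OF ij, symmetric])
  also have "\<dots> = ((tensor t \<star>\<star> \<alpha>) \<star>\<star> ?m l) (i, j)"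
    by (rule pair.conv_cong[OF sigma_coboundary refl])
  also have "\<dots> = (tensor t \<star>\<star> (\<alpha> \<star>\<star> ?m l)) (i, j)" by (rule pair.conv_assoc[OF ij])
  also have "\<dots> = (\<Sum>a<n. \<Sum>b<n. \<Sum>p<n. \<Sum>q<n. (c i a p * t a) * (c j b q * t b) * (\<alpha> \<star>\<star> ?m l) (p, q))"
    unfolding pair.conv_def[of "tensor t"] sum_sq tensor_def fst_conv snd_conv
    by (intro sum.cong refl) (simp only: mult_ac)
  also have "\<dots> = (\<Sum>p<n. \<Sum>q<n. \<Sum>a<n. \<Sum>b<n. (c i a p * t a) * (c j b q * t b) * (\<alpha> \<star>\<star> ?m l) (p, q))"
    by (rule sum_swap22)
  also have "\<dots> = (\<Sum>p<n. \<Sum>q<n. (\<Sum>a<n. c i a p * t a) * (\<Sum>b<n. c j b q * t b) * (\<alpha> \<star>\<star> ?m l) (p, q))"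
    unfolding sum_product unfolding sum_distrib_right by simp
  also have "\<dots> = (\<Sum>p<n. \<Sum>q<n. (t \<star> unitv p) i * (t \<star> unitv q) j * (\<alpha> \<star>\<star> ?m l) (p, q))"
  proof -
    have "(t \<star> unitv p) i = (\<Sum>a<n. c i a p * t a)" if "p < n" for p i
      using that by (simp add: conv_def unitv_mult)
    then show ?thesis by simp
  qed
  finally show ?thesis .
qed

end

end

section \<open>Coordinates on a finite-dimensional Hopf algebra\<close>

lemma type_algebra_simps [simp]:
  "carrier (type_algebra scale) = UNIV"
  "x \<oplus>\<^bsub>type_algebra scale\<^esub> y = x + y"
  "x \<otimes>\<^bsub>type_algebra scale\<^esub> y = x * y"
  "\<zero>\<^bsub>type_algebra scale\<^esub> = 0"
  "\<one>\<^bsub>type_algebra scale\<^esub> = 1"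
  "c \<odot>\<^bsub>type_algebra scale\<^esub> x = scale c x"
  by (simp_all add: type_algebra_def)

lemma abelian_group_type_algebra: "abelian_group (type_algebra scale)"
proof (rule abelian_groupI)
  show "\<exists>y\<in>carrier (type_algebra scale). y \<oplus>\<^bsub>type_algebra scale\<^esub> x = \<zero>\<^bsub>type_algebra scale\<^esub>" for x
    by (rule bexI[of _ "- x"]) auto
qed (auto simp: add_ac)

lemma tensor_algebra_simps [simp]:
  "carrier (tensor_algebra R M N) = carrier (tensor_additive R M N)"
  "U \<oplus>\<^bsub>tensor_algebra R M N\<^esub> V = U \<oplus>\<^bsub>tensor_additive R M N\<^esub> V"
  "\<zero>\<^bsub>tensor_algebra R M N\<^esub> = \<zero>\<^bsub>tensor_additive R M N\<^esub>"
  "\<one>\<^bsub>tensor_algebra R M N\<^esub> = pure_tensor R M N \<one>\<^bsub>M\<^esub> \<one>\<^bsub>N\<^esub>"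
  by (simp_all add: tensor_algebra_def Let_def)

lemma joint_embedding_cong:
  assumes "joint_embedding W \<chi>" "carrier W' = carrier W" "add W' = add W" "\<zero>\<^bsub>W'\<^esub> = \<zero>\<^bsub>W\<^esub>"
  shows "joint_embedding W' \<chi>"
  using assms abelian_group_cong[of W W'] by (simp add: joint_embedding_def)

context free_tensor
begin

lemma coord_emb_algebra: "joint_embedding (tensor_algebra R M N) coord"
  by (rule joint_embedding_cong[OF coord_emb]) (simp_all add: tensor_algebra_def Let_def)

lemma smult_tensor_algebra:
  assumes r: "r \<in> carrier R" and U: "U \<in> carrier T"
  shows "r \<odot>\<^bsub>tensor_algebra R M N\<^esub> U \<in> carrier T"
    and "coord (r \<odot>\<^bsub>tensor_algebra R M N\<^esub> U) i = \<rho> r * coord U i"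
proof -
  have eq: "r \<odot>\<^bsub>tensor_algebra R M N\<^esub> U = tensor_lift T (\<lambda>m n. tens (r \<odot>\<^bsub>M\<^esub> m) n) U"
    by (simp add: tensor_algebra_def Let_def)
  note * = lift_linear[OF coord_emb, of "\<lambda>m n. tens (r \<odot>\<^bsub>M\<^esub> m) n" "\<lambda>i v. \<rho> r * v i", OF _ _ _ U]
  show "r \<odot>\<^bsub>tensor_algebra R M N\<^esub> U \<in> carrier T" unfolding eq
    by (rule *) (auto simp: coord_pure phi_smult M_smult r tens_closed algebra_simps)
  show "coord (r \<odot>\<^bsub>tensor_algebra R M N\<^esub> U) i = \<rho> r * coord U i" unfolding eq
    by (rule *) (auto simp: coord_pure phi_smult M_smult r tens_closed algebra_simps)
qed

end

section \<open>A basis of the Hopf algebra and coordinates of its operations\<close>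

locale fd_hopf = hopf_algebra scale \<Delta> \<epsilon> antipode + symmetric_coordinates scale n e crd
  for scale :: "'k::field \<Rightarrow> 'h::ring_1 \<Rightarrow> 'h" and \<Delta> \<epsilon> antipode n e crd +
  assumes crd_e: "\<And>i j. j < n \<Longrightarrow> crd i (e j) = (if i = j then 1 else 0)"
    and crd_outside: "\<And>i x. n \<le> i \<Longrightarrow> crd i x = 0"
begin

lemma type_algebra_embedding:
  fixes h :: "'k \<Rightarrow> 'f::field"
  assumes h: "comm_ring_hom h"
  shows "joint_embedding (type_algebra scale) (\<lambda>x i. h (crd i x))"
proof -
  interpret h: comm_ring_hom h by fact
  have hinj: "h a = h b \<Longrightarrow> a = b" for a b
  proof -
    assume "h a = h b"
    then have 0: "h (a - b) = 0" by (simp add: h.hom_minus)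
    show "a = b"
    proof (rule ccontr)
      assume "a \<noteq> b"
      then have "h ((a - b) * inverse (a - b)) = 1" by simp
      then show False using 0 unfolding h.hom_mult by simp
    qed
  qed
  have "x = y" if "\<And>i. h (crd i x) = h (crd i y)" for x y
    using crd_expansion[of x] crd_expansion[of y] hinj[OF that] by simp
  then show ?thesis
    by (auto simp: joint_embedding_def abelian_group_type_algebra crd_add h.hom_add)
qed

lemma id_hom: "comm_ring_hom (\<lambda>x::'k. x)"
  by unfold_locales auto

lemma scale_closed: "tensor_pair ring_of_type_algebra (type_algebra scale) (type_algebra scale)"
  by (rule tensor_pair.intro) (auto intro: abelian_group_type_algebra)

sublocale H2: free_tensor ring_of_type_algebra "type_algebra scale" "type_algebra scale"
  "\<lambda>x. x" "\<lambda>x i. crd i x" "\<lambda>x i. crd i x" "{..<n}" e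
proof (intro free_tensor.intro free_tensor_axioms.intro scale_closed)
  show "joint_embedding (type_algebra scale) (\<lambda>x i. crd i x)"
    by (rule type_algebra_embedding[OF id_hom])
  show "joint_embedding (type_algebra scale) (\<lambda>x i. crd i x)"
    by (rule type_algebra_embedding[OF id_hom])
qed (auto simp: crd_scale crd_outside crd_e)

lemma square_pair: "tensor_pair ring_of_type_algebra (type_algebra scale) (tensor_square scale)"
proof (rule tensor_pair.intro)
  show "abelian_group (tensor_square scale)" using H2.coord_emb_algebra by (simp add: joint_embedding_def)
qed (auto intro: abelian_group_type_algebra simp: H2.smult_tensor_algebra)

text \<open>Coassociativity is stated in H tensor (H tensor H); this instance gives it coordinates
  indexed by nested pairs, with the tensor square in the role of the free factor.\<close>

sublocale H3: free_tensor ring_of_type_algebra "type_algebra scale" "tensor_square scale"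
  "\<lambda>x. x" "\<lambda>x i. crd i x" H2.coord "{..<n} \<times> {..<n}" "\<lambda>i. pure2 scale (e (fst i)) (e (snd i))"
proof (intro free_tensor.intro free_tensor_axioms.intro square_pair)
  show "joint_embedding (type_algebra scale) (\<lambda>x i. crd i x)"
    by (rule type_algebra_embedding[OF id_hom])
  show "joint_embedding (tensor_square scale) H2.coord" by (rule H2.coord_emb_algebra)
  show "H2.coord U l = 0" if "U \<in> carrier (tensor_square scale)" "l \<notin> {..<n} \<times> {..<n}" for U l
  proof -
    obtain j k where l: "l = (j, k)" by force
    have U: "U \<in> carrier H2.T" using that(1) by simp
    have jk: "\<not> (j < n \<and> k < n)" using that(2) l by simp
    show ?thesis
    proof (cases "k < n")
      case True
      then obtain m where "\<forall>p. H2.coord U (p, k) = crd p m"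
        using H2.coord_range[OF U, of k] by auto
      then show ?thesis using jk True by (simp add: l crd_outside)
    next
      case False
      then show ?thesis using H2.coord_outside[OF U] l by simp
    qed
  qed
qed (auto simp: crd_scale H2.smult_tensor_algebra H2.tens_closed H2.coord_pure crd_e crd_outside split: if_splits)

definition D :: "'h \<Rightarrow> nat \<Rightarrow> nat \<Rightarrow> 'k" where
  "D x j k = H2.coord (\<Delta> x) (j, k)"

lemma comult_closed: "\<Delta> x \<in> carrier H2.T"
  using ring_hom_memE(1)[OF comult_hom, of x] by simp

lemma D_add: "D (x + y) j k = D x j k + D y j k"
  using ring_hom_memE(3)[OF comult_hom, of x y] by (simp add: D_def H2.coord_add comult_closed)

lemma D_scale: "D (scale a x) j k = a * D x j k"
  by (simp add: D_def comult_scale H2.smult_tensor_algebra comult_closed)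

lemma D_one: "D 1 j k = crd j 1 * crd k 1"
  using ring_hom_memE(4)[OF comult_hom] by (simp add: D_def H2.coord_pure)

end

text \<open>Forms on H take values in an extension field reached through \<open>h\<close>. With the
  identity for \<open>h\<close> the Hopf axioms over the ground field are read off; with the
  embedding into rational functions the same rules serve for t and for the universal
  cocycle.\<close>

locale hopf_forms = fd_hopf scale \<Delta> \<epsilon> antipode n e crd + comm_ring_hom h
  for scale :: "'k::field \<Rightarrow> 'h::ring_1 \<Rightarrow> 'h" and \<Delta> \<epsilon> antipode n e crd and h :: "'k \<Rightarrow> 'f::field"
begin

definition lin :: "('h \<Rightarrow> 'f) \<Rightarrow> bool" where
  "lin g \<longleftrightarrow> (\<forall>x y. g (x + y) = g x + g y) \<and> (\<forall>a x. g (scale a x) = h a * g x)"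

lemma lin_sum [intro]: "(\<And>i. i \<in> A \<Longrightarrow> lin (g i)) \<Longrightarrow> lin (\<lambda>x. \<Sum>i\<in>A. g i x)"
  by (simp add: lin_def sum.distrib sum_distrib_left)

lemma lin_mult_left [intro]: "lin g \<Longrightarrow> lin (\<lambda>x. a * g x)"
  by (simp add: lin_def algebra_simps)

lemma lin_mult_right [intro]: "lin g \<Longrightarrow> lin (\<lambda>x. g x * a)"
  by (simp add: lin_def algebra_simps)

lemma lin_D [intro]: "lin (\<lambda>x. h (D x j k))"
  by (simp add: lin_def D_add D_scale hom_add hom_mult)

lemma lin_crd [intro]: "lin (\<lambda>x. h (crd j x))"
  by (simp add: lin_def crd_add crd_scale hom_add hom_mult)

lemma lin_times_left: "lin g \<Longrightarrow> lin (\<lambda>x. g (x * y))"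
  by (simp add: lin_def distrib_right mult_scale_left)

lemma lin_times_right: "lin g \<Longrightarrow> lin (\<lambda>x. g (y * x))"
  by (simp add: lin_def distrib_left mult_scale_right)

lemma lin_expand:
  assumes "lin g" shows "g x = (\<Sum>i<n. h (crd i x) * g (e i))"
proof -
  have 0: "g 0 = 0" using assms unfolding lin_def by (metis add_cancel_right_right)
  have "g (\<Sum>i\<in>A. scale (crd i x) (e i)) = (\<Sum>i\<in>A. h (crd i x) * g (e i))" for A :: "nat set"
    using assms by (induction A rule: infinite_finite_induct) (auto simp: lin_def 0)
  then show ?thesis using crd_expansion[of x] by metis
qed

definition bil :: "('h \<Rightarrow> 'h \<Rightarrow> 'f) \<Rightarrow> bool" where
  "bil g \<longleftrightarrow> (\<forall>x. lin (g x)) \<and> (\<forall>y. lin (\<lambda>x. g x y))"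

lemma bil_expand:
  assumes "bil g" shows "g x y = (\<Sum>j<n. \<Sum>k<n. h (crd j x) * h (crd k y) * g (e j) (e k))"
proof -
  have "g x y = (\<Sum>j<n. h (crd j x) * g (e j) y)"
    using assms by (intro lin_expand[where g="\<lambda>x. g x y"]) (simp add: bil_def)
  also have "\<dots> = (\<Sum>j<n. h (crd j x) * (\<Sum>k<n. h (crd k y) * g (e j) (e k)))"
    using assms by (intro sum.cong refl arg_cong2[of _ _ _ _ "(*)"] lin_expand) (simp add: bil_def)
  finally show ?thesis by (simp add: sum_distrib_left mult.assoc)
qed

text \<open>The Sweedler sum computed from values on the basis only. It is linear in
  \<open>x\<close> for every \<open>g\<close>, which keeps the linearity rules for nested sums
  simple; for bilinear \<open>g\<close> it agrees with \<open>sweedler\<close>.\<close>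

definition swd :: "'h \<Rightarrow> ('h \<Rightarrow> 'h \<Rightarrow> 'f) \<Rightarrow> 'f" where
  "swd x g = (\<Sum>j<n. \<Sum>k<n. h (D x j k) * g (e j) (e k))"

lemma lin_swd [intro]: "lin (\<lambda>x. swd x g)"
  unfolding swd_def by (intro lin_sum lin_mult_right lin_D)

lemma lin_swd_arg [intro]: "(\<And>j k. lin (\<lambda>x. g x (e j) (e k))) \<Longrightarrow> lin (\<lambda>x. swd y (g x))"
  unfolding swd_def by (intro lin_sum lin_mult_left)

lemma swd_one: "bil g \<Longrightarrow> swd 1 g = g 1 1"
  by (simp add: swd_def D_one hom_mult bil_expand[of g 1 1])

text \<open>The coordinates of the coproduct determine the sum as soon as the values are bilinear,
  by \<open>lift_linear\<close>. All later Sweedler expressions are evaluated through this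
  rule.\<close>

lemma
  assumes W: "joint_embedding W \<chi>" and f: "\<And>x y. f x y \<in> carrier W"
    and b: "\<And>l. bil (\<lambda>x y. \<chi> (f x y) l)"
  shows sweedler_closed: "sweedler \<Delta> W x f \<in> carrier W"
    and sweedler_eval: "\<chi> (sweedler \<Delta> W x f) l = swd x (\<lambda>x y. \<chi> (f x y) l)"
proof -
  let ?\<Lambda> = "\<lambda>l v. \<Sum>j<n. \<Sum>k<n. h (v (j, k)) * \<chi> (f (e j) (e k)) l"
  have 1: "\<chi> (f x y) l = ?\<Lambda> l (H2.coord (H2.tens x y))" for x y l
    by (simp add: H2.coord_pure bil_expand[OF b, of x y] hom_mult)
  have 2: "?\<Lambda> l (\<lambda>i. v i + w i) = ?\<Lambda> l v + ?\<Lambda> l w" for l v w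
    by (simp add: hom_add algebra_simps sum.distrib)
  note * = H2.lift_linear[OF W f 1 2 comult_closed]
  show "sweedler \<Delta> W x f \<in> carrier W" unfolding sweedler_def by (rule *)
  show "\<chi> (sweedler \<Delta> W x f) l = swd x (\<lambda>x y. \<chi> (f x y) l)"
    unfolding sweedler_def swd_def D_def by (rule *)
qed

end

context fd_hopf
begin

lemma self_forms: "hopf_forms scale \<Delta> \<epsilon> antipode n e crd (\<lambda>x. x)"
  by (intro hopf_forms.intro fd_hopf_axioms id_hom)

definition c :: "nat \<Rightarrow> nat \<Rightarrow> nat \<Rightarrow> 'k" where
  "c i j k = D (e i) j k"

definition \<mu> :: "nat \<Rightarrow> nat \<Rightarrow> nat \<Rightarrow> 'k" where
  "\<mu> i j l = crd l (e i * e j)"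

lemma D_expand: "D x j k = (\<Sum>i<n. crd i x * c i j k)"
proof -
  interpret self: hopf_forms scale \<Delta> \<epsilon> antipode n e crd "\<lambda>x. x" by (rule self_forms)
  show ?thesis unfolding c_def by (rule self.lin_expand) (rule self.lin_D)
qed

lemma mult_expand: "crd l (x * y) = (\<Sum>i<n. \<Sum>j<n. crd i x * crd j y * \<mu> i j l)"
proof -
  interpret self: hopf_forms scale \<Delta> \<epsilon> antipode n e crd "\<lambda>x. x" by (rule self_forms)
  show ?thesis unfolding \<mu>_def
    by (rule self.bil_expand)
      (auto simp: self.bil_def intro!: self.lin_times_left[of "crd l"] self.lin_times_right[of "crd l"] self.lin_crd)
qed

lemma crd_e_sum:
  assumes j: "j < n"
  shows "(\<Sum>i<n. crd j (e i) * f i) = f j" "(\<Sum>i<n. f i * crd j (e i)) = f j"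
    "(\<Sum>i<n. crd i (e j) * f i) = f j" "(\<Sum>i<n. f i * crd i (e j)) = f j"
proof -
  have *: "crd j (e i) = (if j = i then 1 else 0)" "crd i (e j) = (if j = i then 1 else 0)" if "i \<in> {..<n}" for i
    using crd_e that j by auto
  show "(\<Sum>i<n. crd j (e i) * f i) = f j"
    by (rule trans[OF sum.cong[OF refl] delta_sum(2)[OF j]]) (simp only: *)
  show "(\<Sum>i<n. f i * crd j (e i)) = f j"
    by (rule trans[OF sum.cong[OF refl] delta_sum(4)[OF j]]) (simp only: *)
  show "(\<Sum>i<n. crd i (e j) * f i) = f j"
    by (rule trans[OF sum.cong[OF refl] delta_sum(2)[OF j]]) (simp only: *)
  show "(\<Sum>i<n. f i * crd i (e j)) = f j"
    by (rule trans[OF sum.cong[OF refl] delta_sum(4)[OF j]]) (simp only: *)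
qed

lemma counit_add: "\<epsilon> (x + y) = \<epsilon> x + \<epsilon> y" and counit_scale: "\<epsilon> (scale a x) = a * \<epsilon> x"
  using counit_linear by (auto simp: Vector_Spaces.linear_iff)

lemma counit_left_coord: "(\<Sum>j<n. D x j l * \<epsilon> (e j)) = crd l x"
proof (cases "l < n")
  case True
  interpret self: hopf_forms scale \<Delta> \<epsilon> antipode n e crd "\<lambda>x. x" by (rule self_forms)
  have lin_eps: "self.lin \<epsilon>" by (simp add: self.lin_def counit_add counit_scale)
  have "crd l x = crd l (sweedler \<Delta> (type_algebra scale) x (\<lambda>x1 x2. scale (\<epsilon> x1) x2))"
    using counit_left by simp
  also have "\<dots> = self.swd x (\<lambda>x1 x2. crd l (scale (\<epsilon> x1) x2))"
    by (rule self.sweedler_eval[OF type_algebra_embedding[OF id_hom]])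
      (auto simp: self.bil_def crd_scale intro: lin_eps self.lin_crd)
  also have "\<dots> = (\<Sum>j<n. D x j l * \<epsilon> (e j))"
    unfolding self.swd_def crd_scale mult.assoc[symmetric] by (simp only: crd_e_sum True)
  finally show ?thesis by simp
qed (simp add: D_def crd_outside H2.coord_outside comult_closed)

lemma counit_right_coord: "l < n \<Longrightarrow> (\<Sum>k<n. D x l k * \<epsilon> (e k)) = crd l x"
proof -
  assume l: "l < n"
  interpret self: hopf_forms scale \<Delta> \<epsilon> antipode n e crd "\<lambda>x. x" by (rule self_forms)
  have lin_eps: "self.lin \<epsilon>" by (simp add: self.lin_def counit_add counit_scale)
  have "crd l x = crd l (sweedler \<Delta> (type_algebra scale) x (\<lambda>x1 x2. scale (\<epsilon> x2) x1))"
    using counit_right by simp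
  also have "\<dots> = self.swd x (\<lambda>x1 x2. crd l (scale (\<epsilon> x2) x1))"
    by (rule self.sweedler_eval[OF type_algebra_embedding[OF id_hom]])
      (auto simp: self.bil_def crd_scale intro: lin_eps self.lin_crd)
  also have "\<dots> = (\<Sum>k<n. \<Sum>j<n. D x j k * \<epsilon> (e k) * crd l (e j))"
    unfolding self.swd_def crd_scale mult.assoc[symmetric] by (rule sum.swap)
  also have "\<dots> = (\<Sum>k<n. D x l k * \<epsilon> (e k))" by (simp only: crd_e_sum l)
  finally show ?thesis by simp
qed

text \<open>Both sides of the coassociativity axiom are evaluated at the coordinate
  \<open>(p, (q, r))\<close>.\<close>

lemma coassoc_coord:
  assumes "p < n" "q < n" "r < n"
  shows "(\<Sum>j<n. D x j r * D (e j) p q) = (\<Sum>j<n. D x p j * D (e j) q r)"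
proof -
  interpret self: hopf_forms scale \<Delta> \<epsilon> antipode n e crd "\<lambda>x. x" by (rule self_forms)
  let ?C = "tensor_cube scale"
  note W = H3.coord_emb_algebra
  let ?inner = "\<lambda>x1 x2. sweedler \<Delta> ?C x1 (\<lambda>x11 x12. pure3 scale x11 (pure2 scale x12 x2))"
  have 1: "pure3 scale a (pure2 scale b d) \<in> carrier ?C"
    "H3.coord (pure3 scale a (pure2 scale b d)) i = crd (fst i) a * (crd (fst (snd i)) b * crd (snd (snd i)) d)" for a b d i
    by (auto simp: H3.tens_closed H2.tens_closed H3.coord_pure H2.coord_pure)
  have b1: "self.bil (\<lambda>x11 x12. H3.coord (pure3 scale x11 (pure2 scale x12 x2)) i)" for x2 i
    unfolding 1 self.bil_def by (intro conjI allI self.lin_mult_left self.lin_mult_right self.lin_crd)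
  have inner: "?inner x1 x2 \<in> carrier ?C"
    "H3.coord (?inner x1 x2) i =
      self.swd x1 (\<lambda>x11 x12. H3.coord (pure3 scale x11 (pure2 scale x12 x2)) i)" for x1 x2 i
    by (rule self.sweedler_closed[OF W], rule 1(1), rule b1, rule self.sweedler_eval[OF W], rule 1(1), rule b1)
  have b2: "self.bil (\<lambda>x1 x2. H3.coord (?inner x1 x2) i)" for i
    unfolding inner(2) 1 self.bil_def
    by (intro conjI allI self.lin_swd self.lin_swd_arg self.lin_mult_left self.lin_crd)
  have L: "H3.coord (sweedler \<Delta> ?C x ?inner) (p, (q, r)) = (\<Sum>j<n. D x j r * D (e j) p q)"
  proof -
    have "H3.coord (sweedler \<Delta> ?C x ?inner) (p, (q, r)) = self.swd x (\<lambda>x1 x2. H3.coord (?inner x1 x2) (p, (q, r)))"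
      by (rule self.sweedler_eval[OF W], rule inner(1), rule b2)
    also have "\<dots> = (\<Sum>j<n. \<Sum>k<n. D x j k * (\<Sum>a<n. \<Sum>b<n. D (e j) a b * crd p (e a) * crd q (e b)) * crd r (e k))"
      unfolding inner(2) 1 self.swd_def fst_conv snd_conv sum_distrib_left sum_distrib_right
      by (simp only: mult.assoc)
    also have "\<dots> = (\<Sum>j<n. D x j r * D (e j) p q)"
    proof -
      have "(\<Sum>a<n. \<Sum>b<n. D (e j) a b * crd p (e a) * crd q (e b)) = D (e j) p q" for j
        by (simp only: crd_e_sum assms)
      then show ?thesis by (simp only: crd_e_sum assms)
    qed
    finally show ?thesis .
  qed
  have 2: "pure3 scale a (\<Delta> b) \<in> carrier ?C"
    "H3.coord (pure3 scale a (\<Delta> b)) (p, (q, r)) = crd p a * D b q r" for a b p q r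
    using comult_closed by (auto simp: H3.tens_closed H3.coord_pure D_def)
  have b3: "self.bil (\<lambda>x1 x2. H3.coord (pure3 scale x1 (\<Delta> x2)) i)" for i
  proof -
    obtain p q r where i: "i = (p, (q, r))" by (metis surj_pair)
    show ?thesis unfolding i 2(2) self.bil_def
      by (intro conjI allI self.lin_mult_left self.lin_mult_right self.lin_crd self.lin_D)
  qed
  have R: "H3.coord (sweedler \<Delta> ?C x (\<lambda>x1 x2. pure3 scale x1 (\<Delta> x2))) (p, (q, r)) = (\<Sum>j<n. D x p j * D (e j) q r)"
  proof -
    have "H3.coord (sweedler \<Delta> ?C x (\<lambda>x1 x2. pure3 scale x1 (\<Delta> x2))) (p, (q, r)) =
       self.swd x (\<lambda>x1 x2. H3.coord (pure3 scale x1 (\<Delta> x2)) (p, (q, r)))"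
      by (rule self.sweedler_eval[OF W], rule 2(1), rule b3)
    also have "\<dots> = (\<Sum>k<n. \<Sum>j<n. D x j k * D (e k) q r * crd p (e j))"
      unfolding self.swd_def 2 by (subst sum.swap) (simp only: mult_ac)
    also have "\<dots> = (\<Sum>j<n. D x p j * D (e j) q r)" by (simp only: crd_e_sum assms)
    finally show ?thesis .
  qed
  show ?thesis using L R coassoc[of x] by simp
qed

text \<open>The product of the tensor square is a nested lift, so \<open>lift_bilinear\<close>
  expresses its coordinates by those of the factors; the coproduct is multiplicative.\<close>

lemma comult_mult_coord:
  "D (x * y) p q =
    (\<Sum>a<n. \<Sum>a'<n. \<Sum>b<n. \<Sum>b'<n. D x a b * D y a' b' * \<mu> a a' p * \<mu> b b' q)"
proof -
  let ?\<Lambda> = "\<lambda>k v w. \<Sum>a<n. \<Sum>a'<n. \<Sum>b<n. \<Sum>b'<n. v (a, b) * w (a', b') * \<mu> a a' (fst k) * \<mu> b b' (snd k)"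
  have "H2.coord (tensor_lift H2.T (\<lambda>m n. tensor_lift H2.T (\<lambda>m' n'. H2.tens (m * m') (n * n')) (\<Delta> y)) (\<Delta> x)) (p, q)
    = ?\<Lambda> (p, q) (H2.coord (\<Delta> x)) (H2.coord (\<Delta> y))"
  proof (rule H2.lift_bilinear(2)[OF H2.coord_emb _ _ _ _ comult_closed comult_closed])
    show "H2.coord (H2.tens (m * m') (k * k')) i = ?\<Lambda> i (H2.coord (H2.tens m k)) (H2.coord (H2.tens m' k'))"
      for m k m' k' i
    proof -
      have "H2.coord (H2.tens (m * m') (k * k')) i =
        (\<Sum>a<n. \<Sum>a'<n. crd a m * crd a' m' * \<mu> a a' (fst i)) * (\<Sum>b<n. \<Sum>b'<n. crd b k * crd b' k' * \<mu> b b' (snd i))"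
        by (simp add: H2.coord_pure mult_expand)
      also have "\<dots> = (\<Sum>a<n. \<Sum>a'<n. \<Sum>b<n. \<Sum>b'<n. (crd a m * crd a' m' * \<mu> a a' (fst i)) * (crd b k * crd b' k' * \<mu> b b' (snd i)))"
        by (simp only: sum_distrib_right) (simp only: sum_distrib_left)
      also have "\<dots> = ?\<Lambda> i (H2.coord (H2.tens m k)) (H2.coord (H2.tens m' k'))"
        by (intro sum.cong refl) (simp add: H2.coord_pure)
      finally show ?thesis .
    qed
    show "?\<Lambda> k (\<lambda>i. v i + w i) u = ?\<Lambda> k v u + ?\<Lambda> k w u" for k v w u
      by (simp add: algebra_simps sum.distrib)
    show "?\<Lambda> k u (\<lambda>i. v i + w i) = ?\<Lambda> k u v + ?\<Lambda> k u w" for k v w u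
      by (simp add: algebra_simps sum.distrib)
  qed (auto intro: H2.tens_closed)
  moreover have "\<Delta> (x * y) = tensor_lift H2.T (\<lambda>m n. tensor_lift H2.T (\<lambda>m' n'. H2.tens (m * m') (n * n')) (\<Delta> y)) (\<Delta> x)"
    using ring_hom_memE(2)[OF comult_hom, of x y] by (simp add: tensor_algebra_def Let_def)
  ultimately show ?thesis by (simp add: D_def)
qed

end

section \<open>Transport of semisimplicity along isomorphisms\<close>

lemma set_add_iff: "x \<in> I <+>\<^bsub>G\<^esub> J \<longleftrightarrow> (\<exists>i\<in>I. \<exists>j\<in>J. x = i \<oplus>\<^bsub>G\<^esub> j)"
  by (simp add: set_add_def set_mult_def)

text \<open>\<open>B\<close> is not presupposed to be a ring: its ring laws come through the
  isomorphism. A left ideal is pulled back, complemented in \<open>A\<close>, and the complement is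
  pushed forward.\<close>

lemma semisimple_ring_transfer:
  assumes ss: "semisimple_ring A" and bij: "bij_betw f (carrier A) (carrier B)"
    and add: "\<And>x y. x \<in> carrier A \<Longrightarrow> y \<in> carrier A \<Longrightarrow> f (x \<oplus>\<^bsub>A\<^esub> y) = f x \<oplus>\<^bsub>B\<^esub> f y"
    and mult: "\<And>x y. x \<in> carrier A \<Longrightarrow> y \<in> carrier A \<Longrightarrow> f (x \<otimes>\<^bsub>A\<^esub> y) = f x \<otimes>\<^bsub>B\<^esub> f y"
    and one: "f \<one>\<^bsub>A\<^esub> = \<one>\<^bsub>B\<^esub>" and zero: "f \<zero>\<^bsub>A\<^esub> = \<zero>\<^bsub>B\<^esub>"
  shows "semisimple_ring B"
proof -
  interpret A: ring A using ss by (simp add: semisimple_ring_def)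
  have f_closed: "f x \<in> carrier B" if "x \<in> carrier A" for x
    using bij that by (auto simp: bij_betw_def)
  have "f \<in> ring_iso A B"
    using bij f_closed add mult one by (auto simp: ring_iso_def Ring.ring_hom_def)
  then have "ring (B\<lparr>ring.zero := f \<zero>\<^bsub>A\<^esub>\<rparr>)" by (rule A.ring_iso_imp_img_ring)
  then interpret B: ring B by (simp add: zero)
  define g where "g = inv_into (carrier A) f"
  have g: "g y \<in> carrier A" "f (g y) = y" if "y \<in> carrier B" for y
    using bij that by (auto simp: g_def bij_betw_def f_inv_into_f inv_into_into)
  have gf: "g (f x) = x" if "x \<in> carrier A" for x
    using bij that by (auto simp: g_def bij_betw_def)
  have g_add: "g (x \<oplus>\<^bsub>B\<^esub> y) = g x \<oplus>\<^bsub>A\<^esub> g y" if "x \<in> carrier B" "y \<in> carrier B" for x y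
    using gf[of "g x \<oplus>\<^bsub>A\<^esub> g y"] that g add by simp
  have g_mult: "g (x \<otimes>\<^bsub>B\<^esub> y) = g x \<otimes>\<^bsub>A\<^esub> g y" if "x \<in> carrier B" "y \<in> carrier B" for x y
    using gf[of "g x \<otimes>\<^bsub>A\<^esub> g y"] that g mult by simp
  have f_neg: "f (\<ominus>\<^bsub>A\<^esub> x) = \<ominus>\<^bsub>B\<^esub> f x" if "x \<in> carrier A" for x
  proof (rule B.minus_equality[symmetric])
    show "f (\<ominus>\<^bsub>A\<^esub> x) \<oplus>\<^bsub>B\<^esub> f x = \<zero>\<^bsub>B\<^esub>"
      using add[of "\<ominus>\<^bsub>A\<^esub> x" x] that zero by (simp add: A.l_neg)
  qed (use that f_closed in auto)
  have g_neg: "g (\<ominus>\<^bsub>B\<^esub> y) = \<ominus>\<^bsub>A\<^esub> g y" if "y \<in> carrier B" for y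
    using f_neg[of "g y"] gf[of "\<ominus>\<^bsub>A\<^esub> g y"] g that by simp
  have ideal_f: "left_ideal (f ` J) B" if J: "left_ideal J A" for J
  proof -
    interpret J: additive_subgroup J A using J by (simp add: left_ideal_def)
    have Jc: "J \<subseteq> carrier A" by (rule J.a_subset)
    have "additive_subgroup (f ` J) B"
    proof (intro additive_subgroup.intro subgroup.intro)
      show "inv\<^bsub>add_monoid B\<^esub> y \<in> f ` J" if y: "y \<in> f ` J" for y
      proof -
        obtain x where x: "x \<in> J" "y = f x" using y by blast
        then have "f (\<ominus>\<^bsub>A\<^esub> x) = inv\<^bsub>add_monoid B\<^esub> y"
          using f_neg[of x] Jc by (auto simp: a_inv_def[of B])
        then show ?thesis using imageI[OF J.a_inv_closed[OF x(1)], of f] by simp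
      qed
      show "x \<otimes>\<^bsub>add_monoid B\<^esub> y \<in> f ` J" if xy: "x \<in> f ` J" "y \<in> f ` J" for x y
      proof -
        obtain a b where ab: "a \<in> J" "x = f a" "b \<in> J" "y = f b" using xy by blast
        then have "f (a \<oplus>\<^bsub>A\<^esub> b) = x \<otimes>\<^bsub>add_monoid B\<^esub> y"
          using add[of a b] Jc by auto
        then show ?thesis using imageI[OF J.a_closed[OF ab(1,3)], of f] by simp
      qed
      have "f \<zero>\<^bsub>A\<^esub> \<in> f ` J" using J.zero_closed by blast
      then show "\<one>\<^bsub>add_monoid B\<^esub> \<in> f ` J" using zero by simp
    qed (use Jc f_closed in auto)
    moreover have "b \<otimes>\<^bsub>B\<^esub> y \<in> f ` J" if b: "b \<in> carrier B" and y: "y \<in> f ` J" for b y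
    proof -
      obtain x where x: "x \<in> J" "y = f x" using y by blast
      have mem: "g b \<otimes>\<^bsub>A\<^esub> x \<in> J" using J x g(1)[OF b] by (auto simp: left_ideal_def)
      have "f (g b \<otimes>\<^bsub>A\<^esub> x) = b \<otimes>\<^bsub>B\<^esub> y" using mult[of "g b" x] g[OF b] x Jc by auto
      then show ?thesis using imageI[OF mem, of f] by simp
    qed
    ultimately show ?thesis by (simp add: left_ideal_def)
  qed
  have ideal_g: "left_ideal (g ` I) A" if I: "left_ideal I B" for I
  proof -
    interpret I: additive_subgroup I B using I by (simp add: left_ideal_def)
    have Ic: "I \<subseteq> carrier B" by (rule I.a_subset)
    have "g \<zero>\<^bsub>B\<^esub> = \<zero>\<^bsub>A\<^esub>" using gf[of "\<zero>\<^bsub>A\<^esub>"] zero by simp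
    have "additive_subgroup (g ` I) A"
    proof (intro additive_subgroup.intro subgroup.intro)
      show "inv\<^bsub>add_monoid A\<^esub> y \<in> g ` I" if y: "y \<in> g ` I" for y
      proof -
        obtain x where x: "x \<in> I" "y = g x" using y by blast
        then have "g (\<ominus>\<^bsub>B\<^esub> x) = inv\<^bsub>add_monoid A\<^esub> y"
          using g_neg[of x] Ic by (auto simp: a_inv_def[of A])
        then show ?thesis using imageI[OF I.a_inv_closed[OF x(1)], of g] by simp
      qed
      show "x \<otimes>\<^bsub>add_monoid A\<^esub> y \<in> g ` I" if xy: "x \<in> g ` I" "y \<in> g ` I" for x y
      proof -
        obtain a b where ab: "a \<in> I" "x = g a" "b \<in> I" "y = g b" using xy by blast
        then have "g (a \<oplus>\<^bsub>B\<^esub> b) = x \<otimes>\<^bsub>add_monoid A\<^esub> y"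
          using g_add[of a b] Ic by auto
        then show ?thesis using imageI[OF I.a_closed[OF ab(1,3)], of g] by simp
      qed
      have "g \<zero>\<^bsub>B\<^esub> \<in> g ` I" using I.zero_closed by blast
      then show "\<one>\<^bsub>add_monoid A\<^esub> \<in> g ` I" using \<open>g \<zero>\<^bsub>B\<^esub> = \<zero>\<^bsub>A\<^esub>\<close> by simp
    qed (use Ic g in auto)
    moreover have "a \<otimes>\<^bsub>A\<^esub> y \<in> g ` I" if a: "a \<in> carrier A" and y: "y \<in> g ` I" for a y
    proof -
      obtain x where x: "x \<in> I" "y = g x" using y by blast
      have mem: "f a \<otimes>\<^bsub>B\<^esub> x \<in> I" using I x f_closed[OF a] by (auto simp: left_ideal_def)
      have "g (f a \<otimes>\<^bsub>B\<^esub> x) = a \<otimes>\<^bsub>A\<^esub> y" using g_mult[of "f a" x] gf[OF a] x Ic f_closed[OF a] by auto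
      then show ?thesis using imageI[OF mem, of g] by simp
    qed
    ultimately show ?thesis by (simp add: left_ideal_def)
  qed
  show ?thesis
    unfolding semisimple_ring_def
  proof (intro conjI allI impI B.ring_axioms)
    fix I assume I: "left_ideal I B"
    interpret I: additive_subgroup I B using I by (simp add: left_ideal_def)
    have Ic: "I \<subseteq> carrier B" by (rule I.a_subset)
    obtain J where J: "left_ideal J A" "g ` I \<inter> J = {\<zero>\<^bsub>A\<^esub>}" "g ` I <+>\<^bsub>A\<^esub> J = carrier A"
      using ss ideal_g[OF I] unfolding semisimple_ring_def by blast
    interpret J: additive_subgroup J A using J by (simp add: left_ideal_def)
    have Jc: "J \<subseteq> carrier A" by (rule J.a_subset)
    have "I \<inter> f ` J = {\<zero>\<^bsub>B\<^esub>}"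
    proof
      show "I \<inter> f ` J \<subseteq> {\<zero>\<^bsub>B\<^esub>}"
      proof
        fix y assume y: "y \<in> I \<inter> f ` J"
        then obtain x where x: "x \<in> J" "y = f x" by blast
        then have "g y = x" using gf[of x] Jc by auto
        then have "x \<in> g ` I" using y by blast
        then have "x = \<zero>\<^bsub>A\<^esub>" using J(2) x by blast
        then show "y \<in> {\<zero>\<^bsub>B\<^esub>}" using x zero by simp
      qed
      have "f \<zero>\<^bsub>A\<^esub> \<in> f ` J" using J.zero_closed by blast
      then show "{\<zero>\<^bsub>B\<^esub>} \<subseteq> I \<inter> f ` J" using I.zero_closed zero by simp
    qed
    moreover have "I <+>\<^bsub>B\<^esub> f ` J = carrier B"
    proof
      show "I <+>\<^bsub>B\<^esub> f ` J \<subseteq> carrier B" using Ic Jc f_closed by (auto simp: set_add_iff)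
      show "carrier B \<subseteq> I <+>\<^bsub>B\<^esub> f ` J"
      proof
        fix y assume y: "y \<in> carrier B"
        then have "g y \<in> g ` I <+>\<^bsub>A\<^esub> J" using J(3) g by simp
        then obtain i j where ij: "i \<in> I" "j \<in> J" "g y = g i \<oplus>\<^bsub>A\<^esub> j" unfolding set_add_iff by blast
        then have "y = i \<oplus>\<^bsub>B\<^esub> f j"
        proof -
          have "i \<in> carrier B" "j \<in> carrier A" using ij Ic Jc by auto
          then have "f (g y) = i \<oplus>\<^bsub>B\<^esub> f j" using add[of "g i" j] g[of i] ij(3) by simp
          then show ?thesis using g(2)[OF y] by simp
        qed
        then show "y \<in> I <+>\<^bsub>B\<^esub> f ` J" unfolding set_add_iff using ij by blast
      qed
    qed
    ultimately show "\<exists>J. left_ideal J B \<and> I \<inter> J = {\<zero>\<^bsub>B\<^esub>} \<and> I <+>\<^bsub>B\<^esub> J = carrier B"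
      using ideal_f[OF J(1)] by blast
  qed
qed

text \<open>The map now starts at the structure whose ring laws are still unknown, as a coordinate
  map does. Closure under the operations is therefore part of the hypotheses, and the inverse map
  reduces the claim to the previous lemma.\<close>

lemma semisimple_ring_transfer_back:
  assumes ss: "semisimple_ring A" and bij: "bij_betw f (carrier B) (carrier A)"
    and add: "\<And>x y. x \<in> carrier B \<Longrightarrow> y \<in> carrier B \<Longrightarrow> x \<oplus>\<^bsub>B\<^esub> y \<in> carrier B \<and> f (x \<oplus>\<^bsub>B\<^esub> y) = f x \<oplus>\<^bsub>A\<^esub> f y"
    and mult: "\<And>x y. x \<in> carrier B \<Longrightarrow> y \<in> carrier B \<Longrightarrow> x \<otimes>\<^bsub>B\<^esub> y \<in> carrier B \<and> f (x \<otimes>\<^bsub>B\<^esub> y) = f x \<otimes>\<^bsub>A\<^esub> f y"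
    and one: "\<one>\<^bsub>B\<^esub> \<in> carrier B" "f \<one>\<^bsub>B\<^esub> = \<one>\<^bsub>A\<^esub>" and zero: "\<zero>\<^bsub>B\<^esub> \<in> carrier B" "f \<zero>\<^bsub>B\<^esub> = \<zero>\<^bsub>A\<^esub>"
  shows "semisimple_ring B"
proof -
  let ?g = "inv_into (carrier B) f"
  have gf: "?g (f x) = x" if "x \<in> carrier B" for x using bij that by (auto simp: bij_betw_def)
  have g: "?g y \<in> carrier B" "f (?g y) = y" if "y \<in> carrier A" for y
    using bij that by (auto simp: bij_betw_def f_inv_into_f inv_into_into)
  show ?thesis
  proof (rule semisimple_ring_transfer[OF ss bij_betw_inv_into[OF bij]])
    show "?g (x \<oplus>\<^bsub>A\<^esub> y) = ?g x \<oplus>\<^bsub>B\<^esub> ?g y" if "x \<in> carrier A" "y \<in> carrier A" for x y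
      using add[of "?g x" "?g y"] gf[of "?g x \<oplus>\<^bsub>B\<^esub> ?g y"] g that by simp
    show "?g (x \<otimes>\<^bsub>A\<^esub> y) = ?g x \<otimes>\<^bsub>B\<^esub> ?g y" if "x \<in> carrier A" "y \<in> carrier A" for x y
      using mult[of "?g x" "?g y"] gf[of "?g x \<otimes>\<^bsub>B\<^esub> ?g y"] g that by simp
    show "?g \<one>\<^bsub>A\<^esub> = \<one>\<^bsub>B\<^esub>" using gf[OF one(1)] one(2) by simp
    show "?g \<zero>\<^bsub>A\<^esub> = \<zero>\<^bsub>B\<^esub>" using gf[OF zero(1)] zero(2) by simp
  qed
qed

section \<open>Structure constants of the Hopf algebra and of its twisted algebras\<close>

lemma hopf_constants_hom:
  fixes h :: "'k::field \<Rightarrow> 'f::field"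
  assumes "comm_ring_hom h" and H: "hopf_constants n c eps \<mu>"
  shows "hopf_constants n (\<lambda>i j k. h (c i j k)) (\<lambda>i. h (eps i)) (\<lambda>i j k. h (\<mu> i j k))"
proof -
  interpret h: comm_ring_hom h by fact
  interpret hopf_constants n c eps \<mu> by fact
  have h_if: "h (if b then 1 else 0) = (if b then 1 else 0)" for b by simp
  show ?thesis
  proof (intro hopf_constants.intro coalgebra_constants.intro hopf_constants_axioms.intro)
    fix i p q m assume "i \<in> {..<n}" "p \<in> {..<n}" "q \<in> {..<n}" "m \<in> {..<n}"
    from coassoc[OF this]
    show "(\<Sum>j<n. h (c i j m) * h (c j p q)) = (\<Sum>j<n. h (c i p j) * h (c j q m))"
      unfolding h.hom_mult[symmetric] h.hom_sum[symmetric] by (rule arg_cong[where f=h])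
  next
    fix i m assume im: "i \<in> {..<n}" "m \<in> {..<n}"
    show "(\<Sum>j<n. h (c i j m) * h (eps j)) = (if i = m then 1 else 0)"
      unfolding h.hom_mult[symmetric] h.hom_sum[symmetric] counit_left[OF im] by (rule h_if)
    show "(\<Sum>j<n. h (c i m j) * h (eps j)) = (if i = m then 1 else 0)"
      unfolding h.hom_mult[symmetric] h.hom_sum[symmetric] counit_right[OF im] by (rule h_if)
  next
    fix i j p q assume "i < n" "j < n" "p < n" "q < n"
    from comult_mult[OF this]
    show "(\<Sum>l<n. h (\<mu> i j l) * h (c l p q)) =
      (\<Sum>a<n. \<Sum>a'<n. \<Sum>b<n. \<Sum>b'<n. h (c i a b) * h (c j a' b') * h (\<mu> a a' p) * h (\<mu> b b' q))"
      unfolding h.hom_mult[symmetric] h.hom_sum[symmetric] by (rule arg_cong[where f=h])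
  next
    fix i j assume "i < n" "j < n"
    from counit_mult[OF this]
    show "(\<Sum>l<n. h (\<mu> i j l) * h (eps l)) = h (eps i) * h (eps j)"
      unfolding h.hom_mult[symmetric] h.hom_sum[symmetric] by (rule arg_cong[where f=h])
  qed simp
qed

lemma (in fd_hopf) counit_expand: "\<epsilon> x = (\<Sum>i<n. crd i x * \<epsilon> (e i))"
proof -
  interpret self: hopf_forms scale \<Delta> \<epsilon> antipode n e crd "\<lambda>x. x" by (rule self_forms)
  have "self.lin \<epsilon>" by (simp add: self.lin_def counit_add counit_scale)
  then show ?thesis by (rule self.lin_expand)
qed

lemma (in fd_hopf) hopf_constants: "hopf_constants n c (\<lambda>i. \<epsilon> (e i)) \<mu>"
proof (intro hopf_constants.intro coalgebra_constants.intro hopf_constants_axioms.intro)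
  fix i p q m assume "i \<in> {..<n}" "p \<in> {..<n}" "q \<in> {..<n}" "m \<in> {..<n}"
  then show "(\<Sum>j<n. c i j m * c j p q) = (\<Sum>j<n. c i p j * c j q m)"
    unfolding c_def by (intro coassoc_coord) auto
next
  fix i m assume im: "i \<in> {..<n}" "m \<in> {..<n}"
  have d: "crd m (e i) = (if i = m then 1 else 0)" using im crd_e[of i m] by auto
  show "(\<Sum>j<n. c i j m * \<epsilon> (e j)) = (if i = m then 1 else 0)"
    unfolding c_def counit_left_coord by (rule d)
  have m: "m < n" using im by simp
  show "(\<Sum>j<n. c i m j * \<epsilon> (e j)) = (if i = m then 1 else 0)"
    unfolding c_def counit_right_coord[OF m] by (rule d)
next
  fix i j p q assume "i < n" "j < n" "p < n" "q < n"
  show "(\<Sum>l<n. \<mu> i j l * c l p q) =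
    (\<Sum>a<n. \<Sum>a'<n. \<Sum>b<n. \<Sum>b'<n. c i a b * c j a' b' * \<mu> a a' p * \<mu> b b' q)"
  proof -
    have "(\<Sum>l<n. \<mu> i j l * c l p q) = D (e i * e j) p q"
      unfolding D_expand[of "e i * e j"] \<mu>_def by (rule refl)
    then show ?thesis by (simp only: comult_mult_coord c_def)
  qed
next
  fix i j assume "i < n" "j < n"
  show "(\<Sum>l<n. \<mu> i j l * \<epsilon> (e l)) = \<epsilon> (e i) * \<epsilon> (e j)"
    unfolding \<mu>_def counit_mult[symmetric] by (rule counit_expand[symmetric])
qed simp

text \<open>A single injective map separates points by itself, so the index set of the family has
  one element.\<close>

lemma cring_embedding_joint:
  assumes "cring_embedding R \<phi>"
  shows "joint_embedding R (\<lambda>r (_::unit). \<phi> r)"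
  using cring_embedding_simps[OF assms] cring.axioms(1)[OF cring_embedding_cring[OF assms]]
  by (auto simp: joint_embedding_def ring.is_abelian_group)

lemma cring_embedding_inv:
  assumes R: "cring_embedding R (\<phi> :: 'a \<Rightarrow> 'f::field)" and xy: "x \<in> carrier R" "y \<in> carrier R" "\<phi> x * \<phi> y = 1"
  shows "inv\<^bsub>R\<^esub> x = y"
proof -
  interpret cring R by (rule cring_embedding_cring[OF R])
  have "x \<otimes>\<^bsub>R\<^esub> y = \<one>\<^bsub>R\<^esub>" "y \<otimes>\<^bsub>R\<^esub> x = \<one>\<^bsub>R\<^esub>"
    using cring_embedding_simps(9)[OF R, of "x \<otimes>\<^bsub>R\<^esub> y" "\<one>\<^bsub>R\<^esub>"] cring_embedding_simps(4,8)[OF R] xy m_comm by auto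
  then show ?thesis using xy by (intro comm_inv_char) auto
qed

text \<open>Common setting for \<alpha> with values in the ground field and \<sigma> with values in
  \<open>B\<close>. The twisted algebra is treated as a record with a bilinear product; whether that
  product is associative is settled later, in coordinates.\<close>

locale twisted = hopf_forms scale \<Delta> \<epsilon> antipode n e crd h
  for scale :: "'k::field \<Rightarrow> 'h::ring_1 \<Rightarrow> 'h" and \<Delta> \<epsilon> antipode n e crd and h :: "'k \<Rightarrow> 'f::field" +
  fixes R :: "('k, 'r, 'z) module_scheme" and \<phi> :: "'r \<Rightarrow> 'f" and \<gamma> :: "'h \<Rightarrow> 'h \<Rightarrow> 'r"
  assumes R_emb: "cring_embedding R \<phi>"
    and R_smult_closed: "\<And>a r. r \<in> carrier R \<Longrightarrow> a \<odot>\<^bsub>R\<^esub> r \<in> carrier R"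
    and R_smult: "\<And>a r. r \<in> carrier R \<Longrightarrow> \<phi> (a \<odot>\<^bsub>R\<^esub> r) = h a * \<phi> r"
    and gamma_bilinear: "bilinear_map scale R \<gamma>"
begin

lemma gamma_closed: "\<gamma> x y \<in> carrier R"
  using gamma_bilinear by (simp add: bilinear_map_def linear_map_def)

lemma phi_gamma_lin: "lin (\<lambda>x. \<phi> (\<gamma> x y))" "lin (\<lambda>y. \<phi> (\<gamma> x y))"
  using gamma_bilinear gamma_closed cring_embedding_simps(2)[OF R_emb] R_smult
  by (auto simp: lin_def bilinear_map_def linear_map_def)

lemma R_group: "abelian_group R"
  using cring_embedding_joint[OF R_emb] by (simp add: joint_embedding_def)

sublocale ft: free_tensor ring_of_type_algebra R "type_algebra scale" h
  "\<lambda>r (_::unit). \<phi> r" "\<lambda>x i. h (crd i x)" "{..<n}" e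
proof (intro free_tensor.intro free_tensor_axioms.intro tensor_pair.intro)
  show "joint_embedding R (\<lambda>r (_::unit). \<phi> r)" by (rule cring_embedding_joint[OF R_emb])
  show "joint_embedding (type_algebra scale) (\<lambda>x i. h (crd i x))"
    by (rule type_algebra_embedding[OF comm_ring_hom_axioms])
qed (auto simp: R_group abelian_group_type_algebra R_smult_closed R_smult crd_scale hom_mult crd_outside crd_e)

abbreviation "TA \<equiv> twisted_algebra scale \<Delta> R \<gamma>"

definition xi :: "('r \<times> 'h \<Rightarrow>\<^sub>0 int) set \<Rightarrow> nat \<Rightarrow> 'f" where
  "xi U l = ft.coord U ((), l)"

lemma TA_simps:
  "carrier TA = carrier ft.T"
  "U \<oplus>\<^bsub>TA\<^esub> V = U \<oplus>\<^bsub>ft.T\<^esub> V"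
  "\<zero>\<^bsub>TA\<^esub> = \<zero>\<^bsub>ft.T\<^esub>"
  "\<one>\<^bsub>TA\<^esub> = ft.tens (inv\<^bsub>R\<^esub> (\<gamma> 1 1)) 1"
  by (simp_all add: twisted_algebra_def Let_def)

lemma xi_emb: "joint_embedding TA xi"
proof -
  have "joint_embedding ft.T xi"
    using ft.coord_emb unfolding joint_embedding_def xi_def by (simp add: unit_all_eq1 split_paired_all)
  then show ?thesis by (rule joint_embedding_cong) (simp_all add: twisted_algebra_def Let_def)
qed

lemma xi_pure: "r \<in> carrier R \<Longrightarrow> xi (ft.tens r x) l = \<phi> r * h (crd l x)"
  by (simp add: xi_def ft.coord_pure)

lemma xi_vecs: "U \<in> carrier TA \<Longrightarrow> xi U \<in> vecs n (\<phi> ` carrier R)"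
  using ft.coord_range[of U] ft.coord_outside[of U] by (fastforce simp: TA_simps xi_def vecs_def)

lemma xi_surj: "v \<in> vecs n (\<phi> ` carrier R) \<Longrightarrow> \<exists>U\<in>carrier TA. xi U = v"
proof -
  assume v: "v \<in> vecs n (\<phi> ` carrier R)"
  then have "\<forall>l<n. \<exists>r. r \<in> carrier R \<and> v l = \<phi> r" by (auto simp: vecs_def)
  then obtain m where m: "\<And>l. l < n \<Longrightarrow> m l \<in> carrier R" "\<And>l. l < n \<Longrightarrow> v l = \<phi> (m l)" by metis
  obtain U where "U \<in> carrier ft.T" "\<And>p l. ft.coord U (p, l) = (if l \<in> {..<n} then \<phi> (m l) else 0)"
    using ft.coord_surj[of m] m(1) by auto
  then show ?thesis using m(2) v by (intro bexI[of _ U]) (auto simp: TA_simps xi_def vecs_def fun_eq_iff)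
qed

text \<open>The coefficient of \<open>e l\<close> in the twisted product of 1 tensor x and 1 tensor
  y.\<close>

definition tform :: "nat \<Rightarrow> 'h \<Rightarrow> 'h \<Rightarrow> 'f" where
  "tform l x y = swd x (\<lambda>x1 x2. swd y (\<lambda>y1 y2. \<phi> (\<gamma> x1 y1) * h (crd l (x2 * y2))))"

definition sconst :: "nat \<Rightarrow> nat \<Rightarrow> nat \<Rightarrow> 'f" where
  "sconst i j l = tform l (e i) (e j)"

lemma lin_crd_times: "lin (\<lambda>x. h (crd l (x * y)))" "lin (\<lambda>y. h (crd l (x * y)))"
  by (rule lin_times_left[OF lin_crd], rule lin_times_right[OF lin_crd])

lemma tform_bil: "bil (tform l)"
  unfolding bil_def tform_def by (intro conjI allI lin_swd lin_swd_arg)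

lemma mult_coord_pure:
  fixes x y :: 'h
  assumes m: "m \<in> carrier R" "m' \<in> carrier R"
  defines "f \<equiv> sweedler \<Delta> ft.T x (\<lambda>x1 x2. sweedler \<Delta> ft.T y (\<lambda>y1 y2.
      ft.tens (m \<otimes>\<^bsub>R\<^esub> m' \<otimes>\<^bsub>R\<^esub> \<gamma> x1 y1) (x2 * y2)))"
  shows "f \<in> carrier ft.T" and "ft.coord f i = \<phi> m * \<phi> m' * tform (snd i) x y"
proof -
  note W = ft.coord_emb
  note R_simps = cring_embedding_simps(1-4)[OF R_emb]
  have 1: "ft.tens (m \<otimes>\<^bsub>R\<^esub> m' \<otimes>\<^bsub>R\<^esub> \<gamma> x1 y1) (x2 * y2) \<in> carrier ft.T" for x1 x2 y1 y2
    using m gamma_closed by (auto intro!: ft.tens_closed R_simps)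
  have 2: "ft.coord (ft.tens (m \<otimes>\<^bsub>R\<^esub> m' \<otimes>\<^bsub>R\<^esub> \<gamma> x1 y1) (x2 * y2)) i =
      \<phi> m * \<phi> m' * (\<phi> (\<gamma> x1 y1) * h (crd (snd i) (x2 * y2)))" for x1 x2 y1 y2 i
    using m gamma_closed by (simp add: ft.coord_pure R_simps mult.assoc)
  have b1: "bil (\<lambda>y1 y2. ft.coord (ft.tens (m \<otimes>\<^bsub>R\<^esub> m' \<otimes>\<^bsub>R\<^esub> \<gamma> x1 y1) (x2 * y2)) i)" for x1 x2 i
    unfolding 2 bil_def by (intro conjI allI lin_mult_left lin_mult_right phi_gamma_lin lin_crd_times)
  let ?inner = "\<lambda>x1 x2. sweedler \<Delta> ft.T y (\<lambda>y1 y2. ft.tens (m \<otimes>\<^bsub>R\<^esub> m' \<otimes>\<^bsub>R\<^esub> \<gamma> x1 y1) (x2 * y2))"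
  have inner: "?inner x1 x2 \<in> carrier ft.T"
    "ft.coord (?inner x1 x2) i = swd y (\<lambda>y1 y2. ft.coord (ft.tens (m \<otimes>\<^bsub>R\<^esub> m' \<otimes>\<^bsub>R\<^esub> \<gamma> x1 y1) (x2 * y2)) i)" for x1 x2 i
    by (rule sweedler_closed[OF W], rule 1, rule b1, rule sweedler_eval[OF W], rule 1, rule b1)
  have swd_scale: "swd z (\<lambda>y1 y2. a * g y1 y2) = a * swd z g" for z a g
    by (simp add: swd_def sum_distrib_left mult_ac)
  have inner': "ft.coord (?inner x1 x2) i =
      \<phi> m * \<phi> m' * swd y (\<lambda>y1 y2. \<phi> (\<gamma> x1 y1) * h (crd (snd i) (x2 * y2)))" for x1 x2 i
    unfolding inner(2) 2 by (rule swd_scale)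
  have b2: "bil (\<lambda>x1 x2. ft.coord (?inner x1 x2) i)" for i
    unfolding inner' bil_def
    by (intro conjI allI lin_mult_left[of "\<lambda>x. swd y (G x)" for G] lin_swd_arg lin_mult_left lin_mult_right phi_gamma_lin lin_crd_times)
  show "f \<in> carrier ft.T" unfolding f_def
    by (rule sweedler_closed[OF W], rule inner(1), rule b2)
  have "ft.coord f i = swd x (\<lambda>x1 x2. ft.coord (?inner x1 x2) i)" unfolding f_def
    by (rule sweedler_eval[OF W], rule inner(1), rule b2)
  also have "\<dots> = \<phi> m * \<phi> m' * tform (snd i) x y"
    unfolding inner' tform_def by (rule swd_scale)
  finally show "ft.coord f i = \<phi> m * \<phi> m' * tform (snd i) x y" .
qed

lemma
  assumes U: "U \<in> carrier TA" and V: "V \<in> carrier TA"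
  shows TA_mult_closed: "U \<otimes>\<^bsub>TA\<^esub> V \<in> carrier TA"
    and TA_mult: "xi (U \<otimes>\<^bsub>TA\<^esub> V) = sc_mul n sconst (xi U) (xi V)"
proof -
  let ?\<Lambda> = "\<lambda>i v w. sc_mul n sconst (\<lambda>a. v ((), a)) (\<lambda>a. w ((), a)) (snd i)"
  let ?f = "\<lambda>m x m' y. sweedler \<Delta> ft.T x (\<lambda>x1 x2. sweedler \<Delta> ft.T y (\<lambda>y1 y2.
      ft.tens (m \<otimes>\<^bsub>R\<^esub> m' \<otimes>\<^bsub>R\<^esub> \<gamma> x1 y1) (x2 * y2)))"
  have eq: "U \<otimes>\<^bsub>TA\<^esub> V = tensor_lift ft.T (\<lambda>m x. tensor_lift ft.T (\<lambda>m' y. ?f m x m' y) V) U"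
    by (simp add: twisted_algebra_def Let_def)
  have \<chi>f: "ft.coord (?f m x m' y) i = ?\<Lambda> i (ft.coord (ft.tens m x)) (ft.coord (ft.tens m' y))"
    if "m \<in> carrier R" "m' \<in> carrier R" for m x m' y i
  proof (cases "snd i < n")
    case True
    have "ft.coord (?f m x m' y) i = \<phi> m * \<phi> m' * tform (snd i) x y" by (rule mult_coord_pure(2)[OF that])
    also have "\<dots> = \<phi> m * \<phi> m' * (\<Sum>a<n. \<Sum>b<n. h (crd a x) * h (crd b y) * sconst a b (snd i))"
      unfolding sconst_def bil_expand[OF tform_bil, of _ x y] ..
    also have "\<dots> = ?\<Lambda> i (ft.coord (ft.tens m x)) (ft.coord (ft.tens m' y))"
      using True that by (simp add: sc_mul_def ft.coord_pure sum_distrib_left mult_ac)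
    finally show ?thesis .
  next
    case False
    \<comment> \<open>For indices from \<open>n\<close> on, the coordinates vanish and
      \<open>sc_mul\<close> is 0 by default.\<close>
    have "ft.coord (?f m x m' y) i = 0"
      using ft.coord_outside[OF mult_coord_pure(1)[OF that], of "snd i" _ _ "fst i"] False by (cases i) auto
    then show ?thesis using False by (simp add: sc_mul_def)
  qed
  have add: "?\<Lambda> i (\<lambda>i. v i + w i) u = ?\<Lambda> i v u + ?\<Lambda> i w u" "?\<Lambda> i u (\<lambda>i. v i + w i) = ?\<Lambda> i u v + ?\<Lambda> i u w" for i v w u
    by (simp_all add: sc_mul_def algebra_simps sum.distrib)
  have U': "U \<in> carrier ft.T" and V': "V \<in> carrier ft.T" using U V by (simp_all add: TA_simps)
  show "U \<otimes>\<^bsub>TA\<^esub> V \<in> carrier TA"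
    unfolding eq TA_simps
    by (rule ft.lift_bilinear(1)[where \<Lambda>="?\<Lambda>", OF ft.coord_emb mult_coord_pure(1) \<chi>f add U' V'])
  show "xi (U \<otimes>\<^bsub>TA\<^esub> V) = sc_mul n sconst (xi U) (xi V)"
  proof
    fix l
    have "ft.coord (U \<otimes>\<^bsub>TA\<^esub> V) ((), l) = ?\<Lambda> ((), l) (ft.coord U) (ft.coord V)"
      unfolding eq
      by (rule ft.lift_bilinear(2)[where \<Lambda>="?\<Lambda>", OF ft.coord_emb mult_coord_pure(1) \<chi>f add U' V'])
    then show "xi (U \<otimes>\<^bsub>TA\<^esub> V) l = sc_mul n sconst (xi U) (xi V) l" by (simp add: xi_def[abs_def])
  qed
qed

lemma
  assumes b: "b \<in> carrier R" and U: "U \<in> carrier TA"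
  shows TA_smult_closed: "b \<odot>\<^bsub>TA\<^esub> U \<in> carrier TA"
    and TA_smult: "xi (b \<odot>\<^bsub>TA\<^esub> U) l = \<phi> b * xi U l"
proof -
  have eq: "b \<odot>\<^bsub>TA\<^esub> U = tensor_lift ft.T (\<lambda>c x. ft.tens (b \<otimes>\<^bsub>R\<^esub> c) x) U"
    by (simp add: twisted_algebra_def Let_def)
  have U': "U \<in> carrier ft.T" using U by (simp add: TA_simps)
  have 1: "ft.tens (b \<otimes>\<^bsub>R\<^esub> c) x \<in> carrier ft.T" if "c \<in> carrier R" for c x
    using that b by (auto intro!: ft.tens_closed cring_embedding_simps(3)[OF R_emb])
  have 2: "ft.coord (ft.tens (b \<otimes>\<^bsub>R\<^esub> c) x) i = \<phi> b * ft.coord (ft.tens c x) i" if "c \<in> carrier R" for c x i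
    using that b by (simp add: ft.coord_pure cring_embedding_simps(3,4)[OF R_emb])
  show "b \<odot>\<^bsub>TA\<^esub> U \<in> carrier TA"
    unfolding eq TA_simps
    by (rule ft.lift_linear(1)[where \<Lambda>="\<lambda>i v. \<phi> b * v i"
        and f="\<lambda>c x. ft.tens (b \<otimes>\<^bsub>R\<^esub> c) x", OF ft.coord_emb 1 2 distrib_left U'])
  show "xi (b \<odot>\<^bsub>TA\<^esub> U) l = \<phi> b * xi U l"
    unfolding eq xi_def
    by (rule ft.lift_linear(2)[where \<Lambda>="\<lambda>i v. \<phi> b * v i"
        and f="\<lambda>c x. ft.tens (b \<otimes>\<^bsub>R\<^esub> c) x", OF ft.coord_emb 1 2 distrib_left U'])
qed

text \<open>The structure constants are the convolution over H tensor H of the cocycle with a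
  coordinate of the product. This is the form to which the gauge computation applies.\<close>

lemma sconst_conv:
  assumes "i < n" "j < n" "l < n"
  shows "sconst i j l = coalgebra_constants.conv ({..<n} \<times> {..<n})
    (\<lambda>i j k. h (c (fst i) (fst j) (fst k)) * h (c (snd i) (snd j) (snd k)))
    (\<lambda>k. \<phi> (\<gamma> (e (fst k)) (e (snd k)))) (\<lambda>k. h (\<mu> (fst k) (snd k) l)) (i, j)"
proof -
  interpret H: hopf_constants n "\<lambda>i j k. h (c i j k)" "\<lambda>i. h (\<epsilon> (e i))" "\<lambda>i j k. h (\<mu> i j k)"
    by (rule hopf_constants_hom[OF comm_ring_hom_axioms hopf_constants])
  have "sconst i j l = (\<Sum>a<n. \<Sum>b<n. \<Sum>a'<n. \<Sum>b'<n.
      h (c i a b) * h (c j a' b') * \<phi> (\<gamma> (e a) (e a')) * h (\<mu> b b' l))"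
    unfolding sconst_def tform_def swd_def c_def \<mu>_def sum_distrib_left by (simp only: mult.assoc)
  also have "\<dots> = (\<Sum>a<n. \<Sum>a'<n. \<Sum>b<n. \<Sum>b'<n.
      h (c i a b) * h (c j a' b') * \<phi> (\<gamma> (e a) (e a')) * h (\<mu> b b' l))"
    by (intro sum.cong refl sum.swap)
  finally show ?thesis unfolding H.pair.conv_def H.sum_sq fst_conv snd_conv .
qed

end

section \<open>Twisted algebras in coordinates\<close>

lemma algebra_via_simps [simp]:
  "carrier (algebra_via \<psi> A) = carrier A"
  "x \<oplus>\<^bsub>algebra_via \<psi> A\<^esub> y = x \<oplus>\<^bsub>A\<^esub> y"
  "x \<otimes>\<^bsub>algebra_via \<psi> A\<^esub> y = x \<otimes>\<^bsub>A\<^esub> y"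
  "\<zero>\<^bsub>algebra_via \<psi> A\<^esub> = \<zero>\<^bsub>A\<^esub>"
  "\<one>\<^bsub>algebra_via \<psi> A\<^esub> = \<one>\<^bsub>A\<^esub>"
  "r \<odot>\<^bsub>algebra_via \<psi> A\<^esub> x = \<psi> r \<otimes>\<^bsub>A\<^esub> x"
  by (simp_all add: algebra_via_def)

lemma algebra_via_embedding: "cring_embedding A \<phi> \<Longrightarrow> cring_embedding (algebra_via \<psi> A) \<phi>"
  by (erule cring_embedding_cong) simp_all

lemma cring_embedding_one_not_zero:
  assumes "cring_embedding D (\<phi> :: 'a \<Rightarrow> 'f::field)"
  shows "\<one>\<^bsub>D\<^esub> \<noteq> \<zero>\<^bsub>D\<^esub>"
proof
  assume "\<one>\<^bsub>D\<^esub> = \<zero>\<^bsub>D\<^esub>"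
  then have "\<phi> \<one>\<^bsub>D\<^esub> = \<phi> \<zero>\<^bsub>D\<^esub>" by (rule arg_cong)
  then show False using cring_embedding_simps(6,8)[OF assms] by simp
qed

lemma comm_ring_hom_inj:
  fixes h :: "'k::field \<Rightarrow> 'f::field"
  assumes "comm_ring_hom h" "h a = h b" shows "a = b"
proof (rule ccontr)
  interpret h: comm_ring_hom h by fact
  assume "a \<noteq> b"
  then have "h ((a - b) * inverse (a - b)) = 1" by simp
  moreover have "h ((a - b) * inverse (a - b)) = 0"
    unfolding h.hom_mult h.hom_minus using assms(2) by simp
  ultimately show False by simp
qed

context twisted
begin

lemma u_vecs_one:
  assumes "inv\<^bsub>R\<^esub> (\<gamma> 1 1) \<in> carrier R"
  shows "\<one>\<^bsub>TA\<^esub> \<in> carrier TA" "xi \<one>\<^bsub>TA\<^esub> = (\<lambda>l. \<phi> (inv\<^bsub>R\<^esub> (\<gamma> 1 1)) * h (crd l 1))"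
  using assms by (auto simp: TA_simps xi_pure fun_eq_iff intro!: ft.tens_closed)

lemma semisimple_coordinates:
  assumes ss: "semisimple_ring TA" and inv: "inv\<^bsub>R\<^esub> (\<gamma> 1 1) \<in> carrier R"
  shows "semisimple_ring (sc_ring n (\<phi> ` carrier R) sconst (\<lambda>l. \<phi> (inv\<^bsub>R\<^esub> (\<gamma> 1 1)) * h (crd l 1)))"
proof (rule semisimple_ring_transfer[OF ss])
  show "bij_betw xi (carrier TA) (carrier (sc_ring n (\<phi> ` carrier R) sconst (\<lambda>l. \<phi> (inv\<^bsub>R\<^esub> (\<gamma> 1 1)) * h (crd l 1))))"
    unfolding bij_betw_def
  proof
    show "inj_on xi (carrier TA)" by (rule inj_onI) (rule joint_embedding_inj[OF xi_emb], auto)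
    show "xi ` carrier TA = carrier (sc_ring n (\<phi> ` carrier R) sconst (\<lambda>l. \<phi> (inv\<^bsub>R\<^esub> (\<gamma> 1 1)) * h (crd l 1)))"
      using xi_vecs xi_surj by (fastforce simp: image_iff)
  qed
qed (auto simp: TA_mult u_vecs_one[OF inv] joint_embedding_add[OF xi_emb] joint_embedding_zero[OF xi_emb])

abbreviation "Q \<equiv> fraction_algebra R"
abbreviation "\<psi> \<equiv> fraction_value \<phi>"

lemma Q_emb: "cring_embedding Q \<psi>"
  unfolding fraction_algebra_def by (rule algebra_via_embedding[OF fraction_field_embedding[OF R_emb]])

lemma Q_smult:
  assumes "r \<in> carrier R" "q \<in> carrier Q"
  shows "r \<odot>\<^bsub>Q\<^esub> q \<in> carrier Q" "\<psi> (r \<odot>\<^bsub>Q\<^esub> q) = \<phi> r * \<psi> q"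
proof -
  have f: "fraction R r \<one>\<^bsub>R\<^esub> \<in> carrier (fraction_field R)" "\<psi> (fraction R r \<one>\<^bsub>R\<^esub>) = \<phi> r"
    using fraction_carrier[OF R_emb assms(1)] fraction_value[OF R_emb assms(1)]
      cring_embedding_simps(7,8)[OF R_emb] cring_embedding_one_not_zero[OF R_emb] by simp_all
  have q: "q \<in> carrier (fraction_field R)" using assms(2) by (simp add: fraction_algebra_def)
  show "r \<odot>\<^bsub>Q\<^esub> q \<in> carrier Q" "\<psi> (r \<odot>\<^bsub>Q\<^esub> q) = \<phi> r * \<psi> q"
    using cring_embedding_simps(3,4)[OF fraction_field_embedding[OF R_emb] f(1) q] f(2)
    by (simp_all add: fraction_algebra_def)
qed

text \<open>The twisted algebra is free over \<open>R\<close> on the elements 1 tensor e_i, so the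
  free-tensor machinery applies to extension of scalars along \<open>R\<close>, with coordinates
  \<open>xi\<close>.\<close>

lemma fraction_tensor: "free_tensor R Q TA \<phi> (\<lambda>q (_::unit). \<psi> q) xi {..<n} (\<lambda>i. ft.tens \<one>\<^bsub>R\<^esub> (e i))"
proof (intro free_tensor.intro free_tensor_axioms.intro tensor_pair.intro)
  show "joint_embedding Q (\<lambda>q (_::unit). \<psi> q)" by (rule cring_embedding_joint[OF Q_emb])
  then show "abelian_group Q" by (simp add: joint_embedding_def)
  show "joint_embedding TA xi" by (rule xi_emb)
  then show "abelian_group TA" by (simp add: joint_embedding_def)
  show "xi U l = 0" if "U \<in> carrier TA" "l \<notin> {..<n}" for U l
    using xi_vecs[OF that(1)] that(2) by (simp add: vecs_def)
  show "xi U l \<in> \<phi> ` carrier R" if "U \<in> carrier TA" "l \<in> {..<n}" for U l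
    using xi_vecs[OF that(1)] that(2) by (simp add: vecs_def)
  show "ft.tens \<one>\<^bsub>R\<^esub> (e l) \<in> carrier TA" for l
    by (auto simp: TA_simps cring_embedding_simps(7)[OF R_emb] intro!: ft.tens_closed)
  show "xi (ft.tens \<one>\<^bsub>R\<^esub> (e l)) l' = (if l = l' then 1 else 0)" if "l \<in> {..<n}" for l l'
    using that by (simp add: xi_pure cring_embedding_simps(7,8)[OF R_emb] crd_e)
qed (simp_all add: Q_smult TA_smult_closed TA_smult)

text \<open>Extension of scalars keeps the structure constants and only enlarges the set of
  admissible coordinates. The coordinate map is thus an isomorphism onto an algebra given by
  constants, from which even the ring laws are pulled back.\<close>

lemma semisimple_base_change:
  assumes inv: "inv\<^bsub>R\<^esub> (\<gamma> 1 1) \<in> carrier R"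
    and ss: "semisimple_ring (sc_ring n (\<psi> ` carrier Q) sconst (\<lambda>l. \<phi> (inv\<^bsub>R\<^esub> (\<gamma> 1 1)) * h (crd l 1)))"
  shows "semisimple_ring (tensor_algebra R Q TA)"
proof -
  interpret fr: free_tensor R Q TA \<phi> "\<lambda>q (_::unit). \<psi> q" xi "{..<n}" "\<lambda>i. ft.tens \<one>\<^bsub>R\<^esub> (e i)"
    by (rule fraction_tensor)
  define zeta where "zeta U l = fr.coord U ((), l)" for U l
  have zeta_emb: "joint_embedding (tensor_algebra R Q TA) zeta"
    using fr.coord_emb_algebra unfolding joint_embedding_def zeta_def by (simp add: split_paired_all)
  have one_Q: "\<one>\<^bsub>Q\<^esub> \<in> carrier Q" "\<psi> \<one>\<^bsub>Q\<^esub> = 1" using cring_embedding_simps(7,8)[OF Q_emb] by simp_all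
  have vecs: "zeta U \<in> vecs n (\<psi> ` carrier Q)" if U: "U \<in> carrier fr.T" for U
    unfolding vecs_def mem_Collect_eq
  proof (intro conjI allI impI)
    fix i assume "i < n"
    then obtain q where "q \<in> carrier Q" "fr.coord U ((), i) = \<psi> q"
      using fr.coord_range[OF U, of i] by auto
    then show "zeta U i \<in> \<psi> ` carrier Q" by (simp add: zeta_def)
  next
    fix i assume "n \<le> i"
    then show "zeta U i = 0" using fr.coord_outside[OF U, of i] by (simp add: zeta_def)
  qed
  have surj: "\<exists>U\<in>carrier fr.T. zeta U = v" if v: "v \<in> vecs n (\<psi> ` carrier Q)" for v
  proof -
    have "\<forall>l. \<exists>r. l < n \<longrightarrow> r \<in> carrier Q \<and> v l = \<psi> r" using v by (auto simp: vecs_def)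
    from choice[OF this] obtain m where m: "\<And>l. l < n \<Longrightarrow> m l \<in> carrier Q \<and> v l = \<psi> (m l)" by blast
    obtain U where U: "U \<in> carrier fr.T" "\<And>p l. fr.coord U (p, l) = (if l \<in> {..<n} then \<psi> (m l) else 0)"
      using fr.coord_surj[of m] m by auto
    have "zeta U l = v l" for l
      using U(2)[of "()" l] m[of l] v by (cases "l < n") (auto simp: zeta_def vecs_def)
    then show ?thesis using U(1) by blast
  qed
  let ?A = "sc_ring n (\<psi> ` carrier Q) sconst (\<lambda>l. \<phi> (inv\<^bsub>R\<^esub> (\<gamma> 1 1)) * h (crd l 1))"
  have mult: "U \<otimes>\<^bsub>tensor_algebra R Q TA\<^esub> V \<in> carrier fr.T \<and>
      zeta (U \<otimes>\<^bsub>tensor_algebra R Q TA\<^esub> V) = sc_mul n sconst (zeta U) (zeta V)"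
    if U: "U \<in> carrier fr.T" and V: "V \<in> carrier fr.T" for U V
  proof -
    let ?\<Lambda> = "\<lambda>i v w. sc_mul n sconst (\<lambda>a. v ((), a)) (\<lambda>a. w ((), a)) (snd i)"
    let ?f = "\<lambda>m x m' y. fr.tens (m \<otimes>\<^bsub>Q\<^esub> m') (x \<otimes>\<^bsub>TA\<^esub> y)"
    have eq: "U \<otimes>\<^bsub>tensor_algebra R Q TA\<^esub> V = tensor_lift fr.T (\<lambda>m x. tensor_lift fr.T (\<lambda>m' y. ?f m x m' y) V) U"
      by (simp add: tensor_algebra_def Let_def)
    have closed: "?f m x m' y \<in> carrier fr.T"
      if "m \<in> carrier Q" "x \<in> carrier TA" "m' \<in> carrier Q" "y \<in> carrier TA" for m x m' y
      using that by (intro fr.tens_closed cring_embedding_simps(3)[OF Q_emb] TA_mult_closed)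
    have \<chi>f: "fr.coord (?f m x m' y) i = ?\<Lambda> i (fr.coord (fr.tens m x)) (fr.coord (fr.tens m' y))"
      if "m \<in> carrier Q" "x \<in> carrier TA" "m' \<in> carrier Q" "y \<in> carrier TA" for m x m' y i
    proof -
      have "fr.coord (?f m x m' y) i = \<psi> m * \<psi> m' * sc_mul n sconst (xi x) (xi y) (snd i)"
        using that by (simp add: fr.coord_pure cring_embedding_simps(3,4)[OF Q_emb] TA_mult TA_mult_closed)
      also have "\<dots> = ?\<Lambda> i (fr.coord (fr.tens m x)) (fr.coord (fr.tens m' y))"
        using that by (simp add: sc_mul_def fr.coord_pure sum_distrib_left mult_ac)
      finally show ?thesis .
    qed
    have add: "?\<Lambda> i (\<lambda>i. v i + w i) u = ?\<Lambda> i v u + ?\<Lambda> i w u" "?\<Lambda> i u (\<lambda>i. v i + w i) = ?\<Lambda> i u v + ?\<Lambda> i u w" for i v w u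
      by (simp_all add: sc_mul_def algebra_simps sum.distrib)
    have 1: "U \<otimes>\<^bsub>tensor_algebra R Q TA\<^esub> V \<in> carrier fr.T"
      unfolding eq by (rule fr.lift_bilinear(1)[where \<Lambda>="?\<Lambda>", OF fr.coord_emb closed \<chi>f add U V])
    have "fr.coord (U \<otimes>\<^bsub>tensor_algebra R Q TA\<^esub> V) ((), l) = ?\<Lambda> ((), l) (fr.coord U) (fr.coord V)" for l
      unfolding eq by (rule fr.lift_bilinear(2)[where \<Lambda>="?\<Lambda>", OF fr.coord_emb closed \<chi>f add U V])
    then have "zeta (U \<otimes>\<^bsub>tensor_algebra R Q TA\<^esub> V) = sc_mul n sconst (zeta U) (zeta V)"
      by (simp add: zeta_def[abs_def])
    with 1 show ?thesis by blast
  qed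
  show ?thesis
  proof (rule semisimple_ring_transfer_back[OF ss])
    show "bij_betw zeta (carrier (tensor_algebra R Q TA)) (carrier ?A)"
      unfolding bij_betw_def
    proof
      show "inj_on zeta (carrier (tensor_algebra R Q TA))"
        by (rule inj_onI) (rule joint_embedding_inj[OF zeta_emb], auto)
      show "zeta ` carrier (tensor_algebra R Q TA) = carrier ?A"
      proof
        show "zeta ` carrier (tensor_algebra R Q TA) \<subseteq> carrier ?A" using vecs by auto
        show "carrier ?A \<subseteq> zeta ` carrier (tensor_algebra R Q TA)" using surj by force
      qed
    qed
    show "x \<oplus>\<^bsub>tensor_algebra R Q TA\<^esub> y \<in> carrier (tensor_algebra R Q TA) \<and>
        zeta (x \<oplus>\<^bsub>tensor_algebra R Q TA\<^esub> y) = zeta x \<oplus>\<^bsub>?A\<^esub> zeta y"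
      if "x \<in> carrier (tensor_algebra R Q TA)" "y \<in> carrier (tensor_algebra R Q TA)" for x y
    proof
      show "x \<oplus>\<^bsub>tensor_algebra R Q TA\<^esub> y \<in> carrier (tensor_algebra R Q TA)" using that by simp
      show "zeta (x \<oplus>\<^bsub>tensor_algebra R Q TA\<^esub> y) = zeta x \<oplus>\<^bsub>?A\<^esub> zeta y"
        by (rule ext) (use joint_embedding_add[OF zeta_emb that] in simp)
    qed
    show "x \<otimes>\<^bsub>tensor_algebra R Q TA\<^esub> y \<in> carrier (tensor_algebra R Q TA) \<and>
        zeta (x \<otimes>\<^bsub>tensor_algebra R Q TA\<^esub> y) = zeta x \<otimes>\<^bsub>?A\<^esub> zeta y"
      if "x \<in> carrier (tensor_algebra R Q TA)" "y \<in> carrier (tensor_algebra R Q TA)" for x y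
      using mult that by simp
    show "\<one>\<^bsub>tensor_algebra R Q TA\<^esub> \<in> carrier (tensor_algebra R Q TA)"
      using one_Q u_vecs_one(1)[OF inv] by (simp add: fr.tens_closed)
    show "zeta \<one>\<^bsub>tensor_algebra R Q TA\<^esub> = \<one>\<^bsub>?A\<^esub>"
      by (rule ext) (use one_Q u_vecs_one[OF inv] in \<open>simp add: zeta_def fr.coord_pure\<close>)
    show "\<zero>\<^bsub>tensor_algebra R Q TA\<^esub> \<in> carrier (tensor_algebra R Q TA)" by simp
    show "zeta \<zero>\<^bsub>tensor_algebra R Q TA\<^esub> = \<zero>\<^bsub>?A\<^esub>"
      by (rule ext) (use joint_embedding_zero[OF zeta_emb] in simp)
  qed
qed

end

section \<open>Iterated Sweedler sums\<close>

context hopf_forms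
begin

lemma
  assumes R: "cring_embedding R \<phi>" and f: "\<And>x y. f x y \<in> carrier R" and b: "bil (\<lambda>x y. \<phi> (f x y))"
  shows sweedler_ring_closed: "sweedler \<Delta> R x f \<in> carrier R"
    and sweedler_ring: "\<phi> (sweedler \<Delta> R x f) = swd x (\<lambda>x y. \<phi> (f x y))"
proof -
  note W = cring_embedding_joint[OF R]
  show "sweedler \<Delta> R x f \<in> carrier R" by (rule sweedler_closed[OF W], rule f, rule b)
  show "\<phi> (sweedler \<Delta> R x f) = swd x (\<lambda>x y. \<phi> (f x y))"
    by (rule sweedler_eval[OF W], rule f, rule b)
qed

definition tri :: "('h \<Rightarrow> 'h \<Rightarrow> 'h \<Rightarrow> 'f) \<Rightarrow> bool" where
  "tri g \<longleftrightarrow> (\<forall>y z. lin (\<lambda>x. g x y z)) \<and> (\<forall>x z. lin (\<lambda>y. g x y z)) \<and> (\<forall>x y. lin (g x y))"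

definition swd3 :: "'h \<Rightarrow> ('h \<Rightarrow> 'h \<Rightarrow> 'h \<Rightarrow> 'f) \<Rightarrow> 'f" where
  "swd3 x g = swd x (\<lambda>x1 x'. swd x' (g x1))"

lemma lin_swd3 [intro]: "lin (\<lambda>x. swd3 x g)"
  unfolding swd3_def by (rule lin_swd)

lemma lin_swd3_arg [intro]: "(\<And>i j k. lin (\<lambda>x. g x (e i) (e j) (e k))) \<Longrightarrow> lin (\<lambda>x. swd3 y (g x))"
  unfolding swd3_def by (intro lin_swd_arg)

lemma swd3_one: "tri g \<Longrightarrow> swd3 1 g = g 1 1 1"
proof -
  assume g: "tri g"
  have "swd3 1 g = swd 1 (g 1)" unfolding swd3_def
    by (rule swd_one) (use g in \<open>auto simp: bil_def tri_def intro!: lin_swd lin_swd_arg\<close>)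
  also have "\<dots> = g 1 1 1" by (rule swd_one) (use g in \<open>auto simp: bil_def tri_def\<close>)
  finally show ?thesis .
qed

lemma
  assumes R: "cring_embedding R \<phi>" and f: "\<And>x y z. f x y z \<in> carrier R" and b: "tri (\<lambda>x y z. \<phi> (f x y z))"
  shows sweedler3_ring_closed: "sweedler3 \<Delta> R x f \<in> carrier R"
    and sweedler3_ring: "\<phi> (sweedler3 \<Delta> R x f) = swd3 x (\<lambda>x y z. \<phi> (f x y z))"
proof -
  have b1: "bil (\<lambda>y z. \<phi> (f x y z))" for x using b by (auto simp: bil_def tri_def)
  have inner: "sweedler \<Delta> R x' (f x1) \<in> carrier R"
    "\<phi> (sweedler \<Delta> R x' (f x1)) = swd x' (\<lambda>y z. \<phi> (f x1 y z))" for x' x1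
    by (rule sweedler_ring_closed[OF R], rule f, rule b1, rule sweedler_ring[OF R], rule f, rule b1)
  have b2: "bil (\<lambda>x1 x'. \<phi> (sweedler \<Delta> R x' (f x1)))"
    unfolding inner(2) bil_def using b by (auto simp: tri_def intro!: lin_swd lin_swd_arg)
  show "sweedler3 \<Delta> R x f \<in> carrier R" unfolding sweedler3_def
    by (rule sweedler_ring_closed[OF R], rule inner(1), rule b2)
  have "\<phi> (sweedler3 \<Delta> R x f) = swd x (\<lambda>x1 x'. \<phi> (sweedler \<Delta> R x' (f x1)))" unfolding sweedler3_def
    by (rule sweedler_ring[OF R], rule inner(1), rule b2)
  then show "\<phi> (sweedler3 \<Delta> R x f) = swd3 x (\<lambda>x y z. \<phi> (f x y z))"
    unfolding inner(2) swd3_def .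
qed

end

section \<open>The generic linear form\<close>

lemma (in polynomial_evaluation) peval_hom: "comm_ring_hom (peval h g)"
  by (rule peval.comm_ring_hom_axioms)

lemma Const_zero: "Const 0 = 0"
  by (simp add: Const_def)

lemma to_fract_hom: "comm_ring_hom (to_fract :: 'a::idom \<Rightarrow> 'a fract)"
  by unfold_locales auto

text \<open>The large field: fractions of the polynomial ring with indeterminates indexed by natural
  numbers. Its first \<open>n\<close> indeterminates are the values of t on the basis.\<close>

locale universal = hopf_forms scale \<Delta> \<epsilon> antipode n e crd "\<lambda>a. to_fract (Const a :: ('k, nat) polys)"
  for scale :: "'k::field \<Rightarrow> 'h::ring_1 \<Rightarrow> 'h" and \<Delta> \<epsilon> antipode n e crd
begin

abbreviation emb :: "'k \<Rightarrow> ('k, nat) polys fract" where "emb a \<equiv> to_fract (Const a)"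
abbreviation "K \<equiv> sym_field scale"
abbreviation "\<Phi> \<equiv> fraction_value sym_value"

sublocale HF: hopf_constants n "\<lambda>i j k. emb (c i j k)" "\<lambda>i. emb (\<epsilon> (e i))" "\<lambda>i j k. emb (\<mu> i j k)"
  by (rule hopf_constants_hom[OF comm_ring_hom_axioms hopf_constants])

notation HF.conv (infixl "\<star>" 70)
notation HF.pair.conv (infixl "\<star>\<star>" 70)

lemma K_emb: "cring_embedding K \<Phi>"
  unfolding sym_field_def by (rule algebra_via_embedding[OF fraction_field_embedding[OF sym_value_embedding]])

lemma sym_fraction:
  "fraction (symmetric_algebra scale) (sym_class scale p) \<one>\<^bsub>symmetric_algebra scale\<^esub> \<in> carrier K"
  "\<Phi> (fraction (symmetric_algebra scale) (sym_class scale p) \<one>\<^bsub>symmetric_algebra scale\<^esub>) = to_fract (sym_eval p)"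
proof -
  have p: "sym_class scale p \<in> carrier (symmetric_algebra scale)"
    unfolding symmetric_algebra_simps by (rule rangeI)
  have one: "\<one>\<^bsub>symmetric_algebra scale\<^esub> \<in> carrier (symmetric_algebra scale)"
    "\<one>\<^bsub>symmetric_algebra scale\<^esub> \<noteq> \<zero>\<^bsub>symmetric_algebra scale\<^esub>"
    using cring_embedding_simps(7)[OF sym_value_embedding] cring_embedding_one_not_zero[OF sym_value_embedding] by auto
  show "fraction (symmetric_algebra scale) (sym_class scale p) \<one>\<^bsub>symmetric_algebra scale\<^esub> \<in> carrier K"
    using fraction_carrier[OF sym_value_embedding p one] by (simp add: sym_field_def)
  have "sym_value \<one>\<^bsub>symmetric_algebra scale\<^esub> = 1" by (rule cring_embedding_simps(8)[OF sym_value_embedding])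
  then show "\<Phi> (fraction (symmetric_algebra scale) (sym_class scale p) \<one>\<^bsub>symmetric_algebra scale\<^esub>) = to_fract (sym_eval p)"
    using fraction_value[OF sym_value_embedding p one] by (simp add: sym_value_class)
qed

lemma K_smult:
  assumes "x \<in> carrier K" shows "a \<odot>\<^bsub>K\<^esub> x \<in> carrier K" "\<Phi> (a \<odot>\<^bsub>K\<^esub> x) = emb a * \<Phi> x"
proof -
  note a = sym_fraction[of "Const a"]
  have eq: "a \<odot>\<^bsub>K\<^esub> x = fraction (symmetric_algebra scale) (sym_class scale (Const a)) \<one>\<^bsub>symmetric_algebra scale\<^esub> \<otimes>\<^bsub>K\<^esub> x"
    by (simp add: sym_field_def)
  show "a \<odot>\<^bsub>K\<^esub> x \<in> carrier K" unfolding eq by (rule cring_embedding_simps(3)[OF K_emb a(1) assms])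
  show "\<Phi> (a \<odot>\<^bsub>K\<^esub> x) = emb a * \<Phi> x"
    unfolding eq cring_embedding_simps(4)[OF K_emb a(1) assms] a(2) by (simp add: ev.peval_Const)
qed

lemma K_scalar: "a \<odot>\<^bsub>K\<^esub> \<one>\<^bsub>K\<^esub> \<in> carrier K" "\<Phi> (a \<odot>\<^bsub>K\<^esub> \<one>\<^bsub>K\<^esub>) = emb a"
  using K_smult[OF cring_embedding_simps(7)[OF K_emb]] cring_embedding_simps(8)[OF K_emb] by simp_all

text \<open>\<open>\<Phi>\<close> is not onto in general, as indeterminates with index from
  \<open>n\<close> on do not occur in its image. When elements of \<open>K\<close> are built from
  their values, membership in this image has to be tracked.\<close>

lemma K_subfield: "subfield_set (\<Phi> ` carrier K)"
  using fraction_field_subfield[OF sym_value_embedding] by (simp add: sym_field_def)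

lemma t_elem: "t_elem scale x \<in> carrier K" "\<Phi> (t_elem scale x) = to_fract (lin_form x)"
  unfolding t_elem_def using sym_fraction[of "Indet x"] by (simp_all add: ev.peval_Indet)

lemma t_lin: "lin (\<lambda>x. \<Phi> (t_elem scale x))"
  unfolding t_elem lin_def by (simp add: lin_form_add lin_form_scale)

definition t :: "nat \<Rightarrow> ('k, nat) polys fract" where
  "t i = \<Phi> (t_elem scale (e i))"

lemma lin_form_e: "i < n \<Longrightarrow> lin_form (e i) = Indet i"
proof -
  assume i: "i < n"
  have "Const (crd j (e i)) * Indet j = (if j = i then Indet i else 0 :: ('k, nat) polys)" for j
    unfolding crd_e[OF i] by (simp add: Const_one Const_zero)
  then show ?thesis unfolding lin_form_def using i by simp
qed

lemma swd_conv: "swd (e i) (\<lambda>x y. f x * g y) = ((\<lambda>i. f (e i)) \<star> (\<lambda>i. g (e i))) i"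
  unfolding swd_def HF.conv_def unfolding c_def by (simp only: mult.assoc)

text \<open>The matrix of the gauge map: convolving t with the coordinate form
  \<open>unitv l\<close> extracts the coefficient of \<open>e l\<close> in the sum of t(x_1) tensor
  x_2 at x = \<open>e i\<close>.\<close>

definition Theta :: "nat \<Rightarrow> nat \<Rightarrow> ('k, nat) polys fract" where
  "Theta i l = (t \<star> unitv l) i"

lemma Theta_eq: "l < n \<Longrightarrow> Theta i l = (\<Sum>a<n. emb (c i a l) * t a)"
  by (simp add: Theta_def HF.conv_def unitv_mult)

text \<open>Convolution with \<open>t\<close> is the action of \<open>Theta\<close> on column
  vectors, so the invertibility of this one matrix yields both the gauge isomorphism and the
  convolution inverse of t.\<close>

lemma conv_t: "(t \<star> f) i = (\<Sum>l<n. Theta i l * f l)"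
proof -
  have "(t \<star> f) i = (\<Sum>l<n. \<Sum>a<n. emb (c i a l) * t a * f l)"
    unfolding HF.conv_def by (rule sum.swap)
  also have "\<dots> = (\<Sum>l<n. Theta i l * f l)"
    by (rule sum.cong[OF refl]) (simp add: Theta_eq sum_distrib_right)
  finally show ?thesis .
qed

text \<open>Specialising \<open>t\<close> to the counit turns \<open>Theta\<close> into the identity matrix, so its determinant is a
  nonzero polynomial.\<close>

lemma Theta_injective:
  assumes v: "v \<in> vecs n UNIV" and 0: "\<And>i. i < n \<Longrightarrow> (\<Sum>l<n. Theta i l * v l) = 0"
  shows "v = 0"
proof -
  \<comment> \<open>The entries are first written as polynomials, because the specialisation is
    defined on polynomials and not on fractions. The determinant is nonzero there and remains so in
    the field of fractions.\<close>
  let ?P = "\<lambda>i l. \<Sum>a<n. Const (c i a l) * Indet a :: ('k, nat) polys"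
  define A where "A = mat n n (\<lambda>(i, l). ?P i l)"
  have A: "A \<in> carrier_mat n n" by (simp add: A_def)
  interpret fr: comm_ring_hom "to_fract :: ('k, nat) polys \<Rightarrow> _" by (rule to_fract_hom)
  let ?s = "peval (\<lambda>x::'k. x) (\<lambda>a::nat. \<epsilon> (e a))"
  have pe: "polynomial_evaluation (\<lambda>x::'k. x)"
    unfolding polynomial_evaluation_def by (rule id_hom)
  note pe_simps = polynomial_evaluation.peval_mult[OF pe] polynomial_evaluation.peval_Const[OF pe]
    polynomial_evaluation.peval_Indet[OF pe]
  interpret sp: comm_ring_hom ?s by (rule polynomial_evaluation.peval_hom[OF pe])
  \<comment> \<open>This is the left counit axiom: replacing t by the counit in the sum of t(x_1)
    tensor x_2 returns x.\<close>
  have s_entry: "?s (?P i l) = (if i = l then 1 else 0)" if "i < n" "l < n" for i l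
  proof -
    have "?s (?P i l) = (\<Sum>a<n. c i a l * \<epsilon> (e a))"
      by (simp only: sp.hom_sum pe_simps)
    also have "\<dots> = crd l (e i)" unfolding c_def by (rule counit_left_coord)
    finally show ?thesis using crd_e[OF that(1), of l] by auto
  qed
  have "map_mat ?s A = 1\<^sub>m n"
    by (rule eq_matI) (auto simp: A_def s_entry)
  then have "?s (det A) = 1" using sp.hom_det[of A] by simp
  then have "det A \<noteq> 0" by auto
  then have det: "det (map_mat to_fract A) \<noteq> 0" by simp
  have x: "vec n v \<in> carrier_vec n" by simp
  have entry: "to_fract (?P i l) = Theta i l" if "l < n" for i l
    using that by (simp add: Theta_eq fr.hom_sum t_def t_elem lin_form_e)
  have "map_mat to_fract A *\<^sub>v vec n v = 0\<^sub>v n"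
  proof (rule eq_vecI)
    fix i assume i: "i < dim_vec (0\<^sub>v n :: ('k, nat) polys fract vec)"
    then have "(map_mat to_fract A *\<^sub>v vec n v) $ i = (\<Sum>l<n. to_fract (?P i l) * v l)"
      by (simp add: A_def scalar_prod_def atLeast0LessThan)
    also have "\<dots> = 0" using 0[of i] i entry by simp
    finally show "(map_mat to_fract A *\<^sub>v vec n v) $ i = 0\<^sub>v n $ i" using i by simp
  qed (simp add: A_def)
  moreover have M: "map_mat to_fract A \<in> carrier_mat n n" using A by simp
  ultimately have "vec n v = 0\<^sub>v n"
    using det x unfolding det_0_iff_vec_prod_zero_field[OF M] by blast
  then have v_vec: "vec n v $ i = 0\<^sub>v n $ i" for i by simp
  have "v i = 0" if "i < n" for i using v_vec[of i] that by simp
  then show ?thesis using v vecs_zero[OF subfield_set_UNIV] by (intro vecs_eqI) auto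
qed

lemma conv_t_injective:
  assumes "\<And>i. i < n \<Longrightarrow> (t \<star> f) i = (t \<star> g) i" "i < n"
  shows "f i = g i"
proof -
  define v where "v = (\<lambda>i. if i < n then f i - g i else 0)"
  have "v = 0"
  proof (rule Theta_injective)
    show "v \<in> vecs n UNIV" by (simp add: v_def vecs_def)
    fix i assume "i < n"
    then have "(\<Sum>l<n. Theta i l * f l) - (\<Sum>l<n. Theta i l * g l) = 0"
      using assms(1) by (simp add: conv_t)
    then show "(\<Sum>l<n. Theta i l * v l) = 0"
      by (simp add: v_def sum_subtractf algebra_simps)
  qed
  then have "v i = 0" by simp
  then show ?thesis using assms(2) by (simp add: v_def)
qed

text \<open>The entries of \<open>Theta\<close> lie in the image of \<open>K\<close>, a subfield,
  and the adjugate formula keeps the inverse there; the values of t^{-1} can then be pulled back to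
  \<open>K\<close>.\<close>

lemma Theta_inverse:
  obtains Xi where "\<And>i j. i < n \<Longrightarrow> j < n \<Longrightarrow> Xi i j \<in> \<Phi> ` carrier K"
    "\<And>i j. i < n \<Longrightarrow> j < n \<Longrightarrow> (\<Sum>m<n. Theta i m * Xi m j) = (if i = j then 1 else 0)"
    "\<And>i j. i < n \<Longrightarrow> j < n \<Longrightarrow> (\<Sum>m<n. Xi i m * Theta m j) = (if i = j then 1 else 0)"
proof (rule matrix_inverse_subfield_set[OF K_subfield, of n Theta])
  show "Theta i j \<in> \<Phi> ` carrier K" if "j < n" for i j
  proof -
    have "emb a \<in> \<Phi> ` carrier K" for a
      unfolding K_scalar(2)[symmetric] by (rule imageI[OF K_scalar(1)])
    moreover have "t a \<in> \<Phi> ` carrier K" for a unfolding t_def using t_elem(1) by blast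
    ultimately show ?thesis unfolding Theta_eq[OF that]
      by (intro subfield_set_sum[OF K_subfield] subfield_set_ops(4)[OF K_subfield])
  qed
  show "v = 0" if "v \<in> vecs n UNIV" "\<And>i. i < n \<Longrightarrow> (\<Sum>j<n. Theta i j * v j) = 0" for v
    by (rule Theta_injective[OF that])
qed (rule that)

definition is_t_inv :: "('h \<Rightarrow> ('k, 'h) sym_fracs) \<Rightarrow> bool" where
  "is_t_inv s \<longleftrightarrow> linear_map scale K s \<and>
    (\<forall>h. sweedler \<Delta> K h (\<lambda>h1 h2. t_elem scale h1 \<otimes>\<^bsub>K\<^esub> s h2) = \<epsilon> h \<odot>\<^bsub>K\<^esub> \<one>\<^bsub>K\<^esub> \<and>
         sweedler \<Delta> K h (\<lambda>h1 h2. s h1 \<otimes>\<^bsub>K\<^esub> t_elem scale h2) = \<epsilon> h \<odot>\<^bsub>K\<^esub> \<one>\<^bsub>K\<^esub>)"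

lemma linear_map_K:
  assumes "linear_map scale K s"
  shows "s x \<in> carrier K" "lin (\<lambda>x. \<Phi> (s x))"
  using assms K_smult(2) cring_embedding_simps(2)[OF K_emb] by (auto simp: linear_map_def lin_def)

lemma counit_lin: "lin (\<lambda>x. emb (\<epsilon> x))"
  by (simp add: lin_def counit_add counit_scale Const_add Const_mult)

lemma K_product:
  assumes "\<And>x. f x \<in> carrier K" "lin (\<lambda>x. \<Phi> (f x))" "\<And>x. g x \<in> carrier K" "lin (\<lambda>x. \<Phi> (g x))"
  shows "sweedler \<Delta> K x (\<lambda>x1 x2. f x1 \<otimes>\<^bsub>K\<^esub> g x2) = \<epsilon> x \<odot>\<^bsub>K\<^esub> \<one>\<^bsub>K\<^esub> \<longleftrightarrow>
    swd x (\<lambda>x1 x2. \<Phi> (f x1) * \<Phi> (g x2)) = emb (\<epsilon> x)"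
proof -
  have 1: "f x \<otimes>\<^bsub>K\<^esub> g y \<in> carrier K" "\<Phi> (f x \<otimes>\<^bsub>K\<^esub> g y) = \<Phi> (f x) * \<Phi> (g y)" for x y
    using cring_embedding_simps(3,4)[OF K_emb] assms(1,3) by auto
  have b: "bil (\<lambda>x y. \<Phi> (f x \<otimes>\<^bsub>K\<^esub> g y))"
    unfolding 1(2) bil_def by (intro conjI allI lin_mult_left lin_mult_right assms)
  have sw: "sweedler \<Delta> K x (\<lambda>x1 x2. f x1 \<otimes>\<^bsub>K\<^esub> g x2) \<in> carrier K"
    "\<Phi> (sweedler \<Delta> K x (\<lambda>x1 x2. f x1 \<otimes>\<^bsub>K\<^esub> g x2)) = swd x (\<lambda>x1 x2. \<Phi> (f x1) * \<Phi> (g x2))"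
    by (rule sweedler_ring_closed[OF K_emb], rule 1, rule b)
      (subst sweedler_ring[OF K_emb], rule 1, rule b, simp only: 1(2))
  show ?thesis
    using cring_embedding_simps(9)[OF K_emb sw(1) K_scalar(1)] unfolding sw(2) K_scalar(2) by blast
qed

lemma is_t_inv_iff:
  "is_t_inv s \<longleftrightarrow> linear_map scale K s \<and>
    (\<forall>i<n. (t \<star> (\<lambda>i. \<Phi> (s (e i)))) i = emb (\<epsilon> (e i)) \<and> ((\<lambda>i. \<Phi> (s (e i))) \<star> t) i = emb (\<epsilon> (e i)))"
proof (cases "linear_map scale K s")
  case True
  note s = linear_map_K[OF True]
  have ext: "(\<forall>x. f x = g x) \<longleftrightarrow> (\<forall>i<n. f (e i) = g (e i))" if "lin f" "lin g" for f g
  proof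
    assume eq: "\<forall>i<n. f (e i) = g (e i)"
    show "\<forall>x. f x = g x"
    proof
      fix x
      have "f x = (\<Sum>i<n. emb (crd i x) * f (e i))" by (rule lin_expand[OF that(1)])
      also have "\<dots> = (\<Sum>i<n. emb (crd i x) * g (e i))" by (rule sum.cong[OF refl]) (simp add: eq)
      also have "\<dots> = g x" by (rule lin_expand[OF that(2), symmetric])
      finally show "f x = g x" .
    qed
  qed blast
  have 1: "(\<forall>x. swd x (\<lambda>x1 x2. \<Phi> (t_elem scale x1) * \<Phi> (s x2)) = emb (\<epsilon> x)) \<longleftrightarrow>
      (\<forall>i<n. (t \<star> (\<lambda>i. \<Phi> (s (e i)))) i = emb (\<epsilon> (e i)))"
    unfolding ext[OF lin_swd counit_lin] swd_conv t_def[abs_def] ..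
  have 2: "(\<forall>x. swd x (\<lambda>x1 x2. \<Phi> (s x1) * \<Phi> (t_elem scale x2)) = emb (\<epsilon> x)) \<longleftrightarrow>
      (\<forall>i<n. ((\<lambda>i. \<Phi> (s (e i))) \<star> t) i = emb (\<epsilon> (e i)))"
    unfolding ext[OF lin_swd counit_lin] swd_conv t_def[abs_def] ..
  show ?thesis
    unfolding is_t_inv_def K_product[OF t_elem(1) t_lin s] K_product[OF s t_elem(1) t_lin] all_conj_distrib
    using 1 2 True by blast
qed (simp add: is_t_inv_def)

text \<open>The inverse matrix solves the equation for a right inverse. That it is also a left
  inverse follows by cancelling \<open>t\<close> on the left:
  \<open>t \<star> (\<tau> \<star> t)\<close> and \<open>t \<star> \<epsilon>\<close> both equal
  \<open>t\<close>. Uniqueness is the same cancellation applied to two right inverses.\<close>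

lemma ex1_t_inv: "\<exists>!s. is_t_inv s"
proof (rule ex_ex1I)
  obtain Xi where Xi: "\<And>i j. i < n \<Longrightarrow> j < n \<Longrightarrow> Xi i j \<in> \<Phi> ` carrier K"
    "\<And>i j. i < n \<Longrightarrow> j < n \<Longrightarrow> (\<Sum>m<n. Theta i m * Xi m j) = (if i = j then 1 else 0)"
  proof (rule Theta_inverse)
    fix Y assume "\<And>i j. i < n \<Longrightarrow> j < n \<Longrightarrow> Y i j \<in> \<Phi> ` carrier K"
      "\<And>i j. i < n \<Longrightarrow> j < n \<Longrightarrow> (\<Sum>m<n. Theta i m * Y m j) = (if i = j then 1 else 0)"
    then show thesis by (rule that)
  qed
  \<comment> \<open>The solution of the linear system with matrix \<open>Theta\<close> and the
    counit as right-hand side.\<close>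
  define \<tau> where "\<tau> i = (\<Sum>k<n. Xi i k * emb (\<epsilon> (e k)))" for i
  have emb_K: "emb a \<in> \<Phi> ` carrier K" for a
    unfolding K_scalar(2)[symmetric] by (rule imageI[OF K_scalar(1)])
  have \<tau>_K: "\<tau> i \<in> \<Phi> ` carrier K" if "i < n" for i
    unfolding \<tau>_def
    by (intro subfield_set_sum[OF K_subfield] subfield_set_ops(4)[OF K_subfield] Xi(1) emb_K that) simp
  have right: "(t \<star> \<tau>) i = emb (\<epsilon> (e i))" if i: "i < n" for i
  proof -
    have "(t \<star> \<tau>) i = (\<Sum>k<n. (\<Sum>l<n. Theta i l * Xi l k) * emb (\<epsilon> (e k)))"
      unfolding conv_t \<tau>_def sum_distrib_left sum_distrib_right
      by (rule trans[OF sum.swap]) (simp only: mult.assoc)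
    also have "\<dots> = (\<Sum>k<n. (if i = k then 1 else 0) * emb (\<epsilon> (e k)))"
    proof (rule sum.cong[OF refl])
      fix k assume "k \<in> {..<n}"
      then have k: "k < n" by simp
      show "(\<Sum>l<n. Theta i l * Xi l k) * emb (\<epsilon> (e k)) = (if i = k then 1 else 0) * emb (\<epsilon> (e k))"
        unfolding Xi(2)[OF i k] by (rule refl)
    qed
    also have "\<dots> = emb (\<epsilon> (e i))" by (rule delta_sum(2)[OF i])
    finally show ?thesis .
  qed
  have left: "(\<tau> \<star> t) i = emb (\<epsilon> (e i))" if i: "i < n" for i
  proof (rule conv_t_injective[OF _ i])
    fix j assume j: "j < n"
    have "(t \<star> (\<tau> \<star> t)) j = ((t \<star> \<tau>) \<star> t) j" using j by (intro HF.conv_assoc[symmetric]) simp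
    also have "\<dots> = ((\<lambda>i. emb (\<epsilon> (e i))) \<star> t) j" by (rule HF.conv_cong) (auto simp: right)
    also have "\<dots> = t j" using j by (intro HF.conv_eps_left) simp
    also have "\<dots> = (t \<star> (\<lambda>i. emb (\<epsilon> (e i)))) j" using j by (intro HF.conv_eps_right[symmetric]) simp
    finally show "(t \<star> (\<tau> \<star> t)) j = (t \<star> (\<lambda>i. emb (\<epsilon> (e i)))) j" .
  qed
  \<comment> \<open>The linear extension of \<open>\<tau>\<close>, with its values pulled back from
    the field type into \<open>K\<close>.\<close>
  define s where "s x = inv_into (carrier K) \<Phi> (\<Sum>i<n. emb (crd i x) * \<tau> i)" for x
  have mem: "(\<Sum>i<n. emb (crd i x) * \<tau> i) \<in> \<Phi> ` carrier K" for x
    by (intro subfield_set_sum[OF K_subfield] subfield_set_ops(4)[OF K_subfield] emb_K \<tau>_K) simp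
  have s: "s x \<in> carrier K" "\<Phi> (s x) = (\<Sum>i<n. emb (crd i x) * \<tau> i)" for x
    unfolding s_def by (rule inv_into_into[OF mem], rule f_inv_into_f[OF mem])
  have "linear_map scale K s"
    unfolding linear_map_def
  proof (intro conjI allI)
    show "s (x + y) = s x \<oplus>\<^bsub>K\<^esub> s y" for x y
    proof -
      have "\<Phi> (s (x + y)) = \<Phi> (s x \<oplus>\<^bsub>K\<^esub> s y)"
        unfolding cring_embedding_simps(2)[OF K_emb s(1) s(1)] s(2)
        by (simp add: crd_add Const_add algebra_simps sum.distrib)
      then show ?thesis
        using cring_embedding_simps(9)[OF K_emb s(1) cring_embedding_simps(1)[OF K_emb s(1) s(1)]] by blast
    qed
    show "s (scale a x) = a \<odot>\<^bsub>K\<^esub> s x" for a x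
    proof -
      have "\<Phi> (s (scale a x)) = \<Phi> (a \<odot>\<^bsub>K\<^esub> s x)"
        unfolding K_smult(2)[OF s(1)] s(2) by (simp add: crd_scale Const_mult sum_distrib_left mult.assoc)
      then show ?thesis
        using cring_embedding_simps(9)[OF K_emb s(1) K_smult(1)[OF s(1)]] by blast
    qed
  qed (rule s(1))
  moreover have s_e: "\<Phi> (s (e i)) = \<tau> i" if "i < n" for i
  proof -
    have "(\<Sum>j<n. emb (crd j (e i)) * \<tau> j) = (\<Sum>j<n. (if i = j then 1 else 0) * \<tau> j)"
    proof (rule sum.cong[OF refl])
      fix j
      have "emb (crd j (e i)) = (if i = j then 1 else 0)"
        unfolding crd_e[OF that] by (simp add: Const_one Const_zero)
      then show "emb (crd j (e i)) * \<tau> j = (if i = j then 1 else 0) * \<tau> j" by simp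
    qed
    then show ?thesis unfolding s(2) by (simp only: delta_sum(2)[OF that])
  qed
  moreover have "(t \<star> (\<lambda>i. \<Phi> (s (e i)))) i = (t \<star> \<tau>) i" "((\<lambda>i. \<Phi> (s (e i))) \<star> t) i = (\<tau> \<star> t) i" for i
    by (rule HF.conv_cong[OF refl]; simp add: s_e) (rule HF.conv_cong[OF _ refl]; simp add: s_e)
  ultimately have "is_t_inv s" unfolding is_t_inv_iff using left right by simp
  then show "\<exists>s. is_t_inv s" by blast
next
  fix s s' assume "is_t_inv s" "is_t_inv s'"
  then have l: "linear_map scale K s" "linear_map scale K s'"
    and r: "\<And>i. i < n \<Longrightarrow> (t \<star> (\<lambda>i. \<Phi> (s (e i)))) i = emb (\<epsilon> (e i))"
      "\<And>i. i < n \<Longrightarrow> (t \<star> (\<lambda>i. \<Phi> (s' (e i)))) i = emb (\<epsilon> (e i))"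
    by (auto simp: is_t_inv_iff)
  have "\<Phi> (s (e i)) = \<Phi> (s' (e i))" if "i < n" for i
    by (rule conv_t_injective[OF _ that]) (simp add: r)
  then have "\<Phi> (s x) = \<Phi> (s' x)" for x
    using lin_expand[OF linear_map_K(2)[OF l(1)], of x] lin_expand[OF linear_map_K(2)[OF l(2)], of x] by simp
  then show "s = s'"
    using cring_embedding_simps(9)[OF K_emb linear_map_K(1)[OF l(1)] linear_map_K(1)[OF l(2)]] by (intro ext) blast
qed

abbreviation "tinv \<equiv> t_inv scale \<Delta> \<epsilon>"

lemma is_t_inv: "is_t_inv tinv"
proof -
  have "tinv = (THE s. is_t_inv s)"
    unfolding t_inv_def Let_def is_t_inv_def by (rule refl)
  then show ?thesis using theI'[OF ex1_t_inv] by simp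
qed

lemma tinv: "tinv x \<in> carrier K" "lin (\<lambda>x. \<Phi> (tinv x))"
proof -
  have "linear_map scale K tinv" using is_t_inv unfolding is_t_inv_def by (rule conjunct1)
  then show "tinv x \<in> carrier K" "lin (\<lambda>x. \<Phi> (tinv x))" by (rule linear_map_K)+
qed

lemma tinv_conv: "i < n \<Longrightarrow> ((\<lambda>i. \<Phi> (tinv (e i))) \<star> t) i = emb (\<epsilon> (e i))"
  using is_t_inv unfolding is_t_inv_iff by simp

lemma tinv_one: "\<Phi> (t_elem scale 1) * \<Phi> (tinv 1) = 1"
proof -
  have "sweedler \<Delta> K 1 (\<lambda>h1 h2. t_elem scale h1 \<otimes>\<^bsub>K\<^esub> tinv h2) = \<epsilon> 1 \<odot>\<^bsub>K\<^esub> \<one>\<^bsub>K\<^esub>"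
    using is_t_inv unfolding is_t_inv_def by simp
  then have "swd 1 (\<lambda>x1 x2. \<Phi> (t_elem scale x1) * \<Phi> (tinv x2)) = emb (\<epsilon> 1)"
    unfolding K_product[OF t_elem(1) t_lin tinv] .
  moreover have "bil (\<lambda>x1 x2. \<Phi> (t_elem scale x1) * \<Phi> (tinv x2))"
    unfolding bil_def by (intro conjI allI lin_mult_left lin_mult_right t_lin tinv)
  ultimately show ?thesis by (simp add: swd_one counit_one Const_one)
qed

end

section \<open>The universal cocycle\<close>

text \<open>Semisimplicity as defined includes the ring laws, so the laws of the \<alpha>-twisted
  algebra in coordinates are read off from the semisimple ring itself.\<close>

lemma ring_imp_sc_algebra:
  fixes s :: "nat \<Rightarrow> nat \<Rightarrow> nat \<Rightarrow> 'f::field"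
  assumes "ring (sc_ring n UNIV s u)"
  shows "sc_algebra n s u"
proof -
  interpret ring "sc_ring n UNIV s u" by fact
  show ?thesis
    by unfold_locales (use m_assoc l_one r_one one_closed in simp_all)
qed

lemma type_field_embedding:
  fixes h :: "'k::field \<Rightarrow> 'f::field"
  assumes "comm_ring_hom h"
  shows "cring_embedding (type_algebra ((*) :: 'k \<Rightarrow> 'k \<Rightarrow> 'k)) h"
proof -
  interpret h: comm_ring_hom h by fact
  show ?thesis
    using comm_ring_hom_inj[OF assms] h.hom_uminus[symmetric]
    unfolding cring_embedding_def type_algebra_simps
    by (auto simp: h.hom_add h.hom_mult inj_on_def)
qed

context universal
begin

lemma emb_hom: "comm_ring_hom emb"
  by (rule comm_ring_hom_axioms)

lemma swd_pair_conv:
  "swd (e i) (\<lambda>x1 x2. swd (e j) (\<lambda>y1 y2. f x1 y1 * g x2 y2)) =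
    ((\<lambda>k. f (e (fst k)) (e (snd k))) \<star>\<star> (\<lambda>k. g (e (fst k)) (e (snd k)))) (i, j)"
proof -
  have "swd (e i) (\<lambda>x1 x2. swd (e j) (\<lambda>y1 y2. f x1 y1 * g x2 y2)) = (\<Sum>a<n. \<Sum>b<n. \<Sum>a'<n. \<Sum>b'<n.
      emb (c i a b) * emb (c j a' b') * f (e a) (e a') * g (e b) (e b'))"
    unfolding swd_def c_def sum_distrib_left by (simp only: mult.assoc)
  also have "\<dots> = (\<Sum>a<n. \<Sum>a'<n. \<Sum>b<n. \<Sum>b'<n.
      emb (c i a b) * emb (c j a' b') * f (e a) (e a') * g (e b) (e b'))"
    by (intro sum.cong refl sum.swap)
  finally show ?thesis unfolding HF.pair.conv_def HF.sum_sq fst_conv snd_conv .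
qed

abbreviation "T x \<equiv> \<Phi> (t_elem scale x)"
abbreviation "T' x \<equiv> \<Phi> (tinv x)"

text \<open>The bracketing of \<open>sweedler3\<close>, which splits the second leg again, is that
  of the right-nested convolution; what remains is to interleave the sums for x with those for
  y.\<close>

lemma swd3_sigma:
  assumes i: "i < n" and j: "j < n"
  shows "swd3 (e i) (\<lambda>x1 x2 x3. swd3 (e j) (\<lambda>y1 y2 y3. T x1 * T y1 * (f x2 y2 * T' (x3 * y3)))) =
    (HF.tensor t \<star>\<star> ((\<lambda>k. f (e (fst k)) (e (snd k))) \<star>\<star> HF.pull (\<lambda>i. T' (e i)))) (i, j)"
proof -
  have T'_mult: "T' (e q * e q') = HF.pull (\<lambda>i. T' (e i)) (q, q')" for q q'
    unfolding HF.pull_def fst_conv snd_conv unfolding \<mu>_def by (rule lin_expand[OF tinv(2)])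
  let ?E = "\<lambda>a b p q a' b' p' q'. emb (c i a b) * emb (c j a' b') * (t a * t a') *
      (emb (c b p q) * emb (c b' p' q') * f (e p) (e p') * HF.pull (\<lambda>i. T' (e i)) (q, q'))"
  have "swd3 (e i) (\<lambda>x1 x2 x3. swd3 (e j) (\<lambda>y1 y2 y3. T x1 * T y1 * (f x2 y2 * T' (x3 * y3)))) =
    (\<Sum>a<n. \<Sum>b<n. \<Sum>p<n. \<Sum>q<n. \<Sum>a'<n. \<Sum>b'<n. \<Sum>p'<n. \<Sum>q'<n. ?E a b p q a' b' p' q')"
    unfolding swd3_def swd_def c_def[symmetric] T'_mult t_def[symmetric] sum_distrib_left
    by (intro sum.cong refl) (simp only: mult_ac)
  also have "\<dots> = (\<Sum>a<n. \<Sum>b<n. \<Sum>a'<n. \<Sum>b'<n. \<Sum>p<n. \<Sum>q<n. \<Sum>p'<n. \<Sum>q'<n. ?E a b p q a' b' p' q')"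
    by (intro sum.cong refl sum_swap22)
  also have "\<dots> = (\<Sum>a<n. \<Sum>a'<n. \<Sum>b<n. \<Sum>b'<n. \<Sum>p<n. \<Sum>q<n. \<Sum>p'<n. \<Sum>q'<n. ?E a b p q a' b' p' q')"
    by (rule sum.cong[OF refl], rule sum.swap)
  also have "\<dots> = (\<Sum>a<n. \<Sum>a'<n. \<Sum>b<n. \<Sum>b'<n. \<Sum>p<n. \<Sum>p'<n. \<Sum>q<n. \<Sum>q'<n. ?E a b p q a' b' p' q')"
    by (rule sum.cong[OF refl], rule sum.cong[OF refl], rule sum.cong[OF refl], rule sum.cong[OF refl],
        rule sum.cong[OF refl], rule sum.swap)
  also have "\<dots> = (HF.tensor t \<star>\<star> ((\<lambda>k. f (e (fst k)) (e (snd k))) \<star>\<star> HF.pull (\<lambda>i. T' (e i)))) (i, j)"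
    unfolding HF.pair.conv_def HF.sum_sq HF.tensor_def fst_conv snd_conv sum_distrib_left by (rule refl)
  finally show ?thesis .
qed

lemma lin_T'_times: "lin (\<lambda>x. T' (x * y))" "lin (\<lambda>y. T' (x * y))"
  by (rule lin_times_left[OF tinv(2)], rule lin_times_right[OF tinv(2)])

lemma lin_T_times: "lin (\<lambda>x. T (x * y))" "lin (\<lambda>y. T (x * y))"
  by (rule lin_times_left[OF t_lin], rule lin_times_right[OF t_lin])

end

locale universal_cocycle = universal scale \<Delta> \<epsilon> antipode n e crd
  for scale :: "'k::field \<Rightarrow> 'h::ring_1 \<Rightarrow> 'h" and \<Delta> \<epsilon> antipode n e crd +
  fixes \<alpha> :: "'h \<Rightarrow> 'h \<Rightarrow> 'k"
  assumes alpha_bilinear: "bilinear_map scale (type_algebra (*)) \<alpha>"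
    and alpha_one: "\<alpha> 1 1 = 1"
    and alpha_invertible: "conv_invertible scale \<Delta> \<epsilon> (type_algebra (*)) \<alpha>"
begin

abbreviation "\<sigma> \<equiv> sigma scale \<Delta> \<epsilon> \<alpha>"
abbreviation "\<sigma>i \<equiv> sigma_inv scale \<Delta> \<epsilon> \<alpha>"
abbreviation "\<beta> \<equiv> conv_inverse scale \<Delta> \<epsilon> (type_algebra (*)) \<alpha>"
abbreviation "B \<equiv> B_alg scale \<Delta> \<epsilon> \<alpha>"

lemma field_embedding: "cring_embedding (type_algebra ((*) :: 'k \<Rightarrow> 'k \<Rightarrow> 'k)) emb"
  by (rule type_field_embedding[OF emb_hom])

lemma scalar_form_lin:
  assumes "bilinear_map scale (type_algebra (*)) f"
  shows "lin (\<lambda>x. emb (f x y))" "lin (\<lambda>y. emb (f x y))"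
  using assms by (simp_all add: bilinear_map_def linear_map_def lin_def Const_add Const_mult)

lemma scalar_conv:
  assumes f: "bilinear_map scale (type_algebra (*)) f" and g: "bilinear_map scale (type_algebra (*)) g"
    and eq: "sweedler \<Delta> (type_algebra (*)) x (\<lambda>x1 x2. sweedler \<Delta> (type_algebra (*)) y
      (\<lambda>y1 y2. f x1 y1 \<otimes>\<^bsub>type_algebra (*)\<^esub> g x2 y2)) = (\<epsilon> x * \<epsilon> y) \<odot>\<^bsub>type_algebra (*)\<^esub> \<one>\<^bsub>type_algebra (*)\<^esub>"
  shows "swd x (\<lambda>x1 x2. swd y (\<lambda>y1 y2. emb (f x1 y1) * emb (g x2 y2))) = emb (\<epsilon> x) * emb (\<epsilon> y)"
proof -
  note R = field_embedding
  have prod: "emb (f x1 y1 \<otimes>\<^bsub>type_algebra (*)\<^esub> g x2 y2) = emb (f x1 y1) * emb (g x2 y2)" for x1 x2 y1 y2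
    by (simp add: Const_mult)
  have b1: "bil (\<lambda>y1 y2. emb (f x1 y1 \<otimes>\<^bsub>type_algebra (*)\<^esub> g x2 y2))" for x1 x2
    unfolding prod bil_def by (intro conjI allI lin_mult_left lin_mult_right scalar_form_lin f g)
  have inner: "emb (sweedler \<Delta> (type_algebra (*)) y (\<lambda>y1 y2. f x1 y1 \<otimes>\<^bsub>type_algebra (*)\<^esub> g x2 y2)) =
      swd y (\<lambda>y1 y2. emb (f x1 y1) * emb (g x2 y2))" for x1 x2
    unfolding prod[symmetric] by (rule sweedler_ring[OF R], simp, rule b1)
  have b2: "bil (\<lambda>x1 x2. emb (sweedler \<Delta> (type_algebra (*)) y (\<lambda>y1 y2. f x1 y1 \<otimes>\<^bsub>type_algebra (*)\<^esub> g x2 y2)))"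
    unfolding inner bil_def
    by (intro conjI allI lin_swd_arg lin_mult_left lin_mult_right scalar_form_lin f g)
  have "swd x (\<lambda>x1 x2. emb (sweedler \<Delta> (type_algebra (*)) y (\<lambda>y1 y2. f x1 y1 \<otimes>\<^bsub>type_algebra (*)\<^esub> g x2 y2))) =
      emb (sweedler \<Delta> (type_algebra (*)) x (\<lambda>x1 x2. sweedler \<Delta> (type_algebra (*)) y
        (\<lambda>y1 y2. f x1 y1 \<otimes>\<^bsub>type_algebra (*)\<^esub> g x2 y2)))"
    by (rule sweedler_ring[OF R, symmetric], simp, rule b2)
  also have "\<dots> = emb (\<epsilon> x) * emb (\<epsilon> y)" unfolding eq by (simp add: Const_mult)
  finally show ?thesis unfolding inner .
qed

text \<open>The inverse of \<alpha> is a definite description, so uniqueness is required. The usual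
  cancellation is carried out on basis pairs in the large field and brought back by injectivity of
  \<open>emb\<close>.\<close>

lemma conv_inverse_unique:
  assumes "is_conv_inverse scale \<Delta> \<epsilon> (type_algebra (*)) \<alpha> \<beta>1" "is_conv_inverse scale \<Delta> \<epsilon> (type_algebra (*)) \<alpha> \<beta>2"
  shows "\<beta>1 = \<beta>2"
proof -
  have bl: "bilinear_map scale (type_algebra (*)) \<beta>1" "bilinear_map scale (type_algebra (*)) \<beta>2"
    using assms by (simp_all add: is_conv_inverse_def)
  let ?f = "\<lambda>f k. emb (f (e (fst k)) (e (snd k)))"
  have left: "(?f \<beta>1 \<star>\<star> ?f \<alpha>) (i, j) = emb (\<epsilon> (e i)) * emb (\<epsilon> (e j))" for i j
    unfolding swd_pair_conv[symmetric, where f="\<lambda>x y. emb (\<beta>1 x y)" and g="\<lambda>x y. emb (\<alpha> x y)"]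
    by (rule scalar_conv[OF bl(1) alpha_bilinear]) (use assms(1) in \<open>simp only: is_conv_inverse_def\<close>)
  have right: "(?f \<alpha> \<star>\<star> ?f \<beta>2) (i, j) = emb (\<epsilon> (e i)) * emb (\<epsilon> (e j))" for i j
    unfolding swd_pair_conv[symmetric, where f="\<lambda>x y. emb (\<alpha> x y)" and g="\<lambda>x y. emb (\<beta>2 x y)"]
    by (rule scalar_conv[OF alpha_bilinear bl(2)]) (use assms(2) in \<open>simp only: is_conv_inverse_def\<close>)
  have eq: "?f \<beta>1 k = ?f \<beta>2 k" if k: "k \<in> HF.sq" for k
  proof -
    have "?f \<beta>1 k = (?f \<beta>1 \<star>\<star> HF.eeps) k" by (rule HF.pair.conv_eps_right[OF k, symmetric])
    also have "\<dots> = (?f \<beta>1 \<star>\<star> (?f \<alpha> \<star>\<star> ?f \<beta>2)) k"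
    proof (rule HF.pair.conv_cong[OF refl])
      fix j :: "nat \<times> nat"
      show "HF.eeps j = (?f \<alpha> \<star>\<star> ?f \<beta>2) j" using right[of "fst j" "snd j"] by simp
    qed
    also have "\<dots> = ((?f \<beta>1 \<star>\<star> ?f \<alpha>) \<star>\<star> ?f \<beta>2) k" by (rule HF.pair.conv_assoc[OF k, symmetric])
    also have "\<dots> = (HF.eeps \<star>\<star> ?f \<beta>2) k"
    proof (rule HF.pair.conv_cong[OF _ refl])
      fix j :: "nat \<times> nat"
      show "(?f \<beta>1 \<star>\<star> ?f \<alpha>) j = HF.eeps j" using left[of "fst j" "snd j"] by simp
    qed
    also have "\<dots> = ?f \<beta>2 k" by (rule HF.pair.conv_eps_left[OF k])
    finally show ?thesis .
  qed
  have "emb (\<beta>1 x y) = emb (\<beta>2 x y)" for x y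
  proof -
    have b: "bil (\<lambda>x y. emb (\<beta>1 x y))" "bil (\<lambda>x y. emb (\<beta>2 x y))"
      unfolding bil_def by (intro conjI allI scalar_form_lin bl)+
    have "emb (\<beta>1 x y) = (\<Sum>j<n. \<Sum>k<n. emb (crd j x) * emb (crd k y) * emb (\<beta>1 (e j) (e k)))"
      by (rule bil_expand[OF b(1)])
    also have "\<dots> = (\<Sum>j<n. \<Sum>k<n. emb (crd j x) * emb (crd k y) * emb (\<beta>2 (e j) (e k)))"
    proof (rule sum.cong[OF refl], rule sum.cong[OF refl])
      fix j k assume "j \<in> {..<n}" "k \<in> {..<n}"
      then show "emb (crd j x) * emb (crd k y) * emb (\<beta>1 (e j) (e k)) = emb (crd j x) * emb (crd k y) * emb (\<beta>2 (e j) (e k))"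
        using eq[of "(j, k)"] by simp
    qed
    also have "\<dots> = emb (\<beta>2 x y)" by (rule bil_expand[OF b(2), symmetric])
    finally show ?thesis .
  qed
  then show ?thesis using comm_ring_hom_inj[OF emb_hom] by (intro ext) blast
qed

lemma beta: "is_conv_inverse scale \<Delta> \<epsilon> (type_algebra (*)) \<alpha> \<beta>"
proof -
  obtain \<beta>0 where \<beta>0: "is_conv_inverse scale \<Delta> \<epsilon> (type_algebra (*)) \<alpha> \<beta>0"
    using alpha_invertible unfolding conv_invertible_def by (rule exE)
  show ?thesis unfolding conv_inverse_def
    by (rule theI[of _ \<beta>0]) (rule \<beta>0, rule conv_inverse_unique[OF _ \<beta>0])
qed

lemma beta_bilinear: "bilinear_map scale (type_algebra (*)) \<beta>"
  using beta by (simp add: is_conv_inverse_def)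

lemma beta_one: "emb (\<beta> 1 1) = 1"
proof -
  have "swd 1 (\<lambda>x1 x2. swd 1 (\<lambda>y1 y2. emb (\<alpha> x1 y1) * emb (\<beta> x2 y2))) = emb (\<epsilon> 1) * emb (\<epsilon> 1)"
    by (rule scalar_conv[OF alpha_bilinear beta_bilinear]) (use beta in \<open>simp only: is_conv_inverse_def\<close>)
  moreover have "swd 1 (\<lambda>x1 x2. swd 1 (\<lambda>y1 y2. emb (\<alpha> x1 y1) * emb (\<beta> x2 y2))) =
      swd 1 (\<lambda>y1 y2. emb (\<alpha> 1 y1) * emb (\<beta> 1 y2))"
    by (rule swd_one, unfold bil_def)
      (intro conjI allI lin_swd_arg lin_mult_left lin_mult_right scalar_form_lin alpha_bilinear beta_bilinear)
  moreover have "swd 1 (\<lambda>y1 y2. emb (\<alpha> 1 y1) * emb (\<beta> 1 y2)) = emb (\<alpha> 1 1) * emb (\<beta> 1 1)"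
    by (rule swd_one, unfold bil_def)
      (intro conjI allI lin_mult_left lin_mult_right scalar_form_lin alpha_bilinear beta_bilinear)
  ultimately show ?thesis by (simp add: alpha_one counit_one Const_one)
qed

lemma sigma_value:
  "\<sigma> x y \<in> carrier K"
  "\<Phi> (\<sigma> x y) = swd3 x (\<lambda>x1 x2 x3. swd3 y (\<lambda>y1 y2 y3. T x1 * T y1 * (emb (\<alpha> x2 y2) * T' (x3 * y3))))"
proof -
  let ?G = "\<lambda>x1 x2 x3 y1 y2 y3. t_elem scale x1 \<otimes>\<^bsub>K\<^esub> t_elem scale y1 \<otimes>\<^bsub>K\<^esub> (\<alpha> x2 y2 \<odot>\<^bsub>K\<^esub> tinv (x3 * y3))"
  note K_simps = cring_embedding_simps(3,4)[OF K_emb]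
  have G: "?G x1 x2 x3 y1 y2 y3 \<in> carrier K"
    "\<Phi> (?G x1 x2 x3 y1 y2 y3) = T x1 * T y1 * (emb (\<alpha> x2 y2) * T' (x3 * y3))" for x1 x2 x3 y1 y2 y3
    by (simp_all add: K_simps t_elem(1) K_smult tinv(1))
  note lins = lin_mult_left lin_mult_right t_lin lin_T'_times scalar_form_lin alpha_bilinear
  have t1: "tri (\<lambda>y1 y2 y3. \<Phi> (?G x1 x2 x3 y1 y2 y3))" for x1 x2 x3
    unfolding G(2) tri_def by (intro conjI allI lins)
  have inner: "sweedler3 \<Delta> K y (?G x1 x2 x3) \<in> carrier K"
    "\<Phi> (sweedler3 \<Delta> K y (?G x1 x2 x3)) = swd3 y (\<lambda>y1 y2 y3. \<Phi> (?G x1 x2 x3 y1 y2 y3))" for x1 x2 x3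
    by (rule sweedler3_ring_closed[OF K_emb], rule G(1), rule t1, rule sweedler3_ring[OF K_emb], rule G(1), rule t1)
  have t2: "tri (\<lambda>x1 x2 x3. \<Phi> (sweedler3 \<Delta> K y (?G x1 x2 x3)))"
    unfolding inner(2) G(2) tri_def by (intro conjI allI lin_swd3_arg lins)
  have eq: "\<sigma> x y = sweedler3 \<Delta> K x (\<lambda>x1 x2 x3. sweedler3 \<Delta> K y (?G x1 x2 x3))"
    unfolding sigma_def Let_def by (rule refl)
  show "\<sigma> x y \<in> carrier K" unfolding eq
    by (rule sweedler3_ring_closed[OF K_emb], rule inner(1), rule t2)
  have "\<Phi> (\<sigma> x y) = swd3 x (\<lambda>x1 x2 x3. \<Phi> (sweedler3 \<Delta> K y (?G x1 x2 x3)))" unfolding eq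
    by (rule sweedler3_ring[OF K_emb], rule inner(1), rule t2)
  then show "\<Phi> (\<sigma> x y) = swd3 x (\<lambda>x1 x2 x3. swd3 y (\<lambda>y1 y2 y3. T x1 * T y1 * (emb (\<alpha> x2 y2) * T' (x3 * y3))))"
    unfolding inner(2) G(2) .
qed

lemma sigma_inv_value:
  "\<sigma>i x y \<in> carrier K"
  "\<Phi> (\<sigma>i x y) = swd3 x (\<lambda>x1 x2 x3. swd3 y (\<lambda>y1 y2 y3. T (x1 * y1) * (emb (\<beta> x2 y2) * (T' x3 * T' y3))))"
proof -
  let ?G = "\<lambda>x1 x2 x3 y1 y2 y3. t_elem scale (x1 * y1) \<otimes>\<^bsub>K\<^esub> (\<beta> x2 y2 \<odot>\<^bsub>K\<^esub> (tinv x3 \<otimes>\<^bsub>K\<^esub> tinv y3))"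
  note K_simps = cring_embedding_simps(3,4)[OF K_emb]
  have G: "?G x1 x2 x3 y1 y2 y3 \<in> carrier K"
    "\<Phi> (?G x1 x2 x3 y1 y2 y3) = T (x1 * y1) * (emb (\<beta> x2 y2) * (T' x3 * T' y3))" for x1 x2 x3 y1 y2 y3
    by (simp_all add: K_simps t_elem(1) K_smult tinv(1))
  note lins = lin_mult_left lin_mult_right tinv(2) lin_T_times scalar_form_lin beta_bilinear
  have t1: "tri (\<lambda>y1 y2 y3. \<Phi> (?G x1 x2 x3 y1 y2 y3))" for x1 x2 x3
    unfolding G(2) tri_def by (intro conjI allI lins)
  have inner: "sweedler3 \<Delta> K y (?G x1 x2 x3) \<in> carrier K"
    "\<Phi> (sweedler3 \<Delta> K y (?G x1 x2 x3)) = swd3 y (\<lambda>y1 y2 y3. \<Phi> (?G x1 x2 x3 y1 y2 y3))" for x1 x2 x3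
    by (rule sweedler3_ring_closed[OF K_emb], rule G(1), rule t1, rule sweedler3_ring[OF K_emb], rule G(1), rule t1)
  have t2: "tri (\<lambda>x1 x2 x3. \<Phi> (sweedler3 \<Delta> K y (?G x1 x2 x3)))"
    unfolding inner(2) G(2) tri_def by (intro conjI allI lin_swd3_arg lins)
  have eq: "\<sigma>i x y = sweedler3 \<Delta> K x (\<lambda>x1 x2 x3. sweedler3 \<Delta> K y (?G x1 x2 x3))"
    unfolding sigma_inv_def Let_def by (rule refl)
  show "\<sigma>i x y \<in> carrier K" unfolding eq
    by (rule sweedler3_ring_closed[OF K_emb], rule inner(1), rule t2)
  have "\<Phi> (\<sigma>i x y) = swd3 x (\<lambda>x1 x2 x3. \<Phi> (sweedler3 \<Delta> K y (?G x1 x2 x3)))" unfolding eq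
    by (rule sweedler3_ring[OF K_emb], rule inner(1), rule t2)
  then show "\<Phi> (\<sigma>i x y) = swd3 x (\<lambda>x1 x2 x3. swd3 y (\<lambda>y1 y2 y3. T (x1 * y1) * (emb (\<beta> x2 y2) * (T' x3 * T' y3))))"
    unfolding inner(2) G(2) .
qed

text \<open>As 1 is grouplike, the sums collapse to t_1 t_1 \<alpha>(1,1) t_1^{-1}. Together with
  the analogous value of the inverse cocycle this identifies the unit of the \<sigma>-twisted
  algebra.\<close>

lemma sigma_one: "\<Phi> (\<sigma> 1 1) = T 1"
proof -
  note lins = lin_mult_left lin_mult_right t_lin lin_T'_times scalar_form_lin alpha_bilinear
  have "\<Phi> (\<sigma> 1 1) = swd3 1 (\<lambda>y1 y2 y3. T 1 * T y1 * (emb (\<alpha> 1 y2) * T' (1 * y3)))"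
    unfolding sigma_value(2) by (rule swd3_one, unfold tri_def) (intro conjI allI lin_swd3_arg lins)
  also have "\<dots> = T 1 * T 1 * (emb (\<alpha> 1 1) * T' (1 * 1))"
    by (rule swd3_one, unfold tri_def) (intro conjI allI lins)
  also have "\<dots> = T 1 * (T 1 * T' 1)" by (simp add: alpha_one Const_one)
  finally show ?thesis unfolding tinv_one by simp
qed

lemma sigma_inv_one: "\<Phi> (\<sigma>i 1 1) = T' 1"
proof -
  note lins = lin_mult_left lin_mult_right tinv(2) lin_T_times scalar_form_lin beta_bilinear
  have "\<Phi> (\<sigma>i 1 1) = swd3 1 (\<lambda>y1 y2 y3. T (1 * y1) * (emb (\<beta> 1 y2) * (T' 1 * T' y3)))"
    unfolding sigma_inv_value(2) by (rule swd3_one, unfold tri_def) (intro conjI allI lin_swd3_arg lins)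
  also have "\<dots> = T (1 * 1) * (emb (\<beta> 1 1) * (T' 1 * T' 1))"
    by (rule swd3_one, unfold tri_def) (intro conjI allI lins)
  also have "\<dots> = (T 1 * T' 1) * T' 1" unfolding beta_one by simp
  finally show ?thesis unfolding tinv_one by simp
qed

end

section \<open>The algebra of values of the cocycle, and descent to its field of fractions\<close>

context universal_cocycle
begin

definition "gens = {a \<odot>\<^bsub>K\<^esub> \<one>\<^bsub>K\<^esub> | a. True} \<union> {\<sigma> x y | x y. True} \<union> {\<sigma>i x y | x y. True}"

lemma gens_carrier: "gens \<subseteq> carrier K"
  using K_scalar(1) sigma_value(1) sigma_inv_value(1) by (auto simp: gens_def)

lemma B_simps:
  "carrier B = generate_ring K gens" "x \<oplus>\<^bsub>B\<^esub> y = x \<oplus>\<^bsub>K\<^esub> y" "x \<otimes>\<^bsub>B\<^esub> y = x \<otimes>\<^bsub>K\<^esub> y"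
  "\<zero>\<^bsub>B\<^esub> = \<zero>\<^bsub>K\<^esub>" "\<one>\<^bsub>B\<^esub> = \<one>\<^bsub>K\<^esub>" "a \<odot>\<^bsub>B\<^esub> x = a \<odot>\<^bsub>K\<^esub> x"
  by (simp_all add: B_alg_def Let_def gens_def)

lemma B_carrier: "x \<in> carrier B \<Longrightarrow> x \<in> carrier K"
  using ring.generate_ring_in_carrier[OF cring.axioms(1)[OF cring_embedding_cring[OF K_emb]] gens_carrier]
  by (simp add: B_simps)

lemma gens_B: "x \<in> gens \<Longrightarrow> x \<in> carrier B"
  by (simp add: B_simps generate_ring.incl)

lemma sigma_B: "\<sigma> x y \<in> carrier B" and sigma_inv_B: "\<sigma>i x y \<in> carrier B"
  and scalar_B: "a \<odot>\<^bsub>K\<^esub> \<one>\<^bsub>K\<^esub> \<in> carrier B"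
  by (rule gens_B, auto simp: gens_def)+

lemma B_emb: "cring_embedding B \<Phi>"
proof -
  interpret K: cring K by (rule cring_embedding_cring[OF K_emb])
  show ?thesis
    unfolding cring_embedding_def
  proof (intro conjI ballI)
    show "inj_on \<Phi> (carrier B)"
      using cring_embedding_simps(9)[OF K_emb] B_carrier by (auto simp: inj_on_def)
    show "x \<oplus>\<^bsub>B\<^esub> y \<in> carrier B" "x \<otimes>\<^bsub>B\<^esub> y \<in> carrier B" if "x \<in> carrier B" "y \<in> carrier B" for x y
      using that by (simp_all add: B_simps generate_ring.intros)
    show "\<Phi> (x \<oplus>\<^bsub>B\<^esub> y) = \<Phi> x + \<Phi> y" if "x \<in> carrier B" "y \<in> carrier B" for x y
      unfolding B_simps(2) by (rule cring_embedding_simps(2)[OF K_emb B_carrier[OF that(1)] B_carrier[OF that(2)]])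
    show "\<Phi> (x \<otimes>\<^bsub>B\<^esub> y) = \<Phi> x * \<Phi> y" if "x \<in> carrier B" "y \<in> carrier B" for x y
      unfolding B_simps(3) by (rule cring_embedding_simps(4)[OF K_emb B_carrier[OF that(1)] B_carrier[OF that(2)]])
    show "\<zero>\<^bsub>B\<^esub> \<in> carrier B" unfolding B_simps by (rule K.zero_in_generate)
    show "\<one>\<^bsub>B\<^esub> \<in> carrier B" unfolding B_simps by (rule generate_ring.one)
    show "\<Phi> \<zero>\<^bsub>B\<^esub> = 0" unfolding B_simps by (rule cring_embedding_simps(6)[OF K_emb])
    show "\<Phi> \<one>\<^bsub>B\<^esub> = 1" unfolding B_simps by (rule cring_embedding_simps(8)[OF K_emb])
    show "\<exists>y\<in>carrier B. \<Phi> y = - \<Phi> x" if "x \<in> carrier B" for x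
    proof (rule bexI[of _ "\<ominus>\<^bsub>K\<^esub> x"])
      show "\<Phi> (\<ominus>\<^bsub>K\<^esub> x) = - \<Phi> x" by (rule cring_embedding_minus[OF K_emb B_carrier[OF that]])
      show "\<ominus>\<^bsub>K\<^esub> x \<in> carrier B" using that unfolding B_simps by (rule generate_ring.a_inv)
    qed
  qed
qed

text \<open>The scalar multiples of 1 are among the generators, and scalar multiplication is
  multiplication by them.\<close>

lemma B_smult:
  assumes "x \<in> carrier B"
  shows "a \<odot>\<^bsub>B\<^esub> x \<in> carrier B" "\<Phi> (a \<odot>\<^bsub>B\<^esub> x) = emb a * \<Phi> x"
proof -
  note x = B_carrier[OF assms]
  have "\<Phi> (a \<odot>\<^bsub>K\<^esub> x) = \<Phi> ((a \<odot>\<^bsub>K\<^esub> \<one>\<^bsub>K\<^esub>) \<otimes>\<^bsub>K\<^esub> x)"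
    unfolding K_smult(2)[OF x] cring_embedding_simps(4)[OF K_emb K_scalar(1) x] K_scalar(2) by (rule refl)
  then have "a \<odot>\<^bsub>K\<^esub> x = (a \<odot>\<^bsub>K\<^esub> \<one>\<^bsub>K\<^esub>) \<otimes>\<^bsub>K\<^esub> x"
    using cring_embedding_simps(9)[OF K_emb K_smult(1)[OF x] cring_embedding_simps(3)[OF K_emb K_scalar(1) x]] by blast
  then show "a \<odot>\<^bsub>B\<^esub> x \<in> carrier B"
    using cring_embedding_simps(3)[OF B_emb scalar_B assms] by (simp only: B_simps)
  show "\<Phi> (a \<odot>\<^bsub>B\<^esub> x) = emb a * \<Phi> x" unfolding B_simps by (rule K_smult(2)[OF x])
qed

lemma linear_map_B:
  assumes "\<And>x. f x \<in> carrier B" "lin (\<lambda>x. \<Phi> (f x))"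
  shows "linear_map scale B f"
  unfolding linear_map_def
proof (intro conjI allI)
  note inj = cring_embedding_simps(9)[OF B_emb]
  show "f (x + y) = f x \<oplus>\<^bsub>B\<^esub> f y" for x y
  proof (rule iffD1[OF inj])
    show "\<Phi> (f (x + y)) = \<Phi> (f x \<oplus>\<^bsub>B\<^esub> f y)"
      unfolding cring_embedding_simps(2)[OF B_emb assms(1) assms(1)] using assms(2) by (simp add: lin_def)
  qed (intro assms cring_embedding_simps(1)[OF B_emb])+
  show "f (scale a x) = a \<odot>\<^bsub>B\<^esub> f x" for a x
  proof (rule iffD1[OF inj])
    show "\<Phi> (f (scale a x)) = \<Phi> (a \<odot>\<^bsub>B\<^esub> f x)"
      unfolding B_smult(2)[OF assms(1)] using assms(2) by (simp add: lin_def)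
  qed (intro assms B_smult)+
qed (rule assms)

lemma sigma_bilinear: "bilinear_map scale B \<sigma>"
  unfolding bilinear_map_def
proof (intro conjI allI)
  note lins = lin_mult_left lin_mult_right t_lin lin_T'_times scalar_form_lin alpha_bilinear
  show "linear_map scale B (\<sigma> x)" for x
    by (rule linear_map_B[OF sigma_B]) (unfold sigma_value(2), intro lin_swd3_arg lin_swd3)
  show "linear_map scale B (\<lambda>x. \<sigma> x y)" for y
    by (rule linear_map_B[OF sigma_B]) (unfold sigma_value(2), rule lin_swd3)
qed

lemma twisted_B: "twisted scale \<Delta> \<epsilon> antipode n e crd emb B \<Phi> \<sigma>"
  by (intro twisted.intro twisted_axioms.intro hopf_forms_axioms B_emb B_smult sigma_bilinear)

sublocale TB: twisted scale \<Delta> \<epsilon> antipode n e crd emb B \<Phi> \<sigma>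
  by (rule twisted_B)

lemma inv_sigma: "inv\<^bsub>B\<^esub> (\<sigma> 1 1) = \<sigma>i 1 1"
  by (rule cring_embedding_inv[OF B_emb sigma_B sigma_inv_B])
    (simp only: sigma_one sigma_inv_one tinv_one)

definition uB :: "nat \<Rightarrow> ('k, nat) polys fract" where
  "uB l = \<Phi> (inv\<^bsub>B\<^esub> (\<sigma> 1 1)) * emb (crd l 1)"

text \<open>The gauge map sends 1 to t_1 tensor 1, because 1 is grouplike; the factor t_1^{-1} of
  the unit of the \<sigma>-twisted algebra cancels t_1.\<close>

lemma uB_Theta:
  assumes l: "l < n" shows "(\<Sum>i<n. uB i * Theta i l) = emb (crd l 1)"
proof -
  have "(\<Sum>i<n. emb (crd i 1) * Theta i l) = (\<Sum>i<n. \<Sum>a<n. emb (crd i 1) * (emb (c i a l) * t a))"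
    unfolding Theta_eq[OF l] sum_distrib_left by (rule refl)
  also have "\<dots> = (\<Sum>a<n. \<Sum>i<n. emb (crd i 1) * (emb (c i a l) * t a))" by (rule sum.swap)
  also have "\<dots> = (\<Sum>a<n. emb (\<Sum>i<n. crd i 1 * c i a l) * t a)"
    unfolding hom_sum hom_mult sum_distrib_right by (simp only: mult.assoc)
  also have "\<dots> = (\<Sum>a<n. emb (crd a 1) * t a) * emb (crd l 1)"
    unfolding D_expand[symmetric] D_one hom_mult sum_distrib_right by (simp only: mult_ac)
  also have "(\<Sum>a<n. emb (crd a 1) * t a) = T 1"
    unfolding t_def by (rule lin_expand[OF t_lin, symmetric])
  finally have *: "(\<Sum>i<n. emb (crd i 1) * Theta i l) = T 1 * emb (crd l 1)" .
  have "(\<Sum>i<n. uB i * Theta i l) = T' 1 * (\<Sum>i<n. emb (crd i 1) * Theta i l)"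
    unfolding uB_def inv_sigma sigma_inv_one sum_distrib_left by (simp only: mult.assoc)
  also have "\<dots> = (T 1 * T' 1) * emb (crd l 1)" unfolding * by (simp only: mult_ac)
  finally show ?thesis unfolding tinv_one by simp
qed

text \<open>The constants \<open>s\<close> are specified only through their values as a convolution,
  since in the application they are images under \<open>emb\<close> of constants computed over the
  ground field.\<close>

lemma sconst_B_gauge:
  assumes "i < n" "j < n" "l < n"
    and s: "\<And>p q. p < n \<Longrightarrow> q < n \<Longrightarrow>
      s p q l = ((\<lambda>k. emb (\<alpha> (e (fst k)) (e (snd k)))) \<star>\<star> (\<lambda>k. emb (\<mu> (fst k) (snd k) l))) (p, q)"
  shows "(\<Sum>p<n. TB.sconst i j p * Theta p l) = (\<Sum>p<n. \<Sum>q<n. Theta i p * Theta j q * s p q l)"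
proof -
  let ?\<sigma> = "\<lambda>k. \<Phi> (\<sigma> (e (fst k)) (e (snd k)))"
  let ?\<alpha> = "\<lambda>k. emb (\<alpha> (e (fst k)) (e (snd k)))"
  have "(\<Sum>p<n. TB.sconst i j p * Theta p l) =
      (\<Sum>p<n. (?\<sigma> \<star>\<star> (\<lambda>k. emb (\<mu> (fst k) (snd k) p))) (i, j) * (t \<star> unitv l) p)"
  proof (rule sum.cong[OF refl])
    fix p assume "p \<in> {..<n}"
    then have p: "p < n" by simp
    show "TB.sconst i j p * Theta p l =
        (?\<sigma> \<star>\<star> (\<lambda>k. emb (\<mu> (fst k) (snd k) p))) (i, j) * (t \<star> unitv l) p"
      unfolding TB.sconst_conv[OF assms(1,2) p] Theta_def by (rule refl)
  qed
  also have "\<dots> = (\<Sum>p<n. \<Sum>q<n. (t \<star> unitv p) i * (t \<star> unitv q) j *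
      (?\<alpha> \<star>\<star> (\<lambda>k. emb (\<mu> (fst k) (snd k) l))) (p, q))"
  proof (rule HF.gauge_multiplicative[OF tinv_conv _ assms(1-3)])
    fix k assume "k \<in> HF.sq"
    then obtain a b where k: "k = (a, b)" "a < n" "b < n" by auto
    show "?\<sigma> k = (HF.tensor t \<star>\<star> (?\<alpha> \<star>\<star> HF.pull (\<lambda>i. T' (e i)))) k"
      unfolding k(1) fst_conv snd_conv sigma_value(2)
      by (rule swd3_sigma[OF k(2,3), of "\<lambda>x y. emb (\<alpha> x y)"])
  qed
  also have "\<dots> = (\<Sum>p<n. \<Sum>q<n. Theta i p * Theta j q * s p q l)"
    by (rule sum.cong[OF refl], rule sum.cong[OF refl]) (simp add: Theta_def s)
  finally show ?thesis .
qed

text \<open>The isomorphism is used over the large field, where it yields the algebra laws and the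
  nondegeneracy for the constants of \<sigma>. Those constants and the unit have their entries in
  \<open>?F\<close>, the image of the field of fractions of \<open>B\<close>, and so the
  separability argument can be run over \<open>?F\<close>.\<close>

lemma semisimple_sigma:
  assumes A: "sc_algebra n s u" and nd: "sc_algebra.nondegenerate n s"
    and s: "\<And>p q l. p < n \<Longrightarrow> q < n \<Longrightarrow> l < n \<Longrightarrow>
      s p q l = ((\<lambda>k. emb (\<alpha> (e (fst k)) (e (snd k)))) \<star>\<star> (\<lambda>k. emb (\<mu> (fst k) (snd k) l))) (p, q)"
    and u: "\<And>l. l < n \<Longrightarrow> u l = emb (crd l 1)"
  shows "semisimple_ring (tensor_algebra B (fraction_algebra B) (A_alg scale \<Delta> \<epsilon> \<alpha>))"
proof -
  let ?F = "TB.\<psi> ` carrier TB.Q"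
  have F: "subfield_set ?F"
    using fraction_field_subfield[OF B_emb] by (simp add: fraction_algebra_def)
  have B_F: "\<Phi> b \<in> ?F" if "b \<in> carrier B" for b
  \<comment> \<open>Each element of \<open>B\<close> is the fraction with denominator 1, which
    places its value in \<open>?F\<close>.\<close>
  proof -
    have one: "\<one>\<^bsub>B\<^esub> \<in> carrier B" "\<one>\<^bsub>B\<^esub> \<noteq> \<zero>\<^bsub>B\<^esub>" "\<Phi> \<one>\<^bsub>B\<^esub> = 1"
      using cring_embedding_simps(7,8)[OF B_emb] cring_embedding_one_not_zero[OF B_emb] by auto
    have "TB.\<psi> (fraction B b \<one>\<^bsub>B\<^esub>) = \<Phi> b" using fraction_value[OF B_emb that one(1,2)] one(3) by simp
    moreover have "fraction B b \<one>\<^bsub>B\<^esub> \<in> carrier TB.Q"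
      using fraction_carrier[OF B_emb that one(1,2)] by (simp add: fraction_algebra_def)
    ultimately show ?thesis by (rule image_eqI[OF sym])
  qed
  have emb_F: "emb a \<in> ?F" for a
    using B_F[OF scalar_B[of a]] unfolding K_scalar(2) .
  have uB_vecs: "uB \<in> vecs n ?F"
    using subfield_set_ops(4)[OF F B_F[OF sigma_inv_B] emb_F]
    by (auto simp: vecs_def uB_def inv_sigma crd_outside Const_zero)
  have s_F: "TB.sconst i j l \<in> ?F" if "i < n" "j < n" "l < n" for i j l
    unfolding TB.sconst_conv[OF that] HF.pair.conv_def
    by (intro subfield_set_sum[OF F] subfield_set_ops(4)[OF F] emb_F B_F sigma_B)
  obtain Xi where Xi: "\<And>i j. i < n \<Longrightarrow> j < n \<Longrightarrow> (\<Sum>m<n. Theta i m * Xi m j) = (if i = j then 1 else 0)"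
    "\<And>i j. i < n \<Longrightarrow> j < n \<Longrightarrow> (\<Sum>m<n. Xi i m * Theta m j) = (if i = j then 1 else 0)"
  proof (rule Theta_inverse)
    fix Y assume "\<And>i j. i < n \<Longrightarrow> j < n \<Longrightarrow> (\<Sum>m<n. Theta i m * Y m j) = (if i = j then 1 else 0)"
      "\<And>i j. i < n \<Longrightarrow> j < n \<Longrightarrow> (\<Sum>m<n. Y i m * Theta m j) = (if i = j then 1 else 0)"
    then show thesis by (rule that)
  qed
  have gauge: "(\<Sum>p<n. TB.sconst i j p * Theta p l) = (\<Sum>p<n. \<Sum>q<n. Theta i p * Theta j q * s p q l)"
    if "i < n" "j < n" "l < n" for i j l
    by (rule sconst_B_gauge[OF that]) (rule s[OF _ _ that(3)])
  have uB_u: "(\<Sum>i<n. uB i * Theta i l) = u l" if "l < n" for l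
    unfolding u[OF that] by (rule uB_Theta[OF that])
  have tr: "sc_algebra n TB.sconst uB"
    by (rule sc_algebra_transfer(1)[OF A Xi gauge vecs_UNIV[OF uB_vecs] uB_u])
  have nd': "sc_algebra.nondegenerate n TB.sconst"
    by (rule sc_algebra_transfer(2)[OF A Xi gauge vecs_UNIV[OF uB_vecs] uB_u nd])
  \<comment> \<open>Only here does the base field shrink from the large field to
    \<open>?F\<close>.\<close>
  have "semisimple_ring (sc_ring n ?F TB.sconst uB)"
    by (rule nondegenerate_imp_semisimple[OF tr F s_F uB_vecs nd'])
  moreover have "uB = (\<lambda>l. \<Phi> (inv\<^bsub>B\<^esub> (\<sigma> 1 1)) * emb (crd l 1))" by (rule ext) (rule uB_def)
  ultimately have ss: "semisimple_ring (sc_ring n ?F TB.sconst (\<lambda>l. \<Phi> (inv\<^bsub>B\<^esub> (\<sigma> 1 1)) * emb (crd l 1)))"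
    by simp
  have inv: "inv\<^bsub>B\<^esub> (\<sigma> 1 1) \<in> carrier B" unfolding inv_sigma by (rule sigma_inv_B)
  show ?thesis unfolding A_alg_def by (rule TB.semisimple_base_change[OF inv ss])
qed

end

text \<open>An enumeration of the given basis turns \<open>representation\<close> into numbered
  coordinates; outside the range they are set to 0, as the coordinate locales demand.\<close>

lemma fd_hopf_exists:
  assumes H: "hopf_algebra scale \<Delta> \<epsilon> antipode" and fd: "finite_dimensional_vector_space scale Basis"
  shows "\<exists>n e crd. fd_hopf scale \<Delta> \<epsilon> antipode n e crd"
proof -
  interpret hopf_algebra scale \<Delta> \<epsilon> antipode by fact
  interpret fd: finite_dimensional_vector_space scale Basis by fact
  obtain e where e: "bij_betw e {0..<card Basis} Basis"
    using ex_bij_betw_nat_finite[OF fd.finite_Basis] by blast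
  let ?n = "card Basis"
  define crd where "crd i x = (if i < ?n then representation Basis x (e i) else 0)" for i x
  have e_Basis: "e i \<in> Basis" if "i < ?n" for i using e that by (auto simp: bij_betw_def)
  have span: "x \<in> span Basis" for x using fd.span_Basis by simp
  note ind = fd.independent_Basis
  have "fd_hopf scale \<Delta> \<epsilon> antipode ?n e crd"
  proof (intro fd_hopf.intro symmetric_coordinates.intro fd_hopf_axioms.intro H)
    show "crd i (x + y) = crd i x + crd i y" for i x y
      by (simp add: crd_def representation_add[OF ind span span])
    show "crd i (scale a x) = a * crd i x" for i a x
      by (simp add: crd_def representation_scale[OF ind span])
    show "x = (\<Sum>i<?n. scale (crd i x) (e i))" for x
    proof -
      have "x = (\<Sum>b\<in>Basis. scale (representation Basis x b) b)"
        by (rule sum_representation_eq[OF ind span fd.finite_Basis order_refl, symmetric])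
      also have "\<dots> = (\<Sum>i\<in>{0..<?n}. scale (representation Basis x (e i)) (e i))"
        by (rule sum.reindex_bij_betw[OF e, symmetric])
      also have "\<dots> = (\<Sum>i<?n. scale (crd i x) (e i))"
        by (rule sum.cong) (auto simp: crd_def atLeast0LessThan)
      finally show ?thesis .
    qed
    show "crd i (e j) = (if i = j then 1 else 0)" if "j < ?n" for i j
    proof -
      have "e j = e i \<longleftrightarrow> i = j" if "i < ?n"
        using e \<open>j < ?n\<close> that by (auto simp: bij_betw_def inj_on_def)
      then show ?thesis using that by (auto simp: crd_def representation_basis[OF ind e_Basis[OF that]])
    qed
    show "crd i x = 0" if "?n \<le> i" for i x using that by (simp add: crd_def)
  qed
  then show ?thesis by blast
qed

theorem theorem6p3:
  fixes scale :: "'k::field_char_0 \<Rightarrow> 'h::ring_1 \<Rightarrow> 'h"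
    and \<Delta> :: "'h \<Rightarrow> ('h \<times> 'h \<Rightarrow>\<^sub>0 int) set"
    and \<epsilon> :: "'h \<Rightarrow> 'k"
    and antipode :: "'h \<Rightarrow> 'h"
    and \<alpha> :: "'h \<Rightarrow> 'h \<Rightarrow> 'k"
  assumes "hopf_algebra scale \<Delta> \<epsilon> antipode"
    and "\<exists>Basis. finite_dimensional_vector_space scale Basis"
    and "two_cocycle scale \<Delta> (type_algebra (*)) \<alpha>"
    and "normalized \<epsilon> (type_algebra (*)) \<alpha>"
    and "conv_invertible scale \<Delta> \<epsilon> (type_algebra (*)) \<alpha>"
    and "semisimple_ring (twisted_algebra scale \<Delta> (type_algebra (*)) \<alpha>)"
  shows "semisimple_ring
           (tensor_algebra (B_alg scale \<Delta> \<epsilon> \<alpha>)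
              (fraction_algebra (B_alg scale \<Delta> \<epsilon> \<alpha>)) (A_alg scale \<Delta> \<epsilon> \<alpha>))"
proof -
  obtain Basis where fd: "finite_dimensional_vector_space scale Basis" using assms(2) by blast
  obtain n e crd where fdh: "fd_hopf scale \<Delta> \<epsilon> antipode n e crd"
    using fd_hopf_exists[OF assms(1) fd] by blast
  let ?Const = "Const :: 'k \<Rightarrow> ('k, nat) polys"
  have emb: "comm_ring_hom (\<lambda>a. to_fract (?Const a))"
  proof -
    interpret C: comm_ring_hom ?Const by (rule comm_ring_hom_Const)
    show ?thesis by unfold_locales (auto simp: C.hom_add C.hom_mult)
  qed
  have bil: "bilinear_map scale (type_algebra (*)) \<alpha>" using assms(3) by (simp add: two_cocycle_def)
  have H1: "\<epsilon> 1 = 1" by (rule hopf_algebra.counit_one[OF assms(1)])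
  have one: "\<alpha> 1 1 = 1" using assms(4) H1 by (simp add: normalized_def)
  interpret U: universal_cocycle scale \<Delta> \<epsilon> antipode n e crd \<alpha>
    by (intro universal_cocycle.intro universal.intro hopf_forms.intro universal_cocycle_axioms.intro
        fdh emb bil one assms(5))
  note id = fd_hopf.id_hom[OF fdh]
  note k_emb = type_field_embedding[OF id]
  \<comment> \<open>The \<alpha>-twisted algebra is put in coordinates over the ground field itself,
    with the identity as embedding, because semisimplicity is assumed there.\<close>
  have tw: "twisted scale \<Delta> \<epsilon> antipode n e crd (\<lambda>x. x) (type_algebra (*)) (\<lambda>x. x) \<alpha>"
    by (intro twisted.intro twisted_axioms.intro hopf_forms.intro fdh id k_emb bil) simp_all
  let ?s = "twisted.sconst \<Delta> n e crd (\<lambda>x. x) (\<lambda>x. x) \<alpha>"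
  let ?u = "\<lambda>l. inv\<^bsub>type_algebra (*)\<^esub> (\<alpha> 1 1) * crd l 1"
  have "semisimple_ring (sc_ring n ((\<lambda>x. x) ` carrier (type_algebra ((*) :: 'k \<Rightarrow> 'k \<Rightarrow> 'k))) ?s ?u)"
    by (rule twisted.semisimple_coordinates[OF tw assms(6)]) simp
  then have ss: "semisimple_ring (sc_ring n UNIV ?s ?u)" by simp
  have sc: "sc_algebra n ?s ?u"
    by (rule ring_imp_sc_algebra) (use ss in \<open>simp add: semisimple_ring_def\<close>)
  \<comment> \<open>Characteristic zero enters here: a vanishing trace must force the rank of an
    idempotent to vanish.\<close>
  have nd: "sc_algebra.nondegenerate n ?s" by (rule semisimple_imp_nondegenerate[OF sc ss])
  have inv: "inv\<^bsub>type_algebra (*)\<^esub> (\<alpha> 1 1) = 1"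
    by (rule cring_embedding_inv[OF k_emb]) (simp_all add: one)
  interpret k: hopf_constants n U.c "\<lambda>i. \<epsilon> (e i)" U.\<mu> by (rule U.hopf_constants)
  show ?thesis
  \<comment> \<open>Laws and nondegeneracy are pushed forward along the embedding of the ground
    field into the large field; it remains to match the constants and the unit.\<close>
  proof (rule U.semisimple_sigma[OF sc_algebra_hom[OF emb sc] nondegenerate_hom[OF emb sc nd]])
    fix p q l assume pql: "p < n" "q < n" "l < n"
    show "to_fract (?Const (?s p q l)) =
      U.HF.pair.conv (\<lambda>k. to_fract (?Const (\<alpha> (e (fst k)) (e (snd k))))) (\<lambda>k. to_fract (?Const (U.\<mu> (fst k) (snd k) l))) (p, q)"
      unfolding twisted.sconst_conv[OF tw pql] k.pair.conv_def U.HF.pair.conv_def U.hom_sum U.hom_mult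
      by (rule refl)
  next
    fix l show "to_fract (?Const (?u l)) = to_fract (?Const (crd l 1))" unfolding inv by simp
  qed
qed

end
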